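(* Let $\Lambda$ be the discretized rings associated to $\{r_n\}_n$ and $\{\epsilon_n\}_n$. The following properties are equivalent: (a) $\Lambda$ is a sampling sequence for $\mathcal{N}$. (b) $\sum_{\lambda\in\Lambda\cap\Gamma_\psi(\zeta)}(1-|\lambda|)=\infty$ for all $\zeta\in\mathbb{T}$ and all $\psi\in\mathcal{F}$. (c) $\displaystyle\sum_{n=0}^\infty\left(\frac{1-r_n}{\epsilon_n}\right)^{1/2}=\infty$.
   Context: $\mathbb{D}$ is the open unit disk and $\mathbb{T}=\partial\mathbb{D}$. Discretized rings: let $r_n\in(0,1)$, $n\ge0$, be an increasing sequence with $\lim_nr_n=1$ and $0<\inf_n\frac{1-r_{n+1}}{1-r_n}\le\sup_n\frac{1-r_{n+1}}{1-r_n}<1$, and let $\epsilon_n\in(0,1)$ be a decreasing sequence with $\lim_n\epsilon_n=0$. The discretized rings associated to $\{r_n\}_n$ and $\{\epsilon_n\}_n$ is the sequence $\Lambda=\{\lambda_{n,j}\}_{n,j}$, $$\lambda_{n,j}=r_n\exp\bigl(2\pi i\,j\,(1-r_n)\epsilon_n\bigr),\qquad n\ge0,\quad 0\le j<\Bigl[\frac1{(1-r_n)\epsilon_n}\Bigr],$$ where $[\cdot]$ is the integer part. The Nevanlinna class is $\mathcal{N}=\{f\in \mathrm{Hol}(\mathbb{D}):\lim_{r\to1}\frac1{2\pi}\int_0^{2\pi}\log^+|f(re^{i\theta})|\,d\theta<\infty\}$; $\mathrm{Har}_+(\mathbb{D})$ is the set of non-negative harmonic functions on $\mathbb{D}$.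 For $f\in\mathcal{N}$ put $N(f)=\inf\{h(0): h\in\mathrm{Har}_+(\mathbb{D}),\ \log(1+|f|)\le h \text{ on } \mathbb{D}\}$ and $N(f|\Lambda)=\inf\{h(0): h\in\mathrm{Har}_+(\mathbb{D}),\ \log(1+|f(\lambda)|)\le h(\lambda)\ \forall\lambda\in\Lambda\}$. $\Lambda$ is sampling for $\mathcal{N}$ if there exists $C>0$ such that $N(f)\le N(f|\Lambda)+C$ for all $f\in\mathcal{N}$. $\mathcal{F}$ is the set of non-decreasing continuous $\psi:[0,1)\to[0,\infty)$ with $\psi(0)=0$ and $\int_0\frac{\psi(x)}{x^2}\,dx<\infty$ (convergence at $0$). For $\zeta\in\mathbb{T}$, $\Gamma_\psi(\zeta)=\{z\in\mathbb{D}:|z-\zeta|<1,\ \psi(|z-\zeta|)\le1-|z|\}$. *)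

theory Defs
  imports "HOL-Complex_Analysis.Complex_Analysis"
begin

definition logplus :: "real \<Rightarrow> real" where
  "logplus x = ln (max 1 x)"

text \<open>The limit of the circular means is required to exist as a real number; the means are
  non-decreasing in the radius, so this is the same as their limit being finite.\<close>

definition nevanlinna_class :: "(complex \<Rightarrow> complex) set" where
  "nevanlinna_class = {f. f holomorphic_on ball 0 1 \<and>
     (\<exists>L::real. ((\<lambda>r. 1 / (2 * pi) *
        integral {0..2 * pi} (\<lambda>\<theta>. logplus (norm (f (of_real r * exp (\<i> * of_real \<theta>))))))
          \<longlongrightarrow> L) (at_left 1))}"

text \<open>\<open>u\<close> is of class \<open>C\<^sup>2\<close> with vanishing Laplacian; \<open>ux\<close>, \<open>uy\<close> and \<open>uxx\<close>, \<open>uxy\<close>, \<open>uyx\<close>, \<open>uyy\<close>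
  are its partial derivatives of first and second order. Intended for open \<open>S\<close>.\<close>

definition harmonic_on :: "(complex \<Rightarrow> real) \<Rightarrow> complex set \<Rightarrow> bool" where
  "harmonic_on u S \<longleftrightarrow> (\<exists>ux uy uxx uxy uyx uyy :: complex \<Rightarrow> real.
     continuous_on S uxx \<and> continuous_on S uxy \<and> continuous_on S uyx \<and> continuous_on S uyy \<and>
     (\<forall>z\<in>S. (u has_derivative (\<lambda>h. ux z * Re h + uy z * Im h)) (at z) \<and>
            (ux has_derivative (\<lambda>h. uxx z * Re h + uxy z * Im h)) (at z) \<and>
            (uy has_derivative (\<lambda>h. uyx z * Re h + uyy z * Im h)) (at z) \<and>
            uxx z + uyy z = 0))"

definition Har_plus :: "(complex \<Rightarrow> real) set" where
  "Har_plus = {h. harmonic_on h (ball 0 1) \<and> (\<forall>z\<in>ball 0 1. 0 \<le> h z)}"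

text \<open>\<open>N(f|A)\<close> for a subset \<open>A\<close> of the unit disk. The infimum is taken in the extended reals,
  so it is \<open>\<infinity>\<close> when there is no admissible \<open>h\<close>.\<close>

definition N_restr :: "(complex \<Rightarrow> complex) \<Rightarrow> complex set \<Rightarrow> ereal" where
  "N_restr f A = Inf {ereal (h 0) | h. h \<in> Har_plus \<and> (\<forall>z\<in>A. ln (1 + norm (f z)) \<le> h z)}"

definition N_full :: "(complex \<Rightarrow> complex) \<Rightarrow> ereal" where
  "N_full f = N_restr f (ball 0 1)"

definition sampling_nevanlinna :: "complex set \<Rightarrow> bool" where
  "sampling_nevanlinna A \<longleftrightarrow>
     (\<exists>C::real. C > 0 \<and> (\<forall>f\<in>nevanlinna_class. N_full f \<le> N_restr f A + ereal C))"

text \<open>Only the values on \<open>[0,1)\<close> matter. Integrability is required near \<open>0\<close> only, since \<open>\<psi>\<close> may be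
  unbounded near \<open>1\<close>.\<close>

definition class_F :: "(real \<Rightarrow> real) set" where
  "class_F = {\<psi>. mono_on {0..<1} \<psi> \<and> continuous_on {0..<1} \<psi> \<and>
     (\<forall>x\<in>{0..<1}. 0 \<le> \<psi> x) \<and> \<psi> 0 = 0 \<and>
     (\<exists>\<delta>. 0 < \<delta> \<and> \<delta> < 1 \<and> set_integrable lborel {0<..<\<delta>} (\<lambda>x. \<psi> x / x\<^sup>2))}"

definition Gamma_region :: "(real \<Rightarrow> real) \<Rightarrow> complex \<Rightarrow> complex set" where
  "Gamma_region \<psi> \<zeta> = {z \<in> ball 0 1. norm (z - \<zeta>) < 1 \<and> \<psi> (norm (z - \<zeta>)) \<le> 1 - norm z}"

definition ring_data :: "(nat \<Rightarrow> real) \<Rightarrow> (nat \<Rightarrow> real) \<Rightarrow> bool" where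
  "ring_data r \<epsilon> \<longleftrightarrow>
     (\<forall>n. 0 < r n \<and> r n < 1) \<and> incseq r \<and> r \<longlonglongrightarrow> 1 \<and>
     0 < (INF n. (1 - r (Suc n)) / (1 - r n)) \<and>
     (SUP n. (1 - r (Suc n)) / (1 - r n)) < 1 \<and>
     (\<forall>n. 0 < \<epsilon> n \<and> \<epsilon> n < 1) \<and> decseq \<epsilon> \<and> \<epsilon> \<longlonglongrightarrow> 0"

text \<open>The points are pairwise distinct for distinct \<open>(n, j)\<close> under \<open>ring_data\<close> (the \<open>r n\<close> are strictly
  increasing and, for fixed \<open>n\<close>, the arguments are distinct elements of \<open>[0, 2\<pi>)\<close>), so the
  sequence may be treated as a set, also in sums over it.\<close>

definition discretized_rings :: "(nat \<Rightarrow> real) \<Rightarrow> (nat \<Rightarrow> real) \<Rightarrow> complex set" where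
  "discretized_rings r \<epsilon> =
     {of_real (r n) * exp (2 * of_real pi * \<i> * of_nat j * of_real ((1 - r n) * \<epsilon> n)) | n j.
        int j < \<lfloor>1 / ((1 - r n) * \<epsilon> n)\<rfloor>}"

end

theory Submission
  imports Defs
begin

text \<open>
  Put \<open>\<delta>\<^sub>n = 1 - r\<^sub>n\<close>, \<open>s\<^sub>n = sqrt (\<delta>\<^sub>n / \<epsilon>\<^sub>n)\<close> and \<open>x\<^sub>n = sqrt (\<delta>\<^sub>n \<epsilon>\<^sub>n)\<close>, so that \<open>s\<^sub>n = \<delta>\<^sub>n / x\<^sub>n = x\<^sub>n / \<epsilon>\<^sub>n\<close>. Both the
  sampling property and the condition on the regions \<open>\<Gamma>\<^sub>\<psi>(\<zeta>)\<close> are shown to be equivalent to the divergence of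
  \<open>\<Sum> s\<^sub>n\<close>. The number \<open>x\<^sub>n\<close> is the distance from a boundary point at which two costs balance. A function of
  size \<open>exp (Re ((1 + z) / (1 - z)))\<close> is to be hidden from the ring \<open>n\<close>. Cancelling it by zeros at the lattice
  points nearer than \<open>x\<close> to the point \<open>1\<close> costs \<open>x / \<epsilon>\<^sub>n\<close> in the Blaschke sum, and majorizing it farther out by
  a Poisson kernel with pole at distance \<open>x\<close> outside the disk costs \<open>\<delta>\<^sub>n / x\<close>. The cheapest choice costs \<open>s\<^sub>n\<close>.

  Convergence implies failure of sampling (\<open>summable_imp_not_sampling\<close>). If \<open>\<Sum> s\<^sub>n < \<infinity>\<close>, this scheme can be
  carried out on all rings at once: \<open>f = B exp (c (1 + z) / (1 - z))\<close>, with \<open>B\<close> vanishing at the selected lattice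
  points, has \<open>N(f) \<ge> c\<close> and \<open>N(f|\<Lambda>) \<le> 2\<close>, for every \<open>c\<close>. The lower bound for \<open>N(f)\<close> rests on an extremal
  property of \<open>B\<close> (\<open>extremal_bounded_function\<close>): no function bounded by \<open>1\<close> with these zeros is larger at \<open>0\<close>.

  Divergence implies sampling (\<open>divergent_imp_sampling\<close>). Let \<open>h\<close> be admissible for \<open>f\<close> on \<open>\<Lambda>\<close>, \<open>h = Re H\<close>. Then
  \<open>g = f exp (-H)\<close> satisfies \<open>|g| \<le> 1\<close> on \<open>\<Lambda>\<close>, and it suffices to show \<open>|g| \<le> 1\<close> on the disk
  (\<open>bounded_on_rings_imp_bounded\<close>), since this gives \<open>log (1 + |f|) \<le> h + log 2\<close>. Replace \<open>h\<close> by the least harmonic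
  majorant of \<open>log\<^sup>+ |g|\<close> and assume \<open>h(0) > 0\<close>. The function \<open>F = g exp (-H)\<close> is bounded by \<open>1\<close>, and \<open>|F| \<le> exp (-h)\<close> on
  \<open>\<Lambda>\<close>. A box of side \<open>\<delta>\<^sub>n\<close> at the ring \<open>n\<close> contains about \<open>1/\<epsilon>\<^sub>n\<close> lattice points, and the zeros of \<open>F\<close> cannot
  make it small at substantially more lattice points than there are zeros; hence \<open>log 1/|F|\<close>, regularized to a harmonic function
  \<open>u\<close>, is bounded below by \<open>min h (1/\<epsilon>\<^sub>n)\<close>, up to a constant, on the whole ring (\<open>box_estimate\<close>, \<open>harmonic_companion\<close>).
  On the other hand \<open>min h u\<close> has small circular means, because \<open>h\<close> is the least majorant: at each point either
  \<open>log\<^sup>+ |g|\<close> vanishes, and then \<open>h\<close> is the difference \<open>h - log\<^sup>+ |g|\<close>, or \<open>u\<close> is at most a multiple of it, up to a small constant. Hence there is a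
  boundary point \<open>\<zeta>\<close> near which the boundary measure of \<open>u\<close> is small compared with that of \<open>h\<close>, uniformly at all
  scales (\<open>good_boundary_point\<close>). As \<open>u\<close> must nevertheless reach \<open>min h (1/\<epsilon>\<^sub>n)\<close> near \<open>\<zeta>\<close>, each ring forces an
  annulus around \<open>\<zeta>\<close> to carry so much mass of \<open>u\<close> that the square root of the mass grows by at least a constant
  multiple of \<open>s\<^sub>n\<close> (\<open>critical_scale\<close>). For a lacunary subsequence of the rings these annuli are disjoint, the
  increments telescope (\<open>core_estimate\<close>), and \<open>\<Sum> s\<^sub>n\<close> is bounded by the square root of the total mass of \<open>u\<close>.

  The regions \<open>\<Gamma>\<^sub>\<psi>(\<zeta>)\<close>. If \<open>X\<^sub>n\<close> is the largest distance with \<open>\<psi> \<le> \<delta>\<^sub>n\<close>, the ring \<open>n\<close> contributes about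
  \<open>X\<^sub>n / \<epsilon>\<^sub>n\<close> to the sum over \<open>\<Lambda> \<inter> \<Gamma>\<^sub>\<psi>(\<zeta>)\<close>, while \<open>\<Sum> \<delta>\<^sub>n / X\<^sub>n < \<infinity>\<close> by the integrability of \<open>\<psi>(x) / x\<^sup>2\<close>. As \<open>s\<^sub>n\<close> is the
  geometric mean of \<open>X\<^sub>n / \<epsilon>\<^sub>n\<close> and \<open>\<delta>\<^sub>n / X\<^sub>n\<close>, a finite sum forces \<open>\<Sum> s\<^sub>n < \<infinity>\<close>
  (\<open>finite_region_sum_imp_summable\<close>). Conversely, if \<open>\<Sum> s\<^sub>n < \<infinity>\<close>, a \<open>\<psi>\<close> can be written down for which \<open>X\<^sub>n \<le> x\<^sub>n\<close>
  (\<open>summable_imp_finite_region_sum\<close>).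
\<close>

section \<open>Harmonic functions as real parts of holomorphic functions\<close>

lemma has_real_derivative_along_line:
  fixes u :: "complex \<Rightarrow> real"
  assumes "(u has_derivative (\<lambda>h. a * Re h + b * Im h)) (at (c + of_real t * d))"
  shows "((\<lambda>t. u (c + of_real t * d)) has_real_derivative (a * Re d + b * Im d)) (at t)"
proof -
  have 1: "((\<lambda>t::real. c + of_real t * d) has_derivative (\<lambda>x. of_real x * d)) (at t)"
    by (auto intro!: derivative_eq_intros)
  have "((\<lambda>t. u (c + of_real t * d)) has_derivative
          (\<lambda>x. a * Re (of_real x * d) + b * Im (of_real x * d))) (at t)"
    using has_derivative_compose[OF 1 assms] by simp
  then show ?thesis
    unfolding has_field_derivative_def by (rule has_derivative_eq_rhs) (auto simp: algebra_simps)
qed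

text \<open>Schwarz's theorem. Both mixed derivatives at \<open>z\<close> are limits of the same second difference of \<open>u\<close> over
  small squares.\<close>

lemma mixed_partials_eq:
  fixes u ux uy uxx uxy uyx uyy :: "complex \<Rightarrow> real"
  assumes S: "open S" "z \<in> S" and c: "continuous_on S uxy" "continuous_on S uyx"
    and u: "\<And>z. z \<in> S \<Longrightarrow> (u has_derivative (\<lambda>h. ux z * Re h + uy z * Im h)) (at z)"
    and ux: "\<And>z. z \<in> S \<Longrightarrow> (ux has_derivative (\<lambda>h. uxx z * Re h + uxy z * Im h)) (at z)"
    and uy: "\<And>z. z \<in> S \<Longrightarrow> (uy has_derivative (\<lambda>h. uyx z * Re h + uyy z * Im h)) (at z)"
  shows "uxy z = uyx z"
proof -
  have "\<bar>uxy z - uyx z\<bar> \<le> e" if e: "e > 0" for e :: real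
  proof -
    have "continuous (at z) uxy" "continuous (at z) uyx"
      using c S by (simp_all add: continuous_on_eq_continuous_at)
    then obtain d1 d2 where d12: "d1 > 0" "d2 > 0"
      "\<And>w. dist w z < d1 \<Longrightarrow> dist (uxy w) (uxy z) < e/2"
      "\<And>w. dist w z < d2 \<Longrightarrow> dist (uyx w) (uyx z) < e/2"
      using e unfolding continuous_at_eps_delta by (metis half_gt_zero)
    obtain d3 where d3: "d3 > 0" "ball z d3 \<subseteq> S" using S openE by blast
    define d where "d = min d1 (min d2 d3)"
    have d: "d > 0" "\<And>w. dist w z < d \<Longrightarrow> w \<in> S \<and> \<bar>uxy w - uxy z\<bar> < e/2 \<and> \<bar>uyx w - uyx z\<bar> < e/2"
      using d12 d3 by (auto simp: d_def dist_real_def dist_commute subset_iff)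
    define s where "s = d / 3"
    have s: "s > 0" using d by (simp add: s_def)
    have near: "dist (z + of_real p + of_real q * \<i>) z < d" if "0 \<le> p" "p \<le> s" "0 \<le> q" "q \<le> s" for p q :: real
    proof -
      have "norm (of_real p + of_real q * \<i>) \<le> norm (of_real p :: complex) + norm (of_real q * \<i>)"
        by (rule norm_triangle_ineq)
      also have "\<dots> = p + q" using that by (simp add: norm_mult)
      also have "\<dots> < d" using that d by (simp add: s_def)
      finally show ?thesis by (simp add: dist_norm add.assoc)
    qed
    note line = has_real_derivative_along_line
    \<comment> \<open>The second difference over the square of side \<open>s\<close> is evaluated twice by the mean value
      theorem, once for each order of the variables.\<close>
    have "\<exists>t1. 0 < t1 \<and> t1 < s \<and> (u (z + of_real s * 1 + of_real s * \<i>) - u (z + of_real s * 1)) -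
        (u (z + of_real 0 * 1 + of_real s * \<i>) - u (z + of_real 0 * 1))
        = (s - 0) * (ux (z + of_real t1 + of_real s * \<i>) - ux (z + of_real t1))"
    proof (rule MVT2[where f = "\<lambda>t. u (z + of_real t * 1 + of_real s * \<i>) - u (z + of_real t * 1)"])
      fix t assume t: "0 \<le> t" "t \<le> s"
      have 1: "z + of_real t + of_real s * \<i> \<in> S" "z + of_real t \<in> S"
        using near[of t s] near[of t 0] d(2) t s by auto
      have "((\<lambda>t. u (z + of_real s * \<i> + of_real t * 1)) has_real_derivative
          (ux (z + of_real t + of_real s * \<i>) * Re 1 + uy (z + of_real t + of_real s * \<i>) * Im 1)) (at t)"
        by (rule line) (use u[OF 1(1)] in \<open>simp add: algebra_simps\<close>)
      moreover have "((\<lambda>t. u (z + of_real t * 1)) has_real_derivative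
          (ux (z + of_real t) * Re 1 + uy (z + of_real t) * Im 1)) (at t)"
        by (rule line) (use u[OF 1(2)] in simp)
      ultimately show "((\<lambda>t. u (z + of_real t * 1 + of_real s * \<i>) - u (z + of_real t * 1)) has_real_derivative
         (ux (z + of_real t + of_real s * \<i>) - ux (z + of_real t))) (at t)"
        by (auto intro!: derivative_eq_intros simp: algebra_simps)
    qed (rule s)
    then obtain t1 where t1: "0 < t1" "t1 < s" and eq1:
      "(u (z + of_real s + of_real s * \<i>) - u (z + of_real s)) - (u (z + of_real s * \<i>) - u z)
        = s * (ux (z + of_real t1 + of_real s * \<i>) - ux (z + of_real t1))" by auto
    have "\<exists>t2. 0 < t2 \<and> t2 < s \<and> ux (z + of_real t1 + of_real s * \<i>) - ux (z + of_real t1 + of_real 0 * \<i>)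
        = (s - 0) * uxy (z + of_real t1 + of_real t2 * \<i>)"
    proof (rule MVT2[where f = "\<lambda>t. ux (z + of_real t1 + of_real t * \<i>)"])
      fix t assume t: "0 \<le> t" "t \<le> s"
      have 1: "z + of_real t1 + of_real t * \<i> \<in> S" using near[of t1 t] d(2) t t1 by auto
      show "((\<lambda>t. ux (z + of_real t1 + of_real t * \<i>)) has_real_derivative
          uxy (z + of_real t1 + of_real t * \<i>)) (at t)"
        using line[OF ux[OF 1]] by simp
    qed (rule s)
    then obtain t2 where t2: "0 < t2" "t2 < s" and eq2:
      "ux (z + of_real t1 + of_real s * \<i>) - ux (z + of_real t1) = s * uxy (z + of_real t1 + of_real t2 * \<i>)"
      by auto
    have "\<exists>t3. 0 < t3 \<and> t3 < s \<and> (u (z + of_real s + of_real s * \<i>) - u (z + of_real s * \<i>)) -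
        (u (z + of_real s + of_real 0 * \<i>) - u (z + of_real 0 * \<i>))
        = (s - 0) * (uy (z + of_real s + of_real t3 * \<i>) - uy (z + of_real t3 * \<i>))"
    proof (rule MVT2[where f = "\<lambda>t. u (z + of_real s + of_real t * \<i>) - u (z + of_real t * \<i>)"])
      fix t assume t: "0 \<le> t" "t \<le> s"
      have 1: "z + of_real s + of_real t * \<i> \<in> S" "z + of_real t * \<i> \<in> S"
        using near[of s t] near[of 0 t] d(2) t s by auto
      show "((\<lambda>t. u (z + of_real s + of_real t * \<i>) - u (z + of_real t * \<i>)) has_real_derivative
         (uy (z + of_real s + of_real t * \<i>) - uy (z + of_real t * \<i>))) (at t)"
        using DERIV_diff[OF line[OF u[OF 1(1)]] line[OF u[OF 1(2)]]] by simp
    qed (rule s)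
    then obtain t3 where t3: "0 < t3" "t3 < s" and eq3:
      "(u (z + of_real s + of_real s * \<i>) - u (z + of_real s * \<i>)) - (u (z + of_real s) - u z)
        = s * (uy (z + of_real s + of_real t3 * \<i>) - uy (z + of_real t3 * \<i>))" by auto
    have "\<exists>t4. 0 < t4 \<and> t4 < s \<and> uy (z + of_real t3 * \<i> + of_real s * 1) - uy (z + of_real t3 * \<i> + of_real 0 * 1)
        = (s - 0) * uyx (z + of_real t3 * \<i> + of_real t4 * 1)"
    proof (rule MVT2[where f = "\<lambda>t. uy (z + of_real t3 * \<i> + of_real t * 1)"])
      fix t assume t: "0 \<le> t" "t \<le> s"
      have 1: "z + of_real t3 * \<i> + of_real t * 1 \<in> S"
        using near[of t t3] d(2) t t3 by (auto simp: algebra_simps)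
      show "((\<lambda>t. uy (z + of_real t3 * \<i> + of_real t * 1)) has_real_derivative
          uyx (z + of_real t3 * \<i> + of_real t * 1)) (at t)"
        using line[OF uy[OF 1]] by simp
    qed (rule s)
    then obtain t4 where t4: "0 < t4" "t4 < s" and eq4:
      "uy (z + of_real s + of_real t3 * \<i>) - uy (z + of_real t3 * \<i>) = s * uyx (z + of_real t4 + of_real t3 * \<i>)"
      by (auto simp: algebra_simps)
    have "s * (s * uxy (z + of_real t1 + of_real t2 * \<i>)) = s * (s * uyx (z + of_real t4 + of_real t3 * \<i>))"
      using eq1 eq3 unfolding eq2 eq4 by (simp add: algebra_simps)
    then have "uxy (z + of_real t1 + of_real t2 * \<i>) = uyx (z + of_real t4 + of_real t3 * \<i>)"
      using s by simp
    moreover have "\<bar>uxy (z + of_real t1 + of_real t2 * \<i>) - uxy z\<bar> < e/2"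
      "\<bar>uyx (z + of_real t4 + of_real t3 * \<i>) - uyx z\<bar> < e/2"
      using near[of t1 t2] near[of t4 t3] t1 t2 t3 t4 d(2) by auto
    ultimately show ?thesis by linarith
  qed
  from this[of "\<bar>uxy z - uyx z\<bar> / 2"] show ?thesis by (cases "uxy z = uyx z") auto
qed

text \<open>The partial derivatives of \<open>Re f\<close> are the real and imaginary parts of \<open>f'\<close> and \<open>f''\<close>, up to sign.\<close>

lemma harmonic_on_Re:
  assumes "f holomorphic_on S" "open S"
  shows "harmonic_on (\<lambda>z. Re (f z)) S"
proof -
  have h1: "deriv f holomorphic_on S" and h2: "deriv (deriv f) holomorphic_on S"
    using assms by (auto intro: holomorphic_deriv)
  have cont: "continuous_on S (deriv (deriv f))" by (rule holomorphic_on_imp_continuous_on[OF h2])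
  have d: "(g has_derivative (\<lambda>h. deriv g z * h)) (at z)" if "g holomorphic_on S" "z \<in> S" for g z
    using holomorphic_derivI[OF that(1) assms(2) that(2)] by (simp add: has_field_derivative_def)
  have dRe: "((\<lambda>z. Re (g z)) has_derivative (\<lambda>h. Re (deriv g z) * Re h + (- Im (deriv g z)) * Im h)) (at z)"
   and dIm: "((\<lambda>z. - Im (g z)) has_derivative (\<lambda>h. (- Im (deriv g z)) * Re h + (- Re (deriv g z)) * Im h)) (at z)"
    if "g holomorphic_on S" "z \<in> S" for g z
  proof -
    show "((\<lambda>z. Re (g z)) has_derivative (\<lambda>h. Re (deriv g z) * Re h + (- Im (deriv g z)) * Im h)) (at z)"
      using has_derivative_Re[OF d[OF that]] by (rule has_derivative_eq_rhs) auto
    show "((\<lambda>z. - Im (g z)) has_derivative (\<lambda>h. (- Im (deriv g z)) * Re h + (- Re (deriv g z)) * Im h)) (at z)"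
      using has_derivative_minus[OF has_derivative_Im[OF d[OF that]]] by (rule has_derivative_eq_rhs) (auto simp: algebra_simps)
  qed
  show ?thesis
    unfolding harmonic_on_def
    by (rule exI[of _ "\<lambda>z. Re (deriv f z)"], rule exI[of _ "\<lambda>z. - Im (deriv f z)"],
        rule exI[of _ "\<lambda>z. Re (deriv (deriv f) z)"], rule exI[of _ "\<lambda>z. - Im (deriv (deriv f) z)"],
        rule exI[of _ "\<lambda>z. - Im (deriv (deriv f) z)"], rule exI[of _ "\<lambda>z. - Re (deriv (deriv f) z)"])
       (use dRe[OF assms(1)] dRe[OF h1] dIm[OF h1] cont in \<open>auto intro!: continuous_intros\<close>)
qed

text \<open>The complex gradient \<open>ux - \<i> uy\<close> satisfies the Cauchy-Riemann equations, and a primitive of it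
  has real part \<open>u\<close> up to a constant.\<close>

lemma harmonic_on_convex_imp_Re:
  assumes "harmonic_on u S" "open S" "convex S"
  obtains H where "H holomorphic_on S" "\<And>z. z \<in> S \<Longrightarrow> Re (H z) = u z"
proof -
  obtain ux uy uxx uxy uyx uyy where c: "continuous_on S uxy" "continuous_on S uyx"
    and u: "\<And>z. z \<in> S \<Longrightarrow> (u has_derivative (\<lambda>h. ux z * Re h + uy z * Im h)) (at z)"
    and ux: "\<And>z. z \<in> S \<Longrightarrow> (ux has_derivative (\<lambda>h. uxx z * Re h + uxy z * Im h)) (at z)"
    and uy: "\<And>z. z \<in> S \<Longrightarrow> (uy has_derivative (\<lambda>h. uyx z * Re h + uyy z * Im h)) (at z)"
    and lap: "\<And>z. z \<in> S \<Longrightarrow> uxx z + uyy z = 0"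
    using assms(1) unfolding harmonic_on_def by blast
  define g where "g z = of_real (ux z) - \<i> * of_real (uy z)" for z
  have g: "(g has_field_derivative (of_real (uxx z) - \<i> * of_real (uxy z))) (at z)" if z: "z \<in> S" for z
  proof -
    have sym: "uyx z = uxy z" using mixed_partials_eq[OF assms(2) z c u ux uy] by simp
    have lap': "uyy z = - uxx z" using lap[OF z] by simp
    have "(g has_derivative (\<lambda>h. of_real (uxx z * Re h + uxy z * Im h) - \<i> * of_real (uyx z * Re h + uyy z * Im h))) (at z)"
      unfolding g_def
      by (rule has_derivative_diff[OF has_derivative_of_real[OF ux[OF z]]
            has_derivative_mult_right[OF has_derivative_of_real[OF uy[OF z]]]])
    then show ?thesis
      unfolding has_field_derivative_def
      by (rule has_derivative_eq_rhs) (auto simp: fun_eq_iff complex_eq_iff sym lap' algebra_simps)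
  qed
  have hg: "g holomorphic_on S"
    unfolding holomorphic_on_open[OF assms(2)] using g by blast
  obtain G where G: "\<And>z. z \<in> S \<Longrightarrow> (G has_field_derivative g z) (at z within S)"
  proof (rule holomorphic_convex_primitive'[OF assms(3,2) hg])
    fix G assume *: "\<And>x. x \<in> S \<Longrightarrow> (G has_field_derivative g x) (at x within S)"
    show thesis by (rule that[of G]) (rule *)
  qed
  have G': "(G has_field_derivative g z) (at z)" if "z \<in> S" for z
    using G[OF that] unfolding at_within_open[OF that assms(2)] .
  have hG: "G holomorphic_on S"
    unfolding holomorphic_on_def field_differentiable_def using G by (intro ballI exI)
  have zero: "((\<lambda>z. u z - Re (G z)) has_derivative (\<lambda>h. 0)) (at z within S)" if z: "z \<in> S" for z
  proof -
    have "(G has_derivative (\<lambda>h. g z * h)) (at z)"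
      using G'[OF z] by (simp add: has_field_derivative_def)
    from has_derivative_diff[OF u[OF z] has_derivative_Re[OF this]]
    have "((\<lambda>z. u z - Re (G z)) has_derivative (\<lambda>h. 0)) (at z)"
      by (rule has_derivative_eq_rhs) (auto simp: g_def fun_eq_iff algebra_simps)
    then show ?thesis by (rule has_derivative_at_withinI)
  qed
  obtain k where k: "\<And>z. z \<in> S \<Longrightarrow> u z - Re (G z) = k"
    using has_derivative_zero_constant[OF assms(3) zero] by blast
  show ?thesis
  proof (rule that[of "\<lambda>z. G z + of_real k"])
    show "(\<lambda>z. G z + of_real k) holomorphic_on S" by (intro holomorphic_intros hG)
    show "Re (G z + of_real k) = u z" if "z \<in> S" for z using k[OF that] by simp
  qed
qed

section \<open>The Poisson formula\<close>

definition poisson :: "complex \<Rightarrow> real \<Rightarrow> real" where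
  "poisson z \<theta> = (1 - (norm z)\<^sup>2) / (norm (cis \<theta> - z))\<^sup>2"

lemma cis_neq: "norm z < 1 \<Longrightarrow> cis \<theta> \<noteq> z"
  by (metis norm_cis less_irrefl)

lemma poisson_pos: "norm z < 1 \<Longrightarrow> poisson z \<theta> > 0"
  using cis_neq[of z \<theta>] by (simp add: poisson_def power_less_one_iff abs_square_less_1)

lemma poisson_0 [simp]: "poisson 0 \<theta> = 1"
  by (simp add: poisson_def)

lemma continuous_on_poisson [continuous_intros]:
  assumes "continuous_on A f" "continuous_on A g" "\<And>x. x \<in> A \<Longrightarrow> norm (f x) < 1"
  shows "continuous_on A (\<lambda>x. poisson (f x) (g x))"
  unfolding poisson_def using assms cis_neq
  by (intro continuous_intros) (auto simp: cis_neq)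

lemma poisson_rotate: "poisson (z * cis c) (\<theta> + c) = poisson z \<theta>"
proof -
  have "cis (\<theta> + c) - z * cis c = (cis \<theta> - z) * cis c" by (simp add: cis_mult algebra_simps)
  then show ?thesis by (simp add: poisson_def norm_mult)
qed

text \<open>Cauchy's formula applied to \<open>w \<mapsto> f w (1 - |z|\<^sup>2) / (1 - cnj z w)\<close>.\<close>

lemma poisson_formula_complex:
  fixes f :: "complex \<Rightarrow> complex"
  assumes f: "f holomorphic_on S" "open S" "cball 0 1 \<subseteq> S" and z: "norm z < 1"
  shows "((\<lambda>\<theta>. f (cis \<theta>) * of_real (poisson z \<theta>)) has_integral (2 * pi * f z)) {0..2*pi}"
proof -
  define k where "k w = f w * (1 - of_real ((norm z)\<^sup>2)) / (1 - cnj z * w)" for w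
  have nz: "1 - cnj z * w \<noteq> 0" if "norm w \<le> 1" for w
  proof
    assume "1 - cnj z * w = 0"
    then have "norm (cnj z * w) = 1" by (metis eq_iff_diff_eq_0 norm_one)
    moreover have "norm (cnj z * w) \<le> norm z * 1" unfolding norm_mult complex_mod_cnj
      by (rule mult_left_mono) (use that in auto)
    ultimately show False using z by simp
  qed
  have hk: "k holomorphic_on cball 0 1" unfolding k_def
    by (intro holomorphic_intros holomorphic_on_subset[OF f(1)] f(3)) (use nz in auto)
  have "((\<lambda>u. k u / (u - z)) has_contour_integral 2 * of_real pi * \<i> * k z) (circlepath 0 1)"
    by (rule Cauchy_integral_circlepath)
       (use z hk in \<open>auto intro: holomorphic_on_imp_continuous_on holomorphic_on_subset\<close>)
  moreover have "k z = f z"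
  proof -
    have "cnj z * z = of_real ((norm z)\<^sup>2)"
      by (metis complex_norm_square mult.commute)
    then show ?thesis using nz[of z] z by (simp add: k_def)
  qed
  ultimately have "((\<lambda>u. k u / (u - z)) has_contour_integral 2 * of_real pi * \<i> * f z) (part_circlepath 0 1 0 (2*pi))"
    by (simp add: circlepath_def)
  then have "((\<lambda>t. k (cis t) / (cis t - z) * \<i> * cis t) has_integral 2 * of_real pi * \<i> * f z) {0..2*pi}"
    by (subst (asm) has_contour_integral_part_circlepath_iff) (auto simp: mult_ac)
  then have "((\<lambda>t. (-\<i>) * (k (cis t) / (cis t - z) * \<i> * cis t)) has_integral (-\<i>) * (2 * of_real pi * \<i> * f z)) {0..2*pi}"
    by (rule has_integral_mult_right)
  then have I: "((\<lambda>t. (-\<i>) * (k (cis t) / (cis t - z) * \<i> * cis t)) has_integral 2 * pi * f z) {0..2*pi}"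
    by (rule has_integral_eq_rhs) (simp add: algebra_simps)
  have "(-\<i>) * (k (cis t) / (cis t - z) * \<i> * cis t) = f (cis t) * of_real (poisson z t)" for t
  proof -
    have nz': "cis t - z \<noteq> 0" using cis_neq[OF z] by simp
    have e1: "1 - cnj z * cis t = cis t * cnj (cis t - z)"
      by (simp add: algebra_simps cis_cnj cis_mult)
    have e2: "(cis t - z) * cnj (cis t - z) = of_real ((norm (cis t - z))\<^sup>2)"
      by (metis complex_norm_square)
    have "k (cis t) / (cis t - z) * cis t
        = f (cis t) * (1 - of_real ((norm z)\<^sup>2)) * cis t / ((cis t * cnj (cis t - z)) * (cis t - z))"
      unfolding k_def e1 by simp
    also have "\<dots> = f (cis t) * (1 - of_real ((norm z)\<^sup>2)) / ((cis t - z) * cnj (cis t - z))"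
      using nz' by (simp add: divide_simps)
    also have "\<dots> = f (cis t) * of_real (poisson z t)" unfolding e2 poisson_def by simp
    finally have "k (cis t) / (cis t - z) * cis t = f (cis t) * of_real (poisson z t)" .
    moreover have "(-\<i>) * (A * \<i> * B) = A * B" for A B :: complex by (simp add: algebra_simps)
    ultimately show ?thesis by simp
  qed
  then show ?thesis using I by simp
qed

text \<open>The arbitrary starting point \<open>c\<close> of the period serves to centre the boundary integral at any
  point of the circle.\<close>

lemma poisson_formula:
  fixes f :: "complex \<Rightarrow> complex"
  assumes f: "f holomorphic_on S" "open S" "cball 0 1 \<subseteq> S" and z: "norm z < 1"
  shows "((\<lambda>\<theta>. Re (f (cis \<theta>)) * poisson z \<theta>) has_integral (2 * pi * Re (f z))) {c..c + 2*pi}"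
proof -
  define r where "r = (\<lambda>w. w * cis c)"
  have S': "open (r -` S)" unfolding r_def
    by (rule continuous_open_vimage[OF f(2)]) (intro continuous_intros)
  have "(f \<circ> r) holomorphic_on (r -` S)"
    by (rule holomorphic_on_compose_gen[OF _ f(1)]) (unfold r_def, intro holomorphic_intros, auto)
  moreover have "cball 0 1 \<subseteq> r -` S" by (auto simp: r_def norm_mult intro!: subsetD[OF f(3)])
  ultimately have "((\<lambda>\<theta>. (f \<circ> r) (cis \<theta>) * of_real (poisson (z * cis (-c)) \<theta>)) has_integral
      (2 * pi * (f \<circ> r) (z * cis (-c)))) {0..2*pi}"
    by (intro poisson_formula_complex[of "f \<circ> r", OF _ S']) (use z in \<open>auto simp: norm_mult\<close>)
  moreover have "r (z * cis (-c)) = z" by (simp add: r_def cis_mult)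
  moreover have "poisson (z * cis (-c)) \<theta> = poisson z (\<theta> + c)" for \<theta>
    using poisson_rotate[of z "-c" "\<theta> + c"] by simp
  ultimately have "((\<lambda>\<theta>. f (cis (\<theta> + c)) * of_real (poisson z (\<theta> + c))) has_integral (2 * pi * f z)) {0..2*pi}"
    by (simp add: o_def r_def cis_mult mult.assoc)
  then have "((\<lambda>\<theta>. f (cis \<theta>) * of_real (poisson z \<theta>)) has_integral (2 * pi * f z)) {c..c+2*pi}"
    using has_integral_affinity'[of "\<lambda>\<theta>. f (cis (\<theta> + c)) * of_real (poisson z (\<theta> + c))" _ 0 "2*pi" 1 "-c"]
    by (simp add: add.commute)
  from has_integral_Re[OF this] show ?thesis by simp
qed

lemma poisson_integral_const:
  assumes "norm z < 1"
  shows "(poisson z has_integral 2 * pi) {c..c+2*pi}"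
  using poisson_formula[of "\<lambda>_. 1" UNIV z c] assms by simp

lemma poisson_lower_bound:
  assumes f: "f holomorphic_on S" "open S" "cball 0 1 \<subseteq> S"
    and z: "norm z < 1" and ge: "\<And>\<theta>. Re (f (cis \<theta>)) \<ge> b"
  shows "Re (f z) \<ge> b"
proof -
  have "((\<lambda>\<theta>. b * poisson z \<theta>) has_integral b * (2 * pi)) {0..0+2*pi}"
    by (intro has_integral_mult_right poisson_integral_const z)
  moreover have "b * poisson z \<theta> \<le> Re (f (cis \<theta>)) * poisson z \<theta>" for \<theta>
    using poisson_pos[OF z, of \<theta>] ge[of \<theta>] by (intro mult_right_mono) auto
  ultimately have "b * (2 * pi) \<le> 2 * pi * Re (f z)"
    using has_integral_le[OF _ poisson_formula[OF f z, of 0]] by blast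
  then show ?thesis by simp
qed

lemma mean_value_Re:
  assumes f: "f holomorphic_on ball 0 1" and r: "0 \<le> r" "r < 1"
  shows "((\<lambda>\<theta>. Re (f (of_real r * cis \<theta>))) has_integral 2 * pi * Re (f 0)) {0..2*pi}"
proof -
  define S where "S = (\<lambda>z::complex. of_real r * z) -` ball 0 1"
  have "open S" unfolding S_def by (rule continuous_open_vimage[OF open_ball]) (intro continuous_intros)
  moreover have "(f \<circ> (\<lambda>z. of_real r * z)) holomorphic_on S"
    by (rule holomorphic_on_compose_gen[OF _ f]) (unfold S_def, intro holomorphic_intros, auto)
  moreover have "cball 0 1 \<subseteq> S"
  proof
    fix z :: complex assume "z \<in> cball 0 1"
    then have "r * norm z \<le> r * 1" using r by (intro mult_left_mono) auto
    then show "z \<in> S" using r by (auto simp: S_def norm_mult)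
  qed
  ultimately show ?thesis
    using poisson_formula[of "f \<circ> (\<lambda>z. of_real r * z)" S 0 0] by simp
qed

section \<open>Blaschke factors\<close>

definition blaschke :: "complex \<Rightarrow> complex \<Rightarrow> complex" where
  "blaschke a z = (z - a) / (1 - cnj a * z)"

lemma blaschke_denom_lower:
  assumes "norm z \<le> 1"
  shows "1 - norm a \<le> norm (1 - cnj a * z)"
proof -
  have "norm (cnj a * z) \<le> norm a" using assms by (simp add: norm_mult mult_left_le)
  then show ?thesis using norm_triangle_ineq2[of 1 "cnj a * z"] by simp
qed

lemma blaschke_denom_nz:
  assumes "norm a < 1" "norm z \<le> 1"
  shows "1 - cnj a * z \<noteq> 0"
  using blaschke_denom_lower[OF assms(2), of a] assms(1) by auto

text \<open>The defect \<open>1 - |b\<^sub>a|\<^sup>2\<close> is symmetric in \<open>a\<close> and \<open>z\<close>; it measures how close \<open>a\<close> and \<open>z\<close> are in the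
  hyperbolic metric and replaces \<open>log 1/|b\<^sub>a|\<close> where the latter is infinite.\<close>

lemma blaschke_norm_identity:
  assumes "1 - cnj a * z \<noteq> 0"
  shows "1 - (norm (blaschke a z))\<^sup>2 = (1 - (norm a)\<^sup>2) * (1 - (norm z)\<^sup>2) / (norm (1 - cnj a * z))\<^sup>2"
proof -
  have "(norm (1 - cnj a * z))\<^sup>2 - (norm (z - a))\<^sup>2 = (1 - (norm a)\<^sup>2) * (1 - (norm z)\<^sup>2)"
    unfolding cmod_power2 by (simp add: power2_eq_square algebra_simps)
  then show ?thesis using assms
    by (simp add: blaschke_def norm_divide power_divide divide_simps)
qed

lemma blaschke_norm_circle:
  assumes "norm a < 1" "norm z = 1"
  shows "norm (blaschke a z) = 1"
proof -
  have "1 - (norm (blaschke a z))\<^sup>2 = 0"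
    using blaschke_norm_identity[OF blaschke_denom_nz[OF assms(1), of z]] assms by simp
  then have "(norm (blaschke a z))\<^sup>2 = 1\<^sup>2" by simp
  then show ?thesis by (metis norm_ge_zero power2_eq_iff_nonneg zero_le_one)
qed

lemma blaschke_norm_le_1:
  assumes "norm a < 1" "norm z \<le> 1"
  shows "norm (blaschke a z) \<le> 1"
proof -
  have "1 - (norm (blaschke a z))\<^sup>2 \<ge> 0"
    unfolding blaschke_norm_identity[OF blaschke_denom_nz[OF assms]]
    using assms by (intro divide_nonneg_nonneg mult_nonneg_nonneg) (auto simp: abs_square_le_1 power_le_one)
  then show ?thesis by (simp add: abs_square_le_1)
qed

lemma blaschke_0 [simp]: "blaschke a 0 = - a"
  by (simp add: blaschke_def)

lemma holomorphic_blaschke: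
  assumes "norm a < 1"
  shows "blaschke a holomorphic_on ball 0 1"
  unfolding blaschke_def
  by (intro holomorphic_intros) (use blaschke_denom_nz[OF assms] in auto)

text \<open>The local factorization at \<open>a\<close> extends to \<open>S\<close>, because \<open>F z / (z - a)^n\<close> is holomorphic elsewhere.\<close>

lemma zero_division:
  assumes F: "F holomorphic_on S" "open S" "connected S" and a: "a \<in> S" "F a = 0" and nz: "b \<in> S" "F b \<noteq> 0"
  obtains n g where "n > 0" "g holomorphic_on S" "g a \<noteq> 0" "\<And>z. z \<in> S \<Longrightarrow> F z = (z - a) ^ n * g z"
proof -
  have nc: "\<not> F constant_on S" unfolding constant_on_def using a nz by metis
  obtain g r n where g: "0 < n" "0 < r" "ball a r \<subseteq> S" "g holomorphic_on ball a r"
      "\<And>w. w \<in> ball a r \<Longrightarrow> F w = (w - a) ^ n * g w" "\<And>w. w \<in> ball a r \<Longrightarrow> g w \<noteq> 0"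
    using holomorphic_factor_zero_nonconstant[OF F a nc] by metis
  define k where "k z = (if z = a then g a else F z / (z - a) ^ n)" for z
  have kg: "k z = g z" if "z \<in> ball a r" for z
    using g(5)[OF that] by (auto simp: k_def)
  have "k holomorphic_on ball a r"
    by (rule holomorphic_transform[OF g(4)]) (use kg in auto)
  moreover have "k holomorphic_on (S - {a})"
  proof -
    have "(\<lambda>z. F z / (z - a) ^ n) holomorphic_on (S - {a})"
      by (intro holomorphic_intros holomorphic_on_subset[OF F(1)]) auto
    then show ?thesis by (rule holomorphic_transform) (auto simp: k_def)
  qed
  ultimately have "k holomorphic_on (ball a r \<union> (S - {a}))"
    using F(2) by (intro holomorphic_on_Un) auto
  moreover have "ball a r \<union> (S - {a}) = S" using g(2,3) a by auto
  ultimately have "k holomorphic_on S" by simp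
  moreover have "k a \<noteq> 0" using g(2,6) by (simp add: k_def)
  moreover have "F z = (z - a) ^ n * k z" if "z \<in> S" for z using a g(1) by (auto simp: k_def)
  ultimately show ?thesis using that g(1) by blast
qed

lemma prod_list_replicate: "prod_list (map f (replicate n a)) = f a ^ n" for f :: "'a \<Rightarrow> 'b::comm_monoid_mult"
  by (induction n) auto

text \<open>There are finitely many zeros in the compact disk; each is divided out with its multiplicity.\<close>

lemma factor_out_zeros:
  assumes F: "F holomorphic_on S" "open S" "connected S" and K: "compact K" "K \<subseteq> S" and nz: "b \<in> S" "F b \<noteq> 0"
  shows "\<exists>as g. set as \<subseteq> K \<and> g holomorphic_on S \<and> (\<forall>z\<in>K. g z \<noteq> 0) \<and>
    (\<forall>z\<in>S. F z = (\<Prod>a\<leftarrow>as. z - a) * g z)"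
proof -
  have fin: "finite {z \<in> K. G z = 0}" if "G holomorphic_on S" "G c \<noteq> 0" "c \<in> S" for G c
  proof (cases "G constant_on S")
    case True
    then have "{z \<in> K. G z = 0} = {}" using that(2,3) K(2) by (auto simp: constant_on_def)
    then show ?thesis by (metis finite.emptyI)
  qed (rule holomorphic_compact_finite_zeros[OF that(1) F(2,3) K])
  show ?thesis
    using F(1) nz
  proof (induction "card {z \<in> K. F z = 0}" arbitrary: F b rule: less_induct)
    case less
    show ?case
    proof (cases "{z \<in> K. F z = 0} = {}")
      case True
      then show ?thesis by (intro exI[of _ "[]"] exI[of _ F]) (use less in auto)
    next
      case False
      then obtain a where a: "a \<in> K" "F a = 0" by auto
      obtain n g where g: "n > 0" "g holomorphic_on S" "g a \<noteq> 0" "\<And>z. z \<in> S \<Longrightarrow> F z = (z - a) ^ n * g z"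
        using zero_division[OF less.prems(1) F(2,3) _ a(2) less.prems(2,3)] a K(2) by blast
      have "{z \<in> K. g z = 0} \<subset> {z \<in> K. F z = 0}"
        using a g K(2) by auto
      then have "card {z \<in> K. g z = 0} < card {z \<in> K. F z = 0}"
        by (intro psubset_card_mono fin[OF less.prems(1,3,2)])
      from less.hyps[OF this g(2) _ g(3)] a K(2) obtain as k where
        k: "set as \<subseteq> K" "k holomorphic_on S" "\<forall>z\<in>K. k z \<noteq> 0" "\<forall>z\<in>S. g z = (\<Prod>a\<leftarrow>as. z - a) * k z"
        by blast
      have "F z = (\<Prod>a\<leftarrow>replicate n a @ as. z - a) * k z" if "z \<in> S" for z
        using g(4)[OF that] k(4) that by (simp add: prod_list_replicate)
      moreover have "set (replicate n a @ as) \<subseteq> K" using k(1) a by auto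
      ultimately show ?thesis using k(2,3) by blast
    qed
  qed
qed

text \<open>Passing to a disk makes logarithms of zero-free functions available near the closed unit disk.\<close>

lemma ball_around_cball:
  assumes "open U" "cball (0::complex) 1 \<subseteq> U"
  obtains R where "R > 1" "ball 0 R \<subseteq> U"
proof -
  obtain e where e: "e > 0" "(\<Union>x\<in>cball (0::complex) 1. ball x e) \<subseteq> U"
    using compact_subset_open_imp_ball_epsilon_subset[OF compact_cball assms] by blast
  have "z \<in> U" if z: "norm z < 1 + e" for z :: complex
  proof (cases "norm z \<le> 1")
    case True then show ?thesis using assms by auto
  next
    case False
    have "norm (sgn z) = 1" using False by (auto simp: norm_sgn)
    moreover have "dist (sgn z) z < e"
    proof -
      have "z - sgn z = of_real (norm z - 1) * sgn z"
      proof -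
        have "of_real (norm z) * sgn z = z" using False by (auto simp: sgn_eq)
        then show ?thesis by (simp add: algebra_simps)
      qed
      then have "norm (z - sgn z) = norm (of_real (norm z - 1) :: complex)"
        using \<open>norm (sgn z) = 1\<close> by (simp only: norm_mult)
      then have "norm (z - sgn z) = norm z - 1" using False unfolding norm_of_real by simp
      then show ?thesis using z by (simp add: dist_norm norm_minus_commute)
    qed
    ultimately show ?thesis using e(2) by (force simp: subset_iff)
  qed
  then show ?thesis by (intro that[of "1 + e"]) (use e in auto)
qed

lemma prod_list_norm: "norm (prod_list (xs :: complex list)) = prod_list (map norm xs)"
  by (induction xs) (auto simp: norm_mult)

text \<open>After division by the Blaschke factors of its zeros \<open>F\<close> has a holomorphic logarithm \<open>V\<close>; a list is
  used for the zeros in order to record multiplicities.\<close>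

lemma blaschke_factorization:
  assumes F: "F holomorphic_on ball 0 R" "R > 1" and nz: "\<And>z. norm z = 1 \<Longrightarrow> F z \<noteq> 0"
  obtains as R' V where "set as \<subseteq> ball 0 1" "R' > 1" "V holomorphic_on ball 0 R'"
    "\<And>z. norm z \<le> 1 \<Longrightarrow> norm (F z) = (\<Prod>a\<leftarrow>as. norm (blaschke a z)) * exp (Re (V z))"
proof -
  have K: "cball 0 1 \<subseteq> ball (0::complex) R" using F(2) by auto
  have "1 \<in> ball (0::complex) R" "F 1 \<noteq> 0" using F(2) nz[of 1] by auto
  then obtain as g where g: "set as \<subseteq> cball 0 1" "g holomorphic_on ball 0 R" "\<forall>z\<in>cball 0 1. g z \<noteq> 0"
    and Fg: "\<forall>z\<in>ball 0 R. F z = (\<Prod>a\<leftarrow>as. z - a) * g z"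
    using factor_out_zeros[OF F(1) open_ball connected_ball compact_cball K, of 1] by auto
  have as: "norm a < 1" if "a \<in> set as" for a
  proof -
    have le: "norm a \<le> 1" using that g(1) by auto
    have "F a = 0" using bspec[OF Fg, of a] le F(2) that by (force simp: prod_list_zero_iff)
    then show ?thesis using nz[of a] le by force
  qed
  define G where "G z = g z * (\<Prod>a\<leftarrow>as. 1 - cnj a * z)" for z
  have hp: "(\<lambda>z. \<Prod>a\<leftarrow>as. 1 - cnj a * z) holomorphic_on UNIV"
    by (induction as) (auto intro!: holomorphic_intros)
  have hG: "G holomorphic_on ball 0 R" unfolding G_def
    by (intro holomorphic_intros g(2) holomorphic_on_subset[OF hp]) auto
  have G0: "G z \<noteq> 0" if "norm z \<le> 1" for z
    using g(3) that blaschke_denom_nz[OF as that] by (auto simp: G_def prod_list_zero_iff)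
  define U where "U = {z \<in> ball 0 R. G z \<noteq> 0}"
  have "open U" unfolding U_def
    using continuous_open_preimage[OF holomorphic_on_imp_continuous_on[OF hG] open_ball, of "- {0}"]
    by (auto simp: vimage_def Int_def)
  moreover have "cball 0 1 \<subseteq> U" using G0 F(2) by (auto simp: U_def)
  ultimately obtain R' where R': "R' > 1" "ball 0 R' \<subseteq> U" by (rule ball_around_cball)
  obtain V where V: "V holomorphic_on ball 0 R'" "\<And>z. z \<in> ball 0 R' \<Longrightarrow> G z = exp (V z)"
  proof (rule contractible_imp_holomorphic_log[of G "ball 0 R'"])
    show "G holomorphic_on ball 0 R'" using hG by (rule holomorphic_on_subset) (use R' in \<open>auto simp: U_def\<close>)
    show "contractible (ball (0::complex) R')" by (simp add: convex_imp_contractible)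
  qed (use R' in \<open>auto simp: U_def\<close>)
  show ?thesis
  proof (rule that[of as R' V])
    fix z :: complex assume z: "norm z \<le> 1"
    have "(\<Prod>a\<leftarrow>as. norm (z - a)) = (\<Prod>a\<leftarrow>as. norm (blaschke a z)) * (\<Prod>a\<leftarrow>as. norm (1 - cnj a * z))"
      using as
    proof (induction as)
      case (Cons a as)
      then have "norm (z - a) = norm (blaschke a z) * norm (1 - cnj a * z)"
        using blaschke_denom_nz[of a z] z by (simp add: blaschke_def norm_divide)
      then show ?case using Cons by simp
    qed simp
    moreover have "norm (F z) = (\<Prod>a\<leftarrow>as. norm (z - a)) * norm (g z)"
      using bspec[OF Fg, of z] z F(2) by (simp add: norm_mult prod_list_norm o_def)
    moreover have "norm (g z) * (\<Prod>a\<leftarrow>as. norm (1 - cnj a * z)) = exp (Re (V z))"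
      using arg_cong[OF V(2)[of z], of norm] z R'(1) by (simp add: G_def norm_mult prod_list_norm o_def)
    ultimately show "norm (F z) = (\<Prod>a\<leftarrow>as. norm (blaschke a z)) * exp (Re (V z))"
      by (simp add: mult_ac)
  qed (use as R' V in auto)
qed

lemma prod_list_blaschke_le_1:
  assumes "set as \<subseteq> ball 0 1" "norm z \<le> 1"
  shows "(\<Prod>a\<leftarrow>as. norm (blaschke a z)) \<in> {0..1}"
  using assms(1)
proof (induction as)
  case (Cons a as)
  then show ?case using blaschke_norm_le_1[of a z] assms(2) by (auto intro!: mult_le_one)
qed auto

lemma prod_list_blaschke_circle:
  assumes "set as \<subseteq> ball 0 1" "norm z = 1"
  shows "(\<Prod>a\<leftarrow>as. norm (blaschke a z)) = 1"
  using assms(1)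
proof (induction as)
  case (Cons a as)
  then show ?case using blaschke_norm_circle[of a z] assms(2) by auto
qed auto

section \<open>Circular means and the least harmonic majorant of \<open>log\<^sup>+|g|\<close>\<close>

definition circle_mean :: "(complex \<Rightarrow> real) \<Rightarrow> real \<Rightarrow> real" where
  "circle_mean u r = integral {0..2*pi} (\<lambda>\<theta>. u (of_real r * cis \<theta>)) / (2 * pi)"

lemma logplus_nonneg [simp]: "logplus x \<ge> 0"
  by (simp add: logplus_def)

lemma logplus_continuous_on [continuous_intros]:
  "continuous_on A f \<Longrightarrow> continuous_on A (\<lambda>x. logplus (f x))"
  unfolding logplus_def by (intro continuous_intros) auto

lemma ln_le_logplus: "0 < x \<Longrightarrow> ln x \<le> logplus x"
  by (simp add: logplus_def)

lemma logplus_le_iff: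
  assumes "b \<ge> 0"
  shows "logplus x \<le> b \<longleftrightarrow> x \<le> exp b"
proof -
  have "logplus x \<le> b \<longleftrightarrow> exp (ln (max 1 x)) \<le> exp b" by (simp only: logplus_def exp_le_cancel_iff)
  also have "\<dots> \<longleftrightarrow> x \<le> exp b" using assms by simp
  finally show ?thesis .
qed

lemma norm_le_exp_logplus: "x \<le> exp (logplus x)"
  using logplus_le_iff[of "logplus x" x] by simp

lemma circle_mean_Re:
  assumes "f holomorphic_on ball 0 1" "0 \<le> r" "r < 1"
  shows "circle_mean (\<lambda>z. Re (f z)) r = Re (f 0)"
  using integral_unique[OF mean_value_Re[OF assms]] by (simp add: circle_mean_def)

lemma continuous_on_circles:
  fixes u :: "complex \<Rightarrow> real"
  assumes "continuous_on (ball 0 1) u" "A \<subseteq> {0..<1}"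
  shows "continuous_on (A \<times> B) (\<lambda>(r, \<theta>). u (of_real r * cis \<theta>))"
  unfolding split_beta
  by (rule continuous_on_compose2[OF assms(1)])
     (use assms(2) in \<open>auto simp: norm_mult intro!: continuous_intros\<close>)

lemma continuous_on_circle:
  fixes u :: "complex \<Rightarrow> real"
  assumes "continuous_on (ball 0 1) u" "0 \<le> r" "r < 1"
  shows "continuous_on B (\<lambda>\<theta>. u (of_real r * cis \<theta>))"
  by (rule continuous_on_compose2[OF assms(1)])
     (use assms(2,3) in \<open>auto simp: norm_mult intro!: continuous_intros\<close>)

lemma circle_mean_continuous:
  assumes "continuous_on (ball 0 1) u"
  shows "continuous_on {0..<1} (circle_mean u)"
proof -
  have "continuous_on {0..<1} (\<lambda>r. integral (cbox 0 (2*pi)) (\<lambda>\<theta>. u (of_real r * cis \<theta>)))"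
    by (rule integral_continuous_on_param) (rule continuous_on_circles[OF assms], auto)
  then show ?thesis unfolding circle_mean_def by (intro continuous_intros) auto
qed

lemma circle_mean_mono:
  assumes "continuous_on (ball 0 1) u" "continuous_on (ball 0 1) v" "0 \<le> r" "r < 1"
    and "\<And>z. norm z = r \<Longrightarrow> u z \<le> v z"
  shows "circle_mean u r \<le> circle_mean v r"
  unfolding circle_mean_def
  by (intro divide_right_mono integral_le integrable_continuous_interval continuous_on_circle assms)
     (use assms(3,4) in \<open>auto simp: norm_mult\<close>)

lemma circle_mean_add:
  assumes "continuous_on (ball 0 1) u" "continuous_on (ball 0 1) v" "0 \<le> r" "r < 1"
  shows "circle_mean (\<lambda>z. u z + v z) r = circle_mean u r + circle_mean v r"
  unfolding circle_mean_def
  by (subst integral_add)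
     (auto intro!: integrable_continuous_interval continuous_on_circle assms simp: add_divide_distrib)

lemma circle_mean_diff:
  assumes "continuous_on (ball 0 1) u" "continuous_on (ball 0 1) v" "0 \<le> r" "r < 1"
  shows "circle_mean (\<lambda>z. u z - v z) r = circle_mean u r - circle_mean v r"
  unfolding circle_mean_def
  by (subst integral_diff)
     (auto intro!: integrable_continuous_interval continuous_on_circle assms simp: diff_divide_distrib)

lemma circle_mean_const [simp]: "circle_mean (\<lambda>_. c) r = c"
  by (simp add: circle_mean_def)

text \<open>The Schwarz integral: the holomorphic function on the disk whose real part is the Poisson integral
  of \<open>v\<close>.\<close>

definition schwarz :: "(real \<Rightarrow> real) \<Rightarrow> complex \<Rightarrow> complex" where
  "schwarz v z = integral {0..2*pi} (\<lambda>\<theta>. (cis \<theta> + z) / (cis \<theta> - z) * of_real (v \<theta>)) / of_real (2 * pi)"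

lemma schwarz_integrable:
  assumes "continuous_on {0..2*pi} v" "norm z < 1"
  shows "(\<lambda>\<theta>. (cis \<theta> + z) / (cis \<theta> - z) * of_real (v \<theta>)) integrable_on {0..2*pi}"
  by (intro integrable_continuous_interval continuous_intros assms)
     (use cis_neq[OF assms(2)] in auto)

lemma holomorphic_schwarz:
  assumes v: "continuous_on {0..2*pi} v"
  shows "schwarz v holomorphic_on ball 0 1"
proof -
  have "(\<lambda>z. integral (cbox 0 (2*pi)) (\<lambda>\<theta>. (cis \<theta> + z) / (cis \<theta> - z) * of_real (v \<theta>))) holomorphic_on ball 0 1"
  proof (rule leibniz_rule_holomorphic[where fx = "\<lambda>z \<theta>. 2 * cis \<theta> / (cis \<theta> - z)\<^sup>2 * of_real (v \<theta>)"])
    fix z :: complex and \<theta> :: real assume "z \<in> ball 0 1"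
    then have "cis \<theta> - z \<noteq> 0" using cis_neq by auto
    then show "((\<lambda>z. (cis \<theta> + z) / (cis \<theta> - z) * of_real (v \<theta>)) has_field_derivative
        2 * cis \<theta> / (cis \<theta> - z)\<^sup>2 * of_real (v \<theta>)) (at z within ball 0 1)"
      by (auto intro!: derivative_eq_intros simp: divide_simps power2_eq_square) (simp add: algebra_simps)
  next
    fix z :: complex assume "z \<in> ball 0 1"
    then show "(\<lambda>\<theta>. (cis \<theta> + z) / (cis \<theta> - z) * of_real (v \<theta>)) integrable_on cbox 0 (2*pi)"
      using schwarz_integrable[OF v, of z] by simp
  next
    have "continuous_on (ball 0 1 \<times> cbox 0 (2*pi)) (\<lambda>x. v (snd x))"
      by (rule continuous_on_compose2[OF v]) (auto intro!: continuous_intros)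
    then show "continuous_on (ball 0 1 \<times> cbox 0 (2*pi)) (\<lambda>(z, \<theta>). 2 * cis \<theta> / (cis \<theta> - z)\<^sup>2 * of_real (v \<theta>))"
      unfolding split_beta by (intro continuous_intros) (use cis_neq in auto)
  qed (rule convex_ball)
  then show ?thesis unfolding schwarz_def by (intro holomorphic_intros) auto
qed

lemma Re_schwarz_kernel:
  assumes "norm z < 1"
  shows "Re ((cis \<theta> + z) / (cis \<theta> - z)) = poisson z \<theta>"
proof -
  have "(cis \<theta> + z) / (cis \<theta> - z) = (cis \<theta> + z) * cnj (cis \<theta> - z) / of_real ((norm (cis \<theta> - z))\<^sup>2)"
    by (metis complex_div_cnj)
  moreover have "Re ((cis \<theta> + z) * cnj (cis \<theta> - z)) = (norm (cis \<theta>))\<^sup>2 - (norm z)\<^sup>2"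
    unfolding cmod_power2 by (simp add: power2_eq_square algebra_simps)
  ultimately show ?thesis by (simp add: poisson_def)
qed

lemma Re_schwarz:
  assumes "continuous_on {0..2*pi} v" "norm z < 1"
  shows "Re (schwarz v z) = integral {0..2*pi} (\<lambda>\<theta>. v \<theta> * poisson z \<theta>) / (2 * pi)"
proof -
  have "((\<lambda>\<theta>. Re ((cis \<theta> + z) / (cis \<theta> - z) * of_real (v \<theta>))) has_integral
      Re (integral {0..2*pi} (\<lambda>\<theta>. (cis \<theta> + z) / (cis \<theta> - z) * of_real (v \<theta>)))) {0..2*pi}"
    by (intro has_integral_Re integrable_integral schwarz_integrable assms)
  moreover have "Re ((cis \<theta> + z) / (cis \<theta> - z) * of_real (v \<theta>)) = v \<theta> * poisson z \<theta>" for \<theta>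
  proof -
    have "Re (w * of_real x) = x * Re w" for w :: complex and x :: real by simp
    then show ?thesis by (simp only: Re_schwarz_kernel[OF assms(2)])
  qed
  ultimately have "integral {0..2*pi} (\<lambda>\<theta>. v \<theta> * poisson z \<theta>)
      = Re (integral {0..2*pi} (\<lambda>\<theta>. (cis \<theta> + z) / (cis \<theta> - z) * of_real (v \<theta>)))"
    by (simp only: integral_unique)
  then show ?thesis by (simp add: schwarz_def)
qed

lemma norm_schwarz_le:
  assumes v: "continuous_on {0..2*pi} v" "\<And>\<theta>. v \<theta> \<ge> 0" and z: "norm z < 1"
  shows "norm (schwarz v z) \<le> 2 / (1 - norm z) * (integral {0..2*pi} v / (2 * pi))"
proof -
  have "norm (integral {0..2*pi} (\<lambda>\<theta>. (cis \<theta> + z) / (cis \<theta> - z) * of_real (v \<theta>)))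
      \<le> integral {0..2*pi} (\<lambda>\<theta>. 2 / (1 - norm z) * v \<theta>)"
  proof (rule integral_norm_bound_integral[OF schwarz_integrable[OF v(1) z]])
    show "(\<lambda>\<theta>. 2 / (1 - norm z) * v \<theta>) integrable_on {0..2*pi}"
      by (intro integrable_continuous_interval continuous_intros v(1))
    fix \<theta> :: real
    have "norm (cis \<theta> + z) \<le> 2" using norm_triangle_ineq[of "cis \<theta>" z] z by simp
    moreover have "norm (cis \<theta> - z) \<ge> 1 - norm z" using norm_triangle_ineq2[of "cis \<theta>" z] by simp
    ultimately have "norm ((cis \<theta> + z) / (cis \<theta> - z)) \<le> 2 / (1 - norm z)"
      unfolding norm_divide using z by (intro frac_le) auto
    then show "norm ((cis \<theta> + z) / (cis \<theta> - z) * of_real (v \<theta>)) \<le> 2 / (1 - norm z) * v \<theta>"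
      unfolding norm_mult using v(2)[of \<theta>] z by (intro mult_mono) auto
  qed
  then have "norm (integral {0..2*pi} (\<lambda>\<theta>. (cis \<theta> + z) / (cis \<theta> - z) * of_real (v \<theta>)))
      \<le> 2 / (1 - norm z) * integral {0..2*pi} v"
    by (simp only: integral_mult_right)
  from divide_right_mono[OF this, of "2 * pi"]
  have "norm (integral {0..2*pi} (\<lambda>\<theta>. (cis \<theta> + z) / (cis \<theta> - z) * of_real (v \<theta>))) / (2 * pi)
      \<le> 2 / (1 - norm z) * integral {0..2*pi} v / (2 * pi)" by simp
  moreover have "norm (of_real (2 * pi) :: complex) = 2 * pi" by (simp only: norm_of_real) simp
  ultimately show ?thesis unfolding schwarz_def norm_divide by (simp only: times_divide_eq_right)
qed

text \<open>Dilation by \<open>r < 1\<close> makes functions on the open disk holomorphic across the unit circle.\<close>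

lemma rescaled_holomorphic:
  assumes "f holomorphic_on ball 0 1" "0 < \<rho>" "\<rho> < 1"
  shows "(\<lambda>z. f (of_real \<rho> * z)) holomorphic_on ball 0 (1 / \<rho>)" "1 / \<rho> > 1"
proof -
  have "(f \<circ> (\<lambda>z. of_real \<rho> * z)) holomorphic_on ball 0 (1 / \<rho>)"
    by (rule holomorphic_on_compose_gen[OF _ assms(1)])
       (intro holomorphic_intros, use assms in \<open>auto simp: norm_mult field_simps\<close>)
  then show "(\<lambda>z. f (of_real \<rho> * z)) holomorphic_on ball 0 (1 / \<rho>)" by (simp add: o_def)
  show "1 / \<rho> > 1" using assms by simp
qed

text \<open>On a dilated disk \<open>log |g|\<close> is at most the real part of the logarithm of the zero-free factor of \<open>g\<close>,
  which the Poisson formula represents by the boundary values of \<open>log |g| \<le> log\<^sup>+ |g|\<close>.\<close>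

lemma logplus_le_poisson:
  assumes g: "g holomorphic_on ball 0 R" "R > 1" and nz: "\<And>z. norm z = 1 \<Longrightarrow> g z \<noteq> 0" and z: "norm z < 1"
  shows "logplus (norm (g z)) \<le> Re (schwarz (\<lambda>\<theta>. logplus (norm (g (cis \<theta>)))) z)"
proof -
  have cont: "continuous_on A (\<lambda>\<theta>. logplus (norm (g (cis \<theta>))))" for A
    by (intro continuous_intros continuous_on_compose2[OF holomorphic_on_imp_continuous_on[OF g(1)]])
       (use g(2) in auto)
  obtain as R' V where as: "set as \<subseteq> ball 0 1" and V: "R' > 1" "V holomorphic_on ball 0 R'"
    and eq: "\<And>z. norm z \<le> 1 \<Longrightarrow> norm (g z) = (\<Prod>a\<leftarrow>as. norm (blaschke a z)) * exp (Re (V z))"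
    using blaschke_factorization[OF g nz] by metis
  have R: "Re (schwarz (\<lambda>\<theta>. logplus (norm (g (cis \<theta>)))) z)
      = integral {0..2*pi} (\<lambda>\<theta>. logplus (norm (g (cis \<theta>))) * poisson z \<theta>) / (2 * pi)"
    by (rule Re_schwarz[OF cont z])
  have int: "(\<lambda>\<theta>. logplus (norm (g (cis \<theta>))) * poisson z \<theta>) integrable_on {0..2*pi}"
    by (intro integrable_continuous_interval continuous_intros cont) (use z in auto)
  have pos: "0 \<le> Re (schwarz (\<lambda>\<theta>. logplus (norm (g (cis \<theta>)))) z)"
    unfolding R using poisson_pos[OF z] by (intro divide_nonneg_pos integral_nonneg int) (auto simp: less_imp_le)
  have "cball 0 1 \<subseteq> ball (0::complex) R'" using V(1) by auto
  note PV = poisson_formula[OF V(2) open_ball this z, of 0]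
  have iV: "(\<lambda>\<theta>. Re (V (cis \<theta>)) * poisson z \<theta>) integrable_on {0..2*pi}"
    using has_integral_integrable[OF PV] by simp
  have "2 * pi * Re (V z) = integral {0..2*pi} (\<lambda>\<theta>. Re (V (cis \<theta>)) * poisson z \<theta>)"
    using integral_unique[OF PV] by simp
  also have "\<dots> \<le> integral {0..2*pi} (\<lambda>\<theta>. logplus (norm (g (cis \<theta>))) * poisson z \<theta>)"
  proof (rule integral_le[OF iV int])
    fix \<theta> :: real
    have "norm (g (cis \<theta>)) = exp (Re (V (cis \<theta>)))"
      using eq[of "cis \<theta>"] prod_list_blaschke_circle[OF as, of "cis \<theta>"] by simp
    then have "Re (V (cis \<theta>)) \<le> logplus (norm (g (cis \<theta>)))"
      using ln_le_logplus[of "norm (g (cis \<theta>))"] by simp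
    then show "Re (V (cis \<theta>)) * poisson z \<theta> \<le> logplus (norm (g (cis \<theta>))) * poisson z \<theta>"
      using poisson_pos[OF z, of \<theta>] by (intro mult_right_mono) auto
  qed
  finally have "Re (V z) \<le> Re (schwarz (\<lambda>\<theta>. logplus (norm (g (cis \<theta>)))) z)"
    unfolding R by (simp add: field_simps)
  moreover have "norm (g z) \<le> 1 * exp (Re (V z))"
    unfolding eq[OF less_imp_le[OF z]] using prod_list_blaschke_le_1[OF as, of z] z
    by (intro mult_right_mono) auto
  ultimately have "norm (g z) \<le> exp (Re (schwarz (\<lambda>\<theta>. logplus (norm (g (cis \<theta>)))) z))"
    by (metis exp_le_cancel_iff mult_1 order_trans)
  then show ?thesis using logplus_le_iff[OF pos] by simp
qed

text \<open>Only finitely many zeros lie in the compact disk of radius \<open>b\<close>.\<close>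

lemma exists_zero_free_radius:
  assumes g: "g holomorphic_on ball 0 1" "z0 \<in> ball 0 1" "g z0 \<noteq> 0" and ab: "a < b" "b < 1" "0 \<le> a"
    and fin: "finite X"
  obtains \<rho> where "a < \<rho>" "\<rho> < b" "\<rho> \<notin> X" "\<And>z. norm z = \<rho> \<Longrightarrow> g z \<noteq> 0"
proof -
  have K: "cball 0 b \<subseteq> ball (0::complex) 1" using ab by auto
  have "finite {z \<in> cball 0 b. g z = 0}"
  proof (cases "g constant_on ball 0 1")
    case True
    then have "g z \<noteq> 0" if "z \<in> cball 0 b" for z
      using that g(2,3) K unfolding constant_on_def by (metis subsetD)
    then have "{z \<in> cball 0 b. g z = 0} = {}" by auto
    then show ?thesis by (metis finite.emptyI)
  qed (rule holomorphic_compact_finite_zeros[OF g(1) open_ball connected_ball compact_cball K])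
  then have "finite (X \<union> norm ` {z \<in> cball 0 b. g z = 0})" using fin by simp
  moreover have "infinite {a<..<b}" using ab by (simp add: infinite_Ioo)
  ultimately obtain \<rho> where "\<rho> \<in> {a<..<b}" "\<rho> \<notin> X \<union> norm ` {z \<in> cball 0 b. g z = 0}"
    by (meson finite_subset subsetI)
  then show ?thesis by (intro that[of \<rho>]) auto
qed

lemma circle_mean_logplus_mono:
  assumes g: "g holomorphic_on ball 0 1" "z0 \<in> ball 0 1" "g z0 \<noteq> 0" and r: "0 \<le> r" "r \<le> s" "s < 1"
  shows "circle_mean (\<lambda>z. logplus (norm (g z))) r \<le> circle_mean (\<lambda>z. logplus (norm (g z))) s"
proof -
  define u where "u = (\<lambda>z. logplus (norm (g z)))"
  have cu: "continuous_on (ball 0 1) u" unfolding u_def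
    by (intro continuous_intros holomorphic_on_imp_continuous_on g)
  have good: "circle_mean u r \<le> circle_mean u \<rho>"
    if \<rho>: "s < \<rho>" "\<rho> < 1" "\<And>z. norm z = \<rho> \<Longrightarrow> g z \<noteq> 0" for \<rho>
  proof -
    have \<rho>0: "0 < \<rho>" "r < \<rho>" using that r by auto
    define G where "G = (\<lambda>z. g (of_real \<rho> * z))"
    have G: "G holomorphic_on ball 0 (1 / \<rho>)" "1 / \<rho> > 1"
      unfolding G_def using rescaled_holomorphic[OF g(1) \<rho>0(1) \<rho>(2)] by auto
    have Gnz: "G z \<noteq> 0" if "norm z = 1" for z
      using \<rho>(3)[of "of_real \<rho> * z"] that \<rho>0 by (simp add: G_def norm_mult)
    define K where "K = schwarz (\<lambda>\<theta>. logplus (norm (G (cis \<theta>))))"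
    have cont: "continuous_on {0..2*pi} (\<lambda>\<theta>. logplus (norm (G (cis \<theta>))))"
      by (intro continuous_intros continuous_on_compose2[OF holomorphic_on_imp_continuous_on[OF G(1)]])
         (use G(2) in auto)
    have hK: "K holomorphic_on ball 0 1" unfolding K_def by (rule holomorphic_schwarz[OF cont])
    have q: "0 \<le> r / \<rho>" "r / \<rho> < 1" using r \<rho>0 by auto
    have le: "u (of_real r * cis \<theta>) \<le> Re (K (of_real (r / \<rho>) * cis \<theta>))" for \<theta>
    proof -
      have "logplus (norm (G (of_real (r / \<rho>) * cis \<theta>))) \<le> Re (K (of_real (r / \<rho>) * cis \<theta>))"
        unfolding K_def by (rule logplus_le_poisson[OF G Gnz]) (use q \<rho>0 r in \<open>auto simp: norm_mult norm_divide\<close>)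
      then show ?thesis using \<rho>0 by (simp add: u_def G_def)
    qed
    have "circle_mean u r \<le> circle_mean (\<lambda>z. Re (K z)) (r / \<rho>)"
      unfolding circle_mean_def
    proof (intro divide_right_mono integral_le)
      show "(\<lambda>\<theta>. u (of_real r * cis \<theta>)) integrable_on {0..2*pi}"
        by (intro integrable_continuous_interval continuous_on_circle[OF cu]) (use r in auto)
      show "(\<lambda>\<theta>. Re (K (of_real (r / \<rho>) * cis \<theta>))) integrable_on {0..2*pi}"
        using mean_value_Re[OF hK q] by (rule has_integral_integrable)
    qed (use le in auto)
    also have "\<dots> = Re (K 0)" by (rule circle_mean_Re[OF hK q])
    also have "\<dots> = circle_mean u \<rho>"
      unfolding K_def by (subst Re_schwarz[OF cont]) (auto simp: circle_mean_def u_def G_def)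
    finally show ?thesis .
  qed
  show ?thesis unfolding u_def[symmetric]
  proof (rule ccontr)
    assume "\<not> circle_mean u r \<le> circle_mean u s"
    then have e: "circle_mean u r - circle_mean u s > 0" by simp
    have s: "s \<in> {0..<1}" using r by auto
    obtain d where d: "d > 0" "\<And>x. x \<in> {0..<1} \<Longrightarrow> dist x s < d \<Longrightarrow> dist (circle_mean u x) (circle_mean u s) < circle_mean u r - circle_mean u s"
      using circle_mean_continuous[OF cu] s e unfolding continuous_on_iff by metis
    define b where "b = min (s + d) ((1 + s) / 2)"
    have b: "s < b" "b < 1" using d s by (auto simp: b_def min_def)
    obtain \<rho> where \<rho>: "s < \<rho>" "\<rho> < b" "\<And>z. norm z = \<rho> \<Longrightarrow> g z \<noteq> 0"
      by (rule exists_zero_free_radius[OF g b _ finite.emptyI]) (use s in auto)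
    have "dist (circle_mean u \<rho>) (circle_mean u s) < circle_mean u r - circle_mean u s"
      by (rule d(2)) (use \<rho> b s in \<open>auto simp: dist_real_def b_def\<close>)
    moreover have "circle_mean u r \<le> circle_mean u \<rho>" by (rule good) (use \<rho> b in auto)
    ultimately show False by (simp add: dist_real_def)
  qed
qed

text \<open>The majorant is a normal-families limit of the Schwarz integrals of \<open>log\<^sup>+|g|\<close> over circles
  increasing to the unit circle. Its value at the centre is the limit of the means, so that it
  exceeds \<open>log\<^sup>+|g|\<close> by a function whose means tend to zero.\<close>

theorem least_harmonic_majorant:
  assumes g: "g holomorphic_on ball 0 1" "z0 \<in> ball 0 1" "g z0 \<noteq> 0"
    and bd: "\<And>r. 0 \<le> r \<Longrightarrow> r < 1 \<Longrightarrow> circle_mean (\<lambda>z. logplus (norm (g z))) r \<le> C"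
  obtains H where "H holomorphic_on ball 0 1" "\<And>z. z \<in> ball 0 1 \<Longrightarrow> logplus (norm (g z)) \<le> Re (H z)"
    "((\<lambda>r. circle_mean (\<lambda>z. Re (H z) - logplus (norm (g z))) r) \<longlongrightarrow> 0) (at_left 1)"
proof -
  define u where "u = (\<lambda>z. logplus (norm (g z)))"
  have cu: "continuous_on (ball 0 1) u" unfolding u_def
    by (intro continuous_intros holomorphic_on_imp_continuous_on g)
  have "\<exists>\<rho>. 1 - 1 / (real n + 1) < \<rho> \<and> \<rho> < 1 \<and> (\<forall>z. norm z = \<rho> \<longrightarrow> g z \<noteq> 0)" for n
  proof -
    have *: "1 - 1 / (real n + 1) < 1 - 1 / (real n + 2)" by (simp add: field_simps)
    have p: "1 / (real n + 2) > 0" by simp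
    obtain \<rho> where "1 - 1 / (real n + 1) < \<rho>" "\<rho> < 1 - 1 / (real n + 2)" "\<And>z. norm z = \<rho> \<Longrightarrow> g z \<noteq> 0"
      by (rule exists_zero_free_radius[OF g * _ _ finite.emptyI]) (use p in auto)
    moreover from this(2) p have "\<rho> < 1" by linarith
    ultimately show ?thesis by blast
  qed
  then obtain \<rho> where \<rho>: "\<And>n. 1 - 1 / (real n + 1) < \<rho> n" "\<And>n. \<rho> n < 1"
      "\<And>n z. norm z = \<rho> n \<Longrightarrow> g z \<noteq> 0" by metis
  have \<rho>0: "\<rho> n > 0" for n
    using \<rho>(1)[of n] by (rule order.strict_trans1[rotated]) simp
  have \<rho>lim: "\<rho> \<longlonglongrightarrow> 1"
  proof (rule tendsto_sandwich[of "\<lambda>n. 1 - 1 / (real n + 1)" _ _ "\<lambda>n. 1"])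
    show "(\<lambda>n. 1 - 1 / (real n + 1)) \<longlonglongrightarrow> 1"
      using tendsto_diff[OF tendsto_const[of 1] LIMSEQ_inverse_real_of_nat] by (simp add: inverse_eq_divide add.commute)
  qed (auto intro!: always_eventually less_imp_le[OF \<rho>(1)] less_imp_le[OF \<rho>(2)])
  define G where "G n = (\<lambda>z. g (of_real (\<rho> n) * z))" for n
  have G: "G n holomorphic_on ball 0 (1 / \<rho> n)" "1 / \<rho> n > 1" for n
    unfolding G_def using rescaled_holomorphic[OF g(1) \<rho>0 \<rho>(2)] by auto
  have Gnz: "G n z \<noteq> 0" if "norm z = 1" for z n
    using \<rho>(3)[of "of_real (\<rho> n) * z"] that \<rho>0[of n] by (simp add: G_def norm_mult)
  define K where "K n = schwarz (\<lambda>\<theta>. logplus (norm (G n (cis \<theta>))))" for n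
  have cont: "continuous_on {0..2*pi} (\<lambda>\<theta>. logplus (norm (G n (cis \<theta>))))" for n
    by (intro continuous_intros continuous_on_compose2[OF holomorphic_on_imp_continuous_on[OF G(1)]])
       (use G(2)[of n] in auto)
  have hK: "K n holomorphic_on ball 0 1" for n unfolding K_def by (rule holomorphic_schwarz[OF cont])
  have mean: "integral {0..2*pi} (\<lambda>\<theta>. logplus (norm (G n (cis \<theta>)))) / (2 * pi) = circle_mean u (\<rho> n)" for n
    by (simp add: circle_mean_def u_def G_def)
  have K0: "Re (K n 0) = circle_mean u (\<rho> n)" for n
    unfolding K_def by (subst Re_schwarz[OF cont]) (auto simp: mean)
  have Kbd: "norm (K n z) \<le> 2 / (1 - norm z) * C" if "norm z < 1" for n z
  proof -
    have "norm (K n z) \<le> 2 / (1 - norm z) * (integral {0..2*pi} (\<lambda>\<theta>. logplus (norm (G n (cis \<theta>)))) / (2 * pi))"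
      unfolding K_def by (rule norm_schwarz_le[OF cont _ that]) simp
    also have "\<dots> \<le> 2 / (1 - norm z) * C"
      unfolding mean u_def using \<rho>0[of n] \<rho>(2)[of n] that by (intro mult_left_mono bd) auto
    finally show ?thesis .
  qed
  define F where "F = {h. h holomorphic_on ball 0 1 \<and> (\<forall>z. norm z < 1 \<longrightarrow> norm (h z) \<le> 2 / (1 - norm z) * C)}"
  have C0: "C \<ge> 0" using bd[of 0] by (simp add: circle_mean_def) (metis logplus_nonneg order_trans)
  obtain H s where H: "H holomorphic_on ball 0 1" "strict_mono (s :: nat \<Rightarrow> nat)"
    and lim: "\<And>x. x \<in> ball 0 1 \<Longrightarrow> (\<lambda>n. K (s n) x) \<longlonglongrightarrow> H x"
  proof (rule Montel[of "ball 0 1" F K])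
    fix A :: "complex set" assume A: "compact A" "A \<subseteq> ball 0 1"
    obtain m where m: "m < 1" "\<And>z. z \<in> A \<Longrightarrow> norm z \<le> m"
    proof (cases "A = {}")
      case False
      then obtain z where "z \<in> A" "\<forall>w\<in>A. norm w \<le> norm z"
        using continuous_attains_sup[OF A(1) False, of norm] by (auto intro: continuous_intros)
      then show ?thesis using A(2) by (intro that[of "norm z"]) auto
    qed (use that[of 0] in auto)
    have "norm (h z) \<le> 2 / (1 - m) * C" if "h \<in> F" "z \<in> A" for h z
    proof -
      have "norm (h z) \<le> 2 / (1 - norm z) * C" using that A(2) by (auto simp: F_def)
      also have "\<dots> \<le> 2 / (1 - m) * C"
        using m(1) m(2)[OF that(2)] C0 by (intro mult_right_mono divide_left_mono) auto
      finally show ?thesis .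
    qed
    then show "\<exists>B. \<forall>h\<in>F. \<forall>z\<in>A. norm (h z) \<le> B" by blast
  qed (use hK Kbd in \<open>auto simp: F_def\<close>)
  have \<rho>s: "(\<lambda>n. \<rho> (s n)) \<longlonglongrightarrow> 1" using LIMSEQ_subseq_LIMSEQ[OF \<rho>lim H(2)] by (simp add: o_def)
  have maj: "u z \<le> Re (H z)" if z: "z \<in> ball 0 1" for z
  proof (rule LIMSEQ_le)
    show "(\<lambda>n. Re (K (s n) z)) \<longlonglongrightarrow> Re (H z)" by (intro tendsto_intros lim z)
    have "isCont u z" using cu z by (simp add: continuous_on_eq_continuous_at)
    moreover have "(\<lambda>n. of_real (\<rho> (s n)) * z) \<longlonglongrightarrow> of_real 1 * z"
      by (intro tendsto_intros \<rho>s)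
    ultimately show "(\<lambda>n. u (of_real (\<rho> (s n)) * z)) \<longlonglongrightarrow> u z"
      by (intro isCont_tendsto_compose[of z u]) auto
    have "u (of_real (\<rho> (s n)) * z) \<le> Re (K (s n) z)" for n
      using logplus_le_poisson[OF G Gnz, of z "s n"] z by (simp add: u_def G_def K_def)
    then show "\<exists>N. \<forall>n\<ge>N. u (of_real (\<rho> (s n)) * z) \<le> Re (K (s n) z)" by blast
  qed
  have cH: "continuous_on (ball 0 1) (\<lambda>z. Re (H z))"
    by (intro continuous_intros holomorphic_on_imp_continuous_on H)
  have Lim: "(\<lambda>n. circle_mean u (\<rho> (s n))) \<longlonglongrightarrow> Re (H 0)"
    unfolding K0[symmetric] by (intro tendsto_intros lim) auto
  have diff: "circle_mean (\<lambda>z. Re (H z) - u z) r = Re (H 0) - circle_mean u r" if "0 \<le> r" "r < 1" for r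
    using circle_mean_diff[OF cH cu that] circle_mean_Re[OF H(1) that] by simp
  have lim0: "((\<lambda>r. circle_mean (\<lambda>z. Re (H z) - u z) r) \<longlongrightarrow> 0) (at_left 1)"
  proof (rule tendstoI)
    fix e :: real assume "e > 0"
    then have "\<forall>\<^sub>F n in sequentially. circle_mean u (\<rho> (s n)) > Re (H 0) - e"
      using Lim by (intro order_tendstoD) auto
    then obtain n where n: "circle_mean u (\<rho> (s n)) > Re (H 0) - e"
      using eventually_happens' trivial_limit_sequentially by blast
    have "dist (circle_mean (\<lambda>z. Re (H z) - u z) r) 0 < e" if r: "r \<in> {\<rho> (s n)<..<1}" for r
    proof -
      have r': "0 \<le> r" "r < 1" using r \<rho>0[of "s n"] by auto
      have "circle_mean u (\<rho> (s n)) \<le> circle_mean u r"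
        unfolding u_def by (rule circle_mean_logplus_mono[OF g]) (use r \<rho>0[of "s n"] in auto)
      moreover have "circle_mean u r \<le> circle_mean (\<lambda>z. Re (H z)) r"
        using circle_mean_mono[OF cu cH r'] maj r' by auto
      ultimately show ?thesis using n diff[OF r'] circle_mean_Re[OF H(1) r'] by (simp add: dist_real_def)
    qed
    then show "\<forall>\<^sub>F r in at_left 1. dist (circle_mean (\<lambda>z. Re (H z) - u z) r) 0 < e"
      unfolding eventually_at_left_field using \<rho>(2)[of "s n"] by (intro exI[of _ "\<rho> (s n)"]) auto
  qed
  show ?thesis
    by (rule that[of H]) (use H(1) maj lim0 in \<open>simp_all add: u_def\<close>)
qed

section \<open>The lattice points in one Whitney box\<close>

lemma norm_diff_polar:
  "(norm (of_real r * cis x - of_real s * cis y))\<^sup>2 = (r - s)\<^sup>2 + 4 * r * s * (sin ((x - y) / 2))\<^sup>2"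
proof -
  have c: "cos (x - y) = 1 - 2 * (sin ((x - y) / 2))\<^sup>2"
  proof -
    have e: "2 * ((x - y) / 2) = x - y" by simp
    show ?thesis using cos_double_sin[of "(x - y) / 2", unfolded e] .
  qed
  have "(norm (of_real r * cis x - of_real s * cis y))\<^sup>2
      = r\<^sup>2 * ((cos x)\<^sup>2 + (sin x)\<^sup>2) + s\<^sup>2 * ((cos y)\<^sup>2 + (sin y)\<^sup>2) - 2 * r * s * (cos x * cos y + sin x * sin y)"
    unfolding cmod_power2
    by (simp add: power2_eq_square algebra_simps del: sin_cos_squared_add sin_cos_squared_add2 sin_cos_squared_add3)
  also have "\<dots> = r\<^sup>2 + s\<^sup>2 - 2 * r * s * cos (x - y)" by (simp add: cos_diff)
  finally show ?thesis unfolding c by (simp add: power2_eq_square algebra_simps)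
qed

lemma cos_ge_quadratic: "1 - x\<^sup>2 / 2 \<le> cos (x::real)"
proof -
  have "\<bar>sin (x / 2)\<bar>\<^sup>2 \<le> \<bar>x / 2\<bar>\<^sup>2" by (intro power_mono abs_sin_x_le_abs_x) auto
  then show ?thesis using cos_double_sin[of "x / 2"] by (simp add: power_divide)
qed

lemma sin_ge_quarter:
  fixes y :: real
  assumes "0 \<le> y" "y \<le> 2"
  shows "y / 4 \<le> sin y"
proof -
  have half: "1/2 \<le> cos t" if "0 \<le> t" "t \<le> 1" for t :: real
    using cos_ge_quadratic[of t] power_le_one[of t 2] that by simp
  have "y / 4 \<le> sin (y / 2)"
  proof (cases "y = 0")
    case False
    then have "\<exists>t. 0 < t \<and> t < y / 2 \<and> sin (y / 2) - sin 0 = (y / 2 - 0) * cos t"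
      using assms by (intro MVT2) (auto intro!: DERIV_sin)
    then obtain t where "0 < t" "t < y / 2" "sin (y / 2) = y / 2 * cos t" by auto
    moreover have "y / 2 * (1/2) \<le> y / 2 * cos t"
      using calculation assms by (intro mult_left_mono half) auto
    ultimately show ?thesis by linarith
  qed simp
  then have "2 * (y / 4) * (1/2) \<le> 2 * sin (y / 2) * cos (y / 2)"
    using assms by (intro mult_mono half) auto
  then show ?thesis using sin_double[of "y / 2"] by simp
qed

lemma abs_sin_ge_quarter:
  fixes y :: real
  assumes "\<bar>y\<bar> \<le> 2"
  shows "\<bar>y\<bar> / 4 \<le> \<bar>sin y\<bar>"
  using sin_ge_quarter[of y] sin_ge_quarter[of "-y"] assms by (cases "y \<ge> 0") auto

text \<open>Harnack's inequality for points of one circle in a common box of side comparable to their distance from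
  the boundary. The constant is \<open>(1 + 2)\<^sup>2\<close>: the distances to a boundary point differ by a factor of at most \<open>3\<close>.\<close>

lemma poisson_harnack:
  assumes "norm w < 1" "norm z = norm w" "norm (w - z) \<le> 2 * (1 - norm w)"
  shows "poisson w \<theta> \<le> 9 * poisson z \<theta>"
proof -
  have "1 - norm w \<le> norm (cis \<theta> - w)" using norm_triangle_ineq2[of "cis \<theta>" w] by simp
  moreover have "norm (cis \<theta> - z) \<le> norm (cis \<theta> - w) + norm (w - z)"
    using norm_triangle_ineq[of "cis \<theta> - w" "w - z"] by simp
  ultimately have "norm (cis \<theta> - z) \<le> 3 * norm (cis \<theta> - w)" using assms by simp
  then have "(norm (cis \<theta> - z))\<^sup>2 \<le> (3 * norm (cis \<theta> - w))\<^sup>2" by (intro power_mono) auto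
  then have le: "(norm (cis \<theta> - z))\<^sup>2 \<le> 9 * (norm (cis \<theta> - w))\<^sup>2" by (simp add: power_mult_distrib)
  have pos: "(norm (cis \<theta> - z))\<^sup>2 > 0" "(norm (cis \<theta> - w))\<^sup>2 > 0"
    using cis_neq[of z \<theta>] cis_neq[of w \<theta>] assms by auto
  have "0 \<le> 1 - (norm w)\<^sup>2" using assms by (simp add: abs_square_le_1)
  then have "(1 - (norm w)\<^sup>2) * (norm (cis \<theta> - z))\<^sup>2 \<le> (1 - (norm w)\<^sup>2) * (9 * (norm (cis \<theta> - w))\<^sup>2)"
    by (intro mult_left_mono le)
  then show ?thesis using pos unfolding poisson_def assms(2) by (simp add: divide_simps) (simp add: algebra_simps)
qed

lemma Re_harnack:
  assumes f: "f holomorphic_on S" "open S" "cball 0 1 \<subseteq> S" and pos: "\<And>\<theta>. Re (f (cis \<theta>)) \<ge> 0"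
    and w: "norm w < 1" "norm z = norm w" "norm (w - z) \<le> 2 * (1 - norm w)"
  shows "Re (f w) \<le> 9 * Re (f z)"
proof -
  have z: "norm z < 1" using w by simp
  have "2 * pi * Re (f w) \<le> 9 * (2 * pi * Re (f z))"
  proof (rule has_integral_le[OF poisson_formula[OF f w(1), of 0] has_integral_mult_right[OF poisson_formula[OF f z, of 0]]])
    fix \<theta>
    have "Re (f (cis \<theta>)) * poisson w \<theta> \<le> Re (f (cis \<theta>)) * (9 * poisson z \<theta>)"
      by (intro mult_left_mono poisson_harnack w pos)
    then show "Re (f (cis \<theta>)) * poisson w \<theta> \<le> 9 * (Re (f (cis \<theta>)) * poisson z \<theta>)" by simp
  qed
  then show ?thesis by simp
qed

text \<open>As a function of the point, the defect of a fixed zero obeys the same inequality as a positive harmonic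
  function: by the identity for the Blaschke norm it behaves like a Poisson kernel.\<close>

lemma blaschke_defect_harnack:
  assumes a: "norm a < 1" and w: "norm w < 1" "norm z = norm w" "norm (w - z) \<le> 2 * (1 - norm w)"
  shows "1 - (norm (blaschke a w))\<^sup>2 \<le> 9 * (1 - (norm (blaschke a z))\<^sup>2)"
proof -
  have nz: "1 - cnj a * w \<noteq> 0" "1 - cnj a * z \<noteq> 0" using blaschke_denom_nz[OF a] w by auto
  have "norm (cnj a * w) \<le> 1 * norm w" unfolding norm_mult using a by (intro mult_right_mono) auto
  then have "1 - norm w \<le> norm (1 - cnj a * w)" using norm_triangle_ineq2[of 1 "cnj a * w"] by simp
  moreover have "norm (1 - cnj a * z) \<le> norm (1 - cnj a * w) + norm (cnj a * (w - z))"
    using norm_triangle_ineq[of "1 - cnj a * w" "cnj a * (w - z)"] by (simp add: algebra_simps)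
  moreover have "norm (cnj a * (w - z)) \<le> 1 * norm (w - z)" unfolding norm_mult using a by (intro mult_right_mono) auto
  ultimately have "norm (1 - cnj a * z) \<le> 3 * norm (1 - cnj a * w)" using w by simp
  then have "(norm (1 - cnj a * z))\<^sup>2 \<le> (3 * norm (1 - cnj a * w))\<^sup>2" by (intro power_mono) auto
  then have le: "(norm (1 - cnj a * z))\<^sup>2 \<le> 9 * (norm (1 - cnj a * w))\<^sup>2" by (simp add: power_mult_distrib)
  have "0 \<le> (1 - (norm a)\<^sup>2) * (1 - (norm w)\<^sup>2)" using a w by (intro mult_nonneg_nonneg) (auto simp: abs_square_le_1)
  then have "(1 - (norm a)\<^sup>2) * (1 - (norm w)\<^sup>2) * (norm (1 - cnj a * z))\<^sup>2
      \<le> (1 - (norm a)\<^sup>2) * (1 - (norm w)\<^sup>2) * (9 * (norm (1 - cnj a * w))\<^sup>2)"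
    by (intro mult_left_mono le)
  then show ?thesis unfolding blaschke_norm_identity[OF nz(1)] blaschke_norm_identity[OF nz(2)] w(2)
    using nz by (simp add: divide_simps mult_ac)
qed

lemma sum_inverse_sqrt_le: "(\<Sum>i=1..n. 1 / sqrt (real i)) \<le> 2 * sqrt (real n)"
proof (induction n)
  case (Suc n)
  have pos: "sqrt (real (Suc n)) > 0" by simp
  have "sqrt (real n) * sqrt (real (Suc n)) \<le> real n + 1/2"
  proof -
    have "sqrt (real n) * sqrt (real (Suc n)) = sqrt (real n * real (Suc n))" by (simp add: real_sqrt_mult)
    also have "\<dots> \<le> sqrt ((real n + 1/2)\<^sup>2)" by (intro real_sqrt_le_mono) (simp add: power2_eq_square algebra_simps)
    finally show ?thesis by simp
  qed
  then have "2 * (sqrt (real n) * sqrt (real (Suc n))) + 1 \<le> 2 * (sqrt (real (Suc n)) * sqrt (real (Suc n)))" by simp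
  then have "2 * sqrt (real n) + 1 / sqrt (real (Suc n)) \<le> 2 * sqrt (real (Suc n))"
    using pos by (simp add: field_simps)
  then show ?case using Suc by simp
qed simp

lemma sum_inverse_sqrt_dist_le:
  assumes "k < N"
  shows "(\<Sum>j\<in>{..<N} - {k}. 1 / sqrt \<bar>real j - real k\<bar>) \<le> 4 * sqrt (real N)"
proof -
  have split: "{..<N} - {k} = {..<k} \<union> {k<..<N}" using assms by auto
  have "(\<Sum>j\<in>{..<N} - {k}. 1 / sqrt \<bar>real j - real k\<bar>)
      = (\<Sum>j\<in>{..<k}. 1 / sqrt \<bar>real j - real k\<bar>) + (\<Sum>j\<in>{k<..<N}. 1 / sqrt \<bar>real j - real k\<bar>)"
    unfolding split by (rule sum.union_disjoint) auto
  also have "(\<Sum>j\<in>{..<k}. 1 / sqrt \<bar>real j - real k\<bar>) = (\<Sum>i=1..k. 1 / sqrt (real i))"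
    by (rule sum.reindex_bij_witness[of _ "\<lambda>i. k - i" "\<lambda>j. k - j"]) (auto simp: of_nat_diff)
  also have "(\<Sum>j\<in>{k<..<N}. 1 / sqrt \<bar>real j - real k\<bar>) = (\<Sum>i=1..N - k - 1. 1 / sqrt (real i))"
    by (rule sum.reindex_bij_witness[of _ "\<lambda>i. k + i" "\<lambda>j. j - k"]) (use assms in \<open>auto simp: of_nat_diff\<close>)
  also have "(\<Sum>i=1..k. 1 / sqrt (real i)) \<le> 2 * sqrt (real N)"
    using sum_inverse_sqrt_le[of k] assms by (intro order_trans[OF sum_inverse_sqrt_le]) auto
  also have "(\<Sum>i=1..N - k - 1. 1 / sqrt (real i)) \<le> 2 * sqrt (real N)"
    by (intro order_trans[OF sum_inverse_sqrt_le]) auto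
  finally show ?thesis by simp
qed

text \<open>The logarithmic singularity is traded for an inverse square root, which can be summed over the lattice
  points by elementary means.\<close>

lemma half_ln_le_sqrt:
  fixes y :: real
  assumes "y > 0"
  shows "ln (1 + y\<^sup>2) / 2 \<le> 2 * sqrt y"
proof -
  have "1 + y\<^sup>2 \<le> (1 + y)\<^sup>2" using assms by (simp add: power2_eq_square algebra_simps)
  then have "ln (1 + y\<^sup>2) \<le> ln ((1 + y)\<^sup>2)" using assms by (subst ln_le_cancel_iff) (auto simp: add_pos_nonneg)
  also have "\<dots> = 2 * ln (1 + y)" using assms by (simp add: ln_realpow)
  finally have 1: "ln (1 + y\<^sup>2) / 2 \<le> ln (1 + y)" by simp
  have "1 + y \<le> (1 + sqrt y)\<^sup>2" using assms by (simp add: power2_eq_square algebra_simps)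
  then have "ln (1 + y) \<le> ln ((1 + sqrt y)\<^sup>2)" using assms by (subst ln_le_cancel_iff) (auto simp: add_pos_nonneg)
  also have "\<dots> = 2 * ln (1 + sqrt y)" using assms by (subst ln_realpow) (auto simp: add_pos_nonneg)
  also have "\<dots> \<le> 2 * sqrt y" using ln_add_one_self_le_self[of "sqrt y"] assms by simp
  finally show ?thesis using 1 by simp
qed

text \<open>If the lattice point nearest to \<open>a\<close> is \<open>l k\<close>, then \<open>a\<close> has distance at least \<open>|j - k| \<Delta> / 16\<close> from \<open>l j\<close>.
  Since the sum over \<open>j\<close> of \<open>1 / sqrt |j - k|\<close> is of order \<open>sqrt N\<close>, the zero contributes on average a bounded
  amount to \<open>log 1/|F|\<close> at the lattice points other than \<open>l k\<close>.\<close>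

lemma blaschke_ln_off_nearest:
  fixes l :: "nat \<Rightarrow> complex"
  assumes a: "norm a < 1" "1 - norm a \<le> 72 * (1 - \<rho>)" and \<rho>: "1/2 \<le> \<rho>" "\<rho> < 1"
    and N: "real N * \<Delta> \<le> 1" "1 - \<rho> \<le> 4 * real N * \<Delta>" "\<Delta> > 0"
    and l: "\<And>j. l j = of_real \<rho> * cis (x0 + real j * \<Delta>)"
    and k: "k < N" "\<And>j. j < N \<Longrightarrow> norm (l k - a) \<le> norm (l j - a)" and j: "j < N" "j \<noteq> k"
  shows "blaschke a (l j) \<noteq> 0" "- ln (norm (blaschke a (l j))) \<le> 67 * sqrt (real N) * (1 / sqrt \<bar>real j - real k\<bar>)"
proof -
  define i where "i = \<bar>real j - real k\<bar>"
  define d where "d = 1 - \<rho>"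
  have i: "i > 0" "i \<le> real N" using j k by (auto simp: i_def)
  have d: "d > 0" using \<rho> by (simp add: d_def)
  have lj: "norm (l j) = \<rho>" using \<rho> by (simp add: l norm_mult)
  have i\<Delta>: "i * \<Delta> \<le> 1" using i N by (meson mult_right_mono order_trans less_imp_le)
  have "x0 + real j * \<Delta> - (x0 + real k * \<Delta>) = (real j - real k) * \<Delta>" by (simp add: algebra_simps)
  then have "(norm (l j - l k))\<^sup>2 = 4 * \<rho> * \<rho> * (sin ((real j - real k) * \<Delta> / 2))\<^sup>2"
    unfolding l norm_diff_polar by simp
  also have "\<dots> = (2 * \<rho> * \<bar>sin ((real j - real k) * \<Delta> / 2)\<bar>)\<^sup>2" by (simp add: power2_eq_square)
  finally have ch: "norm (l j - l k) = 2 * \<rho> * \<bar>sin ((real j - real k) * \<Delta> / 2)\<bar>"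
    using \<rho> by (intro power2_eq_imp_eq[of "norm (l j - l k)"]) auto
  have ab: "\<bar>(real j - real k) * \<Delta> / 2\<bar> = i * \<Delta> / 2" using N by (simp add: i_def abs_mult)
  have "i * \<Delta> / 2 / 4 \<le> \<bar>sin ((real j - real k) * \<Delta> / 2)\<bar>"
    using abs_sin_ge_quarter[of "(real j - real k) * \<Delta> / 2"] i\<Delta> unfolding ab by simp
  then have "2 * (1/2) * (i * \<Delta> / 2 / 4) \<le> 2 * \<rho> * \<bar>sin ((real j - real k) * \<Delta> / 2)\<bar>"
    using \<rho> i N by (intro mult_mono) auto
  then have 1: "i * \<Delta> / 8 \<le> norm (l j - l k)" unfolding ch by simp
  have "norm (l j - l k) \<le> norm (l j - a) + norm (l k - a)"
    using norm_triangle_ineq4[of "l j - a" "l k - a"] by simp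
  then have far: "i * \<Delta> / 16 \<le> norm (l j - a)" using 1 k(2)[OF j(1)] by simp
  have i\<Delta>0: "i * \<Delta> / 16 > 0" using i N by simp
  then have ne: "norm (l j - a) > 0" using far by linarith
  have den: "1 - cnj a * l j \<noteq> 0" using blaschke_denom_nz[OF a(1), of "l j"] lj \<rho> by simp
  show nz: "blaschke a (l j) \<noteq> 0" using ne den by (simp add: blaschke_def)
  define b where "b = norm (blaschke a (l j))"
  have b: "b > 0" using nz by (simp add: b_def)
  have id: "(norm (1 - cnj a * l j))\<^sup>2 - (norm (l j - a))\<^sup>2 = (1 - (norm a)\<^sup>2) * (1 - \<rho>\<^sup>2)"
    unfolding lj[symmetric] cmod_power2 by (simp add: power2_eq_square algebra_simps)
  define Q where "Q = (1 - (norm a)\<^sup>2) * (1 - \<rho>\<^sup>2) / (norm (l j - a))\<^sup>2"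
  have "1 / b\<^sup>2 = (norm (1 - cnj a * l j))\<^sup>2 / (norm (l j - a))\<^sup>2"
    unfolding b_def blaschke_def norm_divide by (simp add: power_divide)
  also have "\<dots> = ((norm (l j - a))\<^sup>2 + (1 - (norm a)\<^sup>2) * (1 - \<rho>\<^sup>2)) / (norm (l j - a))\<^sup>2" using id by simp
  also have "\<dots> = 1 + Q" using ne by (simp add: Q_def add_divide_distrib)
  finally have bQ: "1 / b\<^sup>2 = 1 + Q" .
  have Q: "Q \<le> (1100 * real N / i)\<^sup>2"
  proof -
    have "1 - (norm a)\<^sup>2 = (1 - norm a) * (1 + norm a)" by (simp add: power2_eq_square algebra_simps)
    also have "\<dots> \<le> (72 * d) * 2" using a d by (intro mult_mono) (auto simp: d_def)
    finally have A: "1 - (norm a)\<^sup>2 \<le> 144 * d" by simp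
    have "1 - \<rho>\<^sup>2 = d * (1 + \<rho>)" by (simp add: d_def power2_eq_square algebra_simps)
    also have "\<dots> \<le> d * 2" using \<rho> d by (intro mult_left_mono) auto
    finally have B: "1 - \<rho>\<^sup>2 \<le> 2 * d" by simp
    have "Q \<le> (144 * d) * (2 * d) / (i * \<Delta> / 16)\<^sup>2"
      unfolding Q_def using A B far i\<Delta>0 \<rho> a d
      by (intro frac_le mult_mono power_mono) (auto simp: abs_square_le_1 intro!: mult_nonneg_nonneg)
    also have "\<dots> = 73728 * (d / (i * \<Delta>))\<^sup>2" using i N by (simp add: power2_eq_square field_simps)
    also have "\<dots> \<le> 73728 * (4 * real N / i)\<^sup>2"
    proof -
      have "d / \<Delta> \<le> 4 * real N" using N(2,3) by (simp add: d_def pos_divide_le_eq)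
      from divide_right_mono[OF this, of i] have "d / (i * \<Delta>) \<le> 4 * real N / i" using i by (simp add: mult.commute)
      then show ?thesis using d i N by (intro mult_left_mono power_mono) auto
    qed
    also have "\<dots> = 1179648 * (real N / i)\<^sup>2" by (simp add: power2_eq_square)
    also have "\<dots> \<le> 1210000 * (real N / i)\<^sup>2" by (intro mult_right_mono) auto
    also have "\<dots> = (1100 * real N / i)\<^sup>2" by (simp add: power2_eq_square)
    finally show ?thesis .
  qed
  have Q0: "Q \<ge> 0" unfolding Q_def using a \<rho> by (intro divide_nonneg_nonneg mult_nonneg_nonneg) (auto simp: abs_square_le_1)
  have y: "1100 * real N / i > 0" using i k by auto
  have "- ln b = ln (1 / b\<^sup>2) / 2" using b by (simp add: ln_div ln_realpow)
  also have "\<dots> \<le> ln (1 + (1100 * real N / i)\<^sup>2) / 2"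
    unfolding bQ using Q Q0 by (intro divide_right_mono) (auto simp: add_pos_nonneg)
  also have "\<dots> \<le> 2 * sqrt (1100 * real N / i)" by (rule half_ln_le_sqrt[OF y])
  also have "\<dots> = 2 * sqrt 1100 * (sqrt (real N) / sqrt i)" by (simp add: real_sqrt_mult real_sqrt_divide)
  also have "\<dots> \<le> 2 * (67/2) * (sqrt (real N) / sqrt i)"
    using i by (intro mult_right_mono mult_left_mono real_le_lsqrt) (auto simp: power2_eq_square)
  finally have fin: "- ln b \<le> 67 * (sqrt (real N) / sqrt i)" by simp
  show "- ln (norm (blaschke a (l j))) \<le> 67 * sqrt (real N) * (1 / sqrt \<bar>real j - real k\<bar>)"
    using fin by (simp add: b_def i_def)
qed

lemma sum_list_sum_swap:
  "(\<Sum>j\<in>A. \<Sum>a\<leftarrow>as. f a j) = (\<Sum>a\<leftarrow>as. \<Sum>j\<in>A. (f a j :: real))"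
  by (induction as) (auto simp: sum.distrib)

lemma sum_list_filter_if:
  "(\<Sum>a\<leftarrow>filter P as. f a) = (\<Sum>a\<leftarrow>as. if P a then f a else (0::real))"
  by (induction as) auto

lemma ln_prod_list:
  assumes "\<And>a. a \<in> set as \<Longrightarrow> f a > (0::real)"
  shows "(\<Prod>a\<leftarrow>as. f a) > 0 \<and> ln (\<Prod>a\<leftarrow>as. f a) = (\<Sum>a\<leftarrow>as. ln (f a))"
  using assms
proof (induction as)
  case (Cons a as)
  then have "f a > 0" "(\<Prod>a\<leftarrow>as. f a) > 0 \<and> ln (\<Prod>a\<leftarrow>as. f a) = (\<Sum>a\<leftarrow>as. ln (f a))" by auto
  then show ?case by (simp add: ln_mult)
qed simp

text \<open>The lower bound for \<open>log 1/|F|\<close> in a box with \<open>N\<close> lattice points. Let \<open>S\<close> be the right-hand side. At most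
  \<open>18 S\<close> zeros are close to the box, and the others change \<open>log 1/|F|\<close> at the lattice points by at most a multiple
  of \<open>S\<close>. If \<open>S < N / 36\<close>, at least half of the lattice points are nearest to none of the close zeros, and on
  average over these points each close zero contributes a bounded amount. The average of \<open>log 1/|F|\<close> over them is
  therefore at most a multiple of \<open>S\<close>, and by hypothesis it is at least \<open>h z0 / 9\<close>. If \<open>S \<ge> N / 36\<close>, the bound by \<open>N\<close> suffices.\<close>

theorem box_estimate:
  fixes l :: "nat \<Rightarrow> complex"
  assumes as: "set as \<subseteq> ball 0 1" and \<rho>: "1/2 \<le> \<rho>" "\<rho> < 1" and z0: "norm z0 = \<rho>"
    and N: "real N * \<Delta> \<le> 1" "1 - \<rho> \<le> 4 * real N * \<Delta>" "\<Delta> > 0"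
    and l: "\<And>j. l j = of_real \<rho> * cis (x0 + real j * \<Delta>)"
    and near: "\<And>j. j < N \<Longrightarrow> norm (l j - z0) \<le> 2 * (1 - \<rho>)"
    and h: "\<And>j. j < N \<Longrightarrow> h z0 \<le> 9 * h (l j)" "h z0 \<ge> 0"
    and p: "\<And>j. j < N \<Longrightarrow> p (l j) \<le> 9 * p z0" "p z0 \<ge> 0"
    and F: "\<And>j. j < N \<Longrightarrow> (\<Prod>a\<leftarrow>as. norm (blaschke a (l j))) * exp (- p (l j)) \<le> exp (- h (l j))"
  shows "min (h z0) (real N) / 90000 \<le> (\<Sum>a\<leftarrow>as. 1 - (norm (blaschke a z0))\<^sup>2) + p z0"
proof -
  define D where "D a = 1 - (norm (blaschke a z0))\<^sup>2" for a
  define S where "S = (\<Sum>a\<leftarrow>as. D a) + p z0"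
  have an: "norm a < 1" if "a \<in> set as" for a using that as by auto
  have lj: "norm (l j) = \<rho>" for j using \<rho> by (simp add: l norm_mult)
  have N0: "N > 0" using N(2) \<rho> by (cases "N = 0") auto
  have D0: "D a \<ge> 0" if "a \<in> set as" for a
    using blaschke_norm_le_1[OF an[OF that], of z0] z0 \<rho> by (simp add: D_def abs_square_le_1)
  have S: "S \<ge> 0" "(\<Sum>a\<leftarrow>as. D a) \<le> S" "p z0 \<le> S"
    using p(2) D0 by (auto simp: S_def intro!: sum_list_nonneg add_nonneg_nonneg)
  \<comment> \<open>the zeros close to the box; the threshold \<open>1/18\<close> leaves \<open>|b\<^sub>a|\<^sup>2 \<ge> 1/2\<close> at the lattice points for all others, by Harnack\<close>
  define nr where "nr = filter (\<lambda>a. D a \<ge> 1/18) as"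
  have len: "real (length nr) \<le> 18 * S"
  proof -
    have "real (length nr) = (\<Sum>a\<leftarrow>nr. 1)" by (simp add: sum_list_triv)
    also have "\<dots> = (\<Sum>a\<leftarrow>as. if D a \<ge> 1/18 then 1 else 0)" unfolding nr_def by (rule sum_list_filter_if)
    also have "\<dots> \<le> (\<Sum>a\<leftarrow>as. 18 * D a)" by (rule sum_list_mono) (use D0 in auto)
    also have "\<dots> = 18 * (\<Sum>a\<leftarrow>as. D a)" by (simp add: sum_list_const_mult)
    finally show ?thesis using S(2) by simp
  qed
  have "\<exists>k<N. \<forall>j<N. norm (l k - a) \<le> norm (l j - a)" for a
    using arg_min_if_finite[of "{..<N}" "\<lambda>j. norm (l j - a)"] N0
    by (intro exI[of _ "arg_min_on (\<lambda>j. norm (l j - a)) {..<N}"]) (force simp: not_less)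
  then obtain k where k: "\<And>a. k a < N" "\<And>a j. j < N \<Longrightarrow> norm (l (k a) - a) \<le> norm (l j - a)" by metis
  have near_depth: "1 - norm a \<le> 72 * (1 - \<rho>)" if "a \<in> set nr" for a
  proof (rule ccontr)
    assume far: "\<not> ?thesis"
    have a: "norm a < 1" "D a \<ge> 1/18" using that an by (auto simp: nr_def)
    have low: "1 - norm a \<le> norm (1 - cnj a * z0)" by (rule blaschke_denom_lower) (use z0 \<rho> in simp)
    have pos: "1 - norm a > 0" using a by simp
    have "D a = (1 - (norm a)\<^sup>2) * (1 - \<rho>\<^sup>2) / (norm (1 - cnj a * z0))\<^sup>2"
      unfolding D_def using blaschke_norm_identity[OF blaschke_denom_nz[OF a(1)], of z0] z0 \<rho> by simp
    also have "\<dots> \<le> (2 * (1 - norm a)) * (2 * (1 - \<rho>)) / (1 - norm a)\<^sup>2"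
    proof (intro frac_le mult_mono power_mono low)
      have "1 - (norm a)\<^sup>2 = (1 - norm a) * (1 + norm a)" by (simp add: power2_eq_square algebra_simps)
      also have "\<dots> \<le> (1 - norm a) * 2" using a by (intro mult_left_mono) auto
      finally show "1 - (norm a)\<^sup>2 \<le> 2 * (1 - norm a)" by simp
      have "1 - \<rho>\<^sup>2 = (1 - \<rho>) * (1 + \<rho>)" by (simp add: power2_eq_square algebra_simps)
      also have "\<dots> \<le> (1 - \<rho>) * 2" using \<rho> by (intro mult_left_mono) auto
      finally show "1 - \<rho>\<^sup>2 \<le> 2 * (1 - \<rho>)" by simp
    qed (use a \<rho> pos in \<open>auto simp: abs_square_le_1\<close>)
    also have "\<dots> = 4 * (1 - \<rho>) / (1 - norm a)"
    proof -
      have "(2 * x) * (2 * y) / x\<^sup>2 = 4 * y / x" if "x > 0" for x y :: real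
        using that by (simp add: power2_eq_square field_simps)
      then show ?thesis using pos by blast
    qed
    also have "\<dots> < 1/18" using far pos \<rho> by (simp add: field_simps)
    finally show False using a by simp
  qed
  \<comment> \<open>the lattice points that are nearest to no close zero\<close>
  define E where "E = {..<N} - k ` set nr"
  have fE: "finite E" by (simp add: E_def)
  have cE: "real N - 18 * S \<le> real (card E)"
  proof -
    have "card (k ` set nr) \<le> length nr" by (meson card_image_le card_length finite_set le_trans)
    moreover have "card {..<N} - card (k ` set nr) \<le> card E" unfolding E_def by (rule diff_card_le_card_Diff) simp
    ultimately show ?thesis using len by simp
  qed
  define L where "L a j = - ln (norm (blaschke a (l j)))" for a j
  have off: "blaschke a (l j) \<noteq> 0" "L a j \<le> 67 * sqrt (real N) * (1 / sqrt \<bar>real j - real (k a)\<bar>)"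
    if "a \<in> set nr" "j < N" "j \<noteq> k a" for a j
    using blaschke_ln_off_nearest[OF an near_depth[OF that(1)] \<rho> N l k(1) k(2) that(2,3)] that(1)
    by (auto simp: nr_def L_def)
  have far: "blaschke a (l j) \<noteq> 0" "L a j \<le> 9 * D a" if "a \<in> set as" "a \<notin> set nr" "j < N" for a j
  proof -
    have "D a < 1/18" using that by (auto simp: nr_def)
    moreover have H: "1 - (norm (blaschke a (l j)))\<^sup>2 \<le> 9 * D a"
      unfolding D_def by (rule blaschke_defect_harnack[OF an[OF that(1)]]) (use lj z0 \<rho> near[OF that(3)] in auto)
    ultimately have half: "(norm (blaschke a (l j)))\<^sup>2 \<ge> 1/2" by simp
    then show nz: "blaschke a (l j) \<noteq> 0" by auto
    define b where "b = norm (blaschke a (l j))"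
    have b: "b > 0" "b\<^sup>2 \<ge> 1/2" "1 - b\<^sup>2 \<le> 9 * D a" using nz half H by (auto simp: b_def)
    have "ln (1 / b\<^sup>2) \<le> 1 / b\<^sup>2 - 1" using b by (intro ln_le_minus_one) auto
    also have "\<dots> = (1 - b\<^sup>2) / b\<^sup>2" using b by (simp add: field_simps)
    also have "\<dots> \<le> 9 * D a / (1/2)" using b D0[OF that(1)] by (intro frac_le) auto
    finally show "L a j \<le> 9 * D a" using b by (simp add: L_def b_def ln_div ln_realpow)
  qed
  have ineq: "h z0 / 9 - 9 * S \<le> (\<Sum>a\<leftarrow>nr. L a j)" if "j \<in> E" for j
  proof -
    have j: "j < N" "\<And>a. a \<in> set nr \<Longrightarrow> j \<noteq> k a" using that by (auto simp: E_def)
    have nz: "norm (blaschke a (l j)) > 0" if "a \<in> set as" for a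
      using off(1)[of a j] far(1)[OF that, of j] j by (cases "a \<in> set nr") auto
    have LP: "(\<Prod>a\<leftarrow>as. norm (blaschke a (l j))) > 0"
      "ln (\<Prod>a\<leftarrow>as. norm (blaschke a (l j))) = (\<Sum>a\<leftarrow>as. ln (norm (blaschke a (l j))))"
      using ln_prod_list[of as "\<lambda>a. norm (blaschke a (l j))"] nz by auto
    have "ln ((\<Prod>a\<leftarrow>as. norm (blaschke a (l j))) * exp (- p (l j))) \<le> ln (exp (- h (l j)))"
      using F[OF j(1)] LP by (subst ln_le_cancel_iff) auto
    then have "(\<Sum>a\<leftarrow>as. ln (norm (blaschke a (l j)))) - p (l j) \<le> - h (l j)"
      using LP by (simp add: ln_mult)
    then have "h (l j) \<le> p (l j) + (\<Sum>a\<leftarrow>as. L a j)"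
    proof -
      have "(\<Sum>a\<leftarrow>as. L a j) = - (\<Sum>a\<leftarrow>as. ln (norm (blaschke a (l j))))"
        by (simp add: L_def uminus_sum_list_map o_def)
      then show ?thesis if "(\<Sum>a\<leftarrow>as. ln (norm (blaschke a (l j)))) - p (l j) \<le> - h (l j)" using that by simp
    qed
    moreover have "(\<Sum>a\<leftarrow>as. L a j) \<le> (\<Sum>a\<leftarrow>as. 9 * D a + (if D a \<ge> 1/18 then L a j else 0))"
    proof (rule sum_list_mono)
      fix a assume a: "a \<in> set as"
      show "L a j \<le> 9 * D a + (if D a \<ge> 1/18 then L a j else 0)"
        using D0[OF a] far(2)[OF a _ j(1)] a by (auto simp: nr_def)
    qed
    moreover have "(\<Sum>a\<leftarrow>as. 9 * D a + (if D a \<ge> 1/18 then L a j else 0)) = 9 * (\<Sum>a\<leftarrow>as. D a) + (\<Sum>a\<leftarrow>nr. L a j)"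
      unfolding nr_def sum_list_filter_if by (simp add: sum_list_addf sum_list_const_mult)
    ultimately have "h (l j) \<le> 9 * S + (\<Sum>a\<leftarrow>nr. L a j)" using p(1)[OF j(1)] by (simp add: S_def)
    then show ?thesis using h(1)[OF j(1)] by simp
  qed
  have Lsum: "(\<Sum>j\<in>E. L a j) \<le> 268 * real N" if a: "a \<in> set nr" for a
  proof -
    have "(\<Sum>j\<in>E. L a j) \<le> (\<Sum>j\<in>E. 67 * sqrt (real N) * (1 / sqrt \<bar>real j - real (k a)\<bar>))"
      by (rule sum_mono) (use off(2)[OF a] a in \<open>auto simp: E_def\<close>)
    also have "\<dots> \<le> (\<Sum>j\<in>{..<N} - {k a}. 67 * sqrt (real N) * (1 / sqrt \<bar>real j - real (k a)\<bar>))"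
      by (rule sum_mono2) (use a in \<open>auto simp: E_def\<close>)
    also have "\<dots> = 67 * sqrt (real N) * (\<Sum>j\<in>{..<N} - {k a}. 1 / sqrt \<bar>real j - real (k a)\<bar>)"
      by (simp only: sum_distrib_left)
    also have "\<dots> \<le> 67 * sqrt (real N) * (4 * sqrt (real N))"
      by (intro mult_left_mono sum_inverse_sqrt_dist_le k) auto
    finally show ?thesis by simp
  qed
  have "min (h z0) (real N) \<le> 90000 * S"
  proof (cases "S < real N / 36")
    case True
    show ?thesis
    proof (cases "h z0 / 9 - 9 * S \<le> 0")
      case False
      have "real N / 2 * (h z0 / 9 - 9 * S) \<le> real (card E) * (h z0 / 9 - 9 * S)"
        using cE True False by (intro mult_right_mono) auto
      also have "\<dots> = (\<Sum>j\<in>E. h z0 / 9 - 9 * S)" by simp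
      also have "\<dots> \<le> (\<Sum>j\<in>E. \<Sum>a\<leftarrow>nr. L a j)" by (rule sum_mono) (rule ineq)
      also have "\<dots> = (\<Sum>a\<leftarrow>nr. \<Sum>j\<in>E. L a j)" by (rule sum_list_sum_swap)
      also have "\<dots> \<le> (\<Sum>a\<leftarrow>nr. 268 * real N)" by (rule sum_list_mono) (rule Lsum)
      also have "\<dots> = real (length nr) * (268 * real N)" by (simp add: sum_list_triv)
      also have "\<dots> \<le> 18 * S * (268 * real N)" by (intro mult_right_mono len) auto
      also have "\<dots> = real N / 2 * (9648 * S)" by simp
      finally have "h z0 / 9 - 9 * S \<le> 9648 * S" using N0 by simp
      then show ?thesis using S by (simp add: min_le_iff_disj)
    qed (use S in \<open>simp add: min_le_iff_disj\<close>)
  qed (use S in \<open>simp add: min_le_iff_disj\<close>)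
  then show ?thesis by (simp add: S_def D_def)
qed

section \<open>Masses near a boundary point\<close>

text \<open>The kernel is comparable to the Poisson kernel at a point at distance \<open>t\<close> from \<open>1\<close> and depth \<open>d \<le> t\<close>, divided
  by \<open>d\<close>.\<close>

definition wI :: "(real \<Rightarrow> real) \<Rightarrow> real \<Rightarrow> real" where
  "wI f t = integral {-pi..pi} (\<lambda>\<theta>. f \<theta> / (max t \<bar>\<theta>\<bar>)\<^sup>2)"

definition mass :: "(real \<Rightarrow> real) \<Rightarrow> real \<Rightarrow> real" where
  "mass f s = integral {-s..s} f"

definition poisson_int :: "(real \<Rightarrow> real) \<Rightarrow> complex \<Rightarrow> real" where
  "poisson_int f z = integral {-pi..pi} (\<lambda>\<theta>. f \<theta> * poisson z \<theta>) / (2 * pi)"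

lemma polar_point:
  assumes "0 < d" "d < 1"
  shows "norm (of_real (1 - d) * cis x) = 1 - d"
    "(norm (cis \<theta> - of_real (1 - d) * cis x))\<^sup>2 = d\<^sup>2 + 4 * (1 - d) * (sin ((\<theta> - x) / 2))\<^sup>2"
proof -
  show "norm (of_real (1 - d) * cis x) = 1 - d" using assms by (simp only: norm_mult norm_of_real norm_cis) simp
  show "(norm (cis \<theta> - of_real (1 - d) * cis x))\<^sup>2 = d\<^sup>2 + 4 * (1 - d) * (sin ((\<theta> - x) / 2))\<^sup>2"
    using norm_diff_polar[of 1 \<theta> "1 - d" x] by simp
qed

lemma poisson_lower:
  assumes d: "0 < d" "d \<le> t" "d < 1" and x: "0 \<le> x" "x \<le> 2 * t"
  shows "d / (10 * (max t \<bar>\<theta>\<bar>)\<^sup>2) \<le> poisson (of_real (1 - d) * cis x) \<theta>"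
proof -
  define m where "m = max t \<bar>\<theta>\<bar>"
  have m: "m \<ge> t" "\<bar>\<theta> - x\<bar> \<le> 3 * m" "m > 0" using d x by (auto simp: m_def)
  have "(sin ((\<theta> - x) / 2))\<^sup>2 \<le> ((\<theta> - x) / 2)\<^sup>2"
    using power_mono[OF abs_sin_x_le_abs_x[of "(\<theta> - x) / 2"] abs_ge_zero, of 2] by (simp only: power2_abs)
  then have "4 * (1 - d) * (sin ((\<theta> - x) / 2))\<^sup>2 \<le> 4 * 1 * ((\<theta> - x) / 2)\<^sup>2"
    using d by (intro mult_mono) auto
  also have "\<dots> = \<bar>\<theta> - x\<bar>\<^sup>2" by (simp add: power_divide)
  also have "\<dots> \<le> (3 * m)\<^sup>2" by (intro power_mono m) auto
  finally have "4 * (1 - d) * (sin ((\<theta> - x) / 2))\<^sup>2 \<le> 9 * m\<^sup>2" by (simp add: power_mult_distrib)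
  moreover have "d\<^sup>2 \<le> m\<^sup>2" using d m by (intro power_mono) auto
  ultimately have le: "(norm (cis \<theta> - of_real (1 - d) * cis x))\<^sup>2 \<le> 10 * m\<^sup>2"
    unfolding polar_point(2)[OF d(1,3)] by simp
  have "norm (of_real (1 - d) * cis x) < 1" using polar_point(1)[OF d(1,3)] d by simp
  then have pos: "(norm (cis \<theta> - of_real (1 - d) * cis x))\<^sup>2 > 0" using cis_neq by auto
  have "d / (10 * m\<^sup>2) \<le> (1 - (1 - d)\<^sup>2) / (norm (cis \<theta> - of_real (1 - d) * cis x))\<^sup>2"
  proof (rule frac_le)
    show "d \<le> 1 - (1 - d)\<^sup>2" using mult_left_mono[of d 1 d] d by (simp add: power2_eq_square algebra_simps)
    then show "0 \<le> 1 - (1 - d)\<^sup>2" using d by linarith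
  qed (use le pos in auto)
  then show ?thesis unfolding poisson_def polar_point(1)[OF d(1,3)] m_def .
qed

lemma poisson_upper:
  assumes d: "0 < d" "d \<le> 1/2" and t: "0 < t" "t \<le> 2/5" and x: "t \<le> x" "x \<le> 2 * t"
    and \<theta>: "\<bar>\<theta>\<bar> \<le> pi" "\<bar>\<theta>\<bar> \<le> t / 2 \<or> 4 * t \<le> \<bar>\<theta>\<bar>"
  shows "poisson (of_real (1 - d) * cis x) \<theta> \<le> 256 * d / (max t \<bar>\<theta>\<bar>)\<^sup>2"
proof -
  define m where "m = max t \<bar>\<theta>\<bar>"
  have d1: "d < 1" using d by simp
  have "\<bar>\<theta>\<bar> - x \<le> \<bar>\<theta> - x\<bar>" using t x by arith
  moreover have "x - \<bar>\<theta>\<bar> \<le> \<bar>\<theta> - x\<bar>" using t x by arith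
  ultimately have m: "m > 0" "m / 2 \<le> \<bar>\<theta> - x\<bar>" using t x \<theta> unfolding m_def by linarith+
  have "\<bar>\<theta> - x\<bar> \<le> 4" using \<theta>(1) x t pi_less_4 pi_approx by (simp add: abs_le_iff)
  then have "\<bar>(\<theta> - x) / 2\<bar> / 4 \<le> \<bar>sin ((\<theta> - x) / 2)\<bar>" by (intro abs_sin_ge_quarter) simp
  then have "m / 16 \<le> \<bar>sin ((\<theta> - x) / 2)\<bar>" using m by simp
  then have "(m / 16)\<^sup>2 \<le> \<bar>sin ((\<theta> - x) / 2)\<bar>\<^sup>2" using m by (intro power_mono) auto
  then have "4 * (1/2) * (m / 16)\<^sup>2 \<le> 4 * (1 - d) * (sin ((\<theta> - x) / 2))\<^sup>2" using d by (intro mult_mono) auto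
  then have "m\<^sup>2 / 128 \<le> 4 * (1 - d) * (sin ((\<theta> - x) / 2))\<^sup>2" by (simp only: power_divide) simp
  then have "m\<^sup>2 / 128 \<le> d\<^sup>2 + 4 * (1 - d) * (sin ((\<theta> - x) / 2))\<^sup>2"
    using zero_le_power2[of d] by linarith
  then have ge: "m\<^sup>2 / 128 \<le> (norm (cis \<theta> - of_real (1 - d) * cis x))\<^sup>2" unfolding polar_point(2)[OF d(1) d1] .
  have "(1 - (1 - d)\<^sup>2) / (norm (cis \<theta> - of_real (1 - d) * cis x))\<^sup>2 \<le> (2 * d) / (m\<^sup>2 / 128)"
    using ge d m by (intro frac_le) (auto simp: power2_eq_square algebra_simps)
  then show ?thesis unfolding poisson_def polar_point(1)[OF d(1) d1] m_def by simp
qed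

lemma poisson_swap:
  "poisson (of_real r * cis x) \<theta> = poisson (of_real r * cis \<theta>) x"
proof -
  have e: "(x - \<theta>) / 2 = - ((\<theta> - x) / 2)" by (simp add: field_simps)
  have "(norm (cis \<theta> - of_real r * cis x))\<^sup>2 = (norm (cis x - of_real r * cis \<theta>))\<^sup>2"
    using norm_diff_polar[of 1 \<theta> r x] norm_diff_polar[of 1 x r \<theta>]
    unfolding e by simp
  then show ?thesis by (simp add: poisson_def norm_mult)
qed

lemma wI_integrable:
  assumes "continuous_on {-pi..pi} f" "t > 0" "-pi \<le> p" "q \<le> pi"
  shows "(\<lambda>\<theta>. f \<theta> / (max t \<bar>\<theta>\<bar>)\<^sup>2) integrable_on {p..q}"
  by (intro integrable_continuous_interval continuous_intros continuous_on_subset[OF assms(1)])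
     (use assms in auto)

lemma mass_mono:
  assumes "continuous_on {-pi..pi} f" "\<And>\<theta>. f \<theta> \<ge> 0" "s \<le> s'" "s' \<le> pi"
  shows "mass f s \<le> mass f s'"
  unfolding mass_def using assms
  by (intro integral_subset_le integrable_continuous_interval continuous_on_subset[OF assms(1)]) auto

lemma mass_nonneg:
  assumes "continuous_on {-pi..pi} f" "\<And>\<theta>. f \<theta> \<ge> 0" "s \<le> pi"
  shows "mass f s \<ge> 0"
  unfolding mass_def
  by (intro integral_nonneg integrable_continuous_interval continuous_on_subset[OF assms(1)]) (use assms in auto)

lemma mass_le_wI:
  assumes f: "continuous_on {-pi..pi} f" "\<And>\<theta>. f \<theta> \<ge> 0" and t: "0 < t" and s: "t \<le> s" "s \<le> pi"
  shows "mass f s \<le> s\<^sup>2 * wI f t"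
proof -
  have "mass f s \<le> integral {-s..s} (\<lambda>\<theta>. s\<^sup>2 * (f \<theta> / (max t \<bar>\<theta>\<bar>)\<^sup>2))"
    unfolding mass_def
  proof (rule integral_le)
    show "f integrable_on {-s..s}"
      by (intro integrable_continuous_interval continuous_on_subset[OF f(1)]) (use s in auto)
    show "(\<lambda>\<theta>. s\<^sup>2 * (f \<theta> / (max t \<bar>\<theta>\<bar>)\<^sup>2)) integrable_on {-s..s}"
      by (intro integrable_on_mult_right wI_integrable f t) (use s in auto)
    fix \<theta> assume "\<theta> \<in> {-s..s}"
    then have "(max t \<bar>\<theta>\<bar>)\<^sup>2 \<le> s\<^sup>2" using s t by (intro power_mono) auto
    then have "f \<theta> * (max t \<bar>\<theta>\<bar>)\<^sup>2 \<le> f \<theta> * s\<^sup>2" by (intro mult_left_mono f)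
    moreover have "(max t \<bar>\<theta>\<bar>)\<^sup>2 > 0" using t by auto
    ultimately show "f \<theta> \<le> s\<^sup>2 * (f \<theta> / (max t \<bar>\<theta>\<bar>)\<^sup>2)" by (simp add: pos_le_divide_eq mult.commute)
  qed
  also have "\<dots> = s\<^sup>2 * integral {-s..s} (\<lambda>\<theta>. f \<theta> / (max t \<bar>\<theta>\<bar>)\<^sup>2)" by (rule integral_mult_right)
  also have "\<dots> \<le> s\<^sup>2 * wI f t"
    unfolding wI_def using s t f(2)
    by (intro mult_left_mono integral_subset_le wI_integrable f(1)) auto
  finally show ?thesis .
qed

lemma wI_le:
  assumes f: "continuous_on {-pi..pi} f" "\<And>\<theta>. f \<theta> \<ge> 0" and t: "0 < t"
  shows "wI f t \<le> mass f pi / t\<^sup>2"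
proof -
  have "wI f t \<le> integral {-pi..pi} (\<lambda>\<theta>. f \<theta> / t\<^sup>2)"
    unfolding wI_def
  proof (rule integral_le[OF wI_integrable[OF f(1) t]])
    show "(\<lambda>\<theta>. f \<theta> / t\<^sup>2) integrable_on {-pi..pi}"
      by (intro integrable_continuous_interval continuous_intros f) (use t in auto)
    fix \<theta> :: real
    show "f \<theta> / (max t \<bar>\<theta>\<bar>)\<^sup>2 \<le> f \<theta> / t\<^sup>2"
      using t f(2)[of \<theta>] by (intro divide_left_mono power_mono mult_pos_pos) auto
  qed auto
  then show ?thesis by (simp add: mass_def)
qed

lemma wI_antimono:
  assumes f: "continuous_on {-pi..pi} f" "\<And>\<theta>. f \<theta> \<ge> 0" and t: "0 < t" "t \<le> t'"
  shows "wI f t' \<le> wI f t"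
  unfolding wI_def
proof (rule integral_le)
  fix \<theta> :: real
  show "f \<theta> / (max t' \<bar>\<theta>\<bar>)\<^sup>2 \<le> f \<theta> / (max t \<bar>\<theta>\<bar>)\<^sup>2"
    using t f(2)[of \<theta>] by (intro divide_left_mono power_mono mult_pos_pos) auto
qed (use t in \<open>auto intro!: wI_integrable f\<close>)

lemma wI_scale:
  assumes f: "continuous_on {-pi..pi} f" "\<And>\<theta>. f \<theta> \<ge> 0" and t: "0 < t"
  shows "wI f (t / 8) \<le> 64 * wI f t"
proof -
  have "wI f (t / 8) \<le> integral {-pi..pi} (\<lambda>\<theta>. 64 * (f \<theta> / (max t \<bar>\<theta>\<bar>)\<^sup>2))"
    unfolding wI_def
  proof (rule integral_le)
    show "(\<lambda>\<theta>. 64 * (f \<theta> / (max t \<bar>\<theta>\<bar>)\<^sup>2)) integrable_on {-pi..pi}"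
      by (intro integrable_on_mult_right wI_integrable f t) auto
    fix \<theta> :: real
    have "f \<theta> / (max (t/8) \<bar>\<theta>\<bar>)\<^sup>2 \<le> f \<theta> / (max t \<bar>\<theta>\<bar> / 8)\<^sup>2"
      using t f(2)[of \<theta>] by (intro divide_left_mono power_mono mult_pos_pos) auto
    then show "f \<theta> / (max (t/8) \<bar>\<theta>\<bar>)\<^sup>2 \<le> 64 * (f \<theta> / (max t \<bar>\<theta>\<bar>)\<^sup>2)" by (simp add: power_divide mult.commute)
  qed (use t in \<open>auto intro!: wI_integrable f\<close>)
  then show ?thesis by (simp only: wI_def integral_mult_right)
qed

lemma wI_continuous:
  assumes f: "continuous_on {-pi..pi} f" and p: "0 < p"
  shows "continuous_on {p..q} (wI f)"
proof -
  have "continuous_on ({p..q} \<times> cbox (-pi) pi) (\<lambda>x. f (snd x))"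
    by (rule continuous_on_compose2[OF f]) (auto intro!: continuous_intros)
  then have "continuous_on {p..q} (\<lambda>t. integral (cbox (-pi) pi) (\<lambda>\<theta>. f \<theta> / (max t \<bar>\<theta>\<bar>)\<^sup>2))"
    by (intro integral_continuous_on_param)
       (unfold split_beta, intro continuous_intros, use p in auto)
  then show ?thesis by (simp add: wI_def[abs_def])
qed

lemma symmetric_integral_derivative:
  fixes f :: "real \<Rightarrow> real"
  assumes f: "continuous_on {-L..L} f" and s: "0 < s" "s < L"
  shows "((\<lambda>s. integral {-s..s} f) has_real_derivative (f s + f (-s))) (at s)"
proof -
  define P where "P x = integral {-L..x} f" for x
  have P: "(P has_real_derivative f x) (at x)" if "-L < x" "x < L" for x
  proof -
    have "(P has_real_derivative f x) (at x within {-L..L})" unfolding P_def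
      by (rule integral_has_real_derivative[OF f]) (use that in auto)
    then show ?thesis using that by (simp add: at_within_Icc_at)
  qed
  have eq: "integral {-x..x} f = P x - P (-x)" if "0 < x" "x < L" for x
  proof -
    have "integral {-L..-x} f + integral {-x..x} f = integral {-L..x} f"
      by (rule Henstock_Kurzweil_Integration.integral_combine)
         (use that in \<open>auto intro!: integrable_continuous_interval continuous_on_subset[OF f]\<close>)
    then show ?thesis by (simp add: P_def)
  qed
  have "((\<lambda>x. P x - P (-x)) has_real_derivative (f s - f (-s) * -1)) (at s)"
    by (intro derivative_intros DERIV_chain'[of uminus _ _ _ P] P) (use s in \<open>auto intro!: derivative_eq_intros P\<close>)
  then have "((\<lambda>x. P x - P (-x)) has_real_derivative (f s + f (-s))) (at s)" by simp
  then show ?thesis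
    by (rule DERIV_cong_ev[THEN iffD1, rotated 3])
       (use s in \<open>auto intro!: eventually_mono[OF eventually_nhds_in_open[of "{0<..<L}" s]] eq[symmetric]\<close>)
qed

text \<open>If all centred intervals up to length \<open>s0\<close> have non-negative mass, then so has the kernel
  \<open>1 / max t |\<theta>|\<^sup>2\<close> on \<open>[-s0, s0]\<close>, because it is a positive combination of indicators of centred intervals.\<close>

lemma layer_cake_nonneg:
  assumes f: "continuous_on {-pi..pi} f" and t: "0 < t" "t \<le> s0" "s0 < pi"
    and pos: "\<And>s. 0 < s \<Longrightarrow> s \<le> s0 \<Longrightarrow> mass f s \<ge> 0"
  shows "integral {-s0..s0} (\<lambda>\<theta>. f \<theta> / (max t \<bar>\<theta>\<bar>)\<^sup>2) \<ge> 0"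
proof -
  define g where "g \<theta> = f \<theta> / (max t \<bar>\<theta>\<bar>)\<^sup>2" for \<theta>
  have g: "continuous_on {-pi..pi} g" unfolding g_def by (intro continuous_intros f) (use t in auto)
  define D where "D s = integral {-s..s} g - mass f s / s\<^sup>2" for s
  have "D t \<le> D s0"
  proof (rule DERIV_nonneg_imp_nondecreasing[OF t(2)])
    fix s assume s: "t \<le> s" "s \<le> s0"
    then have s': "0 < s" "s < pi" using t by auto
    have 1: "((\<lambda>s. integral {-s..s} g) has_real_derivative (f s + f (-s)) / s\<^sup>2) (at s)"
      using symmetric_integral_derivative[OF g s'] s s' by (simp add: g_def add_divide_distrib)
    have 2: "(mass f has_real_derivative (f s + f (-s))) (at s)"
      unfolding mass_def[abs_def] by (rule symmetric_integral_derivative[OF f s'])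
    have "(D has_real_derivative ((f s + f (-s)) / s\<^sup>2 - ((f s + f (-s)) * s\<^sup>2 - mass f s * (2 * s)) / (s\<^sup>2 * s\<^sup>2))) (at s)"
      unfolding D_def using s' by (auto intro!: derivative_eq_intros 1 2)
    moreover have "(f s + f (-s)) / s\<^sup>2 - ((f s + f (-s)) * s\<^sup>2 - mass f s * (2 * s)) / (s\<^sup>2 * s\<^sup>2) = 2 * mass f s / s ^ 3"
      using s' by (simp add: field_simps power2_eq_square power3_eq_cube)
    moreover have "2 * mass f s / s ^ 3 \<ge> 0" using pos[of s] s s' by simp
    ultimately show "\<exists>y. (D has_real_derivative y) (at s) \<and> 0 \<le> y" by auto
  qed
  moreover have "D t = 0"
  proof -
    have "integral {-t..t} g = integral {-t..t} (\<lambda>\<theta>. f \<theta> / t\<^sup>2)"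
      by (rule integral_cong) (auto simp: g_def max_def)
    then show ?thesis by (simp add: D_def mass_def)
  qed
  ultimately have "integral {-s0..s0} g \<ge> mass f s0 / s0\<^sup>2" by (simp add: D_def)
  moreover have "mass f s0 / s0\<^sup>2 \<ge> 0" using pos[of s0] t by simp
  ultimately show ?thesis unfolding g_def by linarith
qed

text \<open>Smallness of the mass of \<open>b\<close> relative to that of \<open>a\<close> at all scales up to \<open>s0\<close> passes to the Poisson-like
  averages \<open>wI\<close>; the part of \<open>b\<close> beyond \<open>s0\<close> enters through its total mass only.\<close>

lemma wI_compare:
  assumes a: "continuous_on {-pi..pi} a" "\<And>\<theta>. a \<theta> \<ge> 0" and b: "continuous_on {-pi..pi} b" "\<And>\<theta>. b \<theta> \<ge> 0"
    and t: "0 < t" "t \<le> s0" "s0 < pi" and \<eta>: "\<eta> \<ge> 0"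
    and le: "\<And>s. 0 < s \<Longrightarrow> s \<le> s0 \<Longrightarrow> mass b s \<le> \<eta> * mass a s"
  shows "wI b t \<le> \<eta> * wI a t + mass b pi / s0\<^sup>2"
proof -
  let ?k = "\<lambda>\<theta>. (max t \<bar>\<theta>\<bar>)\<^sup>2"
  have int: "f integrable_on {-s..s}" if "continuous_on {-pi..pi} f" "s \<le> pi" for f :: "real \<Rightarrow> real" and s
    by (intro integrable_continuous_interval continuous_on_subset[OF that(1)]) (use that in auto)
  have "integral {-s0..s0} (\<lambda>\<theta>. (\<eta> * a \<theta> - b \<theta>) / ?k \<theta>) \<ge> 0"
  proof (rule layer_cake_nonneg[OF _ t])
    show ca: "continuous_on {-pi..pi} (\<lambda>\<theta>. \<eta> * a \<theta> - b \<theta>)" by (intro continuous_intros a b)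
    fix s assume s: "0 < s" "s \<le> s0"
    have "mass (\<lambda>\<theta>. \<eta> * a \<theta> - b \<theta>) s = \<eta> * mass a s - mass b s"
      unfolding mass_def integral_mult_right[symmetric] using s t
      by (intro integral_diff integrable_on_mult_right int a b) auto
    then show "0 \<le> mass (\<lambda>\<theta>. \<eta> * a \<theta> - b \<theta>) s" using le[OF s] by simp
  qed
  moreover have "integral {-s0..s0} (\<lambda>\<theta>. (\<eta> * a \<theta> - b \<theta>) / ?k \<theta>)
     = integral {-s0..s0} (\<lambda>\<theta>. \<eta> * (a \<theta> / ?k \<theta>) - b \<theta> / ?k \<theta>)"
    by (simp add: diff_divide_distrib)
  moreover have "\<dots> = \<eta> * integral {-s0..s0} (\<lambda>\<theta>. a \<theta> / ?k \<theta>) - integral {-s0..s0} (\<lambda>\<theta>. b \<theta> / ?k \<theta>)"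
    unfolding integral_mult_right[symmetric]
    using t by (intro integral_diff integrable_on_mult_right wI_integrable a b) auto
  ultimately have 1: "integral {-s0..s0} (\<lambda>\<theta>. b \<theta> / ?k \<theta>) \<le> \<eta> * integral {-s0..s0} (\<lambda>\<theta>. a \<theta> / ?k \<theta>)" by simp
  have 2: "integral {-s0..s0} (\<lambda>\<theta>. a \<theta> / ?k \<theta>) \<le> wI a t"
    unfolding wI_def using t a(2) by (intro integral_subset_le wI_integrable a(1)) auto
  have sub: "{-s0..s0} \<subseteq> {-pi..pi}" using t by auto
  have r: "(\<lambda>\<theta>. if \<theta> \<in> {-s0..s0} then b \<theta> / ?k \<theta> else 0) integrable_on {-pi..pi}"
    unfolding integrable_restrict_Int using t sub by (auto simp: Int_absorb2 intro!: wI_integrable b)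
  have "wI b t \<le> integral {-pi..pi} (\<lambda>\<theta>. (if \<theta> \<in> {-s0..s0} then b \<theta> / ?k \<theta> else 0) + b \<theta> / s0\<^sup>2)"
    unfolding wI_def
  proof (rule integral_le)
    show "(\<lambda>\<theta>. (if \<theta> \<in> {-s0..s0} then b \<theta> / ?k \<theta> else 0) + b \<theta> / s0\<^sup>2) integrable_on {-pi..pi}"
      by (intro integrable_add r integrable_continuous_interval continuous_intros b) (use t in auto)
    fix \<theta> :: real
    show "b \<theta> / ?k \<theta> \<le> (if \<theta> \<in> {-s0..s0} then b \<theta> / ?k \<theta> else 0) + b \<theta> / s0\<^sup>2"
    proof (cases "\<theta> \<in> {-s0..s0}")
      case False
      then have "s0 \<le> max t \<bar>\<theta>\<bar>" by auto
      then show ?thesis using False t b(2)[of \<theta>] by (auto intro!: divide_left_mono power_mono mult_pos_pos)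
    qed (use b(2)[of \<theta>] in auto)
  qed (use t in \<open>auto intro!: wI_integrable b\<close>)
  also have "\<dots> = integral {-pi..pi} (\<lambda>\<theta>. if \<theta> \<in> {-s0..s0} then b \<theta> / ?k \<theta> else 0) + integral {-pi..pi} (\<lambda>\<theta>. b \<theta> / s0\<^sup>2)"
    by (intro integral_add r integrable_continuous_interval continuous_intros b) (use t in auto)
  also have "integral {-pi..pi} (\<lambda>\<theta>. if \<theta> \<in> {-s0..s0} then b \<theta> / ?k \<theta> else 0) = integral {-s0..s0} (\<lambda>\<theta>. b \<theta> / ?k \<theta>)"
    unfolding integral_restrict_Int using sub by (simp only: Int_absorb1 Int_absorb2)
  also have "integral {-pi..pi} (\<lambda>\<theta>. b \<theta> / s0\<^sup>2) = mass b pi / s0\<^sup>2" by (simp add: mass_def)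
  finally show ?thesis using 1 mult_left_mono[OF 2 \<eta>] by linarith
qed

lemma poisson_arc_integral:
  assumes d: "0 < d" "d < 1" and pq: "0 \<le> p" "q \<le> 2 * pi"
  shows "integral {p..q} (\<lambda>x. poisson (of_real (1 - d) * cis x) \<theta>) \<le> 2 * pi"
proof -
  have n: "norm (of_real (1 - d) * cis \<theta>) < 1" using polar_point(1)[OF d] d by simp
  have I: "(poisson (of_real (1 - d) * cis \<theta>) has_integral 2 * pi) {0..2*pi}"
    using poisson_integral_const[OF n, of 0] by simp
  have "integral {p..q} (poisson (of_real (1 - d) * cis \<theta>)) \<le> integral {0..2*pi} (poisson (of_real (1 - d) * cis \<theta>))"
  proof (rule integral_subset_le)
    show "poisson (of_real (1 - d) * cis \<theta>) integrable_on {p..q}"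
      by (rule integrable_on_subinterval[OF has_integral_integrable[OF I]]) (use pq in auto)
  qed (use pq I poisson_pos[OF n] in \<open>auto simp: has_integral_integrable less_imp_le\<close>)
  then show ?thesis unfolding integral_unique[OF I] poisson_swap[of _ _ \<theta>] .
qed

lemma poisson_int_continuous:
  assumes f: "continuous_on {-pi..pi} f" and d: "0 < d" "d < 1"
  shows "continuous_on A (\<lambda>x. poisson_int f (of_real (1 - d) * cis x))"
proof -
  have "continuous_on (A \<times> cbox (-pi) pi) (\<lambda>x. f (snd x))"
    by (rule continuous_on_compose2[OF f]) (auto intro!: continuous_intros)
  then have "continuous_on A (\<lambda>x. integral (cbox (-pi) pi) (\<lambda>\<theta>. f \<theta> * poisson (of_real (1 - d) * cis x) \<theta>))"
    by (intro integral_continuous_on_param)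
       (unfold split_beta, intro continuous_intros, use polar_point(1)[OF d] d in auto)
  then show ?thesis unfolding poisson_int_def by (intro continuous_intros) auto
qed

text \<open>Mass at angles between \<open>t/2\<close> and \<open>4 t\<close> may be concentrated anywhere near the arc, but a Poisson kernel has
  integral at most \<open>2 \<pi>\<close> over the arc; for the remaining mass the kernel is bounded pointwise by \<open>d / max t |\<theta>|\<^sup>2\<close>.\<close>

lemma poisson_int_arc_upper:
  assumes b: "continuous_on {-pi..pi} b" "\<And>\<theta>. b \<theta> \<ge> 0"
    and d: "0 < d" "d \<le> 1/2" and t: "0 < t" "t \<le> 2/5"
  shows "integral {t..2*t} (\<lambda>x. poisson_int b (of_real (1 - d) * cis x))
     \<le> 256 * t * d / (2 * pi) * wI b t + (mass b (4 * t) - mass b (t / 2))"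
proof -
  let ?p = "\<lambda>x \<theta>. poisson (of_real (1 - d) * cis x) \<theta>"
  let ?r = "\<lambda>s \<theta>. if \<theta> \<in> {-s..s} then b \<theta> else 0"
  have d1: "d < 1" using d by simp
  have nn: "norm (of_real (1 - d) * cis x) < 1" for x using polar_point(1)[OF d(1) d1] d by simp
  have t4: "4 * t \<le> pi" using t pi_ge_two by linarith
  have contb: "continuous_on X (\<lambda>x. b (g x))" if "continuous_on X g" "g ` X \<subseteq> {-pi..pi}" for X and g :: "_ \<Rightarrow> real"
    by (rule continuous_on_compose2[OF b(1) that])
  define K where "K \<theta> = integral {t..2*t} (\<lambda>x. ?p x \<theta>)" for \<theta>
  have K: "K \<theta> \<le> 256 * t * d / (max t \<bar>\<theta>\<bar>)\<^sup>2 + 2 * pi * (if t / 2 < \<bar>\<theta>\<bar> \<and> \<bar>\<theta>\<bar> \<le> 4 * t then 1 else 0)"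
    if "\<theta> \<in> {-pi..pi}" for \<theta>
  proof (cases "t / 2 < \<bar>\<theta>\<bar> \<and> \<bar>\<theta>\<bar> \<le> 4 * t")
    case True
    have "K \<theta> \<le> 2 * pi" unfolding K_def by (rule poisson_arc_integral[OF d(1) d1]) (use t t4 in auto)
    moreover have "0 \<le> 256 * t * d / (max t \<bar>\<theta>\<bar>)\<^sup>2" using t d by simp
    ultimately show ?thesis using True by simp
  next
    case False
    have "K \<theta> \<le> integral {t..2*t} (\<lambda>x. 256 * d / (max t \<bar>\<theta>\<bar>)\<^sup>2)"
      unfolding K_def
    proof (rule integral_le)
      show "(\<lambda>x. ?p x \<theta>) integrable_on {t..2*t}"
        by (intro integrable_continuous_interval continuous_intros nn)
      show "?p x \<theta> \<le> 256 * d / (max t \<bar>\<theta>\<bar>)\<^sup>2" if "x \<in> {t..2*t}" for x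
        by (rule poisson_upper[OF d t]) (use that False \<open>\<theta> \<in> {-pi..pi}\<close> in auto)
    qed auto
    then show ?thesis using False t by (auto simp: mult_ac)
  qed
  have contK: "continuous_on {-pi..pi} K"
  proof -
    have "continuous_on {-pi..pi} (\<lambda>\<theta>. integral (cbox t (2*t)) (\<lambda>x. ?p x \<theta>))"
      by (rule integral_continuous_on_param) (unfold split_beta, intro continuous_intros nn)
    then show ?thesis by (simp add: K_def[abs_def])
  qed
  have restr: "?r s integrable_on {-pi..pi}" "integral {-pi..pi} (?r s) = mass b s" if "s \<le> pi" for s
  proof -
    have sub: "{-s..s} \<subseteq> {-pi..pi}" using that by auto
    show "integral {-pi..pi} (?r s) = mass b s"
      unfolding integral_restrict_Int mass_def using sub by (simp only: Int_absorb1 Int_absorb2)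
    show "?r s integrable_on {-pi..pi}"
      unfolding integrable_restrict_Int using sub
      by (simp only: Int_absorb1 Int_absorb2) (intro integrable_continuous_interval continuous_on_subset[OF b(1)])
  qed
  have "integral {t..2*t} (\<lambda>x. integral {-pi..pi} (\<lambda>\<theta>. b \<theta> * ?p x \<theta>))
      = integral {-pi..pi} (\<lambda>\<theta>. integral {t..2*t} (\<lambda>x. b \<theta> * ?p x \<theta>))"
  proof -
    have "continuous_on (cbox (t, -pi) (2*t, pi)) (\<lambda>(x, \<theta>). b \<theta> * ?p x \<theta>)"
      unfolding split_beta by (intro continuous_intros nn contb) (auto simp: cbox_Pair_eq)
    from integral_swap_continuous[OF this] show ?thesis by simp
  qed
  also have "\<dots> = integral {-pi..pi} (\<lambda>\<theta>. b \<theta> * K \<theta>)" unfolding K_def by (simp only: integral_mult_right)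
  also have "\<dots> \<le> integral {-pi..pi} (\<lambda>\<theta>. 256 * t * d * (b \<theta> / (max t \<bar>\<theta>\<bar>)\<^sup>2) + 2 * pi * (?r (4 * t) \<theta> - ?r (t / 2) \<theta>))"
  proof (rule integral_le)
    show "(\<lambda>\<theta>. b \<theta> * K \<theta>) integrable_on {-pi..pi}"
      by (intro integrable_continuous_interval continuous_intros b contK)
    show "(\<lambda>\<theta>. 256 * t * d * (b \<theta> / (max t \<bar>\<theta>\<bar>)\<^sup>2) + 2 * pi * (?r (4 * t) \<theta> - ?r (t / 2) \<theta>)) integrable_on {-pi..pi}"
      using t t4 by (intro integrable_add integrable_on_mult_right integrable_diff restr wI_integrable b) auto
    fix \<theta> assume \<theta>: "\<theta> \<in> {-pi..pi}"
    have "b \<theta> * K \<theta> \<le> b \<theta> * (256 * t * d / (max t \<bar>\<theta>\<bar>)\<^sup>2 + 2 * pi * (if t / 2 < \<bar>\<theta>\<bar> \<and> \<bar>\<theta>\<bar> \<le> 4 * t then 1 else 0))"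
      by (intro mult_left_mono K b \<theta>)
    also have "\<dots> = 256 * t * d * (b \<theta> / (max t \<bar>\<theta>\<bar>)\<^sup>2) + 2 * pi * (?r (4 * t) \<theta> - ?r (t / 2) \<theta>)"
      using t by (auto simp: distrib_left mult_ac)
    finally show "b \<theta> * K \<theta> \<le> 256 * t * d * (b \<theta> / (max t \<bar>\<theta>\<bar>)\<^sup>2) + 2 * pi * (?r (4 * t) \<theta> - ?r (t / 2) \<theta>)" .
  qed
  also have "\<dots> = integral {-pi..pi} (\<lambda>\<theta>. 256 * t * d * (b \<theta> / (max t \<bar>\<theta>\<bar>)\<^sup>2)) + integral {-pi..pi} (\<lambda>\<theta>. 2 * pi * (?r (4 * t) \<theta> - ?r (t / 2) \<theta>))"
    using t t4 by (intro integral_add integrable_on_mult_right integrable_diff restr wI_integrable b) auto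
  also have "\<dots> = 256 * t * d * wI b t + 2 * pi * (integral {-pi..pi} (?r (4 * t)) - integral {-pi..pi} (?r (t / 2)))"
    unfolding integral_mult_right wI_def using t t4 by (subst integral_diff[OF restr(1) restr(1)]) auto
  also have "\<dots> = 256 * t * d * wI b t + 2 * pi * (mass b (4 * t) - mass b (t / 2))"
    using t t4 by (subst (1 2) restr(2)) auto
  finally have "integral {t..2*t} (\<lambda>x. integral {-pi..pi} (\<lambda>\<theta>. b \<theta> * ?p x \<theta>))
     \<le> 256 * t * d * wI b t + 2 * pi * (mass b (4 * t) - mass b (t / 2))" .
  from divide_right_mono[OF this, of "2 * pi"]
  show ?thesis unfolding poisson_int_def integral_divide by (simp add: add_divide_distrib)
qed

lemma poisson_int_arc_lower:
  assumes a: "continuous_on {-pi..pi} a" "\<And>\<theta>. a \<theta> \<ge> 0"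
    and d: "0 < d" "d \<le> t" "d < 1" and x: "0 \<le> x" "x \<le> 2 * t"
  shows "d * wI a t / (20 * pi) \<le> poisson_int a (of_real (1 - d) * cis x)"
proof -
  have nn: "norm (of_real (1 - d) * cis x) < 1" using polar_point(1)[OF d(1,3)] d by simp
  have "integral {-pi..pi} (\<lambda>\<theta>. d / 10 * (a \<theta> / (max t \<bar>\<theta>\<bar>)\<^sup>2)) \<le> integral {-pi..pi} (\<lambda>\<theta>. a \<theta> * poisson (of_real (1 - d) * cis x) \<theta>)"
  proof (rule integral_le)
    fix \<theta> :: real
    have "a \<theta> * (d / (10 * (max t \<bar>\<theta>\<bar>)\<^sup>2)) \<le> a \<theta> * poisson (of_real (1 - d) * cis x) \<theta>"
      by (intro mult_left_mono poisson_lower a d x)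
    then show "d / 10 * (a \<theta> / (max t \<bar>\<theta>\<bar>)\<^sup>2) \<le> a \<theta> * poisson (of_real (1 - d) * cis x) \<theta>"
      by (simp add: mult.commute)
  next
    show "(\<lambda>\<theta>. d / 10 * (a \<theta> / (max t \<bar>\<theta>\<bar>)\<^sup>2)) integrable_on {-pi..pi}"
      using d by (intro integrable_on_mult_right wI_integrable a) auto
    show "(\<lambda>\<theta>. a \<theta> * poisson (of_real (1 - d) * cis x) \<theta>) integrable_on {-pi..pi}"
      by (intro integrable_continuous_interval continuous_intros a nn)
  qed
  then have "d / 10 * wI a t \<le> integral {-pi..pi} (\<lambda>\<theta>. a \<theta> * poisson (of_real (1 - d) * cis x) \<theta>)"
    by (simp only: integral_mult_right wI_def)
  from divide_right_mono[OF this, of "2 * pi"] show ?thesis unfolding poisson_int_def by (simp add: mult_ac)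
qed

text \<open>One ring \<open>|z| = 1 - d\<close> seen at the scale \<open>t\<close>. Over the arc \<open>[t, 2t]\<close> the Poisson integral of \<open>b\<close> has to be
  at least \<open>\<kappa> d wI a t\<close>, up to a constant. By \<open>Ib\<close> the mass of \<open>b\<close> outside the annulus \<open>[t/2, 4t]\<close> supplies
  at most half of it, so the annulus must supply the rest.\<close>

lemma core_step:
  assumes a: "continuous_on {-pi..pi} a" "\<And>\<theta>. a \<theta> \<ge> 0" and b: "continuous_on {-pi..pi} b" "\<And>\<theta>. b \<theta> \<ge> 0"
    and \<kappa>: "\<kappa> > 0" and d: "0 < d" "d \<le> t" "d \<le> 1/2" and t: "t \<le> 1/10"
    and ring: "\<And>x. t \<le> x \<Longrightarrow> x \<le> 2 * t \<Longrightarrow>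
      \<kappa> * min (poisson_int a (of_real (1 - d) * cis x)) (1 / e) \<le> poisson_int b (of_real (1 - d) * cis x)"
    and Ib: "wI b t \<le> \<kappa> / 5120 * wI a t" and small: "d * wI a t / (20 * pi) \<le> 1 / e"
  shows "t * (\<kappa> * (d * wI a t)) / (40 * pi) \<le> mass b (4 * t) - mass b (t / 2)"
    and "mass b (4 * t) \<le> 16 * t\<^sup>2 * (\<kappa> / 5120 * wI a t)"
proof -
  have t0: "t > 0" and d1: "d < 1" using d by auto
  define q where "q = d * wI a t / (20 * pi)"
  have "integral {t..2*t} (\<lambda>x. \<kappa> * q) \<le> integral {t..2*t} (\<lambda>x. poisson_int b (of_real (1 - d) * cis x))"
  proof (rule integral_le)
    show "(\<lambda>x. poisson_int b (of_real (1 - d) * cis x)) integrable_on {t..2*t}"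
      by (intro integrable_continuous_interval poisson_int_continuous b d d1)
    fix x assume x: "x \<in> {t..2*t}"
    have "q \<le> poisson_int a (of_real (1 - d) * cis x)"
      unfolding q_def using x t0 by (intro poisson_int_arc_lower a d d1) auto
    then have "\<kappa> * q \<le> \<kappa> * min (poisson_int a (of_real (1 - d) * cis x)) (1 / e)"
      using small \<kappa> by (intro mult_left_mono) (auto simp: q_def)
    then show "\<kappa> * q \<le> poisson_int b (of_real (1 - d) * cis x)" using ring[of x] x by auto
  qed auto
  then have "t * (\<kappa> * q) \<le> integral {t..2*t} (\<lambda>x. poisson_int b (of_real (1 - d) * cis x))" using t0 by (simp add: mult_ac)
  also have "\<dots> \<le> 256 * t * d / (2 * pi) * wI b t + (mass b (4 * t) - mass b (t / 2))"
    by (intro poisson_int_arc_upper b d) (use t t0 in auto)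
  also have "256 * t * d / (2 * pi) * wI b t \<le> 256 * t * d / (2 * pi) * (\<kappa> / 5120 * wI a t)"
    using t0 d by (intro mult_left_mono Ib) auto
  finally have "t * (\<kappa> * q) \<le> 256 * t * d / (2 * pi) * (\<kappa> / 5120 * wI a t) + (mass b (4 * t) - mass b (t / 2))" by simp
  moreover have "256 * t * d / (2 * pi) * (\<kappa> / 5120 * wI a t) = t * (\<kappa> * (d * wI a t)) / (40 * pi)"
    by (simp add: field_simps)
  moreover have "t * (\<kappa> * q) = 2 * (t * (\<kappa> * (d * wI a t)) / (40 * pi))" by (simp add: q_def field_simps)
  ultimately show "t * (\<kappa> * (d * wI a t)) / (40 * pi) \<le> mass b (4 * t) - mass b (t / 2)" by linarith
  have "mass b (4 * t) \<le> (4 * t)\<^sup>2 * wI b t"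
    using t t0 pi_ge_two by (intro mass_le_wI b) auto
  also have "\<dots> = 16 * t\<^sup>2 * wI b t" by (simp add: power_mult_distrib)
  also have "\<dots> \<le> 16 * t\<^sup>2 * (\<kappa> / 5120 * wI a t)" by (intro mult_left_mono Ib) auto
  finally show "mass b (4 * t) \<le> 16 * t\<^sup>2 * (\<kappa> / 5120 * wI a t)" .
qed

lemma mass_lower:
  assumes "continuous_on {-pi..pi} b" "\<And>\<theta>. b \<theta> \<ge> \<beta>" "0 \<le> s" "s \<le> pi"
  shows "2 * \<beta> * s \<le> mass b s"
proof -
  have "integral {-s..s} (\<lambda>_. \<beta>) \<le> mass b s"
    unfolding mass_def
    by (intro integral_le integrable_continuous_interval continuous_on_subset[OF assms(1)]) (use assms in auto)
  then show ?thesis using assms(3) by (simp add: mult_ac)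
qed

text \<open>The function \<open>d * wI a t / (20 * pi)\<close> of \<open>t\<close> is the lower bound for the Poisson integral of \<open>a\<close> at angles up
  to \<open>2 t\<close>, and the critical scale is where it equals the cap \<open>1 / e\<close>; at this scale the hypothesis \<open>ring\<close> is used with
  full strength. The annulus at the scale \<open>t\<close> then carries mass of \<open>b\<close> of order \<open>\<kappa> t / e\<close>, while the mass inside
  it is at most of order \<open>\<kappa> t\<^sup>2 / (d e)\<close>. Dividing the increment of the mass by the square root of the mass leaves an
  increment of the square root of order \<open>sqrt (\<kappa> d / e)\<close>, independent of \<open>t\<close>.\<close>

lemma critical_scale:
  assumes a: "continuous_on {-pi..pi} a" "\<And>\<theta>. a \<theta> \<ge> 0" and b: "continuous_on {-pi..pi} b" "\<And>\<theta>. b \<theta> \<ge> \<beta>"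
    and pos: "\<kappa> > 0" "\<beta> > 0" and s0: "0 < s0" "s0 \<le> 2/5"
    and le: "\<And>s. 0 < s \<Longrightarrow> s \<le> s0 \<Longrightarrow> mass b s \<le> \<kappa> / 10240 * mass a s"
    and d: "0 < d" "d \<le> s0 / 4" and e: "0 < e" "e \<le> 1"
    and D: "d * mass a pi \<le> s0\<^sup>2" "d * mass b pi \<le> \<kappa> * s0\<^sup>2 / 1000" "d * mass b pi \<le> 2 * \<beta> * s0\<^sup>2"
    and ring: "\<And>x. \<kappa> * min (poisson_int a (of_real (1 - d) * cis x)) (1 / e) \<le> poisson_int b (of_real (1 - d) * cis x)"
  shows "\<exists>t. 0 < t \<and> t \<le> s0 / 4 \<and> wI a t = 20 * pi / (d * e) \<and>
    sqrt \<kappa> / 2 * sqrt (d / e) + sqrt (mass b (t / 2)) \<le> sqrt (mass b (4 * t))"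
proof -
  have b0: "b \<theta> \<ge> 0" for \<theta> using b(2)[of \<theta>] pos by linarith
  have s0pi: "s0 < pi" using s0 pi_ge_two by linarith
  have d12: "d \<le> 1/2" using d s0 by simp
  have \<kappa>0: "\<kappa> / 10240 \<ge> 0" using pos by simp
  have cmp: "wI b t \<le> \<kappa> / 5120 * wI a t" if "0 < t" "t \<le> s0" "mass b pi / s0\<^sup>2 \<le> \<kappa> / 10240 * wI a t" for t
  proof -
    have "\<kappa> / 5120 * wI a t = 2 * (\<kappa> / 10240 * wI a t)" by simp
    then show ?thesis using wI_compare[OF a b(1) b0 that(1,2) s0pi \<kappa>0 le] that(3) by linarith
  qed
  \<comment> \<open>If the cap were inactive already at the scale \<open>d\<close>, the annulus would need more mass than the whole interval \<open>[-4d, 4d]\<close> has. The lower bound \<open>\<beta>\<close> of \<open>b\<close> enters here.\<close>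
  have notA: "\<not> d * wI a d / (20 * pi) \<le> 1 / e"
  proof
    assume A: "d * wI a d / (20 * pi) \<le> 1 / e"
    have "2 * \<beta> * d \<le> mass b d" by (rule mass_lower[OF b]) (use d s0pi s0 in auto)
    also have "\<dots> \<le> \<kappa> / 10240 * mass a d" using d s0 by (intro le) auto
    also have "\<dots> \<le> \<kappa> / 10240 * (d\<^sup>2 * wI a d)" using d s0pi s0 pos by (intro mult_left_mono mass_le_wI a) auto
    finally have "2 * \<beta> / d \<le> \<kappa> / 10240 * wI a d" using d by (simp add: field_simps power2_eq_square)
    moreover have "mass b pi / s0\<^sup>2 \<le> 2 * \<beta> / d" using D(3) d s0 by (simp add: field_simps)
    ultimately have tail: "mass b pi / s0\<^sup>2 \<le> \<kappa> / 10240 * wI a d" by linarith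
    have Ia: "wI a d > 0"
    proof -
      have "0 < 2 * \<beta> / d" using pos d by simp
      then have "0 < \<kappa> / 10240 * wI a d" using \<open>2 * \<beta> / d \<le> \<kappa> / 10240 * wI a d\<close> by linarith
      then show ?thesis using pos by (simp add: zero_less_mult_iff)
    qed
    have "d \<le> s0" "d \<le> 1/10" using d s0 by auto
    note step = core_step[OF a b(1) b0 pos(1) d(1) order_refl d12 this(2) ring cmp[OF d(1) this(1) tail] A]
    have "0 \<le> mass b (d / 2)" by (intro mass_nonneg b b0) (use d s0 s0pi in auto)
    then have "d * (\<kappa> * (d * wI a d)) / (40 * pi) \<le> 16 * d\<^sup>2 * (\<kappa> / 5120 * wI a d)" using step by linarith
    then have "d * (\<kappa> * (d * wI a d)) * 320 \<le> d * (\<kappa> * (d * wI a d)) * (40 * pi)"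
      by (simp add: field_simps power2_eq_square)
    moreover have "d * (\<kappa> * (d * wI a d)) > 0" using d pos Ia by simp
    ultimately have "320 \<le> 40 * pi" by (simp only: mult_le_cancel_left_pos)
    then show False using pi_less_4 by simp
  qed
  have hi: "d * wI a (s0 / 4) / (20 * pi) \<le> 1 / e"
  proof -
    have "d * wI a (s0 / 4) \<le> d * (mass a pi / (s0 / 4)\<^sup>2)" using d s0 by (intro mult_left_mono wI_le a) auto
    also have "\<dots> = 16 * (d * mass a pi / s0\<^sup>2)" by (simp add: power_divide)
    also have "\<dots> \<le> 16 * 1" using D(1) s0 by (intro mult_left_mono) auto
    also have "\<dots> \<le> 20 * pi * 1" using pi_ge_two by simp
    also have "\<dots> \<le> 20 * pi * (1 / e)" using e by (intro mult_left_mono) auto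
    finally show ?thesis by (simp add: field_simps)
  qed
  have "\<exists>t\<ge>d. t \<le> s0 / 4 \<and> d * wI a t / (20 * pi) = 1 / e"
  proof (rule IVT2')
    show "continuous_on {d..s0 / 4} (\<lambda>t. d * wI a t / (20 * pi))"
      by (intro continuous_intros wI_continuous a d) auto
  qed (use d hi notA in auto)
  then obtain t where t: "d \<le> t" "t \<le> s0 / 4" and eq: "d * wI a t / (20 * pi) = 1 / e" by blast
  have t0: "0 < t" "t \<le> s0" "t \<le> 1/10" using t d s0 by auto
  have Ia: "wI a t = 20 * pi / (d * e)" using eq d e by (simp add: field_simps)
  have tail: "mass b pi / s0\<^sup>2 \<le> \<kappa> / 10240 * wI a t"
  proof -
    have "mass b pi / s0\<^sup>2 \<le> \<kappa> / (1000 * d)" using D(2) d s0 by (simp add: field_simps)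
    also have "\<dots> \<le> \<kappa> / 10240 * (40 / d)" using pos d by (simp add: field_simps)
    also have "\<dots> \<le> \<kappa> / 10240 * (20 * pi / (d * e))"
    proof -
      have "40 / d \<le> 20 * pi / (d * e)" using e d pi_ge_two
        by (intro frac_le) (auto simp: mult_le_cancel_left1)
      then show ?thesis using pos by (intro mult_left_mono) auto
    qed
    finally show ?thesis unfolding Ia .
  qed
  have "d * wI a t / (20 * pi) \<le> 1 / e" using eq by simp
  note step = core_step[OF a b(1) b0 pos(1) d(1) t(1) d12 t0(3) ring cmp[OF t0(1,2) tail] this]
  define m where "m = mass b (4 * t)"
  define m' where "m' = mass b (t / 2)"
  have "2 * \<beta> * (4 * t) \<le> m" unfolding m_def by (rule mass_lower[OF b]) (use t0 s0pi t in auto)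
  moreover have "0 < 2 * \<beta> * (4 * t)" using pos t0 by simp
  ultimately have m: "m > 0" by linarith
  have m': "m' \<ge> 0" unfolding m'_def by (intro mass_nonneg b b0) (use t0 t s0pi in auto)
  have dI: "d * wI a t = 20 * pi / e" using Ia d by simp
  have 1: "t * \<kappa> / (2 * e) \<le> m - m'"
    using step(1) unfolding dI m_def m'_def by (simp add: field_simps)
  have 2: "m \<le> t\<^sup>2 * \<kappa> / (4 * d * e)"
  proof -
    have "m \<le> t\<^sup>2 * \<kappa> * pi / (16 * (d * e))" using step(2) unfolding Ia m_def by (simp add: mult_ac)
    also have "\<dots> \<le> t\<^sup>2 * \<kappa> * 4 / (16 * (d * e))"
      using pi_less_4 pos d e by (intro divide_right_mono mult_left_mono) auto
    finally show ?thesis by (simp add: mult_ac)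
  qed
  have "(sqrt (\<kappa> * m * (d / e)))\<^sup>2 = \<kappa> * m * (d / e)" using pos m d e by simp
  also have "\<dots> \<le> \<kappa> * (t\<^sup>2 * \<kappa> / (4 * d * e)) * (d / e)" using 2 pos d e by (intro mult_right_mono mult_left_mono) auto
  also have "\<dots> = (t * \<kappa> / (2 * e))\<^sup>2" using d e by (simp add: power2_eq_square field_simps)
  finally have "sqrt (\<kappa> * m * (d / e)) \<le> t * \<kappa> / (2 * e)" by (rule power2_le_imp_le) (use t0 pos e in auto)
  moreover have "sqrt (\<kappa> * m * (d / e)) = sqrt \<kappa> * sqrt (d / e) * sqrt m"
    by (simp only: real_sqrt_mult mult_ac)
  ultimately have "sqrt \<kappa> * sqrt (d / e) * sqrt m \<le> m - m'" using 1 by linarith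
  also have "\<dots> = (sqrt m - sqrt m') * (sqrt m + sqrt m')" using m m' by (simp add: algebra_simps)
  also have "\<dots> \<le> (sqrt m - sqrt m') * (2 * sqrt m)"
  proof -
    have "0 \<le> t * \<kappa> / (2 * e)" using t0 pos e by simp
    then have "m' \<le> m" using 1 by linarith
    then show ?thesis by (intro mult_left_mono) auto
  qed
  finally have "sqrt m * (sqrt \<kappa> / 2 * sqrt (d / e)) \<le> sqrt m * (sqrt m - sqrt m')" by (simp add: mult_ac)
  then have "sqrt \<kappa> / 2 * sqrt (d / e) \<le> sqrt m - sqrt m'" using m by (simp only: mult_le_cancel_left_pos real_sqrt_gt_zero)
  then show ?thesis using t0 t Ia by (intro exI[of _ t]) (auto simp: m_def m'_def)
qed

text \<open>The critical scales decrease at least by the factor \<open>8\<close>, so that the annuli \<open>[t/2, 4t]\<close> are disjoint and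
  the increments of the square root of the mass telescope.\<close>

theorem core_estimate:
  fixes d e :: "nat \<Rightarrow> real"
  assumes a: "continuous_on {-pi..pi} a" "\<And>\<theta>. a \<theta> \<ge> 0" and b: "continuous_on {-pi..pi} b" "\<And>\<theta>. b \<theta> \<ge> \<beta>"
    and pos: "\<kappa> > 0" "\<beta> > 0" and s0: "0 < s0" "s0 \<le> 2/5"
    and le: "\<And>s. 0 < s \<Longrightarrow> s \<le> s0 \<Longrightarrow> mass b s \<le> \<kappa> / 10240 * mass a s"
    and d: "\<And>n. n < K \<Longrightarrow> 0 < d n \<and> d n \<le> D" and e: "\<And>n. n < K \<Longrightarrow> 0 < e n \<and> e n \<le> 1"
    and dec: "\<And>n. Suc n < K \<Longrightarrow> d (Suc n) \<le> d n / 65 \<and> e (Suc n) \<le> e n"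
    and D: "D \<le> s0 / 4" "D * mass a pi \<le> s0\<^sup>2" "D * mass b pi \<le> \<kappa> * s0\<^sup>2 / 1000" "D * mass b pi \<le> 2 * \<beta> * s0\<^sup>2"
    and ring: "\<And>n x. n < K \<Longrightarrow> \<kappa> * min (poisson_int a (of_real (1 - d n) * cis x)) (1 / e n)
        \<le> poisson_int b (of_real (1 - d n) * cis x)"
  shows "sqrt \<kappa> / 2 * (\<Sum>n<K. sqrt (d n / e n)) \<le> sqrt (mass b pi)"
proof -
  have b0: "b \<theta> \<ge> 0" for \<theta> using b(2)[of \<theta>] pos by linarith
  have s0pi: "s0 < pi" using s0 pi_ge_two by linarith
  have M: "0 \<le> mass a pi" "0 \<le> mass b pi" by (intro mass_nonneg a b b0; simp)+
  have "\<exists>t. 0 < t \<and> t \<le> s0 / 4 \<and> wI a t = 20 * pi / (d n * e n) \<and>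
    sqrt \<kappa> / 2 * sqrt (d n / e n) + sqrt (mass b (t / 2)) \<le> sqrt (mass b (4 * t))" if "n < K" for n
  proof (rule critical_scale[OF a b pos s0 le])
    show "d n * mass a pi \<le> s0\<^sup>2" "d n * mass b pi \<le> \<kappa> * s0\<^sup>2 / 1000" "d n * mass b pi \<le> 2 * \<beta> * s0\<^sup>2"
      using d[OF that] D M by (meson mult_right_mono order_trans)+
  qed (use d[OF that] e[OF that] D ring[OF that] in auto)
  then obtain t where t: "\<And>n. n < K \<Longrightarrow> 0 < t n" "\<And>n. n < K \<Longrightarrow> t n \<le> s0 / 4"
    and I: "\<And>n. n < K \<Longrightarrow> wI a (t n) = 20 * pi / (d n * e n)"
    and inc: "\<And>n. n < K \<Longrightarrow> sqrt \<kappa> / 2 * sqrt (d n / e n) + sqrt (mass b (t n / 2)) \<le> sqrt (mass b (4 * t n))"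
    by metis
  have tdec: "t (Suc n) \<le> t n / 8" if n: "Suc n < K" for n
  proof (rule ccontr)
    assume "\<not> ?thesis"
    then have "wI a (t (Suc n)) \<le> wI a (t n / 8)" using t[of n] n by (intro wI_antimono a) auto
    also have "\<dots> \<le> 64 * wI a (t n)" using t[of n] n by (intro wI_scale a) auto
    finally have 1: "20 * pi / (d (Suc n) * e (Suc n)) \<le> 64 * (20 * pi / (d n * e n))" using I n by simp
    have "65 * (20 * pi / (d n * e n)) = 20 * pi / (d n / 65 * e n)" by simp
    also have "\<dots> \<le> 20 * pi / (d (Suc n) * e (Suc n))"
    proof -
      have "d (Suc n) * e (Suc n) \<le> d n / 65 * e n"
        using d[of n] e[of "Suc n"] dec[OF n] n by (intro mult_mono) auto
      then show ?thesis
        using d[of "Suc n"] e[of "Suc n"] d[of n] e[of n] n by (intro divide_left_mono mult_pos_pos) auto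
    qed
    also note 1
    finally have "20 * pi / (d n * e n) \<le> 0" by simp
    moreover have "20 * pi / (d n * e n) > 0" using d[of n] e[of n] n by simp
    ultimately show False by simp
  qed
  have "sqrt \<kappa> / 2 * (\<Sum>n<j. sqrt (d n / e n)) + (if j = 0 then 0 else sqrt (mass b (t (j - 1) / 2))) \<le> sqrt (mass b pi)"
    if "j \<le> K" for j
    using that
  proof (induction j)
    case 0
    then show ?case using M by simp
  next
    case (Suc j)
    then have j: "j < K" by simp
    have "sqrt (mass b (4 * t j)) \<le> sqrt (mass b pi) - sqrt \<kappa> / 2 * (\<Sum>n<j. sqrt (d n / e n))"
    proof (cases j)
      case 0
      have "mass b (4 * t j) \<le> mass b pi" by (intro mass_mono b b0) (use t[OF j] s0pi in auto)
      then show ?thesis using 0 by simp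
    next
      case (Suc i)
      have "mass b (4 * t j) \<le> mass b (t i / 2)"
        using tdec[of i] t[of i] s0pi s0 j Suc by (intro mass_mono b b0) auto
      then have "sqrt (mass b (4 * t j)) \<le> sqrt (mass b (t i / 2))" by (rule real_sqrt_le_mono)
      moreover have "sqrt \<kappa> / 2 * (\<Sum>n<j. sqrt (d n / e n)) + sqrt (mass b (t i / 2)) \<le> sqrt (mass b pi)"
        using Suc.IH Suc j by simp
      ultimately show ?thesis by linarith
    qed
    then show ?case using inc[OF j] by (simp add: distrib_left)
  qed
  note total = this[of K]
  show ?thesis
  proof (cases "K = 0")
    case False
    have "0 \<le> mass b (t (K - 1) / 2)"
      using t(2)[of "K - 1"] s0pi s0 False by (intro mass_nonneg b b0) auto
    then have "0 \<le> sqrt (mass b (t (K - 1) / 2))" by (rule real_sqrt_ge_zero)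
    moreover have "sqrt \<kappa> / 2 * (\<Sum>n<K. sqrt (d n / e n)) + sqrt (mass b (t (K - 1) / 2)) \<le> sqrt (mass b pi)"
      using total[OF order_refl] False by (simp only: if_False)
    ultimately show ?thesis by linarith
  qed (use M in simp)
qed

section \<open>Choice of the boundary point\<close>

text \<open>A subcover of least cardinality: if three intervals had a common point, one of them would lie in
  the union of the one reaching furthest to the left and the one reaching furthest to the right.\<close>

lemma interval_subcover_overlap_2:
  fixes l r :: "'i \<Rightarrow> real"
  assumes fin: "finite I" and cov: "X \<subseteq> (\<Union>i\<in>I. {l i<..<r i})"
  shows "\<exists>J\<subseteq>I. X \<subseteq> (\<Union>i\<in>J. {l i<..<r i}) \<and> (\<forall>x. card {i \<in> J. x \<in> {l i<..<r i}} \<le> 2)"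
proof -
  define P where "P J \<longleftrightarrow> J \<subseteq> I \<and> X \<subseteq> (\<Union>i\<in>J. {l i<..<r i})" for J
  have "P I" using cov by (simp add: P_def)
  then obtain J where J: "P J" and least: "\<And>J'. P J' \<Longrightarrow> card J \<le> card J'"
    using ex_has_least_nat[of P I card] by blast
  have finJ: "finite J" using J fin by (auto simp: P_def intro: finite_subset)
  have ov: "card {i \<in> J. x \<in> {l i<..<r i}} \<le> 2" for x
  proof (rule ccontr)
    define S where "S = {i \<in> J. x \<in> {l i<..<r i}}"
    assume "\<not> card {i \<in> J. x \<in> {l i<..<r i}} \<le> 2"
    then have c: "card S > 2" by (simp add: S_def)
    have finS: "finite S" using finJ by (simp add: S_def)
    have ne: "S \<noteq> {}" using c by auto
    define p where "p = arg_min_on l S"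
    define q where "q = arg_min_on (\<lambda>i. - r i) S"
    have p: "p \<in> S" "\<And>i. i \<in> S \<Longrightarrow> l p \<le> l i"
      unfolding p_def using arg_min_if_finite[OF finS ne, of l] by (auto simp: not_less)
    have q: "q \<in> S" "\<And>i. i \<in> S \<Longrightarrow> r i \<le> r q"
      unfolding q_def using arg_min_if_finite[OF finS ne, of "\<lambda>i. - r i"] by (auto simp: not_less)
    have "card {p, q} \<le> 2" by (simp add: card_insert_if)
    then have "\<not> S \<subseteq> {p, q}" using c card_mono[of "{p, q}" S] by auto
    then obtain s where s: "s \<in> S" "s \<noteq> p" "s \<noteq> q" by blast
    have sub: "{l s<..<r s} \<subseteq> {l p<..<r p} \<union> {l q<..<r q}"
      using p(1) q(1) s(1) p(2)[OF s(1)] q(2)[OF s(1)] by (auto simp: S_def)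
    have "P (J - {s})"
      unfolding P_def
    proof
      show "J - {s} \<subseteq> I" using J by (auto simp: P_def)
      have "p \<in> J - {s}" "q \<in> J - {s}" using p(1) q(1) s by (auto simp: S_def)
      then show "X \<subseteq> (\<Union>i\<in>J - {s}. {l i<..<r i})" using J sub unfolding P_def by blast
    qed
    from least[OF this] have "card J \<le> card (J - {s})" .
    moreover have "card (J - {s}) < card J" using s(1) finJ by (intro psubset_card_mono) (auto simp: S_def)
    ultimately show False by simp
  qed
  have "J \<subseteq> I" "X \<subseteq> (\<Union>i\<in>J. {l i<..<r i})" using J unfolding P_def by blast+
  then show ?thesis by (intro exI[of _ J] conjI allI ov)
qed

lemma integral_shift:
  fixes f :: "real \<Rightarrow> real"
  assumes "continuous_on {p + c..q + c} f"
  shows "integral {p..q} (\<lambda>x. f (x + c)) = integral {p + c..q + c} f"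
proof -
  have "(f has_integral integral {p + c..q + c} f) (cbox (p + c) (q + c))"
    using integrable_integral[OF integrable_continuous_interval[OF assms]] by simp
  from has_integral_affinity'[OF this, of 1 c] show ?thesis by (simp add: integral_unique)
qed

lemma mass_shift:
  assumes "continuous_on UNIV f"
  shows "mass (\<lambda>x. f (c + x)) s = integral {c - s..c + s} f"
  using integral_shift[of "-s" c s f] continuous_on_subset[OF assms] by (simp add: mass_def add.commute)

text \<open>A maximal inequality: if every centre failed, finitely many of the offending intervals would cover
  the middle interval with overlap at most two.\<close>

lemma good_centre:
  fixes a b :: "real \<Rightarrow> real"
  assumes a: "continuous_on UNIV a" "\<And>x. a x \<ge> 0" and b: "continuous_on UNIV b" "\<And>x. b x \<ge> 0"
    and s0: "0 < s0" and \<eta>: "0 \<le> \<eta>"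
    and ab: "2 * integral {c - 2 * s0..c + 2 * s0} b \<le> \<eta> * integral {c - s0..c + s0} a"
  shows "\<exists>z. \<forall>s. 0 < s \<and> s \<le> s0 \<longrightarrow> integral {z - s..z + s} b \<le> \<eta> * integral {z - s..z + s} a"
proof (rule ccontr)
  assume "\<not> ?thesis"
  then have "\<exists>s. 0 < s \<and> s \<le> s0 \<and> integral {z - s..z + s} b > \<eta> * integral {z - s..z + s} a" for z
    by (auto simp: not_le)
  then obtain s where s: "\<And>z. 0 < s z" "\<And>z. s z \<le> s0"
    and bad: "\<And>z. integral {z - s z..z + s z} b > \<eta> * integral {z - s z..z + s z} a" by metis
  define I0 where "I0 = {c - s0..c + s0}"
  define I1 where "I1 = {c - 2 * s0..c + 2 * s0}"
  have "I0 \<subseteq> (\<Union>z\<in>I0. {z - s z<..<z + s z})" using s(1) by auto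
  then obtain Z where Z: "Z \<subseteq> I0" "finite Z" "I0 \<subseteq> (\<Union>z\<in>Z. {z - s z<..<z + s z})"
    using compactE_image[of I0 I0 "\<lambda>z. {z - s z<..<z + s z}"] by (auto simp: I0_def)
  obtain J where J: "J \<subseteq> Z" "I0 \<subseteq> (\<Union>z\<in>J. {z - s z<..<z + s z})"
    and ov: "\<forall>x. card {z \<in> J. x \<in> {z - s z<..<z + s z}} \<le> 2"
    using interval_subcover_overlap_2[OF Z(2,3)] by (elim exE conjE) (rule that)
  have finJ: "finite J" using J Z by (auto intro: finite_subset)
  have "c \<in> I0" using s0 by (simp add: I0_def)
  then have Jne: "J \<noteq> {}" using J by auto
  have int: "f integrable_on {p..q}" if "continuous_on UNIV f" for f :: "real \<Rightarrow> real" and p q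
    by (intro integrable_continuous_interval continuous_on_subset[OF that]) auto
  let ?r = "\<lambda>f z x. if x \<in> {z - s z<..<z + s z} then f x else (0::real)"
  have restr: "?r f z integrable_on I1" "integral I1 (?r f z) = integral {z - s z..z + s z} f"
    if f: "continuous_on UNIV f" and z: "z \<in> J" for f z
  proof -
    have "z \<in> I0" using z J Z by auto
    then have sub: "{z - s z<..<z + s z} \<subseteq> I1" using s(2)[of z] by (auto simp: I0_def I1_def)
    have o: "(f has_integral integral {z - s z..z + s z} f) {z - s z<..<z + s z}"
      using integrable_integral[OF int[OF f]] has_integral_open_interval[of f _ "z - s z" "z + s z"]
      by (simp add: box_real)
    have "(?r f z has_integral integral {z - s z..z + s z} f) I1"
      using has_integral_restrict[OF sub, of f] o by simp
    then show "?r f z integrable_on I1" "integral I1 (?r f z) = integral {z - s z..z + s z} f"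
      by (auto simp: integral_unique)
  qed
  have sub01: "I0 \<subseteq> I1" using s0 by (auto simp: I0_def I1_def)
  have "(a has_integral integral I0 a) I0"
    unfolding I0_def by (rule integrable_integral[OF int[OF a(1)]])
  then have r01: "((\<lambda>x. if x \<in> I0 then a x else 0) has_integral integral I0 a) I1"
    by (simp only: has_integral_restrict[OF sub01])
  have "integral I0 a = integral I1 (\<lambda>x. if x \<in> I0 then a x else 0)"
    using integral_unique[OF r01] by (rule sym)
  also have "\<dots> \<le> integral I1 (\<lambda>x. \<Sum>z\<in>J. ?r a z x)"
  proof (rule integral_le)
    show "(\<lambda>x. if x \<in> I0 then a x else 0) integrable_on I1"
      by (rule has_integral_integrable[OF r01])
    show "(\<lambda>x. \<Sum>z\<in>J. ?r a z x) integrable_on I1" by (intro integrable_sum finJ restr(1) a(1))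
    fix x
    show "(if x \<in> I0 then a x else 0) \<le> (\<Sum>z\<in>J. ?r a z x)"
    proof (cases "x \<in> I0")
      case True
      then obtain z where z: "z \<in> J" "x \<in> {z - s z<..<z + s z}" using J by blast
      have "a x = ?r a z x" using z by simp
      also have "\<dots> \<le> (\<Sum>z\<in>J. ?r a z x)" by (rule member_le_sum[OF z(1)]) (use a finJ in auto)
      finally show ?thesis using True by simp
    qed (use a in \<open>auto intro!: sum_nonneg\<close>)
  qed
  also have "\<dots> = (\<Sum>z\<in>J. integral {z - s z..z + s z} a)"
    using integral_sum[OF finJ restr(1)[OF a(1)]] restr(2)[OF a(1)] by simp
  finally have "\<eta> * integral I0 a \<le> \<eta> * (\<Sum>z\<in>J. integral {z - s z..z + s z} a)" by (rule mult_left_mono[OF _ \<eta>])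
  also have "\<dots> = (\<Sum>z\<in>J. \<eta> * integral {z - s z..z + s z} a)" by (rule sum_distrib_left)
  also have "\<dots> < (\<Sum>z\<in>J. integral {z - s z..z + s z} b)" by (rule sum_strict_mono[OF finJ Jne]) (rule bad)
  also have "\<dots> = integral I1 (\<lambda>x. \<Sum>z\<in>J. ?r b z x)"
    using integral_sum[OF finJ restr(1)[OF b(1)]] restr(2)[OF b(1)] by simp
  also have "\<dots> \<le> integral I1 (\<lambda>x. 2 * b x)"
  proof (rule integral_le)
    show "(\<lambda>x. \<Sum>z\<in>J. ?r b z x) integrable_on I1" by (intro integrable_sum finJ restr(1) b(1))
    show "(\<lambda>x. 2 * b x) integrable_on I1" unfolding I1_def by (intro integrable_on_mult_right int b)
    fix x
    have "(\<Sum>z\<in>J. ?r b z x) = real (card {z \<in> J. x \<in> {z - s z<..<z + s z}}) * b x"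
      using finJ by (subst sum.inter_filter[symmetric]) auto
    also have "\<dots> \<le> 2 * b x"
    proof (rule mult_right_mono[OF _ b(2)])
      have "real (card {z \<in> J. x \<in> {z - s z<..<z + s z}}) \<le> real 2" using spec[OF ov, of x] by (simp only: of_nat_le_iff)
      then show "real (card {z \<in> J. x \<in> {z - s z<..<z + s z}}) \<le> 2" by simp
    qed
    finally show "(\<Sum>z\<in>J. ?r b z x) \<le> 2 * b x" .
  qed
  also have "\<dots> = 2 * integral I1 b" by (rule integral_mult_right)
  finally show False using ab by (simp add: I0_def I1_def)
qed

lemma poisson_int_rotate:
  assumes f: "f holomorphic_on S" "open S" "cball 0 1 \<subseteq> S" and z: "norm z < 1"
  shows "poisson_int (\<lambda>x. Re (f (cis (c + x)))) z = Re (f (z * cis c))"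
proof -
  have zc: "norm (z * cis c) < 1" using z by (simp add: norm_mult)
  have "((\<lambda>\<theta>. Re (f (cis \<theta>)) * poisson (z * cis c) \<theta>) has_integral 2 * pi * Re (f (z * cis c))) (cbox (c - pi) (c + pi))"
    using poisson_formula[OF f zc, of "c - pi"] by (simp add: add.commute)
  from has_integral_affinity'[OF this, of 1 c]
  have "((\<lambda>x. Re (f (cis (c + x))) * poisson (z * cis c) (x + c)) has_integral 2 * pi * Re (f (z * cis c))) {-pi..pi}"
    by (simp add: add.commute)
  then show ?thesis unfolding poisson_rotate poisson_int_def by (simp add: integral_unique)
qed

lemma boundary_continuous:
  assumes f: "f holomorphic_on S" "cball 0 1 \<subseteq> S"
  shows "continuous_on A (\<lambda>x. Re (f (cis (c + x))))"
  by (intro continuous_intros continuous_on_compose2[OF holomorphic_on_imp_continuous_on[OF f(1)]])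
     (use f(2) in auto)

lemma boundary_mass:
  assumes f: "f holomorphic_on S" "open S" "cball 0 1 \<subseteq> S"
  shows "mass (\<lambda>x. Re (f (cis (c + x)))) pi = 2 * pi * Re (f 0)"
  using poisson_int_rotate[OF f, of 0 c] by (simp add: poisson_int_def mass_def field_simps)

text \<open>On the circle of radius \<open>1 - s0\<close> both functions are bounded below by their masses on arcs of length
  comparable to \<open>s0\<close>. If the mass of \<open>Re U\<close> on these arcs were nowhere small relative to that of \<open>Re H\<close>, then the
  minimum of the two would be bounded below by the mass of \<open>Re H\<close>, and averaging over the centres would contradict
  the smallness of its mean. So one arc is good, and the maximal inequality yields a point that is good at all
  smaller scales.\<close>

lemma good_boundary_point:
  assumes H: "H holomorphic_on S" and U: "U holomorphic_on S" and S: "open S" "cball 0 1 \<subseteq> S"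
    and pos: "\<And>\<theta>. Re (H (cis \<theta>)) \<ge> 0" "\<And>\<theta>. Re (U (cis \<theta>)) \<ge> 0"
    and s0: "0 < s0" "s0 \<le> 2/5" and \<eta>: "0 < \<eta>" "\<eta> \<le> 2"
    and mean: "80 * pi * circle_mean (\<lambda>z. min (Re (H z)) (Re (U z))) (1 - s0) < \<eta> * Re (H 0)"
  shows "\<exists>\<zeta>. \<forall>s. 0 < s \<and> s \<le> s0 \<longrightarrow>
    mass (\<lambda>x. Re (U (cis (\<zeta> + x)))) s \<le> \<eta> * mass (\<lambda>x. Re (H (cis (\<zeta> + x)))) s"
proof -
  define a where "a x = Re (H (cis x))" for x
  define b where "b x = Re (U (cis x))" for x
  have a: "continuous_on UNIV a" "\<And>x. a x \<ge> 0"
    using boundary_continuous[OF H S(2), of UNIV 0] pos by (simp_all add: a_def[abs_def])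
  have b: "continuous_on UNIV b" "\<And>x. b x \<ge> 0"
    using boundary_continuous[OF U S(2), of UNIV 0] pos by (simp_all add: b_def[abs_def])
  have "\<exists>c. 2 * mass (\<lambda>x. b (c + x)) (2 * s0) \<le> \<eta> * mass (\<lambda>x. a (c + x)) s0"
  proof (rule ccontr)
    assume "\<not> ?thesis"
    then have bad: "\<eta> * mass (\<lambda>x. a (c + x)) s0 < 2 * mass (\<lambda>x. b (c + x)) (2 * s0)" for c by (simp add: not_le)
    have s0pi: "2 * s0 \<le> pi" "s0 < 1" using s0 pi_ge_two by auto
    have up: "mass (\<lambda>x. Re (f (cis (c + x)))) (2 * s0) \<le> 80 * pi * s0 * Re (f (of_real (1 - s0) * cis c))"
      if f: "f holomorphic_on S" "\<And>\<theta>. Re (f (cis \<theta>)) \<ge> 0" for f c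
    proof -
      note cf = boundary_continuous[OF f(1) S(2)]
      have 1: "mass (\<lambda>x. Re (f (cis (c + x)))) (2 * s0) \<le> (2 * s0)\<^sup>2 * wI (\<lambda>x. Re (f (cis (c + x)))) (2 * s0)"
        by (intro mass_le_wI cf f) (use s0 s0pi in auto)
      have "s0 * wI (\<lambda>x. Re (f (cis (c + x)))) (2 * s0) / (20 * pi) \<le> poisson_int (\<lambda>x. Re (f (cis (c + x)))) (of_real (1 - s0) * cis 0)"
        by (intro poisson_int_arc_lower cf f) (use s0 s0pi in auto)
      also have "\<dots> = Re (f (of_real (1 - s0) * cis c))"
        using poisson_int_rotate[OF f(1) S, of "of_real (1 - s0)" c] polar_point(1)[of s0 0] s0 s0pi by simp
      finally have "s0 * wI (\<lambda>x. Re (f (cis (c + x)))) (2 * s0) \<le> 20 * pi * Re (f (of_real (1 - s0) * cis c))"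
        by (simp add: field_simps)
      then have "4 * s0 * (s0 * wI (\<lambda>x. Re (f (cis (c + x)))) (2 * s0)) \<le> 4 * s0 * (20 * pi * Re (f (of_real (1 - s0) * cis c)))"
        using s0 by (intro mult_left_mono) auto
      then show ?thesis using 1 by (simp add: power2_eq_square mult_ac)
    qed
    define g where "g z = min (Re (H z)) (Re (U z))" for z
    have cg: "continuous_on (ball 0 1) g"
      unfolding g_def by (intro continuous_intros holomorphic_on_imp_continuous_on holomorphic_on_subset[OF H] holomorphic_on_subset[OF U])
         (use S(2) in auto)
    have R: "0 \<le> 1 - s0" "1 - s0 < 1" using s0 by auto
    have key: "\<eta> * mass (\<lambda>x. a (c + x)) s0 \<le> 160 * pi * s0 * g (of_real (1 - s0) * cis c)" for c
    proof -
      have "mass (\<lambda>x. a (c + x)) s0 \<le> mass (\<lambda>x. a (c + x)) (2 * s0)"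
        unfolding a_def by (intro mass_mono boundary_continuous[OF H S(2)] pos) (use s0 s0pi in auto)
      also have "\<dots> \<le> 80 * pi * s0 * Re (H (of_real (1 - s0) * cis c))"
        unfolding a_def by (rule up[OF H pos(1)])
      finally have A: "mass (\<lambda>x. a (c + x)) s0 \<le> 80 * pi * s0 * Re (H (of_real (1 - s0) * cis c))" .
      have "0 \<le> mass (\<lambda>x. a (c + x)) s0"
        unfolding a_def by (intro mass_nonneg boundary_continuous[OF H S(2)] pos) (use s0 s0pi in auto)
      then have "\<eta> * mass (\<lambda>x. a (c + x)) s0 \<le> 2 * mass (\<lambda>x. a (c + x)) s0" using \<eta> by (intro mult_right_mono) auto
      then have 1: "\<eta> * mass (\<lambda>x. a (c + x)) s0 \<le> 160 * pi * s0 * Re (H (of_real (1 - s0) * cis c))" using A by linarith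
      have 2: "\<eta> * mass (\<lambda>x. a (c + x)) s0 \<le> 160 * pi * s0 * Re (U (of_real (1 - s0) * cis c))"
        using bad[of c] up[OF U pos(2), of c] by (simp add: b_def)
      show ?thesis using 1 2 by (cases "Re (H (of_real (1 - s0) * cis c)) \<le> Re (U (of_real (1 - s0) * cis c))") (auto simp: g_def min_def)
    qed
    have ca: "continuous_on X (\<lambda>x. a (k x))" if "continuous_on X k" for X and k :: "_ \<Rightarrow> real"
      by (rule continuous_on_compose2[OF a(1) that]) auto
    have cm: "continuous_on {0..2*pi} (\<lambda>c. mass (\<lambda>x. a (c + x)) s0)"
    proof -
      have "continuous_on {0..2*pi} (\<lambda>c. integral (cbox (-s0) s0) (\<lambda>x. a (c + x)))"
        by (rule integral_continuous_on_param) (unfold split_beta, intro ca continuous_intros)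
      then show ?thesis by (simp add: mass_def)
    qed
    have "integral {0..2*pi} (\<lambda>c. \<eta> * mass (\<lambda>x. a (c + x)) s0) \<le> integral {0..2*pi} (\<lambda>c. 160 * pi * s0 * g (of_real (1 - s0) * cis c))"
      by (intro integral_le integrable_continuous_interval continuous_intros cm continuous_on_circle[OF cg R] key)
    also have "\<dots> = 160 * pi * s0 * (2 * pi * circle_mean g (1 - s0))"
      unfolding integral_mult_right circle_mean_def by simp
    finally have 1: "\<eta> * integral {0..2*pi} (\<lambda>c. mass (\<lambda>x. a (c + x)) s0) \<le> 160 * pi * s0 * (2 * pi * circle_mean g (1 - s0))"
      unfolding integral_mult_right .
    have "integral {0..2*pi} (\<lambda>c. mass (\<lambda>x. a (c + x)) s0) = integral {-s0..s0} (\<lambda>x. integral {0..2*pi} (\<lambda>c. a (c + x)))"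
    proof -
      have "continuous_on (cbox (0, -s0) (2*pi, s0)) (\<lambda>(c, x). a (c + x))"
        unfolding split_beta by (intro ca continuous_intros)
      from integral_swap_continuous[OF this] show ?thesis by (simp add: mass_def)
    qed
    also have "\<dots> = integral {-s0..s0} (\<lambda>x. 2 * pi * Re (H 0))"
    proof (rule integral_cong)
      fix x
      have "integral {0..2*pi} (\<lambda>c. a (c + x)) = integral {x..x + 2*pi} a"
        using integral_shift[of 0 x "2*pi" a] continuous_on_subset[OF a(1)] by (simp add: add.commute)
      also have "\<dots> = 2 * pi * Re (H 0)"
        using integral_unique[OF poisson_formula[OF H S, of 0 x]] by (simp add: a_def[abs_def])
      finally show "integral {0..2*pi} (\<lambda>c. a (c + x)) = 2 * pi * Re (H 0)" .
    qed
    also have "\<dots> = 2 * s0 * (2 * pi * Re (H 0))" using s0 by simp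
    finally have "\<eta> * (2 * s0 * (2 * pi * Re (H 0))) \<le> 160 * pi * s0 * (2 * pi * circle_mean g (1 - s0))" using 1 by simp
    then have "(4 * pi * s0) * (\<eta> * Re (H 0)) \<le> (4 * pi * s0) * (80 * pi * circle_mean g (1 - s0))" by (simp add: mult_ac)
    then have "\<eta> * Re (H 0) \<le> 80 * pi * circle_mean g (1 - s0)" using s0 by (simp only: mult_le_cancel_left_pos mult_pos_pos pi_gt_zero zero_less_numeral)
    then show False using mean by (simp add: g_def[abs_def])
  qed
  then obtain c where c: "2 * mass (\<lambda>x. b (c + x)) (2 * s0) \<le> \<eta> * mass (\<lambda>x. a (c + x)) s0" by blast
  have "\<exists>z. \<forall>s. 0 < s \<and> s \<le> s0 \<longrightarrow> integral {z - s..z + s} b \<le> \<eta> * integral {z - s..z + s} a"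
    by (rule good_centre[OF a b s0(1) less_imp_le[OF \<eta>(1)] c[unfolded mass_shift[OF a(1)] mass_shift[OF b(1)]]])
  then show ?thesis
    unfolding mass_shift[OF a(1), symmetric] mass_shift[OF b(1), symmetric] by (simp add: a_def b_def)
qed

text \<open>After rotation of a good boundary point to the angle \<open>0\<close> the estimate for masses near this point applies to
  the boundary values of the two functions.\<close>

theorem ring_sum_bounded:
  fixes d e :: "nat \<Rightarrow> real"
  assumes H: "H holomorphic_on S" and U: "U holomorphic_on S" and S: "open S" "cball 0 1 \<subseteq> S"
    and posH: "\<And>\<theta>. Re (H (cis \<theta>)) \<ge> 0" and posU: "\<And>\<theta>. Re (U (cis \<theta>)) \<ge> \<beta>"
    and pos: "\<kappa> > 0" "\<kappa> \<le> 1" "\<beta> > 0" and s0: "0 < s0" "s0 \<le> 2/5"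
    and mean: "80 * pi * circle_mean (\<lambda>z. min (Re (H z)) (Re (U z))) (1 - s0) < \<kappa> / 10240 * Re (H 0)"
    and d: "\<And>n. n < K \<Longrightarrow> 0 < d n \<and> d n \<le> D" and e: "\<And>n. n < K \<Longrightarrow> 0 < e n \<and> e n \<le> 1"
    and dec: "\<And>n. Suc n < K \<Longrightarrow> d (Suc n) \<le> d n / 65 \<and> e (Suc n) \<le> e n"
    and D: "D \<le> s0 / 4" "D * (2 * pi * Re (H 0)) \<le> s0\<^sup>2" "D * (2 * pi * Re (U 0)) \<le> \<kappa> * s0\<^sup>2 / 1000"
      "D * (2 * pi * Re (U 0)) \<le> 2 * \<beta> * s0\<^sup>2"
    and ring: "\<And>n z. n < K \<Longrightarrow> norm z = 1 - d n \<Longrightarrow> \<kappa> * min (Re (H z)) (1 / e n) \<le> Re (U z)"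
  shows "sqrt \<kappa> / 2 * (\<Sum>n<K. sqrt (d n / e n)) \<le> sqrt (2 * pi * Re (U 0))"
proof -
  have posU': "Re (U (cis \<theta>)) \<ge> 0" for \<theta> using posU[of \<theta>] pos by linarith
  have \<eta>: "0 < \<kappa> / 10240" "\<kappa> / 10240 \<le> 2" using pos by auto
  have "\<exists>\<zeta>. \<forall>s. 0 < s \<and> s \<le> s0 \<longrightarrow>
    mass (\<lambda>x. Re (U (cis (\<zeta> + x)))) s \<le> \<kappa> / 10240 * mass (\<lambda>x. Re (H (cis (\<zeta> + x)))) s"
    by (rule good_boundary_point[OF H U S posH posU' s0 \<eta> mean])
  then obtain \<zeta> where \<zeta>: "\<forall>s. 0 < s \<and> s \<le> s0 \<longrightarrow>
    mass (\<lambda>x. Re (U (cis (\<zeta> + x)))) s \<le> \<kappa> / 10240 * mass (\<lambda>x. Re (H (cis (\<zeta> + x)))) s" by blast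
  have "sqrt \<kappa> / 2 * (\<Sum>n<K. sqrt (d n / e n)) \<le> sqrt (mass (\<lambda>x. Re (U (cis (\<zeta> + x)))) pi)"
  proof (rule core_estimate[where a = "\<lambda>x. Re (H (cis (\<zeta> + x)))" and \<beta> = \<beta> and D = D and ?s0.0 = s0])
    show "continuous_on {-pi..pi} (\<lambda>x. Re (H (cis (\<zeta> + x))))" "continuous_on {-pi..pi} (\<lambda>x. Re (U (cis (\<zeta> + x))))"
      by (intro boundary_continuous[OF H S(2)] boundary_continuous[OF U S(2)])+
    show "\<kappa> * min (poisson_int (\<lambda>x. Re (H (cis (\<zeta> + x)))) (of_real (1 - d n) * cis x)) (1 / e n)
        \<le> poisson_int (\<lambda>x. Re (U (cis (\<zeta> + x)))) (of_real (1 - d n) * cis x)" if n: "n < K" for n x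
    proof -
      have d1: "0 < d n" "d n < 1" using d[OF n] D(1) s0 by auto
      note pp = polar_point(1)[OF d1, of x]
      have "norm (of_real (1 - d n) * cis x) < 1" using pp d1 by simp
      note rot = poisson_int_rotate[OF H S this] poisson_int_rotate[OF U S this]
      have "norm (of_real (1 - d n) * cis x * cis \<zeta>) = 1 - d n" using pp by (simp only: norm_mult[of _ "cis \<zeta>"] norm_cis[of \<zeta>] mult_1_right)
      from ring[OF n this] show ?thesis unfolding rot .
    qed
  qed (use \<zeta> posH posU pos s0 d e dec D in \<open>simp_all only: boundary_mass[OF H S] boundary_mass[OF U S]\<close>)
  then show ?thesis unfolding boundary_mass[OF U S] .
qed

section \<open>Functions bounded on the rings\<close>

text \<open>The box is placed to the right of \<open>\<theta>\<close> or to the left of it, in order to avoid the gap of the lattice at the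
  angle \<open>2 \<pi>\<close>.\<close>

lemma lattice_box:
  fixes \<delta> \<epsilon> d \<theta> :: real
  assumes \<epsilon>: "0 < \<epsilon>" "\<epsilon> \<le> 1/32" and d: "0 < d" "\<delta> / 2 \<le> d" "d \<le> \<delta>" "d \<le> 1/4" and \<theta>: "0 \<le> \<theta>" "\<theta> < 2 * pi"
  defines "\<Delta> \<equiv> 2 * pi * (\<delta> * \<epsilon>)"
  shows "\<exists>j0 N. real N * \<Delta> \<le> d \<and> d \<le> 2 * real N * \<Delta> \<and> 1 / (32 * \<epsilon>) \<le> real N \<and>
    (\<forall>j<N. int (j0 + j) < \<lfloor>1 / (\<delta> * \<epsilon>)\<rfloor> \<and> \<bar>real (j0 + j) * \<Delta> - \<theta>\<bar> \<le> 2 * d)"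
proof -
  have \<delta>: "0 < \<delta>" "\<delta> \<le> 2 * d" using d by auto
  have \<Delta>0: "\<Delta> > 0" using \<delta> \<epsilon> by (simp add: \<Delta>_def)
  have "\<Delta> \<le> 2 * 4 * ((2 * d) * \<epsilon>)"
    unfolding \<Delta>_def using \<delta> \<epsilon> pi_less_4 by (intro mult_mono) auto
  also have "\<dots> = 16 * d * \<epsilon>" by simp
  also have "\<dots> \<le> 16 * d * (1/32)" using \<epsilon> d by (intro mult_left_mono) auto
  finally have \<Delta>d: "\<Delta> \<le> d / 2" by simp
  define N where "N = nat \<lfloor>d / \<Delta>\<rfloor>"
  have "d / \<Delta> \<ge> 2" using \<Delta>d \<Delta>0 by (simp add: pos_le_divide_eq)
  then have N: "real N \<le> d / \<Delta>" "d / \<Delta> < real N + 1" "N \<ge> 1" unfolding N_def by linarith+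
  have N1: "real N * \<Delta> \<le> d" using N(1) \<Delta>0 by (simp add: pos_le_divide_eq)
  have "d / \<Delta> \<le> 2 * real N" using N by linarith
  then have N2: "d \<le> 2 * real N * \<Delta>" using \<Delta>0 by (simp add: pos_divide_le_eq)
  have N3: "1 / (32 * \<epsilon>) \<le> real N"
  proof -
    have "1 / (32 * \<epsilon>) \<le> (\<delta> / 2) / (2 * (2 * 4 * (\<delta> * \<epsilon>)))" using \<delta> \<epsilon> by (simp add: field_simps)
    also have "\<dots> \<le> d / (2 * \<Delta>)"
      unfolding \<Delta>_def using d \<delta> \<epsilon> pi_less_4 by (intro frac_le mult_left_mono mult_right_mono) auto
    also have "\<dots> \<le> real N" using N2 \<Delta>0 by (simp add: pos_divide_le_eq mult_ac)
    finally show ?thesis .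
  qed
  define J where "J = \<lfloor>1 / (\<delta> * \<epsilon>)\<rfloor>"
  have e: "1 / (\<delta> * \<epsilon>) = 2 * pi / \<Delta>" using \<delta> \<epsilon> by (simp add: \<Delta>_def)
  have J: "2 * pi / \<Delta> < of_int J + 1" unfolding J_def e by linarith
  have fl: "int k < J" if "real (k + 1) * \<Delta> \<le> 2 * pi" for k :: nat
  proof -
    have "of_int (int k + 1) \<le> 2 * pi / \<Delta>" using that \<Delta>0 by (simp add: pos_le_divide_eq add.commute)
    then have "int k + 1 \<le> J" unfolding J_def e by (simp only: le_floor_iff)
    then show ?thesis by simp
  qed
  have pi2: "pi > 3" using pi_gt3 .
  show ?thesis
  proof (cases "\<theta> \<le> pi")
    case True
    define j0 where "j0 = nat \<lceil>\<theta> / \<Delta>\<rceil>"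
    have "0 \<le> \<theta> / \<Delta>" using \<theta> \<Delta>0 by simp
    then have "\<theta> / \<Delta> \<le> real j0" "real j0 < \<theta> / \<Delta> + 1" unfolding j0_def by linarith+
    then have j0: "\<theta> \<le> real j0 * \<Delta>" "real j0 * \<Delta> < \<theta> + \<Delta>"
      using \<Delta>0 by (simp add: pos_divide_le_eq, simp add: field_simps)
    have "int (j0 + j) < J \<and> \<bar>real (j0 + j) * \<Delta> - \<theta>\<bar> \<le> 2 * d" if "j < N" for j
    proof
      have "real (j + 1) * \<Delta> \<le> real N * \<Delta>" using that \<Delta>0 by (intro mult_right_mono) auto
      then have j: "real j * \<Delta> + \<Delta> \<le> d" using N1 by (simp add: algebra_simps)
      have "real (j0 + j + 1) * \<Delta> = real j0 * \<Delta> + (real j * \<Delta> + \<Delta>)" by (simp add: algebra_simps)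
      also have "\<dots> \<le> 2 * pi" using j0 j \<Delta>d d True pi2 by linarith
      finally show "int (j0 + j) < J" by (rule fl)
      have "real (j0 + j) * \<Delta> = real j0 * \<Delta> + real j * \<Delta>" by (simp add: algebra_simps)
      moreover have "0 \<le> real j * \<Delta>" using \<Delta>0 by simp
      ultimately show "\<bar>real (j0 + j) * \<Delta> - \<theta>\<bar> \<le> 2 * d" using j0 j \<Delta>d d \<Delta>0 by linarith
    qed
    then show ?thesis unfolding J_def[symmetric] using N1 N2 N3 by blast
  next
    case False
    define k where "k = nat \<lfloor>\<theta> / \<Delta>\<rfloor>"
    have "0 \<le> \<theta> / \<Delta>" using \<theta> \<Delta>0 by simp
    then have "real k \<le> \<theta> / \<Delta>" "\<theta> / \<Delta> < real k + 1" unfolding k_def by linarith+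
    then have k: "real k * \<Delta> \<le> \<theta>" "\<theta> < real k * \<Delta> + \<Delta>"
      using \<Delta>0 by (simp add: pos_le_divide_eq, simp add: field_simps)
    have "real N * \<Delta> \<le> real k * \<Delta>" using N1 k False pi2 d \<Delta>d by linarith
    then have Nk: "N \<le> k" using \<Delta>0 by simp
    have "int (k - N + j) < J \<and> \<bar>real (k - N + j) * \<Delta> - \<theta>\<bar> \<le> 2 * d" if "j < N" for j
    proof
      have "real (k - N + j + 1) * \<Delta> \<le> real k * \<Delta>" using that Nk \<Delta>0 by (intro mult_right_mono) auto
      then show "int (k - N + j) < J" using k \<theta> by (intro fl) linarith
      have "real (k - N + j) * \<Delta> = real k * \<Delta> - real N * \<Delta> + real j * \<Delta>"
        using Nk by (simp add: of_nat_diff algebra_simps)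
      moreover have "0 \<le> real j * \<Delta>" "real j * \<Delta> \<le> real N * \<Delta>" using \<Delta>0 that by auto
      ultimately show "\<bar>real (k - N + j) * \<Delta> - \<theta>\<bar> \<le> 2 * d" using k N1 \<Delta>d d by linarith
    qed
    then show ?thesis unfolding J_def[symmetric] using N1 N2 N3 by blast
  qed
qed

lemma ln_lower_defect:
  fixes x :: real
  assumes "0 < x"
  shows "1 - x\<^sup>2 \<le> 2 * (- ln x)"
  using ln_le_minus_one[of "x\<^sup>2"] assms by (simp add: ln_realpow)

lemma Re_blaschke_poisson:
  "Re ((1 + cnj a * z) / (1 - cnj a * z)) = (1 - (norm a)\<^sup>2 * (norm z)\<^sup>2) / (norm (1 - cnj a * z))\<^sup>2"
proof -
  have "Re ((1 + w) / (1 - w)) = (1 - (norm w)\<^sup>2) / (norm (1 - w))\<^sup>2" for w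
  proof -
    have "(1 + w) / (1 - w) = (1 + w) * cnj (1 - w) / of_real ((norm (1 - w))\<^sup>2)"
      by (metis complex_div_cnj)
    moreover have "Re ((1 + w) * cnj (1 - w)) = 1 - (norm w)\<^sup>2"
      unfolding cmod_power2 by (simp add: power2_eq_square algebra_simps)
    ultimately show ?thesis by (simp only: Re_divide_of_real)
  qed
  from this[of "cnj a * z"] show ?thesis by (simp add: norm_mult power_mult_distrib)
qed

lemma sum_list_holomorphic:
  assumes "\<And>a. a \<in> set as \<Longrightarrow> f a holomorphic_on S"
  shows "(\<lambda>z. \<Sum>a\<leftarrow>as. f a z) holomorphic_on S"
  using assms by (induction as) (auto intro!: holomorphic_intros)

lemma Re_sum_list: "Re (\<Sum>a\<leftarrow>as. f a) = (\<Sum>a\<leftarrow>as. Re (f a))"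
  by (induction as) auto

lemma sum_list_filter_le:
  assumes "\<And>a. a \<in> set as \<Longrightarrow> f a \<ge> (0::real)"
  shows "(\<Sum>a\<leftarrow>filter P as. f a) \<le> (\<Sum>a\<leftarrow>as. f a)"
  unfolding sum_list_filter_if by (rule sum_list_mono) (use assms in auto)

text \<open>The zeros \<open>a\<close> with \<open>|a| \<ge> 1 - s0\<close> are swept to the unit circle: \<open>(1 - |a|\<^sup>2)\<close> times the Poisson kernel
  of \<open>a\<close> is harmonic, dominates \<open>1 - |b\<^sub>a|\<^sup>2\<close>, and is comparable to it on \<open>|z| \<le> |a|\<close>. The other zeros
  contribute little near the circle. This replaces \<open>log 1/|F|\<close> by a harmonic function \<open>Re U\<close>.\<close>

lemma harmonic_companion:
  assumes as: "set as \<subseteq> ball 0 1" "0 \<notin> set as" and V: "V holomorphic_on ball 0 R" "R > 1"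
    and \<beta>: "0 < \<beta>" "\<And>\<theta>. Re (V (cis \<theta>)) \<le> - \<beta>" and s0: "0 < s0" "s0 < 1"
    and L: "L = - Re (V 0) + (\<Sum>a\<leftarrow>as. - ln (norm a))"
  shows "\<exists>U S. open S \<and> cball 0 1 \<subseteq> S \<and> S \<subseteq> ball 0 R \<and> U holomorphic_on S \<and>
    (\<forall>\<theta>. \<beta> \<le> Re (U (cis \<theta>))) \<and> Re (U 0) \<le> 2 * L \<and>
    (\<forall>z. norm z = 1 - s0 \<longrightarrow> (\<forall>a\<in>set as. blaschke a z \<noteq> 0) \<longrightarrow>
       Re (U z) \<le> 4 * (- Re (V z) + (\<Sum>a\<leftarrow>as. - ln (norm (blaschke a z))))) \<and>
    (\<forall>z d. 0 < d \<longrightarrow> d < 1 \<longrightarrow> 4 * L * d \<le> \<beta> * s0\<^sup>2 \<longrightarrow> norm z = 1 - d \<longrightarrow>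
       (\<Sum>a\<leftarrow>as. 1 - (norm (blaschke a z))\<^sup>2) - Re (V z) \<le> 2 * Re (U z))"
proof -
  have an: "norm a < 1" if "a \<in> set as" for a using that as by auto
  have a0: "norm a > 0" if "a \<in> set as" for a using that as by auto
  define G where "G z = (\<Prod>a\<leftarrow>as. 1 - cnj a * z)" for z
  define S where "S = ball 0 R \<inter> {z. G z \<noteq> 0}"
  have cG: "continuous_on UNIV G" unfolding G_def by (induction as) (auto intro!: continuous_intros)
  have "open {z. G z \<noteq> 0}" using open_Collect_neq[OF cG continuous_on_const] .
  then have S1: "open S" unfolding S_def by (intro open_Int open_ball)
  have G0: "1 - cnj a * z \<noteq> 0" if "z \<in> S" "a \<in> set as" for a z
    using that by (auto simp: S_def G_def prod_list_zero_iff image_iff)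
  have S2: "cball 0 1 \<subseteq> S"
    using V(2) blaschke_denom_nz[OF an] by (force simp: S_def G_def prod_list_zero_iff)
  \<comment> \<open>Only zeros farther out than the circle \<open>|z| = 1 - s0\<close> can be swept without losing the comparison on this circle.\<close>
  define big where "big = filter (\<lambda>a. 1 - s0 \<le> norm a) as"
  define k where "k a z = of_real (1 - (norm a)\<^sup>2) * ((1 + cnj a * z) / (1 - cnj a * z))" for a z
  define U where "U z = - V z + (\<Sum>a\<leftarrow>big. k a z)" for z
  have hU: "U holomorphic_on S"
    unfolding U_def
  proof (intro holomorphic_intros sum_list_holomorphic)
    show "V holomorphic_on S" using V(1) by (rule holomorphic_on_subset) (auto simp: S_def)
    show "k a holomorphic_on S" if "a \<in> set big" for a
      unfolding k_def using that G0 by (intro holomorphic_intros) (auto simp: big_def)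
  qed
  have ReU: "Re (U z) = - Re (V z) + (\<Sum>a\<leftarrow>big. Re (k a z))" for z
    by (simp add: U_def Re_sum_list)
  have Rek: "Re (k a z) = (1 - (norm a)\<^sup>2) * (1 - (norm a)\<^sup>2 * (norm z)\<^sup>2) / (norm (1 - cnj a * z))\<^sup>2"
    if "a \<in> set as" "norm z \<le> 1" for a z
  proof -
    have "Re (of_real x * w) = x * Re w" for x w by simp
    then show ?thesis unfolding k_def using Re_blaschke_poisson[of a z]
      by (simp only:) simp
  qed
  have da: "0 \<le> 1 - (norm a)\<^sup>2" if "a \<in> set as" for a using an[OF that] by (simp add: abs_square_le_1)
  have kpos: "Re (k a z) \<ge> 0" if "a \<in> set as" "norm z \<le> 1" for a z
  proof -
    have "(norm a)\<^sup>2 * (norm z)\<^sup>2 \<le> 1 * 1" using an[OF that(1)] that(2) by (intro mult_mono) (auto simp: abs_square_le_1)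
    then show ?thesis unfolding Rek[OF that] using da[OF that(1)] by (intro divide_nonneg_nonneg mult_nonneg_nonneg) auto
  qed
  have bigpos: "(\<Sum>a\<leftarrow>big. Re (k a z)) \<ge> 0" if "norm z \<le> 1" for z
    by (intro sum_list_nonneg) (use kpos that in \<open>auto simp: big_def\<close>)
  have V\<beta>: "Re (V z) \<le> - \<beta>" if "norm z \<le> 1" for z
  proof (cases "norm z = 1")
    case True
    then have "z = cis (Arg z)" using cis_Arg[of z] by (metis cis_Arg norm_zero sgn_eq div_by_1 of_real_1 zero_neq_one)
    then show ?thesis using \<beta>(2) by metis
  next
    case False
    have "(\<lambda>z. - V z) holomorphic_on ball 0 R" by (intro holomorphic_intros V)
    moreover have "cball 0 1 \<subseteq> ball (0::complex) R" using V by auto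
    ultimately have "\<beta> \<le> Re (- V z)"
      by (intro poisson_lower_bound[of "\<lambda>z. - V z" "ball 0 R" z \<beta>]) (use False that \<beta> le_minus_iff in \<open>auto simp: \<close>)
    then show ?thesis by simp
  qed
  have 1: "\<beta> \<le> Re (U (cis \<theta>))" for \<theta>
    using V\<beta>[of "cis \<theta>"] bigpos[of "cis \<theta>"] unfolding ReU by simp
  have lnpos: "- ln (norm a) \<ge> 0" if "a \<in> set as" for a using an[OF that] a0[OF that] by simp
  have sumD: "(\<Sum>a\<leftarrow>as. 1 - (norm a)\<^sup>2) \<le> 2 * L"
  proof -
    have "(\<Sum>a\<leftarrow>as. 1 - (norm a)\<^sup>2) \<le> (\<Sum>a\<leftarrow>as. 2 * (- ln (norm a)))"
      by (rule sum_list_mono) (rule ln_lower_defect[OF a0])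
    also have "\<dots> = 2 * (\<Sum>a\<leftarrow>as. - ln (norm a))" by (rule sum_list_const_mult)
    also have "\<dots> \<le> 2 * L" unfolding L using V\<beta>[of 0] \<beta> by simp
    finally show ?thesis .
  qed
  have 2: "Re (U 0) \<le> 2 * L"
  proof -
    have "(\<Sum>a\<leftarrow>big. Re (k a 0)) \<le> (\<Sum>a\<leftarrow>as. Re (k a 0))"
      unfolding big_def by (rule sum_list_filter_le) (use kpos in auto)
    also have "\<dots> = (\<Sum>a\<leftarrow>as. 1 - (norm a)\<^sup>2)" by (simp add: k_def)
    also have "\<dots> \<le> (\<Sum>a\<leftarrow>as. 2 * (- ln (norm a)))"
      by (rule sum_list_mono) (rule ln_lower_defect[OF a0])
    also have "\<dots> = 2 * (\<Sum>a\<leftarrow>as. - ln (norm a))" by (rule sum_list_const_mult)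
    finally show ?thesis unfolding ReU L using V\<beta>[of 0] \<beta> by simp
  qed
  have 3: "Re (U z) \<le> 4 * (- Re (V z) + (\<Sum>a\<leftarrow>as. - ln (norm (blaschke a z))))"
    if z: "norm z = 1 - s0" and nz: "\<forall>a\<in>set as. blaschke a z \<noteq> 0" for z
  proof -
    have z1: "norm z \<le> 1" using z s0 by simp
    have kterm: "Re (k a z) \<le> 4 * (- ln (norm (blaschke a z)))" if a: "a \<in> set big" for a
    proof -
      have a': "a \<in> set as" "norm z \<le> norm a" using a z by (auto simp: big_def)
      note den = blaschke_denom_nz[OF an[OF a'(1)] z1]
      have "(norm z)\<^sup>2 * (norm z)\<^sup>2 \<le> (norm a)\<^sup>2 * (norm z)\<^sup>2" using a' by (intro mult_right_mono power_mono) auto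
      moreover have "1 - (norm z)\<^sup>2 * (norm z)\<^sup>2 = (1 - (norm z)\<^sup>2) * (1 + (norm z)\<^sup>2)" by (simp add: algebra_simps)
      moreover have "(1 - (norm z)\<^sup>2) * (1 + (norm z)\<^sup>2) \<le> (1 - (norm z)\<^sup>2) * 2"
        using z1 by (intro mult_left_mono) (auto simp: abs_square_le_1)
      ultimately have "1 - (norm a)\<^sup>2 * (norm z)\<^sup>2 \<le> 2 * (1 - (norm z)\<^sup>2)" by linarith
      then have "(1 - (norm a)\<^sup>2) * (1 - (norm a)\<^sup>2 * (norm z)\<^sup>2) \<le> (1 - (norm a)\<^sup>2) * (2 * (1 - (norm z)\<^sup>2))"
        by (intro mult_left_mono da a')
      then have "Re (k a z) \<le> (1 - (norm a)\<^sup>2) * (2 * (1 - (norm z)\<^sup>2)) / (norm (1 - cnj a * z))\<^sup>2"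
        unfolding Rek[OF a'(1) z1] by (intro divide_right_mono) auto
      also have "\<dots> = 2 * (1 - (norm (blaschke a z))\<^sup>2)" unfolding blaschke_norm_identity[OF den] by simp
      also have "\<dots> \<le> 2 * (2 * (- ln (norm (blaschke a z))))"
        using nz a'(1) by (intro mult_left_mono ln_lower_defect) auto
      finally show ?thesis by simp
    qed
    have "(\<Sum>a\<leftarrow>big. Re (k a z)) \<le> (\<Sum>a\<leftarrow>big. 4 * (- ln (norm (blaschke a z))))" by (rule sum_list_mono) (rule kterm)
    also have "\<dots> \<le> (\<Sum>a\<leftarrow>as. 4 * (- ln (norm (blaschke a z))))"
      unfolding big_def
    proof (rule sum_list_filter_le)
      fix a assume a: "a \<in> set as"
      have "norm (blaschke a z) \<le> 1" "norm (blaschke a z) > 0" using blaschke_norm_le_1[OF an[OF a] z1] nz a by auto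
      then show "0 \<le> 4 * (- ln (norm (blaschke a z)))" by simp
    qed
    also have "\<dots> = 4 * (\<Sum>a\<leftarrow>as. - ln (norm (blaschke a z)))" by (rule sum_list_const_mult)
    finally show ?thesis unfolding ReU using V\<beta>[OF z1] \<beta> by simp
  qed
  have 4: "(\<Sum>a\<leftarrow>as. 1 - (norm (blaschke a z))\<^sup>2) - Re (V z) \<le> 2 * Re (U z)"
    if d: "0 < d" "d < 1" "4 * L * d \<le> \<beta> * s0\<^sup>2" "norm z = 1 - d" for z d
  proof -
    have z1: "norm z \<le> 1" using d by simp
    have bound: "1 - (norm (blaschke a z))\<^sup>2 \<le> (if 1 - s0 \<le> norm a then Re (k a z) else 0) + 2 * d / s0\<^sup>2 * (1 - (norm a)\<^sup>2)"
      if a: "a \<in> set as" for a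
    proof -
      note den = blaschke_denom_nz[OF an[OF a] z1]
      show ?thesis
      proof (cases "1 - s0 \<le> norm a")
        case True
        have "(norm a)\<^sup>2 * (norm z)\<^sup>2 \<le> 1 * (norm z)\<^sup>2" using an[OF a] by (intro mult_right_mono) (auto simp: abs_square_le_1)
        then have "(1 - (norm a)\<^sup>2) * (1 - (norm z)\<^sup>2) \<le> (1 - (norm a)\<^sup>2) * (1 - (norm a)\<^sup>2 * (norm z)\<^sup>2)"
          by (intro mult_left_mono da a) simp
        then have "1 - (norm (blaschke a z))\<^sup>2 \<le> Re (k a z)"
          unfolding blaschke_norm_identity[OF den] Rek[OF a z1] by (rule divide_right_mono) simp
        moreover have "0 \<le> 2 * d / s0\<^sup>2 * (1 - (norm a)\<^sup>2)" using d da[OF a] by simp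
        ultimately show ?thesis using True by simp
      next
        case False
        have "s0 \<le> norm (1 - cnj a * z)" using blaschke_denom_lower[OF z1, of a] False by simp
        then have "s0\<^sup>2 \<le> (norm (1 - cnj a * z))\<^sup>2" using s0 by (intro power_mono) auto
        moreover have "1 - (norm z)\<^sup>2 \<le> 2 * d" unfolding d(4) by (simp add: power2_eq_square algebra_simps)
        ultimately have "(1 - (norm a)\<^sup>2) * (1 - (norm z)\<^sup>2) / (norm (1 - cnj a * z))\<^sup>2 \<le> (1 - (norm a)\<^sup>2) * (2 * d) / s0\<^sup>2"
          using da[OF a] d s0 by (intro frac_le mult_left_mono mult_nonneg_nonneg) auto
        then show ?thesis unfolding blaschke_norm_identity[OF den] using False by (simp add: mult_ac)
      qed
    qed
    have "(\<Sum>a\<leftarrow>as. 1 - (norm (blaschke a z))\<^sup>2)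
        \<le> (\<Sum>a\<leftarrow>as. (if 1 - s0 \<le> norm a then Re (k a z) else 0) + 2 * d / s0\<^sup>2 * (1 - (norm a)\<^sup>2))"
      by (rule sum_list_mono) (rule bound)
    also have "\<dots> = (\<Sum>a\<leftarrow>big. Re (k a z)) + 2 * d / s0\<^sup>2 * (\<Sum>a\<leftarrow>as. 1 - (norm a)\<^sup>2)"
      unfolding big_def sum_list_filter_if sum_list_addf sum_list_const_mult ..
    also have "2 * d / s0\<^sup>2 * (\<Sum>a\<leftarrow>as. 1 - (norm a)\<^sup>2) \<le> 2 * d / s0\<^sup>2 * (2 * L)"
      using d by (intro mult_left_mono sumD) auto
    also have "\<dots> \<le> \<beta>" using d(3) s0 by (simp add: field_simps)
    finally have "(\<Sum>a\<leftarrow>as. 1 - (norm (blaschke a z))\<^sup>2) \<le> (\<Sum>a\<leftarrow>big. Re (k a z)) + \<beta>" by simp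
    then show ?thesis unfolding ReU using V\<beta>[OF z1] bigpos[OF z1] by (simp add: algebra_simps)
  qed
  have S3: "S \<subseteq> ball 0 R" by (simp add: S_def)
  show ?thesis
    by (rule exI[of _ U], rule exI[of _ S]) (use S1 S2 S3 hU 1 2 3 4 in blast)
qed

text \<open>Passing to a lacunary subsequence of the rings loses nothing: one of the finitely many residue classes
  carries a divergent series.\<close>

lemma not_summable_residue_class:
  fixes s :: "nat \<Rightarrow> real"
  assumes s: "\<And>n. s n \<ge> 0" "\<not> summable s" and k: "k > 0"
  obtains c where "\<not> summable (\<lambda>i. s (k * i + c))"
proof (rule ccontr)
  assume "\<not> thesis"
  then have "summable (\<lambda>i. s (k * i + c))" for c using that by blast
  then have sm: "summable (\<lambda>i. \<Sum>c<k. s (k * i + c))" by (intro summable_sum)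
  have "summable s"
  proof (rule bounded_imp_summable[of s "suminf (\<lambda>i. \<Sum>c<k. s (k * i + c))"])
    fix n
    have "(\<Sum>m\<le>n. s m) \<le> (\<Sum>m<Suc n * k. s m)"
    proof (rule sum_mono2)
      have "Suc n \<le> Suc n * k" using k by (metis One_nat_def Suc_leI mult.right_neutral mult_le_mono2)
      then show "{..n} \<subseteq> {..<Suc n * k}" by auto
    qed (use s in auto)
    also have "\<dots> = (\<Sum>i<Suc n. \<Sum>m = i * k..<i * k + k. s m)" by (rule sum.nat_group[symmetric])
    also have "\<dots> = (\<Sum>i<Suc n. \<Sum>c<k. s (k * i + c))"
    proof (rule sum.cong[OF refl])
      fix i
      show "(\<Sum>m = i * k..<i * k + k. s m) = (\<Sum>c<k. s (k * i + c))"
        by (rule sum.reindex_bij_witness[of _ "\<lambda>c. k * i + c" "\<lambda>m. m - k * i"]) (auto simp: mult.commute)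
    qed
    also have "\<dots> \<le> suminf (\<lambda>i. \<Sum>c<k. s (k * i + c))"
      by (rule sum_le_suminf[OF sm]) (auto intro!: sum_nonneg s)
    finally show "(\<Sum>m\<le>n. s m) \<le> suminf (\<lambda>i. \<Sum>c<k. s (k * i + c))" .
  qed (rule s)
  then show False using s by simp
qed

lemma chord_le_angle:
  assumes "0 \<le> \<rho>" "\<rho> \<le> 1"
  shows "norm (of_real \<rho> * cis x - of_real \<rho> * cis y) \<le> \<bar>x - y\<bar>"
proof -
  have "(norm (of_real \<rho> * cis x - of_real \<rho> * cis y))\<^sup>2 = 4 * (\<rho> * \<rho>) * (sin ((x - y) / 2))\<^sup>2"
    using norm_diff_polar[of \<rho> x \<rho> y] by simp
  also have "\<dots> \<le> 4 * (1 * 1) * \<bar>(x - y) / 2\<bar>\<^sup>2"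
  proof (intro mult_mono)
    show "(sin ((x - y) / 2))\<^sup>2 \<le> \<bar>(x - y) / 2\<bar>\<^sup>2"
      using power_mono[OF abs_sin_x_le_abs_x[of "(x - y) / 2"] abs_ge_zero, of 2] by (simp only: power2_abs)
  qed (use assms in auto)
  also have "\<dots> = \<bar>x - y\<bar>\<^sup>2" by (simp add: power_divide)
  finally show ?thesis by (rule power2_le_imp_le) simp
qed

text \<open>The dilation by \<open>R\<close> makes all functions holomorphic across the unit circle, where factorization and the
  companion \<open>U\<close> are available. The function \<open>F = exp (-\<beta>) g exp (-H)\<close> has modulus at most \<open>exp (-\<beta>)\<close>, which keeps \<open>Re U\<close> away
  from \<open>0\<close> on the circle. None of the constants depends on \<open>R\<close>, so that \<open>R\<close> may be chosen after the number \<open>K\<close> of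
  rings.\<close>

lemma scaled_rings:
  fixes \<delta> \<epsilon> :: "nat \<Rightarrow> real"
  defines "\<kappa> \<equiv> 1 / 5760000 :: real"
  assumes g: "g holomorphic_on ball 0 1" "g 0 \<noteq> 0" and H: "H holomorphic_on ball 0 1"
    and maj: "\<And>z. z \<in> ball 0 1 \<Longrightarrow> logplus (norm (g z)) \<le> Re (H z)"
    and \<beta>: "\<beta> > 0" "640 * pi * \<beta> < \<kappa> / 10240 * Re (H 0)" and s0: "0 < s0" "s0 \<le> 2/5"
    and R: "0 < R" "R < 1" "\<And>z. norm z = R \<Longrightarrow> g z \<noteq> 0"
    and L: "L = \<beta> + Re (H 0) - ln (norm (g 0))"
    and mean: "circle_mean (\<lambda>z. Re (H z) - logplus (norm (g z))) (R * (1 - s0)) \<le> \<beta>"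
    and \<delta>: "\<And>n. n < K \<Longrightarrow> 0 < \<delta> n \<and> \<delta> n \<le> D \<and> 1 - \<delta> n < R \<and> 1 - \<delta> n \<le> R * (1 - \<delta> n / 2)"
    and \<epsilon>: "\<And>n. n < K \<Longrightarrow> 0 < \<epsilon> n \<and> \<epsilon> n \<le> 1/32"
    and dec: "\<And>n. Suc n < K \<Longrightarrow> \<delta> (Suc n) \<le> \<delta> n / 130 \<and> \<epsilon> (Suc n) \<le> \<epsilon> n"
    and D: "D \<le> 1/4" "D \<le> s0 / 4" "D * (2 * pi * Re (H 0)) \<le> s0\<^sup>2" "D * (4 * pi * L) \<le> \<kappa> * s0\<^sup>2 / 1000"
      "D * (4 * pi * L) \<le> 2 * \<beta> * s0\<^sup>2" "4 * L * D \<le> \<beta> * s0\<^sup>2" "0 \<le> D"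
    and ring: "\<And>n j. n < K \<Longrightarrow> int j < \<lfloor>1 / (\<delta> n * \<epsilon> n)\<rfloor> \<Longrightarrow>
      norm (g (of_real (1 - \<delta> n) * cis (real j * (2 * pi * (\<delta> n * \<epsilon> n))))) \<le> exp \<beta>"
  shows "sqrt \<kappa> / 4 * (\<Sum>n<K. sqrt (\<delta> n / \<epsilon> n)) \<le> sqrt (4 * pi * L)"
proof -
  have \<kappa>: "\<kappa> > 0" "\<kappa> \<le> 1" by (auto simp: \<kappa>_def)
  define Hs where "Hs = (\<lambda>z. H (of_real R * z))"
  define gs where "gs = (\<lambda>z. g (of_real R * z))"
  have hs: "Hs holomorphic_on ball 0 (1 / R)" "gs holomorphic_on ball 0 (1 / R)" and R1: "1 / R > 1"
    unfolding Hs_def gs_def using rescaled_holomorphic[OF H R(1,2)] rescaled_holomorphic[OF g(1) R(1,2)] by auto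
  have inb: "of_real R * z \<in> ball 0 1" if "norm z \<le> 1" for z :: complex
  proof -
    have "R * norm z \<le> R * 1" using that R by (intro mult_left_mono) auto
    then have "R * norm z < 1" using R by linarith
    then show ?thesis using R by (simp add: norm_mult)
  qed
  have majs: "logplus (norm (gs z)) \<le> Re (Hs z)" if "norm z \<le> 1" for z
    unfolding gs_def Hs_def by (rule maj[OF inb[OF that]])
  have Hs0: "Re (Hs z) \<ge> 0" if "norm z \<le> 1" for z using order_trans[OF logplus_nonneg majs[OF that]] .
  define G where "G z = gs z * exp (- Hs z - of_real \<beta>)" for z
  have hG: "G holomorphic_on ball 0 (1 / R)" unfolding G_def by (intro holomorphic_intros hs)
  have nG: "norm (G z) = norm (gs z) * exp (- Re (Hs z) - \<beta>)" for z
    by (simp add: G_def norm_mult norm_exp_eq_Re)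
  have gsnz: "gs z \<noteq> 0" if "norm z = 1" for z
    unfolding gs_def by (rule R(3)) (use that R in \<open>simp add: norm_mult\<close>)
  have Gnz: "G z \<noteq> 0" if "norm z = 1" for z using gsnz[OF that] by (simp add: G_def)
  obtain as R' V where as: "set as \<subseteq> ball 0 1" and V: "R' > 1" "V holomorphic_on ball 0 R'"
    and eq: "\<And>z. norm z \<le> 1 \<Longrightarrow> norm (G z) = (\<Prod>a\<leftarrow>as. norm (blaschke a z)) * exp (Re (V z))"
    using blaschke_factorization[OF hG R1 Gnz] by metis
  have G0: "norm (G 0) = norm (g 0) * exp (- Re (H 0) - \<beta>)" unfolding nG by (simp add: gs_def Hs_def)
  have prod0: "(\<Prod>a\<leftarrow>as. norm (blaschke a 0)) \<noteq> 0" using eq[of 0] G0 g(2) by auto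
  have as0: "0 \<notin> set as" using prod0 by (force simp: prod_list_zero_iff)
  have LV: "L = - Re (V 0) + (\<Sum>a\<leftarrow>as. - ln (norm a))"
  proof -
    have apos: "norm (blaschke a 0) > 0" if "a \<in> set as" for a using as0 that by auto
    have "ln (norm (G 0)) = ln (\<Prod>a\<leftarrow>as. norm (blaschke a 0)) + Re (V 0)"
      using eq[of 0] ln_prod_list[of as "\<lambda>a. norm (blaschke a 0)"] apos by (simp add: ln_mult)
    moreover have "ln (\<Prod>a\<leftarrow>as. norm (blaschke a 0)) = (\<Sum>a\<leftarrow>as. ln (norm a))"
      using ln_prod_list[of as "\<lambda>a. norm (blaschke a 0)"] apos by simp
    moreover have "ln (norm (G 0)) = - L" unfolding G0 L using g(2) by (simp add: ln_mult)
    moreover have "(\<Sum>a\<leftarrow>as. - ln (norm a)) = - (\<Sum>a\<leftarrow>as. ln (norm a))" by (simp add: uminus_sum_list_map o_def)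
    ultimately show ?thesis by simp
  qed
  have gsle: "norm (gs z) \<le> exp (Re (Hs z))" if "norm z \<le> 1" for z
    using norm_le_exp_logplus[of "norm (gs z)"] majs[OF that] by (meson exp_le_cancel_iff order_trans)
  have V\<beta>: "Re (V (cis \<theta>)) \<le> - \<beta>" for \<theta>
  proof -
    have "exp (Re (V (cis \<theta>))) = norm (G (cis \<theta>))" using eq[of "cis \<theta>"] prod_list_blaschke_circle[OF as, of "cis \<theta>"] by simp
    also have "\<dots> \<le> exp (Re (Hs (cis \<theta>))) * exp (- Re (Hs (cis \<theta>)) - \<beta>)"
      unfolding nG by (intro mult_right_mono gsle) auto
    also have "\<dots> = exp (- \<beta>)" by (simp flip: exp_add)
    finally show ?thesis by simp
  qed
  have s01: "s0 < 1" using s0 by simp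
  obtain U S where S: "open S" "cball 0 1 \<subseteq> S" "S \<subseteq> ball 0 R'" "U holomorphic_on S"
    and U1: "\<forall>\<theta>. \<beta> \<le> Re (U (cis \<theta>))" and U2: "Re (U 0) \<le> 2 * L"
    and U3: "\<forall>z. norm z = 1 - s0 \<longrightarrow> (\<forall>a\<in>set as. blaschke a z \<noteq> 0) \<longrightarrow>
       Re (U z) \<le> 4 * (- Re (V z) + (\<Sum>a\<leftarrow>as. - ln (norm (blaschke a z))))"
    and U4: "\<forall>z d. 0 < d \<longrightarrow> d < 1 \<longrightarrow> 4 * L * d \<le> \<beta> * s0\<^sup>2 \<longrightarrow> norm z = 1 - d \<longrightarrow>
       (\<Sum>a\<leftarrow>as. 1 - (norm (blaschke a z))\<^sup>2) - Re (V z) \<le> 2 * Re (U z)"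
    using harmonic_companion[OF as as0 V(2,1) \<beta>(1) V\<beta> s0(1) s01 LV] by (elim exE conjE) (rule that)
  define T where "T = S \<inter> ball 0 (1 / R)"
  have T: "open T" "cball 0 1 \<subseteq> T" using S R1 by (auto simp: T_def)
  have hT: "Hs holomorphic_on T" "U holomorphic_on T" "(\<lambda>z. - V z) holomorphic_on T"
    using hs(1) S(3,4) V(2) by (auto simp: T_def intro!: holomorphic_intros elim!: holomorphic_on_subset)
  have Hcis: "Re (Hs (cis \<theta>)) \<ge> 0" for \<theta> by (rule Hs0) simp
  have mV: "Re (- V (cis \<theta>)) \<ge> 0" for \<theta> using V\<beta>[of \<theta>] \<beta> by simp
  have V0: "Re (- V z) \<ge> 0" if "norm z < 1" for z by (rule poisson_lower_bound[OF hT(3) T that mV])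
  have L0: "L > 0"
  proof -
    have "ln (norm (g 0)) \<le> Re (H 0)" using ln_le_logplus[of "norm (g 0)"] maj[of 0] g(2) by simp
    then show ?thesis using \<beta> L by simp
  qed
  define d where "d n = 1 - (1 - \<delta> n) / R" for n
  have d: "\<delta> n / 2 \<le> d n" "d n \<le> \<delta> n" "0 < d n" "d n \<le> D" if "n < K" for n
  proof -
    have "(1 - \<delta> n) / R \<le> 1 - \<delta> n / 2" using \<delta>[OF that] R by (simp add: pos_divide_le_eq mult.commute)
    then show 1: "\<delta> n / 2 \<le> d n" unfolding d_def by linarith
    then show "0 < d n" using \<delta>[OF that] by simp
    have "(1 - \<delta> n) * R \<le> (1 - \<delta> n) * 1" using \<delta>[OF that] D(1) R by (intro mult_left_mono) auto
    then have "1 - \<delta> n \<le> (1 - \<delta> n) / R" using R by (simp add: pos_le_divide_eq)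
    then show 2: "d n \<le> \<delta> n" by (simp add: d_def)
    then show "d n \<le> D" using \<delta>[OF that] by simp
  qed
  have "sqrt \<kappa> / 2 * (\<Sum>n<K. sqrt (d n / \<epsilon> n)) \<le> sqrt (2 * pi * Re (U 0))"
  proof (rule ring_sum_bounded[OF hT(1,2) T Hcis spec[OF U1] \<kappa> \<beta>(1) s0])
    show "80 * pi * circle_mean (\<lambda>z. min (Re (Hs z)) (Re (U z))) (1 - s0) < \<kappa> / 10240 * Re (Hs 0)"
    proof -
      define v where "v z = Re (H z) - logplus (norm (g z))" for z
      define vs where "vs z = Re (Hs z) - logplus (norm (gs z))" for z
      have b1: "ball 0 1 \<subseteq> T" "ball 0 1 \<subseteq> ball (0::complex) (1 / R)" using T(2) R1 by auto
      have c1: "continuous_on (ball 0 1) (\<lambda>z. min (Re (Hs z)) (Re (U z)))"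
        by (intro continuous_intros holomorphic_on_imp_continuous_on holomorphic_on_subset[OF hT(1) b1(1)]
            holomorphic_on_subset[OF hT(2) b1(1)])
      have c2: "continuous_on (ball 0 1) vs"
        unfolding vs_def by (intro continuous_intros holomorphic_on_imp_continuous_on holomorphic_on_subset[OF hs(1) b1(2)]
            holomorphic_on_subset[OF hs(2) b1(2)])
      \<comment> \<open>Where \<open>|g| \<le> 1\<close> the difference \<open>vs\<close> is \<open>Re Hs\<close>; elsewhere \<open>log 1/|G| = vs + \<beta>\<close>, which dominates \<open>Re U\<close>.\<close>
      have le: "min (Re (Hs z)) (Re (U z)) \<le> 4 * (vs z + \<beta>)" if z: "norm z = 1 - s0" for z
      proof -
        have z1: "norm z \<le> 1" using z s0 by simp
        have vs0: "vs z \<ge> 0" using majs[OF z1] by (simp add: vs_def)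
        show ?thesis
        proof (cases "norm (gs z) \<le> 1")
          case True
          then have "vs z = Re (Hs z)" by (simp add: vs_def logplus_def)
          then show ?thesis using vs0 \<beta> by (simp add: min_le_iff_disj)
        next
          case False
          then have Gz: "norm (G z) > 0" unfolding nG by (intro mult_pos_pos) (auto simp: not_le)
          then have "(\<Prod>a\<leftarrow>as. norm (blaschke a z)) \<noteq> 0" using eq[OF z1] by auto
          then have nz: "\<forall>a\<in>set as. blaschke a z \<noteq> 0" by (force simp: prod_list_zero_iff)
          have apos: "norm (blaschke a z) > 0" if "a \<in> set as" for a using nz that by auto
          have "ln (norm (G z)) = (\<Sum>a\<leftarrow>as. ln (norm (blaschke a z))) + Re (V z)"
            using eq[OF z1] ln_prod_list[of as "\<lambda>a. norm (blaschke a z)"] apos by (simp add: ln_mult)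
          moreover have "ln (norm (G z)) = ln (norm (gs z)) - Re (Hs z) - \<beta>" unfolding nG using False
            by (subst ln_mult) auto
          moreover have "logplus (norm (gs z)) = ln (norm (gs z))" using False by (simp add: logplus_def)
          moreover have "(\<Sum>a\<leftarrow>as. - ln (norm (blaschke a z))) = - (\<Sum>a\<leftarrow>as. ln (norm (blaschke a z)))"
            by (simp add: uminus_sum_list_map o_def)
          ultimately have "- Re (V z) + (\<Sum>a\<leftarrow>as. - ln (norm (blaschke a z))) = vs z + \<beta>" by (simp add: vs_def)
          then show ?thesis using U3[rule_format, OF z nz[rule_format]] by (simp add: min_le_iff_disj)
        qed
      qed
      have "circle_mean (\<lambda>z. min (Re (Hs z)) (Re (U z))) (1 - s0) \<le> circle_mean (\<lambda>z. 4 * (vs z + \<beta>)) (1 - s0)"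
        by (rule circle_mean_mono[OF c1 _ _ _ le]) (use s0 c2 in \<open>auto intro!: continuous_intros\<close>)
      also have "\<dots> = 4 * circle_mean (\<lambda>z. vs z + \<beta>) (1 - s0)"
        unfolding circle_mean_def integral_mult_right by simp
      also have "circle_mean (\<lambda>z. vs z + \<beta>) (1 - s0) = circle_mean vs (1 - s0) + \<beta>"
        using circle_mean_add[OF c2 continuous_on_const, of "1 - s0" \<beta>] s0 by simp
      also have "circle_mean vs (1 - s0) = circle_mean v (R * (1 - s0))"
        by (simp add: circle_mean_def vs_def v_def Hs_def gs_def mult.assoc)
      also have "\<dots> \<le> \<beta>" unfolding v_def by (rule mean)
      finally have "circle_mean (\<lambda>z. min (Re (Hs z)) (Re (U z))) (1 - s0) \<le> 8 * \<beta>" by simp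
      then have "80 * pi * circle_mean (\<lambda>z. min (Re (Hs z)) (Re (U z))) (1 - s0) \<le> 80 * pi * (8 * \<beta>)"
        by (intro mult_left_mono) auto
      also have "80 * pi * (8 * \<beta>) = 640 * pi * \<beta>" by simp
      also note \<beta>(2)
      finally show ?thesis by (simp add: Hs_def)
    qed
    show "0 < d n \<and> d n \<le> D" "0 < \<epsilon> n \<and> \<epsilon> n \<le> 1" if "n < K" for n using d[OF that] \<epsilon>[OF that] by auto
    show "d (Suc n) \<le> d n / 65 \<and> \<epsilon> (Suc n) \<le> \<epsilon> n" if "Suc n < K" for n
      using d(2)[OF that] d(1)[of n] dec[OF that] that by auto
    show "D \<le> s0 / 4" "D * (2 * pi * Re (Hs 0)) \<le> s0\<^sup>2" using D by (auto simp: Hs_def)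
    have U0: "2 * pi * Re (U 0) \<le> 4 * pi * L" using U2 mult_left_mono[of "Re (U 0)" "2 * L" "2 * pi"] by simp
    have "D * (2 * pi * Re (U 0)) \<le> D * (4 * pi * L)" using U0 D(7) by (rule mult_left_mono)
    then show "D * (2 * pi * Re (U 0)) \<le> \<kappa> * s0\<^sup>2 / 1000" "D * (2 * pi * Re (U 0)) \<le> 2 * \<beta> * s0\<^sup>2"
      using D(4,5) by linarith+
    show "\<kappa> * min (Re (Hs z)) (1 / \<epsilon> n) \<le> Re (U z)" if n: "n < K" and z: "norm z = 1 - d n" for n z
    proof -
      define \<rho> where "\<rho> = 1 - d n"
      define \<theta> where "\<theta> = Arg2pi z"
      define \<Delta> where "\<Delta> = 2 * pi * (\<delta> n * \<epsilon> n)"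
      have dn: "0 < d n" "d n \<le> 1/4" using d[OF n] D by auto
      have z\<theta>: "z = of_real \<rho> * cis \<theta>" using Arg2pi_eq[of z] z by (simp add: \<rho>_def \<theta>_def cis_conv_exp)
      have \<theta>: "0 \<le> \<theta>" "\<theta> < 2 * pi" using Arg2pi[of z] by (auto simp: \<theta>_def)
      have "R * \<rho> = 1 - \<delta> n" using R(1) by (simp add: \<rho>_def d_def)
      moreover have "1/2 \<le> \<rho>" "\<rho> < 1" using dn unfolding \<rho>_def by linarith+
      ultimately have \<rho>: "1/2 \<le> \<rho>" "\<rho> < 1" "R * \<rho> = 1 - \<delta> n" by simp_all
      have \<Delta>0: "\<Delta> > 0" using \<delta>[OF n] \<epsilon>[OF n] by (simp add: \<Delta>_def)
      obtain j0 N where N: "real N * \<Delta> \<le> d n" "d n \<le> 2 * real N * \<Delta>" "1 / (32 * \<epsilon> n) \<le> real N"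
        and j: "\<forall>j<N. int (j0 + j) < \<lfloor>1 / (\<delta> n * \<epsilon> n)\<rfloor> \<and> \<bar>real (j0 + j) * \<Delta> - \<theta>\<bar> \<le> 2 * d n"
        using lattice_box[of "\<epsilon> n" "d n" "\<delta> n" \<theta>] \<epsilon>[OF n] d[OF n] dn \<theta> unfolding \<Delta>_def by blast
      define l where "l j = of_real \<rho> * cis (real j0 * \<Delta> + real j * \<Delta>)" for j :: nat
      have l: "l j = of_real \<rho> * cis (real (j0 + j) * \<Delta>)" for j by (simp add: l_def distrib_right)
      have ln: "norm (l j) = \<rho>" for j using \<rho> by (simp add: l norm_mult)
      have near: "norm (l j - z) \<le> 2 * (1 - \<rho>)" if "j < N" for j
        unfolding l z\<theta> using j that chord_le_angle[of \<rho> "real (j0 + j) * \<Delta>" \<theta>] \<rho> by (force simp: \<rho>_def)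
      have z': "norm z < 1" "norm z = \<rho>" using z \<rho> by (auto simp: \<rho>_def)
      have "min (Re (Hs z)) (real N) / 90000 \<le> (\<Sum>a\<leftarrow>as. 1 - (norm (blaschke a z))\<^sup>2) + Re (- V z)"
      proof (rule box_estimate[where l = l and \<rho> = \<rho> and \<Delta> = \<Delta> and ?x0.0 = "real j0 * \<Delta>"
            and h = "\<lambda>z. Re (Hs z)" and p = "\<lambda>z. Re (- V z)", OF as \<rho>(1,2) z'(2)])
        show "real N * \<Delta> \<le> 1" "1 - \<rho> \<le> 4 * real N * \<Delta>" "\<Delta> > 0" using N dn \<Delta>0 by (auto simp: \<rho>_def)
        show "l j = of_real \<rho> * cis (real j0 * \<Delta> + real j * \<Delta>)" for j by (simp add: l_def)
        fix j assume j': "j < N"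
        show "norm (l j - z) \<le> 2 * (1 - \<rho>)" by (rule near[OF j'])
        show "Re (Hs z) \<le> 9 * Re (Hs (l j))"
          by (rule Re_harnack[OF hT(1) T Hcis]) (use z' ln near[OF j'] in \<open>auto simp: norm_minus_commute\<close>)
        show "Re (- V (l j)) \<le> 9 * Re (- V z)"
          by (rule Re_harnack[OF hT(3) T mV]) (use z' ln \<rho> near[OF j'] in auto)
        have "of_real R * l j = of_real (1 - \<delta> n) * cis (real (j0 + j) * \<Delta>)"
          unfolding l \<rho>(3)[symmetric] by simp
        then have "norm (gs (l j)) \<le> exp \<beta>"
          using ring[OF n, of "j0 + j"] j j' by (simp add: gs_def \<Delta>_def)
        then have "norm (G (l j)) \<le> exp \<beta> * exp (- Re (Hs (l j)) - \<beta>)" unfolding nG by (intro mult_right_mono) auto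
        also have "\<dots> = exp (- Re (Hs (l j)))" by (simp flip: exp_add)
        finally show "(\<Prod>a\<leftarrow>as. norm (blaschke a (l j))) * exp (- Re (- V (l j))) \<le> exp (- Re (Hs (l j)))"
          using eq[of "l j"] ln[of j] \<rho> by simp
      qed (use Hs0[of z] V0[of z] z' in auto)
      also have "\<dots> \<le> 2 * Re (U z)"
      proof -
        have "4 * L * d n \<le> 4 * L * D" using d(4)[OF n] L0 by (intro mult_left_mono) auto
        then have "4 * L * d n \<le> \<beta> * s0\<^sup>2" using D(6) by linarith
        then show ?thesis using U4[rule_format, OF dn(1) _ _ z] dn by simp
      qed
      finally have "min (Re (Hs z)) (real N) / 90000 \<le> 2 * Re (U z)" .
      moreover have "x / 180000 \<le> y" if "x / 90000 \<le> 2 * y" for x y :: real using that by simp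
      ultimately have 1: "min (Re (Hs z)) (real N) / 180000 \<le> Re (U z)" by blast
      have "\<kappa> * min (Re (Hs z)) (1 / \<epsilon> n) \<le> min (Re (Hs z)) (real N) / 180000"
      proof -
        have "\<kappa> * min (Re (Hs z)) (1 / \<epsilon> n) = min (Re (Hs z) / 32) (1 / (32 * \<epsilon> n)) / 180000"
          using \<epsilon>[OF n] by (simp add: \<kappa>_def min_def field_simps)
        also have "\<dots> \<le> min (Re (Hs z)) (real N) / 180000"
          using N(3) Hs0[of z] z' by (intro divide_right_mono min.mono) auto
        finally show ?thesis .
      qed
      then show ?thesis using 1 by (rule order_trans)
    qed
  qed
  also have "\<dots> \<le> sqrt (4 * pi * L)"
    using U2 mult_left_mono[of "Re (U 0)" "2 * L" "2 * pi"] by simp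
  finally have 1: "sqrt \<kappa> / 2 * (\<Sum>n<K. sqrt (d n / \<epsilon> n)) \<le> sqrt (4 * pi * L)" .
  have "(\<Sum>n<K. sqrt (\<delta> n / \<epsilon> n) / 2) \<le> (\<Sum>n<K. sqrt (d n / \<epsilon> n))"
  proof (rule sum_mono)
    fix n assume "n \<in> {..<K}"
    then have n: "n < K" by simp
    have "sqrt (\<delta> n / \<epsilon> n) / 2 = sqrt (\<delta> n / \<epsilon> n / 4)"
      unfolding real_sqrt_divide[of "\<delta> n / \<epsilon> n" 4] by simp
    also have "\<delta> n / \<epsilon> n / 4 = \<delta> n / 4 / \<epsilon> n" by simp
    also have "sqrt (\<delta> n / 4 / \<epsilon> n) \<le> sqrt (d n / \<epsilon> n)"
      using d[OF n] \<epsilon>[OF n] \<delta>[OF n] by (intro real_sqrt_le_mono divide_right_mono) auto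
    finally show "sqrt (\<delta> n / \<epsilon> n) / 2 \<le> sqrt (d n / \<epsilon> n)" .
  qed
  then have "sqrt \<kappa> / 2 * ((\<Sum>n<K. sqrt (\<delta> n / \<epsilon> n)) / 2) \<le> sqrt \<kappa> / 2 * (\<Sum>n<K. sqrt (d n / \<epsilon> n))"
    unfolding sum_divide_distrib using \<kappa> by (intro mult_left_mono) auto
  then show ?thesis using 1 by simp
qed

lemma exists_small_positive:
  fixes P :: "(real \<times> real) list"
  assumes "\<And>c e. (c, e) \<in> set P \<Longrightarrow> e > 0"
  shows "\<exists>D>0. \<forall>(c, e)\<in>set P. D * c \<le> e"
  using assms
proof (induction P)
  case Nil
  show ?case by (intro exI[of _ 1]) auto
next
  case (Cons p P)
  then obtain D where D: "D > 0" "\<forall>(c, e)\<in>set P. D * c \<le> e" by auto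
  obtain c e where p: "p = (c, e)" by force
  have e: "e > 0" using Cons.prems[of c e] p by simp
  define D' where "D' = min D (e / (\<bar>c\<bar> + 1))"
  have D': "D' > 0" using D e by (simp add: D'_def)
  have "D' * c' \<le> e'" if "(c', e') \<in> set P" for c' e'
  proof (cases "c' \<ge> 0")
    case True
    have "D' * c' \<le> D * c'" using True by (intro mult_right_mono) (simp add: D'_def)
    then show ?thesis using D(2) that by force
  next
    case False
    have "D' * c' \<le> 0" using D' False by (simp add: mult_le_0_iff)
    then show ?thesis using Cons.prems[of c' e'] that by simp
  qed
  moreover have "D' * c \<le> e"
  proof -
    have "D' * c \<le> D' * (\<bar>c\<bar> + 1)" using D' by (intro mult_left_mono) auto
    also have "\<dots> \<le> e / (\<bar>c\<bar> + 1) * (\<bar>c\<bar> + 1)" by (intro mult_right_mono) (auto simp: D'_def)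
    also have "\<dots> = e" by (simp add: add_nonneg_eq_0_iff)
    finally show ?thesis .
  qed
  ultimately show ?case using D' p by (intro exI[of _ D']) auto
qed

lemma ring_data_ratio:
  assumes "ring_data r \<epsilon>"
  obtains q where "0 < q" "q < 1" "\<And>n. 1 - r (Suc n) \<le> q * (1 - r n)"
proof -
  have r: "0 < r n" "r n < 1" for n using assms by (auto simp: ring_data_def)
  have inc: "incseq r" using assms by (simp add: ring_data_def)
  define Q where "Q n = (1 - r (Suc n)) / (1 - r n)" for n
  have Q1: "Q n \<le> 1" for n using r[of n] incseq_SucD[OF inc, of n] by (simp add: Q_def divide_le_eq_1)
  have bdd: "bdd_above (range Q)" by (rule bdd_aboveI[of _ 1]) (use Q1 in auto)
  have "(SUP n. Q n) < 1" using assms by (simp add: ring_data_def Q_def)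
  moreover have le: "Q n \<le> (SUP n. Q n)" for n by (rule cSUP_upper[OF _ bdd]) simp
  moreover have "Q 0 > 0" using r[of "Suc 0"] r[of 0] by (simp add: Q_def)
  ultimately have "0 < (SUP n. Q n)" "(SUP n. Q n) < 1" using le[of 0] by linarith+
  moreover have "1 - r (Suc n) \<le> (SUP n. Q n) * (1 - r n)" for n
    using le[of n] r[of n] by (simp add: Q_def pos_divide_le_eq)
  ultimately show ?thesis using that by blast
qed

text \<open>Suppose that the least harmonic majorant \<open>Re H\<close> of \<open>log\<^sup>+ |g|\<close> is positive at \<open>0\<close>. The order of the choices
  is essential: \<open>\<beta>\<close> is small relative to \<open>Re (H 0)\<close>, then \<open>s0\<close> such that the mean of \<open>Re H - log\<^sup>+ |g|\<close> is below \<open>\<beta>\<close> on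
  circles of radius greater than \<open>1 - 2 s0\<close>, then the depth \<open>D\<close> of the first ring, then the number of rings, and \<open>R\<close> last.
  The resulting bound for the partial sums contradicts divergence. Thus \<open>Re H\<close> vanishes at \<open>0\<close>, hence everywhere by
  the maximum principle.\<close>

theorem bounded_on_rings_imp_bounded:
  assumes rd: "ring_data r \<epsilon>" and dv: "\<not> summable (\<lambda>n. sqrt ((1 - r n) / \<epsilon> n))"
    and g: "g holomorphic_on ball 0 1" "g 0 \<noteq> 0"
    and bd: "\<And>\<rho>. 0 \<le> \<rho> \<Longrightarrow> \<rho> < 1 \<Longrightarrow> circle_mean (\<lambda>z. logplus (norm (g z))) \<rho> \<le> C"
    and rings: "\<And>\<beta>. \<beta> > 0 \<Longrightarrow> \<exists>n0. \<forall>n\<ge>n0. \<forall>j. int j < \<lfloor>1 / ((1 - r n) * \<epsilon> n)\<rfloor> \<longrightarrow>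
      norm (g (of_real (r n) * cis (real j * (2 * pi * ((1 - r n) * \<epsilon> n))))) \<le> exp \<beta>"
    and z: "z \<in> ball 0 1"
  shows "norm (g z) \<le> 1"
proof -
  have z0: "(0::complex) \<in> ball 0 1" by simp
  obtain H where H: "H holomorphic_on ball 0 1" and maj: "\<And>z. z \<in> ball 0 1 \<Longrightarrow> logplus (norm (g z)) \<le> Re (H z)"
    and lim: "((\<lambda>r. circle_mean (\<lambda>z. Re (H z) - logplus (norm (g z))) r) \<longlongrightarrow> 0) (at_left 1)"
  proof (rule least_harmonic_majorant[OF g(1) z0 g(2) bd])
    fix H assume *: "H holomorphic_on ball 0 1" "\<And>z. z \<in> ball 0 1 \<Longrightarrow> logplus (norm (g z)) \<le> Re (H z)"
      "((\<lambda>r. circle_mean (\<lambda>z. Re (H z) - logplus (norm (g z))) r) \<longlongrightarrow> 0) (at_left 1)"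
    show thesis by (rule that[of H]) (fact *)+
  qed
  have Hpos: "Re (H z) \<ge> 0" if "z \<in> ball 0 1" for z using order_trans[OF logplus_nonneg maj[OF that]] .
  have "Re (H 0) = 0"
  proof (rule ccontr)
    assume "Re (H 0) \<noteq> 0"
    then have m: "Re (H 0) > 0" using Hpos[OF z0] by simp
    define \<kappa> :: real where "\<kappa> = 1 / 5760000"
    have \<kappa>: "\<kappa> > 0" by (simp add: \<kappa>_def)
    define \<beta> where "\<beta> = \<kappa> / 10240 * Re (H 0) / (1000 * pi)"
    have \<beta>: "\<beta> > 0" using \<kappa> m by (simp add: \<beta>_def)
    have "1000 * pi * \<beta> = \<kappa> / 10240 * Re (H 0)" by (simp add: \<beta>_def)
    moreover have "640 * pi * \<beta> < 1000 * pi * \<beta>" using \<beta> by simp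
    ultimately have \<beta>': "640 * pi * \<beta> < \<kappa> / 10240 * Re (H 0)" by linarith
    define L where "L = \<beta> + Re (H 0) - ln (norm (g 0))"
    have "\<forall>\<^sub>F \<rho> in at_left 1. circle_mean (\<lambda>z. Re (H z) - logplus (norm (g z))) \<rho> < \<beta>"
      using lim \<beta> by (rule order_tendstoD)
    then obtain \<rho>0 where \<rho>0: "\<rho>0 < 1" "\<And>\<rho>. \<rho>0 < \<rho> \<Longrightarrow> \<rho> < 1 \<Longrightarrow> circle_mean (\<lambda>z. Re (H z) - logplus (norm (g z))) \<rho> < \<beta>"
      unfolding eventually_at_left_field by blast
    define s0 where "s0 = min (2/5) ((1 - \<rho>0) / 4)"
    have s0: "0 < s0" "s0 \<le> 2/5" using \<rho>0 by (auto simp: s0_def)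
    have s0\<rho>: "\<rho>0 < 1 - 2 * s0" 
    proof -
      have "s0 \<le> (1 - \<rho>0) / 4" unfolding s0_def by (rule min.cobounded2)
      then show ?thesis using \<rho>0(1) by (simp add: field_simps)
    qed
    have "\<exists>D>0. \<forall>(c, e)\<in>set [(1, 1/4), (1, s0 / 4), (2 * pi * Re (H 0), s0\<^sup>2), (4 * pi * L, \<kappa> * s0\<^sup>2 / 1000),
        (4 * pi * L, 2 * \<beta> * s0\<^sup>2), (4 * L, \<beta> * s0\<^sup>2)]. D * c \<le> e"
      (is "\<exists>D>0. \<forall>(c, e)\<in>set ?P. D * c \<le> e")
    proof (rule exists_small_positive)
      have "\<forall>p\<in>set ?P. snd p > 0" using s0 \<beta> \<kappa> by simp
      then show "e > 0" if "(c, e) \<in> set ?P" for c e using bspec[OF _ that, of "\<lambda>p. snd p > 0"] by simp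
    qed
    then obtain D where D0: "D > 0" and D: "D \<le> 1/4" "D \<le> s0 / 4" "D * (2 * pi * Re (H 0)) \<le> s0\<^sup>2"
      "D * (4 * pi * L) \<le> \<kappa> * s0\<^sup>2 / 1000" "D * (4 * pi * L) \<le> 2 * \<beta> * s0\<^sup>2" "4 * L * D \<le> \<beta> * s0\<^sup>2"
      by (auto simp: mult.commute mult.left_commute)
    have r: "0 < r n" "r n < 1" and \<epsilon>: "0 < \<epsilon> n" "\<epsilon> n < 1" for n using rd by (auto simp: ring_data_def)
    have inc: "incseq r" and decr: "decseq \<epsilon>" and rlim: "r \<longlonglongrightarrow> 1" and elim: "\<epsilon> \<longlonglongrightarrow> 0"
      using rd by (auto simp: ring_data_def)
    obtain q where q: "0 < q" "q < 1" "\<And>n. 1 - r (Suc n) \<le> q * (1 - r n)" by (rule ring_data_ratio[OF rd]) blast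
    have qk: "1 - r (n + k) \<le> q ^ k * (1 - r n)" for n k
    proof (induction k)
      case (Suc k)
      have "1 - r (n + Suc k) \<le> q * (1 - r (n + k))" using q(3)[of "n + k"] by simp
      also have "\<dots> \<le> q * (q ^ k * (1 - r n))" using q(1) by (intro mult_left_mono Suc) auto
      finally show ?case by simp
    qed simp
    have "\<forall>\<^sub>F k in sequentially. q ^ k < 1/130"
      using LIMSEQ_power_zero[of q] q by (intro order_tendstoD) auto
    then obtain k0 where k0: "\<And>k. k \<ge> k0 \<Longrightarrow> q ^ k < 1/130" unfolding eventually_sequentially by blast
    define k where "k = Suc k0"
    have k: "k > 0" "q ^ k < 1/130" using k0[of k] by (auto simp: k_def)
    define s where "s n = sqrt ((1 - r n) / \<epsilon> n)" for n
    have spos: "s n \<ge> 0" for n using r[of n] \<epsilon>[of n] by (simp add: s_def)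
    obtain c where c: "\<not> summable (\<lambda>i. s (k * i + c))"
      by (rule not_summable_residue_class[OF spos dv[folded s_def] k(1)])
    obtain n0 where n0: "\<forall>n\<ge>n0. \<forall>j. int j < \<lfloor>1 / ((1 - r n) * \<epsilon> n)\<rfloor> \<longrightarrow>
      norm (g (of_real (r n) * cis (real j * (2 * pi * ((1 - r n) * \<epsilon> n))))) \<le> exp \<beta>" using rings[OF \<beta>] by blast
    have "\<forall>\<^sub>F n in sequentially. r n > 1 - D" using rlim D0 by (intro order_tendstoD) auto
    moreover have "\<forall>\<^sub>F n in sequentially. \<epsilon> n < 1/32" using elim by (intro order_tendstoD) auto
    ultimately have "\<forall>\<^sub>F n in sequentially. r n > 1 - D \<and> \<epsilon> n < 1/32" by (rule eventually_conj)
    then obtain n1 where n1: "\<And>n. n \<ge> n1 \<Longrightarrow> r n > 1 - D \<and> \<epsilon> n < 1/32" unfolding eventually_sequentially by blast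
    define i0 where "i0 = n0 + n1"
    define idx where "idx i = k * (i + i0) + c" for i
    have idx: "idx i \<ge> n0" "idx i \<ge> n1" for i
    proof -
      have "1 * (i + i0) \<le> k * (i + i0)" using k by (intro mult_right_mono) auto
      then have "i + i0 \<le> idx i" unfolding idx_def mult_1 by (rule trans_le_add1)
      then show "idx i \<ge> n0" "idx i \<ge> n1" unfolding i0_def by linarith+
    qed
    have idxS: "idx (Suc i) = idx i + k" for i by (simp add: idx_def algebra_simps)
    have ns: "\<not> summable (\<lambda>i. s (idx i))"
    proof
      assume "summable (\<lambda>i. s (idx i))"
      then have "summable (\<lambda>i. s (k * (i + i0) + c))" by (simp add: idx_def)
      then have "summable (\<lambda>i. s (k * i + c))" using summable_iff_shift[of "\<lambda>i. s (k * i + c)" i0] by simp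
      then show False using c by simp
    qed
    have "\<exists>K. sqrt \<kappa> / 4 * (\<Sum>i<K. s (idx i)) > sqrt (4 * pi * L)"
    proof (rule ccontr)
      assume "\<not> ?thesis"
      then have le: "sqrt \<kappa> / 4 * (\<Sum>i<K. s (idx i)) \<le> sqrt (4 * pi * L)" for K by (simp add: not_less)
      have "summable (\<lambda>i. s (idx i))"
      proof (rule bounded_imp_summable[OF spos])
        fix n
        show "(\<Sum>i\<le>n. s (idx i)) \<le> sqrt (4 * pi * L) * (4 / sqrt \<kappa>)"
          using le[of "Suc n"] \<kappa> by (simp add: lessThan_Suc_atMost field_simps)
      qed
      then show False using ns by simp
    qed
    then obtain K where K: "sqrt \<kappa> / 4 * (\<Sum>i<K. s (idx i)) > sqrt (4 * pi * L)" by blast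
    \<comment> \<open>\<open>R > M\<close> guarantees that dilation by \<open>R\<close> changes the depth of the rings below \<open>K\<close> by a factor of at most \<open>2\<close>.\<close>
    define M where "M = max (r (idx K) / (1 - (1 - r (idx K)) / 2)) (1 - s0)"
    have M1: "M < 1" "0 \<le> M"
      using r[of "idx K"] s0 by (auto simp: M_def field_simps)
    obtain R where R: "M < R" "R < 1" "\<And>z. norm z = R \<Longrightarrow> g z \<noteq> 0"
    proof -
      obtain R where "M < R" "R < (1 + M) / 2" "\<And>z. norm z = R \<Longrightarrow> g z \<noteq> 0"
        by (rule exists_zero_free_radius[OF g(1) z0 g(2), of M "(1 + M) / 2" "{}"]) (use M1 in auto)
      then show thesis using M1 by (intro that[of R]) auto
    qed
    have Rr: "r (idx i) < R \<and> r (idx i) \<le> R * (1 - (1 - r (idx i)) / 2)" if "i < K" for i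
    proof -
      have "idx i \<le> idx K" using that by (simp add: idx_def)
      then have le: "r (idx i) \<le> r (idx K)" using inc by (auto dest: incseqD)
      have "r (idx K) / (1 - (1 - r (idx K)) / 2) < R" using R(1) by (simp add: M_def)
      then have a: "2 * r (idx K) < R * (1 + r (idx K))" using r[of "idx K"] by (simp add: field_simps)
      have "(2 - R) * r (idx i) \<le> (2 - R) * r (idx K)" using le R(2) by (intro mult_left_mono) auto
      then have b: "2 * r (idx i) \<le> R * (1 + r (idx i))" using a by (simp add: algebra_simps)
      have "r (idx i) * r (idx i) < r (idx i) * 1" using r[of "idx i"] by (intro mult_strict_left_mono) auto
      have "R * (1 + r (idx i)) < R * 2" using r[of "idx i"] R M1 by (intro mult_strict_left_mono) auto
      then have "r (idx i) < R" using b by simp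
      then show ?thesis using b by (simp add: field_simps)
    qed
    have R0: "0 < R" using R M1 by simp
    have "sqrt \<kappa> / 4 * (\<Sum>i<K. sqrt ((1 - r (idx i)) / \<epsilon> (idx i))) \<le> sqrt (4 * pi * L)"
    proof (rule scaled_rings[OF g H maj \<beta> \<beta>'[unfolded \<kappa>_def] s0 R0 R(2,3) L_def, folded \<kappa>_def, where D = D and K = K])
      have "1 - 2 * s0 < (1 - s0) * (1 - s0)" using s0 by (simp add: algebra_simps)
      also have "\<dots> \<le> R * (1 - s0)" using R(1) s0 by (intro mult_right_mono) (auto simp: M_def)
      finally have "\<rho>0 < R * (1 - s0)" using s0\<rho> by simp
      moreover have "R * (1 - s0) < 1 * 1" using R R0 s0 by (intro mult_strict_mono) auto
      ultimately show "circle_mean (\<lambda>z. Re (H z) - logplus (norm (g z))) (R * (1 - s0)) \<le> \<beta>"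
        using \<rho>0(2)[of "R * (1 - s0)"] by simp
      fix n
      show "0 < 1 - r (idx n) \<and> 1 - r (idx n) \<le> D \<and> 1 - (1 - r (idx n)) < R \<and> 1 - (1 - r (idx n)) \<le> R * (1 - (1 - r (idx n)) / 2)"
        if "n < K" using r[of "idx n"] n1[OF idx(2)[of n]] Rr[OF that] by auto
      show "0 < \<epsilon> (idx n) \<and> \<epsilon> (idx n) \<le> 1/32" using \<epsilon>[of "idx n"] n1[OF idx(2)[of n]] by auto
      have "1 - r (idx (Suc n)) \<le> q ^ k * (1 - r (idx n))" using qk[of "idx n" k] by (simp add: idxS)
      also have "\<dots> \<le> 1/130 * (1 - r (idx n))" using k r[of "idx n"] by (intro mult_right_mono) auto
      finally show "1 - r (idx (Suc n)) \<le> (1 - r (idx n)) / 130 \<and> \<epsilon> (idx (Suc n)) \<le> \<epsilon> (idx n)"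
        using decseqD[OF decr, of "idx n" "idx n + k"] by (simp add: idxS)
      show "norm (g (of_real (1 - (1 - r (idx n))) * cis (real j * (2 * pi * ((1 - r (idx n)) * \<epsilon> (idx n)))))) \<le> exp \<beta>"
        if "int j < \<lfloor>1 / ((1 - r (idx n)) * \<epsilon> (idx n))\<rfloor>" for j
        using n0 idx(1)[of n] that by simp
    qed (use D D0 in auto)
    then show False using K by (simp add: s_def)
  qed
  then have nrm: "norm (exp (- H 0)) = 1" by (simp add: norm_exp_eq_Re)
  have "(\<lambda>z. exp (- H z)) constant_on ball 0 1"
  proof (rule maximum_modulus_principle[of _ _ "ball 0 1" 0])
    show "norm (exp (- H w)) \<le> norm (exp (- H 0))" if "w \<in> ball 0 1" for w
      unfolding nrm using Hpos[OF that] by (simp add: norm_exp_eq_Re)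
  qed (auto intro!: holomorphic_intros H)
  then have "exp (- H z) = exp (- H 0)" using z z0 unfolding constant_on_def by metis
  then have "norm (exp (- H z)) = 1" using nrm by simp
  then have "Re (H z) = 0" by (simp add: norm_exp_eq_Re)
  then have "logplus (norm (g z)) \<le> 0" using maj[OF z] by simp
  then show ?thesis using logplus_le_iff[of 0 "norm (g z)"] by simp
qed

section \<open>Divergence of the series implies sampling\<close>

lemma discretized_ring_point:
  "of_real a * exp (2 * of_real pi * \<i> * of_nat j * of_real x) = of_real a * cis (real j * (2 * pi * x))"
  by (simp add: cis_conv_exp mult_ac)

lemma nevanlinna_class_circle_mean:
  assumes "f \<in> nevanlinna_class"
  obtains L where "f holomorphic_on ball 0 1" "(circle_mean (\<lambda>z. logplus (norm (f z))) \<longlongrightarrow> L) (at_left 1)"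
  using assms unfolding nevanlinna_class_def circle_mean_def[abs_def] cis_conv_exp by auto

text \<open>For admissible \<open>h = Re H\<close> the quotient \<open>g = f exp (-H)\<close> is bounded by \<open>1\<close> on the rings, hence on the disk, so
  that \<open>h + log 2\<close> is admissible on the whole disk. The sampling constant is \<open>log 2\<close>.\<close>

theorem divergent_imp_sampling:
  assumes rd: "ring_data r \<epsilon>" and dv: "\<not> summable (\<lambda>n. sqrt ((1 - r n) / \<epsilon> n))"
  shows "sampling_nevanlinna (discretized_rings r \<epsilon>)"
proof -
  define \<Lambda> where "\<Lambda> = discretized_rings r \<epsilon>"
  have r: "0 < r n" "r n < 1" for n using rd by (auto simp: ring_data_def)
  have rlim: "r \<longlonglongrightarrow> 1" using rd by (auto simp: ring_data_def)
  have key: "N_full f \<le> ereal (h 0) + ereal (ln 2)"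
    if f: "f \<in> nevanlinna_class" and h: "h \<in> Har_plus" "\<forall>z\<in>\<Lambda>. ln (1 + norm (f z)) \<le> h z" for f h
  proof -
    obtain L where hf: "f holomorphic_on ball 0 1"
      and lim: "(circle_mean (\<lambda>z. logplus (norm (f z))) \<longlongrightarrow> L) (at_left 1)"
      by (rule nevanlinna_class_circle_mean[OF f])
    have harm: "harmonic_on h (ball 0 1)" and hpos: "\<And>z. z \<in> ball 0 1 \<Longrightarrow> 0 \<le> h z"
      using h(1) by (auto simp: Har_plus_def)
    obtain H where H: "H holomorphic_on ball 0 1" and ReH: "\<And>z. z \<in> ball 0 1 \<Longrightarrow> Re (H z) = h z"
      using harmonic_on_convex_imp_Re[OF harm open_ball convex_ball] by metis
    define g where "g z = f z * exp (- H z)" for z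
    have hg: "g holomorphic_on ball 0 1" unfolding g_def by (intro holomorphic_intros hf H)
    have ng: "norm (g z) = norm (f z) * exp (- h z)" if "z \<in> ball 0 1" for z
      using ReH[OF that] by (simp add: g_def norm_mult norm_exp_eq_Re)
    have "norm (g z) \<le> 1" if z: "z \<in> ball 0 1" for z
    proof (cases "\<exists>b\<in>ball 0 1. g b \<noteq> 0")
      case True
      then obtain b where b: "b \<in> ball 0 1" "g b \<noteq> 0" by blast
      \<comment> \<open>A zero at the centre is divided out; this costs a factor tending to \<open>1\<close> on the rings.\<close>
      have "\<exists>n g1. g1 holomorphic_on ball 0 1 \<and> g1 0 \<noteq> 0 \<and> (\<forall>z\<in>ball 0 1. g z = z ^ n * g1 z)"
      proof (cases "g 0 = 0")
        case True
        obtain n g1 where "n > 0" "g1 holomorphic_on ball 0 1" "g1 0 \<noteq> 0"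
          "\<And>z. z \<in> ball 0 1 \<Longrightarrow> g z = (z - 0) ^ n * g1 z"
          by (rule zero_division[OF hg open_ball connected_ball _ True b]) auto
        then show ?thesis by (intro exI[of _ n] exI[of _ g1]) auto
      next
        case False
        then show ?thesis using hg by (intro exI[of _ 0] exI[of _ g]) auto
      qed
      then obtain N g1 where g1: "g1 holomorphic_on ball 0 1" "g1 0 \<noteq> 0"
        and gg1: "\<And>z. z \<in> ball 0 1 \<Longrightarrow> g z = z ^ N * g1 z" by blast
      have z0: "(0::complex) \<in> ball 0 1" by simp
      have cont: "continuous_on (ball 0 1) (\<lambda>z. logplus (norm (F z)))" if "F holomorphic_on ball 0 1" for F
        by (intro continuous_intros holomorphic_on_imp_continuous_on that)
      have "\<forall>\<^sub>F \<rho> in at_left 1. circle_mean (\<lambda>z. logplus (norm (f z))) \<rho> < L + 1"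
        using lim by (rule order_tendstoD) simp
      then obtain \<rho>1 where \<rho>1: "\<rho>1 < 1" "\<And>\<rho>. \<rho>1 < \<rho> \<Longrightarrow> \<rho> < 1 \<Longrightarrow> circle_mean (\<lambda>z. logplus (norm (f z))) \<rho> < L + 1"
        unfolding eventually_at_left_field by blast
      have bd: "circle_mean (\<lambda>z. logplus (norm (g1 z))) \<rho> \<le> L + 1 + real N * ln 2" if \<rho>: "0 \<le> \<rho>" "\<rho> < 1" for \<rho>
      proof -
        define \<sigma> where "\<sigma> = (1 + max (1/2) (max \<rho> \<rho>1)) / 2"
        have \<sigma>: "\<sigma> < 1" "\<sigma> \<ge> 1/2" "\<rho> \<le> \<sigma>" "\<rho>1 < \<sigma>" using \<rho> \<rho>1(1) by (auto simp: \<sigma>_def)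
        have "circle_mean (\<lambda>z. logplus (norm (g1 z))) \<rho> \<le> circle_mean (\<lambda>z. logplus (norm (g1 z))) \<sigma>"
          by (rule circle_mean_logplus_mono[OF g1(1) z0 g1(2) \<rho>(1) \<sigma>(3,1)])
        also have "\<dots> \<le> circle_mean (\<lambda>z. logplus (norm (f z)) + real N * ln 2) \<sigma>"
        proof (rule circle_mean_mono[OF cont[OF g1(1)] _ _ \<sigma>(1)])
          show "continuous_on (ball 0 1) (\<lambda>z. logplus (norm (f z)) + real N * ln 2)"
            by (intro continuous_intros cont hf)
          fix z :: complex assume nz: "norm z = \<sigma>"
          then have z: "z \<in> ball 0 1" using \<sigma> by simp
          have "norm z ^ N * norm (g1 z) = norm (g z)" unfolding gg1[OF z] by (simp add: norm_mult norm_power)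
          also have "\<dots> \<le> norm (f z)" unfolding ng[OF z] using hpos[OF z] by (intro mult_left_le) auto
          finally have 1: "norm z ^ N * norm (g1 z) \<le> norm (f z)" .
          have "(1/2) ^ N * norm (g1 z) \<le> norm z ^ N * norm (g1 z)"
            using \<sigma> nz by (intro mult_right_mono power_mono) auto
          then have "(1/2) ^ N * norm (g1 z) \<le> norm (f z)" using 1 by linarith
          then have "2 ^ N * ((1/2) ^ N * norm (g1 z)) \<le> 2 ^ N * norm (f z)" by (rule mult_left_mono) simp
          then have "norm (g1 z) \<le> 2 ^ N * norm (f z)" by (simp add: power_divide)
          also have "\<dots> \<le> exp (real N * ln 2) * exp (logplus (norm (f z)))"
            using norm_le_exp_logplus by (intro mult_mono) (auto simp: exp_of_nat_mult)
          also have "\<dots> = exp (logplus (norm (f z)) + real N * ln 2)" by (simp add: exp_add)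
          finally show "logplus (norm (g1 z)) \<le> logplus (norm (f z)) + real N * ln 2"
            by (subst logplus_le_iff) auto
        qed (use \<sigma> in auto)
        also have "\<dots> = circle_mean (\<lambda>z. logplus (norm (f z))) \<sigma> + real N * ln 2"
          using circle_mean_add[OF cont[OF hf] continuous_on_const _ \<sigma>(1)] \<sigma>(2) by simp
        also have "\<dots> \<le> L + 1 + real N * ln 2" using \<rho>1(2)[OF \<sigma>(4,1)] by simp
        finally show ?thesis .
      qed
      have "norm (g1 z) \<le> 1"
      proof (rule bounded_on_rings_imp_bounded[OF rd dv g1 bd _ z])
        fix \<beta> :: real assume \<beta>: "\<beta> > 0"
        have "(\<lambda>n. r n ^ N) \<longlonglongrightarrow> 1 ^ N" by (intro tendsto_intros rlim)
        then have "\<forall>\<^sub>F n in sequentially. r n ^ N > exp (- \<beta>)" using \<beta> by (intro order_tendstoD) auto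
        then obtain n0 where n0: "\<And>n. n \<ge> n0 \<Longrightarrow> r n ^ N > exp (- \<beta>)" unfolding eventually_sequentially by blast
        have "norm (g1 (of_real (r n) * cis (real j * (2 * pi * ((1 - r n) * \<epsilon> n))))) \<le> exp \<beta>"
          if n: "n \<ge> n0" and j: "int j < \<lfloor>1 / ((1 - r n) * \<epsilon> n)\<rfloor>" for n j
        proof -
          define w where "w = of_real (r n) * cis (real j * (2 * pi * ((1 - r n) * \<epsilon> n)))"
          have w: "w \<in> ball 0 1" "norm w = r n" using r[of n] by (auto simp: w_def norm_mult)
          have "w \<in> \<Lambda>" unfolding \<Lambda>_def discretized_rings_def discretized_ring_point w_def using j by blast
          then have "ln (1 + norm (f w)) \<le> h w" using h(2) by blast
          then have "exp (ln (1 + norm (f w))) \<le> exp (h w)" by (simp only: exp_le_cancel_iff)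
          then have "1 + norm (f w) \<le> exp (h w)" by (subst (asm) exp_ln) (auto simp: add_pos_nonneg)
          then have "norm (g w) \<le> exp (h w) * exp (- h w)" unfolding ng[OF w(1)] by (intro mult_right_mono) auto
          also have "\<dots> = 1" by (simp flip: exp_add)
          finally have 1: "r n ^ N * norm (g1 w) \<le> 1" unfolding gg1[OF w(1)] by (simp add: norm_mult norm_power w)
          have "exp (- \<beta>) * norm (g1 w) \<le> r n ^ N * norm (g1 w)"
            using n0[OF n] by (intro mult_right_mono) auto
          then have "exp (- \<beta>) * norm (g1 w) \<le> 1" using 1 by linarith
          then show ?thesis unfolding w_def[symmetric] by (simp add: exp_minus field_simps)
        qed
        then show "\<exists>n0. \<forall>n\<ge>n0. \<forall>j. int j < \<lfloor>1 / ((1 - r n) * \<epsilon> n)\<rfloor> \<longrightarrow>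
          norm (g1 (of_real (r n) * cis (real j * (2 * pi * ((1 - r n) * \<epsilon> n))))) \<le> exp \<beta>" by blast
      qed
      moreover have "norm z ^ N \<le> 1" using z by (intro power_le_one) auto
      ultimately show ?thesis unfolding gg1[OF z] norm_mult norm_power by (intro mult_le_one) auto
    qed (use z in auto)
    then have g_le: "norm (g z) \<le> 1" if "z \<in> ball 0 1" for z using that .
    have fle: "norm (f z) \<le> exp (h z)" if "z \<in> ball 0 1" for z
    proof -
      have "norm (f z) = norm (g z) * exp (h z)" using ng[OF that] by (simp add: exp_minus field_simps)
      also have "\<dots> \<le> 1 * exp (h z)" by (intro mult_right_mono g_le that) simp
      finally show ?thesis by simp
    qed
    define h' where "h' z = Re (H z + of_real (ln 2))" for z
    have "harmonic_on h' (ball 0 1)"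
      unfolding h'_def[abs_def] by (rule harmonic_on_Re) (intro holomorphic_intros H, simp)
    then have "h' \<in> Har_plus"
      unfolding Har_plus_def using hpos ReH by (auto simp: h'_def)
    moreover have "\<forall>z\<in>ball 0 1. ln (1 + norm (f z)) \<le> h' z"
    proof
      fix z :: complex assume z: "z \<in> ball 0 1"
      have "1 + norm (f z) \<le> 2 * exp (h z)" using fle[OF z] hpos[OF z] by (smt (verit) one_le_exp_iff)
      then have "ln (1 + norm (f z)) \<le> ln (2 * exp (h z))" by (subst ln_le_cancel_iff) (auto simp: add_pos_nonneg)
      then show "ln (1 + norm (f z)) \<le> h' z" using ReH[OF z] by (simp add: ln_mult h'_def)
    qed
    ultimately have "N_full f \<le> ereal (h' 0)" unfolding N_full_def N_restr_def by (intro Inf_lower) blast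
    then show ?thesis using ReH[of 0] by (simp add: h'_def)
  qed
  show ?thesis
    unfolding sampling_nevanlinna_def \<Lambda>_def[symmetric]
  proof (intro exI[of _ "ln 2"] conjI ballI)
    fix f assume f: "f \<in> nevanlinna_class"
    have "N_full f - ereal (ln 2) \<le> N_restr f \<Lambda>"
      unfolding N_restr_def
    proof (rule Inf_greatest)
      fix x assume "x \<in> {ereal (h 0) |h. h \<in> Har_plus \<and> (\<forall>z\<in>\<Lambda>. ln (1 + norm (f z)) \<le> h z)}"
      then show "N_full f - ereal (ln 2) \<le> x" using key[OF f] by (auto simp: ereal_minus_le)
    qed
    then show "N_full f \<le> N_restr f \<Lambda> + ereal (ln 2)" by (simp add: ereal_minus_le)
  qed simp
qed

section \<open>Convergence of the series implies failure of sampling\<close>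

definition ring_points :: "real \<Rightarrow> real \<Rightarrow> nat set" where
  "ring_points \<delta> \<epsilon> = {j. int j < \<lfloor>1 / (\<delta> * \<epsilon>)\<rfloor>}"

lemma finite_ring_points: "finite (ring_points \<delta> \<epsilon>)"
proof (rule finite_subset)
  show "ring_points \<delta> \<epsilon> \<subseteq> {..nat \<lfloor>1 / (\<delta> * \<epsilon>)\<rfloor>}" by (auto simp: ring_points_def)
qed simp

text \<open>The points near \<open>1\<close> lie at both ends of the enumeration of the ring, whence the factor \<open>2\<close>; the term \<open>2 \<delta>\<close>
  absorbs the rounding.\<close>

lemma ring_count_near_1:
  assumes \<delta>: "0 < \<delta>" "\<delta> < 1" and \<epsilon>: "0 < \<epsilon>" and x: "0 \<le> x" and \<rho>: "0 < \<rho>" "\<rho> \<le> 1 - \<delta>"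
  shows "\<delta> * real (card {j \<in> ring_points \<delta> \<epsilon>. norm (of_real (1 - \<delta>) * cis (real j * (2 * pi * (\<delta> * \<epsilon>))) - 1) < x})
    \<le> 2 * x / (\<rho> * \<epsilon>) + 2 * \<delta>"
proof -
  define \<Delta> where "\<Delta> = 2 * pi * (\<delta> * \<epsilon>)"
  have \<Delta>: "\<Delta> > 0" using \<delta> \<epsilon> by (simp add: \<Delta>_def)
  have \<rho>1: "\<rho> < 1" using \<rho> \<delta> by simp
  define K where "K = 4 * x / (\<rho> * \<Delta>)"
  have K: "K \<ge> 0" using x \<rho> \<Delta> by (simp add: K_def)
  define J where "J = \<lfloor>1 / (\<delta> * \<epsilon>)\<rfloor>"
  have J: "of_int J * \<Delta> \<le> 2 * pi"
  proof -
    have "of_int J \<le> 1 / (\<delta> * \<epsilon>)" unfolding J_def by (rule of_int_floor_le)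
    also have "\<dots> = 2 * pi / \<Delta>" by (simp add: \<Delta>_def)
    finally have "of_int J \<le> 2 * pi / \<Delta>" .
    then show ?thesis using \<Delta> by (simp add: pos_le_divide_eq)
  qed
  define A where "A = {j \<in> ring_points \<delta> \<epsilon>. norm (of_real (1 - \<delta>) * cis (real j * \<Delta>) - 1) < x}"
  have small: "y \<le> 2 * x / \<rho>" if y: "0 \<le> y" "y \<le> pi / 2" "4 * (1 - \<delta>) * (sin y)\<^sup>2 < x\<^sup>2" for y
  proof -
    have "y / 4 \<le> sin y" using y pi_less_4 by (intro sin_ge_quarter) auto
    then have "(y / 4)\<^sup>2 \<le> (sin y)\<^sup>2" using y by (intro power_mono) auto
    then have "4 * \<rho> * (y / 4)\<^sup>2 \<le> 4 * (1 - \<delta>) * (sin y)\<^sup>2" using \<rho> \<delta> by (intro mult_mono) auto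
    moreover have "\<rho> * \<rho> \<le> 1 * \<rho>" using \<rho> \<rho>1 by (intro mult_right_mono) auto
    then have "4 * (\<rho> * \<rho>) * (y / 4)\<^sup>2 \<le> 4 * \<rho> * (y / 4)\<^sup>2" by (intro mult_right_mono) auto
    ultimately have "4 * (\<rho> * \<rho>) * (y / 4)\<^sup>2 \<le> x\<^sup>2" using y(3) by linarith
    moreover have "(\<rho> * y / 2)\<^sup>2 = 4 * (\<rho> * \<rho>) * (y / 4)\<^sup>2" by (simp add: power2_eq_square)
    ultimately have "(\<rho> * y / 2)\<^sup>2 \<le> x\<^sup>2" by simp
    then have "\<rho> * y / 2 \<le> x" using x by (rule power2_le_imp_le)
    then show ?thesis using \<rho> by (simp add: field_simps)
  qed
  have sub: "A \<subseteq> {j. real j \<le> K} \<union> (\<lambda>i. nat J - i) ` {i. 1 \<le> i \<and> real i \<le> K}"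
  proof
    fix j assume j: "j \<in> A"
    then have jJ: "int j < J" by (auto simp: A_def ring_points_def J_def)
    define y where "y = real j * \<Delta> / 2"
    have y0: "0 \<le> y" using \<Delta> by (simp add: y_def)
    have "real j \<le> of_int J" using jJ by linarith
    then have "real j * \<Delta> \<le> of_int J * \<Delta>" using \<Delta> by (intro mult_right_mono) auto
    then have ypi: "y \<le> pi" using J by (simp add: y_def)
    have "(norm (of_real (1 - \<delta>) * cis (real j * \<Delta>) - of_real 1 * cis 0))\<^sup>2 = \<delta>\<^sup>2 + 4 * (1 - \<delta>) * (sin y)\<^sup>2"
      unfolding norm_diff_polar by (simp add: y_def)
    moreover have "(norm (of_real (1 - \<delta>) * cis (real j * \<Delta>) - 1))\<^sup>2 < x\<^sup>2"
      using j by (intro power_strict_mono) (auto simp: A_def)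
    ultimately have "\<delta>\<^sup>2 + 4 * (1 - \<delta>) * (sin y)\<^sup>2 < x\<^sup>2" by simp
    then have s: "4 * (1 - \<delta>) * (sin y)\<^sup>2 < x\<^sup>2" using zero_le_power2[of \<delta>] by linarith
    show "j \<in> {j. real j \<le> K} \<union> (\<lambda>i. nat J - i) ` {i. 1 \<le> i \<and> real i \<le> K}"
    proof (cases "y \<le> pi / 2")
      case True
      have "y \<le> 2 * x / \<rho>" by (rule small[OF y0 True s])
      then have "real j * \<Delta> \<le> 4 * x / \<rho>" by (simp add: y_def)
      then have "real j \<le> K" unfolding K_def using \<Delta> \<rho> by (simp add: field_simps)
      then show ?thesis by simp
    next
      case False
      have "pi - y \<le> 2 * x / \<rho>" by (rule small) (use False ypi s in auto)
      then have "2 * pi - real j * \<Delta> \<le> 4 * x / \<rho>" by (simp add: y_def)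
      then have "(of_int J - real j) * \<Delta> \<le> 4 * x / \<rho>" using J by (simp add: left_diff_distrib)
      then have le: "of_int J - real j \<le> K" unfolding K_def using \<Delta> \<rho> by (simp add: field_simps)
      define i where "i = nat J - j"
      have i: "real i = of_int J - real j" "1 \<le> i" "j = nat J - i" using jJ by (auto simp: i_def)
      have iK: "i \<in> {i. 1 \<le> i \<and> real i \<le> K}" using le i(1,2) by simp
      show ?thesis by (rule UnI2, rule image_eqI[where x = i], rule i(3), rule iK)
    qed
  qed
  have fl: "real j \<le> K \<longleftrightarrow> j \<le> nat \<lfloor>K\<rfloor>" for j
  proof
    show "j \<le> nat \<lfloor>K\<rfloor>" if "real j \<le> K" using that by (rule le_nat_floor)
    have "real (nat \<lfloor>K\<rfloor>) \<le> K" using K by (rule of_nat_floor)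
    then show "real j \<le> K" if "j \<le> nat \<lfloor>K\<rfloor>" using that by linarith
  qed
  have f1: "{j::nat. real j \<le> K} = {..nat \<lfloor>K\<rfloor>}" unfolding fl by auto
  have f2: "{i::nat. 1 \<le> i \<and> real i \<le> K} = {1..nat \<lfloor>K\<rfloor>}" unfolding fl by auto
  have "card A \<le> card ({j. real j \<le> K} \<union> (\<lambda>i. nat J - i) ` {i. 1 \<le> i \<and> real i \<le> K})"
    by (rule card_mono[OF _ sub]) (simp add: f1 f2)
  also have "\<dots> \<le> card {j::nat. real j \<le> K} + card ((\<lambda>i. nat J - i) ` {i. 1 \<le> i \<and> real i \<le> K})" by (rule card_Un_le)
  also have "\<dots> \<le> (nat \<lfloor>K\<rfloor> + 1) + nat \<lfloor>K\<rfloor>"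
    unfolding f1 f2 by (intro add_mono) (auto intro: order_trans[OF card_image_le])
  finally have "real (card A) \<le> 2 * K + 1" using K by linarith
  then have "\<delta> * real (card A) \<le> \<delta> * (2 * K + 1)" using \<delta> by (intro mult_left_mono) auto
  also have "\<dots> = 4 * x / (pi * (\<rho> * \<epsilon>)) + \<delta>" using \<delta> \<epsilon> \<rho> by (simp add: K_def \<Delta>_def field_simps)
  also have "4 * x / (pi * (\<rho> * \<epsilon>)) \<le> 4 * x / (2 * (\<rho> * \<epsilon>))"
    using pi_ge_two x \<rho> \<epsilon> by (intro divide_left_mono mult_right_mono mult_pos_pos) auto
  also have "4 * x / (2 * (\<rho> * \<epsilon>)) = 2 * x / (\<rho> * \<epsilon>)" by simp
  finally show ?thesis using \<delta> unfolding A_def \<Delta>_def by linarith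
qed

text \<open>On circles close to the unit circle the Blaschke factor has modulus close to \<open>1\<close>; the maximum modulus
  principle carries the bound inside.\<close>

lemma blaschke_division_bound:
  assumes G: "G holomorphic_on ball 0 1" and le: "\<And>z. z \<in> ball 0 1 \<Longrightarrow> norm (blaschke a z * G z) \<le> 1"
    and a: "norm a < 1" and z: "z \<in> ball 0 1"
  shows "norm (G z) \<le> 1"
proof -
  have lim: "((\<lambda>t::real. (t - norm a) / (1 - norm a * t)) \<longlongrightarrow> (1 - norm a) / (1 - norm a * 1)) (at_left 1)"
    using a by (intro tendsto_intros) auto
  have lower: "(t - norm a) / (1 - norm a * t) \<le> norm (blaschke a w)" if w: "norm w = t" "t < 1" "norm a \<le> t" for w t
  proof -
    have den: "1 - cnj a * w \<noteq> 0" using blaschke_denom_nz[OF a, of w] w by simp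
    have "norm a * t \<le> norm a * 1" using w by (intro mult_left_mono) auto
    then have at: "norm a * t < 1" using a by simp
    have "norm (1 - cnj a * w) \<le> 1 + norm a * t" using norm_triangle_ineq4[of 1 "cnj a * w"] w by (simp add: norm_mult)
    have id: "1 - (norm (blaschke a w))\<^sup>2 = (1 - (norm a)\<^sup>2) * (1 - t\<^sup>2) / (norm (1 - cnj a * w))\<^sup>2"
      using blaschke_norm_identity[OF den] w by simp
    have low: "1 - norm a * t \<le> norm (1 - cnj a * w)" using norm_triangle_ineq2[of 1 "cnj a * w"] w by (simp add: norm_mult)
    have "1 - (norm (blaschke a w))\<^sup>2 \<le> (1 - (norm a)\<^sup>2) * (1 - t\<^sup>2) / (1 - norm a * t)\<^sup>2"
      unfolding id using low at a w norm_ge_zero[of w]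
      by (intro divide_left_mono power_mono mult_nonneg_nonneg mult_pos_pos zero_less_power) (auto simp: abs_square_le_1)
    also have "\<dots> = 1 - ((t - norm a) / (1 - norm a * t))\<^sup>2"
    proof -
      have nz: "(1 - norm a * t)\<^sup>2 \<noteq> 0" using at by simp
      have "(1 - (norm a)\<^sup>2) * (1 - t\<^sup>2) = (1 - norm a * t)\<^sup>2 - (t - norm a)\<^sup>2" by (simp add: power2_eq_square algebra_simps)
      then have "(1 - (norm a)\<^sup>2) * (1 - t\<^sup>2) / (1 - norm a * t)\<^sup>2
          = (1 - norm a * t)\<^sup>2 / (1 - norm a * t)\<^sup>2 - (t - norm a)\<^sup>2 / (1 - norm a * t)\<^sup>2"
        by (simp only: diff_divide_distrib)
      also have "(1 - norm a * t)\<^sup>2 / (1 - norm a * t)\<^sup>2 = 1" by (rule divide_self[OF nz])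
      also have "(t - norm a)\<^sup>2 / (1 - norm a * t)\<^sup>2 = ((t - norm a) / (1 - norm a * t))\<^sup>2" by (rule power_divide[symmetric])
      finally show ?thesis .
    qed
    finally have "((t - norm a) / (1 - norm a * t))\<^sup>2 \<le> (norm (blaschke a w))\<^sup>2" by simp
    then show ?thesis by (rule power2_le_imp_le) simp
  qed
  have lim1: "((\<lambda>t. 1 / ((t - norm a) / (1 - norm a * t))) \<longlongrightarrow> 1 / ((1 - norm a) / (1 - norm a * 1))) (at_left 1)"
    using a by (intro tendsto_divide lim tendsto_const) auto
  have ev: "\<forall>\<^sub>F t in at_left 1. norm (G z) \<le> 1 / ((t - norm a) / (1 - norm a * t))"
  proof -
    define m where "m = max (norm z) (norm a)"
    have m: "m < 1" using a z by (simp add: m_def)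
    have "norm (G z) \<le> 1 / ((t - norm a) / (1 - norm a * t))" if t: "m < t" "t < 1" for t
    proof (rule maximum_modulus_frontier[of G "cball 0 t"])
      have sub: "cball 0 t \<subseteq> ball (0::complex) 1" using t by auto
      show "G holomorphic_on interior (cball 0 t)" using G by (rule holomorphic_on_subset) (use t in auto)
      show "continuous_on (closure (cball 0 t)) G"
        using holomorphic_on_imp_continuous_on[OF G] sub by (simp add: continuous_on_subset)
      show "z \<in> cball 0 t" using t by (simp add: m_def)
      fix w assume "w \<in> frontier (cball (0::complex) t)"
      then have w: "norm w = t" using t by (simp add: frontier_cball)
      have "norm a * t \<le> norm a * 1" using t by (intro mult_left_mono) auto
      then have "norm a * t < 1" using a by simp
      then have pos: "(t - norm a) / (1 - norm a * t) > 0"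
        using t by (intro divide_pos_pos) (auto simp: m_def)
      have "(t - norm a) / (1 - norm a * t) * norm (G w) \<le> norm (blaschke a w) * norm (G w)"
        using t by (intro mult_right_mono lower w) (auto simp: m_def)
      also have "\<dots> \<le> 1" using le[of w] w t by (simp add: norm_mult)
      finally show "norm (G w) \<le> 1 / ((t - norm a) / (1 - norm a * t))"
        unfolding pos_le_divide_eq[OF pos] by (simp only: mult.commute)
    qed simp
    then show ?thesis unfolding eventually_at_left_field using m by (intro exI[of _ m]) auto
  qed
  have "norm (G z) \<le> 1 / ((1 - norm a) / (1 - norm a * 1))"
    by (rule tendsto_lowerbound[OF lim1 ev]) simp
  then show ?thesis using a by simp
qed

text \<open>Jensen's inequality for bounded functions with prescribed simple zeros.\<close>

lemma bounded_zeros_at_0: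
  assumes "finite A" "A \<subseteq> ball 0 1" "G holomorphic_on ball 0 1" "\<And>z. z \<in> ball 0 1 \<Longrightarrow> norm (G z) \<le> 1"
    "\<And>a. a \<in> A \<Longrightarrow> G a = 0"
  shows "norm (G 0) \<le> (\<Prod>a\<in>A. norm a)"
  using assms
proof (induction A arbitrary: G rule: finite_induct)
  case empty
  then show ?case by simp
next
  case (insert a A)
  show ?case
  proof (cases "G 0 = 0")
    case True
    then show ?thesis using insert.hyps by (simp add: prod_nonneg)
  next
    case False
    have a: "norm a < 1" "a \<in> ball 0 1" "G a = 0" using insert.prems(1) insert.prems(4)[of a] by auto
    obtain n g where g: "n > 0" "g holomorphic_on ball 0 1" and Gg: "\<And>z. z \<in> ball 0 1 \<Longrightarrow> G z = (z - a) ^ n * g z"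
    proof (rule zero_division[OF insert.prems(2) open_ball connected_ball a(2,3), of 0])
      fix n g assume *: "n > 0" "g holomorphic_on ball 0 1" "\<And>z. z \<in> ball 0 1 \<Longrightarrow> G z = (z - a) ^ n * g z"
      show thesis by (rule that[OF *(1,2)]) (rule *(3))
    qed (use False in auto)
    \<comment> \<open>the quotient of \<open>G\<close> by its Blaschke factor at \<open>a\<close>\<close>
    define G1 where "G1 z = (z - a) ^ (n - 1) * g z * (1 - cnj a * z)" for z
    have hG1: "G1 holomorphic_on ball 0 1" unfolding G1_def by (intro holomorphic_intros g)
    have fac: "G z = blaschke a z * G1 z" if "z \<in> ball 0 1" for z
    proof -
      have "1 - cnj a * z \<noteq> 0" using blaschke_denom_nz[OF a(1), of z] that by simp
      then have "blaschke a z * G1 z = (z - a) * (z - a) ^ (n - 1) * g z" by (simp add: blaschke_def G1_def)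
      also have "\<dots> = (z - a) ^ n * g z" using g(1) by (simp flip: power_Suc)
      finally show ?thesis using Gg[OF that] by simp
    qed
    have "norm (G1 0) \<le> (\<Prod>a\<in>A. norm a)"
    proof (rule insert.IH)
      show "norm (G1 z) \<le> 1" if "z \<in> ball 0 1" for z
      proof (rule blaschke_division_bound[OF hG1 _ a(1) that])
        fix w :: complex assume w: "w \<in> ball 0 1"
        show "norm (blaschke a w * G1 w) \<le> 1" unfolding fac[OF w, symmetric] by (rule insert.prems(3)[OF w])
      qed
      fix b assume b: "b \<in> A"
      have bb: "b \<in> ball 0 1" "b \<noteq> a" "G b = 0" using b insert.hyps insert.prems(1) insert.prems(4)[of b] by auto
      have "blaschke a b \<noteq> 0" using blaschke_denom_nz[OF a(1), of b] bb by (simp add: blaschke_def)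
      then show "G1 b = 0" using fac[OF bb(1)] bb(3) by simp
    qed (use insert.prems(1) hG1 in auto)
    then have "norm a * norm (G1 0) \<le> norm a * (\<Prod>a\<in>A. norm a)" by (rule mult_left_mono) simp
    moreover have "norm (G 0) = norm a * norm (G1 0)" using fac[of 0] by (simp add: norm_mult)
    ultimately show ?thesis using insert.hyps by simp
  qed
qed

lemma mono_bounded_tendsto_at_left:
  fixes m :: "real \<Rightarrow> real"
  assumes mono: "\<And>r s. 0 \<le> r \<Longrightarrow> r \<le> s \<Longrightarrow> s < 1 \<Longrightarrow> m r \<le> m s" and bd: "\<And>r. 0 \<le> r \<Longrightarrow> r < 1 \<Longrightarrow> m r \<le> C"
  shows "\<exists>L. (m \<longlongrightarrow> L) (at_left 1)"
proof -
  define L where "L = (SUP r\<in>{0..<1}. m r)"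
  have bdd: "bdd_above (m ` {0..<1})" by (rule bdd_aboveI[of _ C]) (use bd in auto)
  have up: "m r \<le> L" if "0 \<le> r" "r < 1" for r
    unfolding L_def by (rule cSUP_upper[OF _ bdd]) (use that in auto)
  have "(m \<longlongrightarrow> L) (at_left 1)"
  proof (rule tendstoI)
    fix e :: real assume "e > 0"
    then have "L - e < (SUP r\<in>{0..<1}. m r)" by (simp add: L_def)
    then obtain r where r: "r \<in> {0..<1}" "L - e < m r"
      using less_cSUP_iff[OF _ bdd, of "L - e"] by auto
    have "dist (m s) L < e" if "r < s" "s < 1" for s
      using mono[of r s] up[of s] r that by (simp add: dist_real_def)
    then show "\<forall>\<^sub>F s in at_left 1. dist (m s) L < e"
      unfolding eventually_at_left_field using r by (intro exI[of _ r]) auto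
  qed
  then show ?thesis by blast
qed

text \<open>The function is a limit of finite Blaschke products along a subsequence. The bound on the sum of the
  defects prevents the limit from vanishing at \<open>0\<close>. The finite products are extremal at \<open>0\<close> for their zeros by Jensen's
  inequality, and this survives in the limit.\<close>

lemma extremal_bounded_function:
  assumes A: "\<And>k. finite (A k)" "\<And>k. A k \<subseteq> ball 0 1" "incseq A" and \<rho>: "0 < \<rho>" "\<And>k a. a \<in> A k \<Longrightarrow> \<rho> \<le> norm a"
    and S: "\<And>k. (\<Sum>a\<in>A k. 1 - norm a) \<le> S"
  shows "\<exists>B. B holomorphic_on ball 0 1 \<and> (\<forall>z\<in>ball 0 1. norm (B z) \<le> 1) \<and> (\<forall>k. \<forall>a\<in>A k. B a = 0) \<and> B 0 \<noteq> 0 \<and>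
    (\<forall>G. G holomorphic_on ball 0 1 \<longrightarrow> (\<forall>z\<in>ball 0 1. norm (G z) \<le> 1) \<longrightarrow> (\<forall>k. \<forall>a\<in>A k. G a = 0) \<longrightarrow> norm (G 0) \<le> norm (B 0))"
proof -
  define P where "P k z = (\<Prod>a\<in>A k. blaschke a z)" for k z
  have an: "norm a < 1" if "a \<in> A k" for a k using A(2)[of k] that by auto
  have hP: "P k holomorphic_on ball 0 1" for k
    unfolding P_def by (intro holomorphic_intros holomorphic_blaschke) (use an in auto)
  have P1: "norm (P k z) \<le> 1" if "z \<in> ball 0 1" for k z
    unfolding P_def prod_norm[symmetric] using that an
    by (intro prod_le_1) (auto intro!: blaschke_norm_le_1)
  obtain B \<phi> where hB: "B holomorphic_on ball 0 1" and \<phi>: "strict_mono (\<phi> :: nat \<Rightarrow> nat)"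
    and lim: "\<And>z. z \<in> ball 0 1 \<Longrightarrow> ((\<lambda>n. P (\<phi> n) z) \<longlonglongrightarrow> B z)"
  proof (rule Montel[of "ball 0 1" "range P" P])
    fix g r assume *: "g holomorphic_on ball 0 1" "strict_mono (r :: nat \<Rightarrow> nat)"
      "\<And>x. x \<in> ball 0 1 \<Longrightarrow> (\<lambda>n. P (r n) x) \<longlonglongrightarrow> g x"
    show thesis by (rule that[of g r]) (fact *)+
  next
    fix K :: "complex set" assume "K \<subseteq> ball 0 1"
    then show "\<exists>B. \<forall>h\<in>range P. \<forall>z\<in>K. norm (h z) \<le> B" using P1 by (intro exI[of _ 1]) auto
  qed (use hP in auto)
  have B1: "norm (B z) \<le> 1" if "z \<in> ball 0 1" for z
    by (rule tendsto_upperbound[OF tendsto_norm[OF lim[OF that]]]) (use P1[OF that] in auto)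
  have Bz: "B a = 0" if a: "a \<in> A k" for a k
  proof (rule LIMSEQ_unique)
    show "(\<lambda>n. P (\<phi> n) a) \<longlonglongrightarrow> B a" using lim A(2) a by blast
    have "P (\<phi> n) a = 0" if "n \<ge> k" for n
    proof -
      have "k \<le> \<phi> n" using strict_mono_imp_increasing[OF \<phi>, of n] that by linarith
      then have "a \<in> A (\<phi> n)" using incseqD[OF A(3)] a by auto
      then show ?thesis unfolding P_def by (intro prod_zero A(1)) (auto simp: blaschke_def intro!: bexI[of _ a])
    qed
    then show "(\<lambda>n. P (\<phi> n) a) \<longlonglongrightarrow> 0" by (intro tendsto_eventually) (auto simp: eventually_sequentially)
  qed
  have nP: "norm (P k 0) = (\<Prod>a\<in>A k. norm a)" for k by (simp add: P_def blaschke_def prod_norm[symmetric])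
  have low: "exp (- S / \<rho>) \<le> norm (P k 0)" for k
  proof -
    have "exp (- S / \<rho>) \<le> exp (\<Sum>a\<in>A k. - ((1 - norm a) / \<rho>))"
      using S[of k] \<rho>(1) by (simp add: sum_negf sum_divide_distrib[symmetric] divide_right_mono)
    also have "\<dots> = (\<Prod>a\<in>A k. exp (- ((1 - norm a) / \<rho>)))" by (rule exp_sum[OF A(1)])
    also have "\<dots> \<le> (\<Prod>a\<in>A k. norm a)"
    proof (rule prod_mono, intro conjI)
      fix a assume a: "a \<in> A k"
      have pos: "norm a > 0" using \<rho>(1) \<rho>(2)[OF a] by linarith
      have "ln (1 / norm a) \<le> 1 / norm a - 1" using pos by (intro ln_le_minus_one) auto
      also have "\<dots> = (1 - norm a) / norm a" using pos by (simp add: diff_divide_distrib)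
      also have "\<dots> \<le> (1 - norm a) / \<rho>" using \<rho>(1) \<rho>(2)[OF a] an[OF a] pos by (intro divide_left_mono mult_pos_pos) auto
      finally have "- ((1 - norm a) / \<rho>) \<le> ln (norm a)" using pos by (simp add: ln_div)
      then have "exp (- ((1 - norm a) / \<rho>)) \<le> exp (ln (norm a))" by (subst exp_le_cancel_iff)
      then show "exp (- ((1 - norm a) / \<rho>)) \<le> norm a" by (simp only: exp_ln[OF pos])
    qed simp
    finally show ?thesis by (simp only: nP)
  qed
  have lim0: "(\<lambda>n. norm (P (\<phi> n) 0)) \<longlonglongrightarrow> norm (B 0)" by (intro tendsto_norm lim) simp
  have "exp (- S / \<rho>) \<le> norm (B 0)" by (rule tendsto_lowerbound[OF lim0]) (use low in auto)
  then have B0: "B 0 \<noteq> 0" using exp_gt_zero[of "- S / \<rho>"] by auto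
  have "norm (G 0) \<le> norm (B 0)"
    if G: "G holomorphic_on ball 0 1" "\<forall>z\<in>ball 0 1. norm (G z) \<le> 1" "\<forall>k. \<forall>a\<in>A k. G a = 0" for G
  proof (rule tendsto_lowerbound[OF lim0])
    have "norm (G 0) \<le> norm (P k 0)" for k
      unfolding nP by (rule bounded_zeros_at_0[OF A(1,2) G(1)]) (use G in auto)
    then show "\<forall>\<^sub>F n in sequentially. norm (G 0) \<le> norm (P (\<phi> n) 0)" by simp
  qed simp
  then show ?thesis by (intro exI[of _ B] conjI hB B0) (use B1 Bz in auto)
qed

lemma Re_of_real_mult: "Re (of_real c * w) = c * Re w"
  by simp

lemma Re_poisson_kernel:
  fixes R :: real
  assumes "z \<noteq> of_real R"
  shows "Re ((of_real R + z) / (of_real R - z)) = (R\<^sup>2 - (norm z)\<^sup>2) / (norm (of_real R - z))\<^sup>2"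
  unfolding Re_divide cmod_power2 by (simp add: power2_eq_square algebra_simps)

text \<open>Poisson kernels with poles \<open>R n\<close> on the positive axis at or outside the unit circle. A sum of them with
  total weight \<open>suminf s\<close> dominates each single one, because all of them are positive on the disk.\<close>

lemma poisson_superposition:
  assumes s: "\<And>n. 0 \<le> s n" "summable s" and R: "\<And>n. 1 \<le> R n" "\<And>n. R n \<le> 2"
  shows "\<exists>U. U holomorphic_on ball 0 1 \<and> Re (U 0) = suminf s \<and>
    (\<forall>z\<in>ball 0 1. 0 \<le> Re (U z) \<and> (\<forall>n. s n * (((R n)\<^sup>2 - (norm z)\<^sup>2) / (norm (of_real (R n) - z))\<^sup>2) \<le> Re (U z)))"
proof -
  define t where "t n z = of_real (s n) * ((of_real (R n) + z) / (of_real (R n) - z))" for n and z :: complex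
  define U where "U z = (\<Sum>n. t n z)" for z
  have Rz: "z \<noteq> of_real (R n)" if "norm z < 1" for z :: complex and n
  proof
    assume "z = of_real (R n)"
    then show False using that R(1)[of n] by simp
  qed
  have bound: "norm (t n z) \<le> s n * (3 / (1 - \<rho>))" if z: "norm z \<le> \<rho>" "\<rho> < 1" for n z \<rho>
  proof -
    have "norm (of_real (R n) + z) \<le> 3" using norm_triangle_ineq[of "of_real (R n)" z] R[of n] z by simp
    moreover have "1 - \<rho> \<le> norm (of_real (R n) - z)" using norm_triangle_ineq2[of "of_real (R n)" z] R[of n] z by simp
    ultimately have "norm (of_real (R n) + z) / norm (of_real (R n) - z) \<le> 3 / (1 - \<rho>)" using z by (intro frac_le) auto
    then have "s n * (norm (of_real (R n) + z) / norm (of_real (R n) - z)) \<le> s n * (3 / (1 - \<rho>))"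
      using s(1) by (rule mult_left_mono)
    then show ?thesis unfolding t_def norm_mult norm_divide using s(1)[of n] by simp
  qed
  have summ: "summable (\<lambda>n. t n z)" if "z \<in> ball 0 1" for z
    by (rule summable_comparison_test'[OF summable_mult2[OF s(2), of "3 / (1 - norm z)"]]) (use bound[of z "norm z"] that in auto)
  have hU: "U holomorphic_on ball 0 1"
  proof (rule holomorphic_uniform_sequence[OF open_ball, where f = "\<lambda>N z. \<Sum>n<N. t n z"])
    show "(\<lambda>z. \<Sum>n<N. t n z) holomorphic_on ball 0 1" for N
      unfolding t_def by (intro holomorphic_intros) (use Rz in auto)
    fix z :: complex assume z: "z \<in> ball 0 1"
    define d where "d = (1 - norm z) / 2"
    have d: "0 < d" "norm z + d < 1" using z by (auto simp: d_def field_simps)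
    have nw: "norm w \<le> norm z + d" if "w \<in> cball z d" for w
      using that norm_triangle_sub[of w z] by (simp add: dist_norm norm_minus_commute)
    have sub: "cball z d \<subseteq> ball 0 1" using nw d by fastforce
    have "uniform_limit (cball z d) (\<lambda>N w. \<Sum>n<N. t n w) (\<lambda>w. \<Sum>n. t n w) sequentially"
      by (rule Weierstrass_m_test[where M = "\<lambda>n. s n * (3 / (1 - (norm z + d)))"])
         (use bound nw d in blast, intro summable_mult2 s)
    then show "\<exists>d>0. cball z d \<subseteq> ball 0 1 \<and> uniform_limit (cball z d) (\<lambda>N z. \<Sum>n<N. t n z) U sequentially"
      unfolding U_def[abs_def] using d sub by blast
  qed
  have Ret: "Re (t n z) = s n * (((R n)\<^sup>2 - (norm z)\<^sup>2) / (norm (of_real (R n) - z))\<^sup>2)" if "z \<in> ball 0 1" for n z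
    using Re_poisson_kernel[of z "R n"] Rz[of z n] that unfolding t_def Re_of_real_mult by simp
  have Ret0: "0 \<le> Re (t n z)" if "z \<in> ball 0 1" for n z
    unfolding Ret[OF that] using s(1)[of n] R(1)[of n] that by (auto intro!: mult_nonneg_nonneg divide_nonneg_nonneg power_mono)
  have sumsRe: "(\<lambda>n. Re (t n z)) sums Re (U z)" if "z \<in> ball 0 1" for z
    unfolding U_def using sums_Re[OF summable_sums[OF summ[OF that]]] .
  have "Re (t n z) \<le> Re (U z)" if z: "z \<in> ball 0 1" for n z
  proof -
    have "sum (\<lambda>n. Re (t n z)) {n} \<le> (\<Sum>n. Re (t n z))"
      by (rule sum_le_suminf) (use sumsRe[OF z] Ret0[OF z] in \<open>auto simp: sums_iff\<close>)
    then show ?thesis using sumsRe[OF z] by (simp add: sums_iff)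
  qed
  moreover have "0 \<le> Re (U z)" if z: "z \<in> ball 0 1" for z
    using sums_le[OF _ sums_zero sumsRe[OF z]] Ret0[OF z] by simp
  moreover have "Re (U 0) = suminf s"
  proof -
    have "t n 0 = of_real (s n)" for n using R(1)[of n] by (simp add: t_def)
    then have "(\<lambda>n. s n) sums Re (U 0)" using sumsRe[of 0] by simp
    then show ?thesis by (simp add: sums_iff)
  qed
  ultimately show ?thesis using hU Ret by (intro exI[of _ U]) auto
qed

text \<open>The means of \<open>log\<^sup>+ |f|\<close> are monotone in the radius and bounded by the value of the majorant at \<open>0\<close>.\<close>

lemma nevanlinna_class_if_harmonic_majorant:
  assumes f: "f holomorphic_on ball 0 1" "f 0 \<noteq> 0" and E: "E holomorphic_on ball 0 1"
    and le: "\<And>z. z \<in> ball 0 1 \<Longrightarrow> 0 \<le> Re (E z)" "\<And>z. z \<in> ball 0 1 \<Longrightarrow> norm (f z) \<le> exp (Re (E z))"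
  shows "f \<in> nevanlinna_class"
proof -
  define m where "m = circle_mean (\<lambda>z. logplus (norm (f z)))"
  have c: "continuous_on (ball 0 1) (\<lambda>z. logplus (norm (f z)))" "continuous_on (ball 0 1) (\<lambda>z. Re (E z))"
    by (intro continuous_intros holomorphic_on_imp_continuous_on f E)+
  have "\<exists>L. (m \<longlongrightarrow> L) (at_left 1)"
  proof (rule mono_bounded_tendsto_at_left)
    show "m r \<le> m s" if "0 \<le> r" "r \<le> s" "s < 1" for r s
      unfolding m_def by (rule circle_mean_logplus_mono[OF f(1) _ f(2) that]) simp
    fix r :: real assume r: "0 \<le> r" "r < 1"
    have "m r \<le> circle_mean (\<lambda>z. Re (E z)) r" unfolding m_def
    proof (rule circle_mean_mono[OF c r])
      fix z :: complex assume "norm z = r"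
      then have z: "z \<in> ball 0 1" using r by simp
      show "logplus (norm (f z)) \<le> Re (E z)" unfolding logplus_def
        using ln_mono[of "max 1 (norm (f z))" "exp (Re (E z))"] le[OF z] by simp
    qed
    then show "m r \<le> Re (E 0)" using circle_mean_Re[OF E r] by simp
  qed
  then show ?thesis unfolding nevanlinna_class_def m_def circle_mean_def[abs_def] cis_conv_exp using f(1) by simp
qed

lemma summable_rings:
  assumes "ring_data r \<epsilon>" shows "summable (\<lambda>n. 1 - r n)"
proof (rule ring_data_ratio[OF assms])
  fix q assume q: "0 < q" "q < 1" "\<And>n. 1 - r (Suc n) \<le> q * (1 - r n)"
  have r: "r n < 1" for n using assms by (auto simp: ring_data_def)
  show ?thesis by (rule summable_ratio_test[of q 0]) (use q r in \<open>auto simp: abs_of_pos\<close>)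
qed

text \<open>The radius is written \<open>1 - (1 - r n)\<close> so that estimates stated in terms of the depth \<open>\<delta> = 1 - r n\<close> apply without
  rewriting.\<close>

definition ring_point :: "(nat \<Rightarrow> real) \<Rightarrow> (nat \<Rightarrow> real) \<Rightarrow> nat \<Rightarrow> nat \<Rightarrow> complex" where
  "ring_point r \<epsilon> n j = of_real (1 - (1 - r n)) * cis (real j * (2 * pi * ((1 - r n) * \<epsilon> n)))"

lemma norm_ring_point: "ring_data r \<epsilon> \<Longrightarrow> norm (ring_point r \<epsilon> n j) = r n"
  by (simp add: ring_point_def norm_mult ring_data_def abs_of_pos)

lemma discretized_rings_conv: "discretized_rings r \<epsilon> = (\<Union>n. ring_point r \<epsilon> n ` ring_points (1 - r n) (\<epsilon> n))"
  unfolding discretized_rings_def discretized_ring_point ring_point_def ring_points_def by auto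

text \<open>The Blaschke condition for the lattice points at distance less than \<open>X n\<close> from \<open>1\<close>.\<close>

lemma sum_near_1_bounded:
  assumes rd: "ring_data r \<epsilon>" and X: "\<And>n. 0 \<le> X n" "summable (\<lambda>n. X n / \<epsilon> n)"
  defines "Z \<equiv> \<lambda>n. ring_point r \<epsilon> n ` {j \<in> ring_points (1 - r n) (\<epsilon> n). norm (ring_point r \<epsilon> n j - 1) < X n}"
  shows "\<exists>S. \<forall>k. (\<Sum>a\<in>(\<Union>n<k. Z n). 1 - norm a) \<le> S"
proof -
  have r: "0 < r n" "r n < 1" for n using rd by (auto simp: ring_data_def)
  have \<epsilon>: "0 < \<epsilon> n" for n using rd by (auto simp: ring_data_def)
  have r0: "r 0 \<le> r n" for n using rd by (auto simp: ring_data_def incseq_def)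
  have fin: "finite (Z n)" for n unfolding Z_def by (intro finite_imageI finite_subset[OF _ finite_ring_points]) auto
  have nZ: "norm a = r n" if "a \<in> Z n" for a n using that norm_ring_point[OF rd] by (auto simp: Z_def)
  define b where "b n = 2 / r 0 * (X n / \<epsilon> n) + 2 * (1 - r n)" for n
  have sb: "summable b" unfolding b_def by (intro summable_add summable_mult X summable_rings[OF rd])
  have b0: "0 \<le> b n" for n using r(1)[of 0] r(2)[of n] X(1)[of n] \<epsilon>[of n]
    unfolding b_def by (intro add_nonneg_nonneg mult_nonneg_nonneg divide_nonneg_nonneg) auto
  have sumZ: "(\<Sum>a\<in>Z n. 1 - norm a) \<le> b n" for n
  proof -
    let ?J = "{j \<in> ring_points (1 - r n) (\<epsilon> n). norm (ring_point r \<epsilon> n j - 1) < X n}"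
    have "card (Z n) \<le> card ?J" unfolding Z_def by (rule card_image_le) (simp add: finite_ring_points)
    then have "(1 - r n) * real (card (Z n)) \<le> (1 - r n) * real (card ?J)" using r(2)[of n] by (intro mult_left_mono) auto
    also have "\<dots> \<le> 2 * X n / (r 0 * \<epsilon> n) + 2 * (1 - r n)" unfolding ring_point_def
      by (rule ring_count_near_1) (use r[of n] \<epsilon>[of n] X(1)[of n] r(1)[of 0] r0[of n] in auto)
    also have "\<dots> = b n" by (simp add: b_def)
    finally show ?thesis using nZ by (simp add: mult.commute)
  qed
  have "(\<Sum>a\<in>(\<Union>n<k. Z n). 1 - norm a) \<le> (\<Sum>n<k. b n)" for k
  proof (induction k)
    case (Suc k)
    let ?A = "\<Union>n<k. Z n"
    have "sum (\<lambda>a. 1 - norm a) (?A \<union> Z k) + sum (\<lambda>a. 1 - norm a) (?A \<inter> Z k) = sum (\<lambda>a. 1 - norm a) ?A + sum (\<lambda>a. 1 - norm a) (Z k)"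
      by (rule sum.union_inter) (use fin in auto)
    moreover have "0 \<le> sum (\<lambda>a. 1 - norm a) (?A \<inter> Z k)" using nZ r(2)[of k] by (intro sum_nonneg) auto
    moreover have "(\<Union>n<Suc k. Z n) = ?A \<union> Z k" by (auto simp: less_Suc_eq)
    ultimately show ?case using Suc.IH sumZ[of k] by simp
  qed simp
  moreover have "(\<Sum>n<k. b n) \<le> suminf b" for k by (rule sum_le_suminf[OF sb]) (use b0 in auto)
  ultimately show ?thesis by (meson order_trans)
qed

text \<open>The zeros of \<open>B\<close> are the lattice points of the ring \<open>n\<close> at distance less than \<open>x\<^sub>n = sqrt (\<delta>\<^sub>n \<epsilon>\<^sub>n)\<close> from
  \<open>1\<close>, and all points of the first \<open>M\<close> rings. At the other lattice points the Poisson kernel with pole at \<open>1\<close> is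
  majorized by the kernel with pole \<open>1 + x\<^sub>n\<close> times a multiple of \<open>s\<^sub>n = \<delta>\<^sub>n / x\<^sub>n\<close>. Discarding the first rings makes the total weight
  of these kernels at most \<open>1\<close>, while the factor \<open>exp (c (1 + z) / (1 - z))\<close> has value \<open>exp c\<close> at \<open>0\<close>.\<close>

theorem summable_imp_not_sampling:
  assumes rd: "ring_data r \<epsilon>" and sm: "summable (\<lambda>n. sqrt ((1 - r n) / \<epsilon> n))"
  shows "\<not> sampling_nevanlinna (discretized_rings r \<epsilon>)"
proof
  assume "sampling_nevanlinna (discretized_rings r \<epsilon>)"
  then obtain C where C: "C > 0" "\<And>f. f \<in> nevanlinna_class \<Longrightarrow> N_full f \<le> N_restr f (discretized_rings r \<epsilon>) + ereal C"
    unfolding sampling_nevanlinna_def by blast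
  have r: "0 < r n" "r n < 1" for n using rd by (auto simp: ring_data_def)
  have \<epsilon>: "0 < \<epsilon> n" "\<epsilon> n < 1" for n using rd by (auto simp: ring_data_def)
  have r0: "r 0 \<le> r n" for n using rd by (auto simp: ring_data_def incseq_def)
  define c where "c = C + 3"
  have c: "c > 0" using C by (simp add: c_def)
  define s where "s n = sqrt ((1 - r n) / \<epsilon> n)" for n
  define x where "x n = sqrt ((1 - r n) * \<epsilon> n)" for n
  have s0: "0 \<le> s n" for n using r[of n] \<epsilon>[of n] by (simp add: s_def)
  have x01: "0 < x n" "x n \<le> 1" for n
    using r[of n] \<epsilon>[of n] by (auto simp: x_def mult_le_one)
  have sx: "s n * x n = 1 - r n" for n
  proof -
    have "s n * x n = sqrt ((1 - r n)\<^sup>2)" unfolding s_def x_def real_sqrt_mult[symmetric]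
      using \<epsilon>[of n] by (simp add: power2_eq_square)
    then show ?thesis using r[of n] by simp
  qed
  have xe: "x n / \<epsilon> n = s n" for n
  proof -
    have "s n * \<epsilon> n = s n * sqrt ((\<epsilon> n)\<^sup>2)" using \<epsilon>[of n] by simp
    also have "\<dots> = x n" unfolding s_def x_def real_sqrt_mult[symmetric]
      using \<epsilon>[of n] by (simp add: power2_eq_square)
    finally show ?thesis using \<epsilon>[of n] by (simp add: field_simps)
  qed
  have ssum: "summable s" using sm by (simp add: s_def[abs_def])
  obtain M where M: "4 * c * (\<Sum>n. s (n + M)) \<le> 1"
  proof -
    have "(\<lambda>M. \<Sum>n. s (n + M)) \<longlonglongrightarrow> 0" by (rule suminf_exist_split2[OF ssum])
    then have "\<forall>\<^sub>F M in sequentially. (\<Sum>n. s (n + M)) < 1 / (4 * c)"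
      by (rule order_tendstoD) (use c in simp)
    then obtain M where "(\<Sum>n. s (n + M)) < 1 / (4 * c)" by (auto simp: eventually_sequentially)
    then have "4 * c * (\<Sum>n. s (n + M)) \<le> 1" using c by (simp add: field_simps)
    then show thesis by (rule that)
  qed
  \<comment> \<open>the radius \<open>3\<close> exceeds the diameter of the disk and so selects all points of the first rings\<close>
  define X where "X n = (if n < M then 3 else x n)" for n
  have X0: "0 \<le> X n" for n using x01[of n] by (simp add: X_def)
  have Xsum: "summable (\<lambda>n. X n / \<epsilon> n)"
  proof (rule summable_cong[THEN iffD2, OF _ ssum])
    show "\<forall>\<^sub>F n in sequentially. X n / \<epsilon> n = s n"
      using eventually_ge_at_top[of M] by eventually_elim (simp add: X_def xe)
  qed
  define Z where "Z n = ring_point r \<epsilon> n ` {j \<in> ring_points (1 - r n) (\<epsilon> n). norm (ring_point r \<epsilon> n j - 1) < X n}" for n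
  define A where "A k = (\<Union>n<k. Z n)" for k
  obtain S where S: "\<And>k. (\<Sum>a\<in>A k. 1 - norm a) \<le> S"
    using sum_near_1_bounded[OF rd X0 Xsum] unfolding A_def Z_def by blast
  have finZ: "finite (Z n)" for n unfolding Z_def by (intro finite_imageI finite_subset[OF _ finite_ring_points]) auto
  have nZ: "norm a = r n" if "a \<in> Z n" for a n using that norm_ring_point[OF rd] by (auto simp: Z_def)
  have "\<exists>B. B holomorphic_on ball 0 1 \<and> (\<forall>z\<in>ball 0 1. norm (B z) \<le> 1) \<and> (\<forall>k. \<forall>a\<in>A k. B a = 0) \<and> B 0 \<noteq> 0 \<and>
    (\<forall>G. G holomorphic_on ball 0 1 \<longrightarrow> (\<forall>z\<in>ball 0 1. norm (G z) \<le> 1) \<longrightarrow> (\<forall>k. \<forall>a\<in>A k. G a = 0) \<longrightarrow> norm (G 0) \<le> norm (B 0))"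
  proof (rule extremal_bounded_function[OF _ _ _ r(1)[of 0] _ S])
    show "finite (A k)" for k using finZ by (simp add: A_def)
    show "A k \<subseteq> ball 0 1" for k using nZ r(2) by (fastforce simp: A_def)
    show "incseq A" unfolding incseq_def A_def by (auto intro: less_le_trans)
    show "r 0 \<le> norm a" if "a \<in> A k" for k a using that nZ r0 by (auto simp: A_def)
  qed
  then obtain B where hB: "B holomorphic_on ball 0 1" and B1: "\<And>z. z \<in> ball 0 1 \<Longrightarrow> norm (B z) \<le> 1"
    and Bz: "\<And>k a. a \<in> A k \<Longrightarrow> B a = 0" and B0: "B 0 \<noteq> 0"
    and ext: "\<And>G. G holomorphic_on ball 0 1 \<Longrightarrow> \<forall>z\<in>ball 0 1. norm (G z) \<le> 1 \<Longrightarrow> \<forall>k. \<forall>a\<in>A k. G a = 0 \<Longrightarrow> norm (G 0) \<le> norm (B 0)"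
    by auto
  define E where "E z = of_real c * ((of_real 1 + z) / (of_real 1 - z))" for z :: complex
  have hE: "E holomorphic_on ball 0 1" unfolding E_def by (intro holomorphic_intros) auto
  have ReE: "Re (E z) = c * ((1 - (norm z)\<^sup>2) / (norm (1 - z))\<^sup>2)" if "z \<in> ball 0 1" for z
  proof -
    have "z \<noteq> of_real 1" using that by auto
    from Re_poisson_kernel[OF this] show ?thesis unfolding E_def Re_of_real_mult by simp
  qed
  have ReE0: "0 \<le> Re (E z)" if "z \<in> ball 0 1" for z
    unfolding ReE[OF that] using c that by (auto intro!: mult_nonneg_nonneg divide_nonneg_nonneg simp: abs_square_le_1)
  have E0: "E 0 = of_real c" by (simp add: E_def)
  define f where "f z = B z * exp (E z)" for z
  have hf: "f holomorphic_on ball 0 1" unfolding f_def by (intro holomorphic_intros hB hE)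
  have fle: "norm (f z) \<le> exp (Re (E z))" if "z \<in> ball 0 1" for z
    using B1[OF that] by (simp add: f_def norm_mult norm_exp_eq_Re mult_right_le_one_le)
  have fN: "f \<in> nevanlinna_class"
    by (rule nevanlinna_class_if_harmonic_majorant[OF hf _ hE ReE0 fle]) (use B0 in \<open>auto simp: f_def\<close>)
  have full: "ereal c \<le> N_full f" unfolding N_full_def N_restr_def
  proof (rule Inf_greatest, clarify)
    fix h assume h: "h \<in> Har_plus" "\<forall>z\<in>ball 0 1. ln (1 + norm (f z)) \<le> h z"
    have harm: "harmonic_on h (ball 0 1)" using h(1) by (simp add: Har_plus_def)
    obtain H where H: "H holomorphic_on ball 0 1" and ReH: "\<And>z. z \<in> ball 0 1 \<Longrightarrow> Re (H z) = h z"
      using harmonic_on_convex_imp_Re[OF harm open_ball convex_ball] by metis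
    define G where "G z = f z * exp (- H z)" for z
    have hG: "G holomorphic_on ball 0 1" unfolding G_def by (intro holomorphic_intros hf H)
    have nG: "norm (G z) = norm (f z) * exp (- h z)" if "z \<in> ball 0 1" for z
      using ReH[OF that] by (simp add: G_def norm_mult norm_exp_eq_Re)
    have "norm (G z) \<le> 1" if z: "z \<in> ball 0 1" for z
    proof -
      have "ln (1 + norm (f z)) \<le> h z" using h(2) z by blast
      then have "exp (ln (1 + norm (f z))) \<le> exp (h z)" by simp
      moreover have "exp (ln (1 + norm (f z))) = 1 + norm (f z)" by (rule exp_ln) (simp add: add_pos_nonneg)
      ultimately have "norm (f z) \<le> exp (h z)" by linarith
      then show ?thesis unfolding nG[OF z] by (simp add: exp_minus field_simps)
    qed
    moreover have "G a = 0" if "a \<in> A k" for k a using Bz[OF that] by (simp add: G_def f_def)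
    ultimately have "norm (G 0) \<le> norm (B 0)" using ext[OF hG] by blast
    moreover have "norm (G 0) = norm (B 0) * exp (c - h 0)"
      using nG[of 0] E0 by (simp add: f_def norm_mult norm_exp_eq_Re exp_diff exp_minus field_simps)
    ultimately have "exp (c - h 0) \<le> 1" using B0 by (simp add: mult_le_cancel_left1)
    then show "ereal c \<le> ereal (h 0)" by simp
  qed
  define s' where "s' n = (if n < M then 0 else 4 * c * s n)" for n
  have s'sum: "summable s'"
  proof (rule summable_cong[THEN iffD2, OF _ summable_mult[OF ssum]])
    show "\<forall>\<^sub>F n in sequentially. s' n = 4 * c * s n"
      using eventually_ge_at_top[of M] by eventually_elim (simp add: s'_def)
  qed
  have s'0: "0 \<le> s' n" for n using s0[of n] c by (simp add: s'_def)
  have s'1: "suminf s' \<le> 1"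
  proof -
    have "suminf s' = (\<Sum>n. s' (n + M)) + sum s' {..<M}" by (rule suminf_split_initial_segment[OF s'sum])
    also have "sum s' {..<M} = 0" by (intro sum.neutral) (simp add: s'_def)
    also have "(\<Sum>n. s' (n + M)) = 4 * c * (\<Sum>n. s (n + M))"
      unfolding s'_def using summable_iff_shift[of s M] ssum by (simp add: suminf_mult)
    finally show ?thesis using M by simp
  qed
  obtain U where hU: "U holomorphic_on ball 0 1" and U0: "Re (U 0) = suminf s'"
    and Upos: "\<And>z. z \<in> ball 0 1 \<Longrightarrow> 0 \<le> Re (U z)"
    and Uge: "\<And>z n. z \<in> ball 0 1 \<Longrightarrow> s' n * (((1 + x n)\<^sup>2 - (norm z)\<^sup>2) / (norm (of_real (1 + x n) - z))\<^sup>2) \<le> Re (U z)"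
    using poisson_superposition[OF s'0 s'sum, of "\<lambda>n. 1 + x n"] x01 by (force simp: less_imp_le)
  have restr: "N_restr f (discretized_rings r \<epsilon>) \<le> ereal 2" unfolding N_restr_def
  proof (rule Inf_lower2)
    let ?h = "\<lambda>z. Re (of_real (ln 2) + U z)"
    have "harmonic_on ?h (ball 0 1)" by (intro harmonic_on_Re holomorphic_intros hU open_ball)
    moreover have "0 \<le> ?h z" if "z \<in> ball 0 1" for z using Upos[OF that] ln_ge_zero[of 2] by simp
    ultimately have hh: "?h \<in> Har_plus" unfolding Har_plus_def by blast
    have le: "ln (1 + norm (f z)) \<le> ?h z" if z: "z \<in> discretized_rings r \<epsilon>" for z
    proof -
      obtain n j where j: "j \<in> ring_points (1 - r n) (\<epsilon> n)" and zj: "z = ring_point r \<epsilon> n j"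
        using z unfolding discretized_rings_conv by auto
      have nz: "norm z = r n" by (simp add: zj norm_ring_point[OF rd])
      have zb: "z \<in> ball 0 1" using nz r(2) by simp
      show ?thesis
      proof (cases "norm (z - 1) < X n")
        case True
        then have "z \<in> A (Suc n)" unfolding A_def Z_def using j zj by blast
        then have "f z = 0" using Bz by (simp add: f_def)
        then show ?thesis using Upos[OF zb] by simp
      next
        case False
        have "norm (z - 1) \<le> 2" using norm_triangle_ineq4[of z 1] zb by simp
        then have nM: "M \<le> n" using False by (auto simp: X_def split: if_splits)
        then have far: "x n \<le> norm (1 - z)" using False by (simp add: X_def norm_minus_commute)
        have d0: "0 < norm (1 - z)" using far x01[of n] by linarith
        have "norm (of_real (1 + x n) - z) \<le> 2 * norm (1 - z)"
          using norm_triangle_ineq[of "1 - z" "of_real (x n)"] far x01[of n] by (simp add: algebra_simps)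
        then have den: "(norm (of_real (1 + x n) - z))\<^sup>2 \<le> (2 * norm (1 - z))\<^sup>2" by (intro power_mono) auto
        have den0: "0 < (norm (of_real (1 + x n) - z))\<^sup>2"
        proof -
          have "norm (of_real (1 + x n) :: complex) - norm z \<le> norm (of_real (1 + x n) - z)" by (rule norm_triangle_ineq2)
          moreover have "norm (of_real (1 + x n) :: complex) = 1 + x n" using x01[of n] by (simp only: norm_of_real)
          ultimately have "0 < norm (of_real (1 + x n) - z)" using x01[of n] nz r(2)[of n] by linarith
          then show ?thesis by (rule zero_less_power)
        qed
        have num: "2 * x n \<le> (1 + x n)\<^sup>2 - (norm z)\<^sup>2"
        proof -
          have "(norm z)\<^sup>2 \<le> 1" using zb by (simp add: abs_square_le_1)
          moreover have "(1 + x n)\<^sup>2 = 1 + 2 * x n + (x n)\<^sup>2" by (simp add: power2_eq_square algebra_simps)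
          ultimately show ?thesis using zero_le_power2[of "x n"] by linarith
        qed
        have "2 * x n / (2 * norm (1 - z))\<^sup>2 \<le> ((1 + x n)\<^sup>2 - (norm z)\<^sup>2) / (norm (of_real (1 + x n) - z))\<^sup>2"
        proof (rule frac_le[OF _ num den0 den])
          show "0 \<le> (1 + x n)\<^sup>2 - (norm z)\<^sup>2" using num x01[of n] by linarith
        qed
        then have "s' n * (2 * x n / (2 * norm (1 - z))\<^sup>2) \<le> s' n * (((1 + x n)\<^sup>2 - (norm z)\<^sup>2) / (norm (of_real (1 + x n) - z))\<^sup>2)"
          by (rule mult_left_mono[OF _ s'0])
        also have "\<dots> \<le> Re (U z)" by (rule Uge[OF zb])
        also have "s' n * (2 * x n / (2 * norm (1 - z))\<^sup>2) = c * (2 * (s n * x n) / (norm (1 - z))\<^sup>2)"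
          using nM by (simp add: s'_def power_mult_distrib)
        also have "\<dots> = c * (2 * (1 - r n) / (norm (1 - z))\<^sup>2)" by (simp only: sx)
        finally have U1: "c * (2 * (1 - r n) / (norm (1 - z))\<^sup>2) \<le> Re (U z)" .
        have "1 - (norm z)\<^sup>2 \<le> 2 * (1 - r n)"
        proof -
          have "0 \<le> (1 - r n)\<^sup>2" by simp
          then show ?thesis unfolding nz by (simp add: power2_eq_square algebra_simps)
        qed
        then have "Re (E z) \<le> c * (2 * (1 - r n) / (norm (1 - z))\<^sup>2)"
          unfolding ReE[OF zb] using c by (intro mult_left_mono divide_right_mono) auto
        then have EU: "Re (E z) \<le> Re (U z)" using U1 by linarith
        have "1 + norm (f z) \<le> 2 * exp (Re (E z))" using fle[OF zb] ReE0[OF zb] one_le_exp_iff[of "Re (E z)"] by linarith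
        then have "ln (1 + norm (f z)) \<le> ln (2 * exp (Re (E z)))" by (subst ln_le_cancel_iff) (auto intro: add_pos_nonneg)
        also have "\<dots> = ln 2 + Re (E z)" by (simp add: ln_mult)
        finally show ?thesis using EU by simp
      qed
    qed
    then show "ereal (?h 0) \<in> {ereal (h 0) |h. h \<in> Har_plus \<and> (\<forall>z\<in>discretized_rings r \<epsilon>. ln (1 + norm (f z)) \<le> h z)}"
      by (intro CollectI exI[of _ ?h] conjI refl hh ballI le)
    show "ereal (?h 0) \<le> ereal 2" using U0 s'1 ln_le_minus_one[of 2] by simp
  qed
  have "ereal c \<le> ereal 2 + ereal C"
    using full C(2)[OF fN] add_right_mono[OF restr, of "ereal C"] by (meson order_trans)
  then show False by (simp add: c_def)
qed

section \<open>Sums over approach regions\<close>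

text \<open>The summands \<open>d t\<^sup>2 / (x\<^sup>2 + t\<^sup>2)\<close> reach half of the height \<open>d\<close> at \<open>t = x\<close>, and \<open>d / (x\<^sup>2 + t\<^sup>2)\<close> has the
  primitive \<open>(d / x) arctan (t / x)\<close>, which bounds the integral of \<open>\<psi>(t) / t\<^sup>2\<close> by a multiple of \<open>\<Sum> d\<^sub>n / x\<^sub>n\<close>.\<close>

lemma class_F_from_series:
  assumes d: "\<And>n. 0 \<le> d n" "summable d" and x: "\<And>n. 0 < x n" and dx: "summable (\<lambda>n. d n / x n)"
  shows "(\<lambda>t. \<Sum>n. d n * (t\<^sup>2 / ((x n)\<^sup>2 + t\<^sup>2))) \<in> class_F"
proof -
  define g where "g n t = t\<^sup>2 / ((x n)\<^sup>2 + t\<^sup>2)" for n t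
  define \<psi> where "\<psi> t = (\<Sum>n. d n * g n t)" for t
  have pos: "0 < (x n)\<^sup>2 + t\<^sup>2" for n t using x[of n] by (intro add_pos_nonneg) auto
  have g01: "0 \<le> g n t" "g n t \<le> 1" for n t using pos[of n t] by (auto simp: g_def)
  have gmono: "g n t \<le> g n u" if "0 \<le> t" "t \<le> u" for n t u
  proof -
    have eq: "g n t = 1 - (x n)\<^sup>2 / ((x n)\<^sup>2 + t\<^sup>2)" for t
    proof -
      have "((x n)\<^sup>2 + t\<^sup>2) / ((x n)\<^sup>2 + t\<^sup>2) = 1" by (rule divide_self) (rule less_imp_neq[OF pos, symmetric])
      then show ?thesis unfolding g_def add_divide_distrib by linarith
    qed
    have "(x n)\<^sup>2 / ((x n)\<^sup>2 + u\<^sup>2) \<le> (x n)\<^sup>2 / ((x n)\<^sup>2 + t\<^sup>2)"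
      using pos that by (intro divide_left_mono add_left_mono power_mono mult_pos_pos) auto
    then show ?thesis unfolding eq by simp
  qed
  have le: "d n * g n t \<le> d n" for n t using mult_left_mono[OF g01(2)[of n t] d(1)[of n]] by simp
  have summ: "summable (\<lambda>n. d n * g n t)" for t
    by (rule summable_comparison_test'[OF d(2)]) (use d(1) g01 le in \<open>auto simp: abs_of_nonneg\<close>)
  have "continuous_on UNIV \<psi>"
  proof (rule uniform_limit_theorem)
    show "uniform_limit UNIV (\<lambda>N t. \<Sum>n<N. d n * g n t) \<psi> sequentially"
      unfolding \<psi>_def by (rule Weierstrass_m_test[OF _ d(2)]) (use d(1) g01 le in \<open>auto simp: abs_of_nonneg\<close>)
    have nz: "(x n)\<^sup>2 + t\<^sup>2 \<noteq> 0" for n t by (rule less_imp_neq[OF pos, symmetric])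
    show "\<forall>\<^sub>F N in sequentially. continuous_on UNIV (\<lambda>t. \<Sum>n<N. d n * g n t)"
      unfolding g_def by (intro always_eventually allI continuous_intros) (use nz in auto)
  qed simp
  then have cont: "continuous_on {0..<1} \<psi>" by (rule continuous_on_subset) simp
  have mono: "mono_on {0..<1} \<psi>" unfolding mono_on_def \<psi>_def
    by (auto intro!: suminf_le summ mult_left_mono gmono d(1))
  have nonneg: "0 \<le> \<psi> t" for t unfolding \<psi>_def by (intro suminf_nonneg summ mult_nonneg_nonneg d(1) g01)
  have zero: "\<psi> 0 = 0" by (simp add: \<psi>_def g_def)
  define f where "f n t = d n / ((x n)\<^sup>2 + t\<^sup>2) * indicator {0..1/2} t" for n and t :: real
  have hf: "has_bochner_integral lborel (f n) (d n / x n * arctan ((1/2) / x n) - d n / x n * arctan (0 / x n))" for n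
    unfolding f_def
  proof (rule has_bochner_integral_FTC_Icc_nonneg)
    have nz: "(x n)\<^sup>2 + t\<^sup>2 \<noteq> 0" for t by (rule less_imp_neq[OF pos, symmetric])
    show "(\<lambda>t. d n / ((x n)\<^sup>2 + t\<^sup>2)) \<in> borel_measurable borel" by measurable
    fix t :: real
    show "0 \<le> d n / ((x n)\<^sup>2 + t\<^sup>2)" using d(1)[of n] pos[of n t] by simp
    have "((\<lambda>t. d n / x n * arctan (t / x n)) has_real_derivative d n / x n * (1 / x n / (1 + (t / x n)\<^sup>2))) (at t)"
      using x[of n] by (auto intro!: derivative_eq_intros simp: divide_simps)
    moreover have "d n / x n * (1 / x n / (1 + (t / x n)\<^sup>2)) = d n / ((x n)\<^sup>2 + t\<^sup>2)"
    proof -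
      have "(x n)\<^sup>2 * (1 + (t / x n)\<^sup>2) = (x n)\<^sup>2 + t\<^sup>2" using x[of n] by (simp add: power_divide distrib_left)
      then show ?thesis by (simp add: power2_eq_square mult.assoc)
    qed
    ultimately show "DERIV (\<lambda>t. d n / x n * arctan (t / x n)) t :> d n / ((x n)\<^sup>2 + t\<^sup>2)" by (simp only:)
  qed simp
  have fnn: "0 \<le> f n t" for n t using d(1)[of n] pos[of n t] by (simp add: f_def)
  have "integrable lborel (\<lambda>t. \<Sum>n. f n t)"
  proof (rule integrable_suminf)
    show "integrable lborel (f n)" for n using hf by (rule integrable.intros)
    have "summable (\<lambda>n. norm (f n t))" if t: "t \<noteq> 0" for t
    proof (rule summable_comparison_test'[OF summable_mult2[OF d(2), of "1 / t\<^sup>2"]])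
      fix n
      have "d n / ((x n)\<^sup>2 + t\<^sup>2) \<le> d n / t\<^sup>2" using d(1)[of n] pos[of n t] t by (intro divide_left_mono mult_pos_pos) auto
      then show "norm (norm (f n t)) \<le> d n * (1 / t\<^sup>2)" using fnn[of n t] d(1)[of n]
        by (auto simp: f_def split: split_indicator)
    qed
    then show "AE t in lborel. summable (\<lambda>n. norm (f n t))" using AE_lborel_singleton[of 0] by (auto elim: eventually_mono)
    have "(\<integral>t. norm (f n t) \<partial>lborel) = d n / x n * arctan ((1/2) / x n)" for n
      using has_bochner_integral_integral_eq[OF hf[of n]] fnn by simp
    then show "summable (\<lambda>n. \<integral>t. norm (f n t) \<partial>lborel)"
    proof (intro summable_comparison_test'[OF summable_mult2[OF dx, of "pi / 2"]])
      fix n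
      assume eq: "\<And>n. (\<integral>t. norm (f n t) \<partial>lborel) = d n / x n * arctan ((1/2) / x n)"
      have "0 \<le> arctan ((1/2) / x n)" "arctan ((1/2) / x n) \<le> pi / 2" using x[of n] arctan_ubound[of "(1/2) / x n"] by auto
      moreover have "0 \<le> d n / x n" using d(1)[of n] x[of n] by simp
      ultimately show "norm (\<integral>t. norm (f n t) \<partial>lborel) \<le> d n / x n * (pi / 2)"
        unfolding eq by (subst real_norm_def, subst abs_of_nonneg) (intro mult_nonneg_nonneg mult_left_mono, assumption+)+
    qed
  qed
  then have "integrable lborel (\<lambda>t. indicator {0<..<1/2} t *\<^sub>R (\<Sum>n. f n t))"
    by (intro integrable_mult_indicator) auto
  also have "(\<lambda>t. indicator {0<..<1/2} t *\<^sub>R (\<Sum>n. f n t)) = (\<lambda>t. indicator {0<..<1/2} t *\<^sub>R (\<psi> t / t\<^sup>2))"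
  proof
    fix t :: real
    show "indicator {0<..<1/2} t *\<^sub>R (\<Sum>n. f n t) = indicator {0<..<1/2} t *\<^sub>R (\<psi> t / t\<^sup>2)"
    proof (cases "t \<in> {0<..<1/2}")
      case True
      have "\<psi> t / t\<^sup>2 = (\<Sum>n. d n * g n t / t\<^sup>2)" unfolding \<psi>_def by (rule suminf_divide[OF summ, symmetric])
      also have "\<dots> = (\<Sum>n. f n t)" using True by (simp add: g_def f_def)
      finally show ?thesis by simp
    qed simp
  qed
  finally have "set_integrable lborel {0<..<1/2} (\<lambda>t. \<psi> t / t\<^sup>2)" unfolding set_integrable_def .
  then have "\<psi> \<in> class_F" unfolding class_F_def
    using mono cont nonneg zero by (intro CollectI conjI ballI exI[of _ "1/2"]) auto
  then show ?thesis unfolding \<psi>_def[abs_def] g_def .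
qed

text \<open>With the heights \<open>4 \<delta>\<^sub>n\<close> the \<open>n\<close>-th summand of \<open>\<psi>\<close> exceeds \<open>\<delta>\<^sub>n\<close> from the distance \<open>x\<^sub>n\<close> onwards, so that
  only lattice points at distance less than \<open>x\<^sub>n\<close> from \<open>1\<close> remain in the region.\<close>

lemma summable_imp_finite_region_sum:
  assumes rd: "ring_data r \<epsilon>" and sm: "summable (\<lambda>n. sqrt ((1 - r n) / \<epsilon> n))"
  shows "\<exists>\<psi>\<in>class_F. (\<Sum>\<^sub>\<infinity>z\<in>discretized_rings r \<epsilon> \<inter> Gamma_region \<psi> 1. ennreal (1 - norm z)) \<noteq> \<infinity>"
proof -
  have r: "0 < r n" "r n < 1" for n using rd by (auto simp: ring_data_def)
  have \<epsilon>: "0 < \<epsilon> n" "\<epsilon> n < 1" for n using rd by (auto simp: ring_data_def)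
  define x where "x n = sqrt ((1 - r n) * \<epsilon> n)" for n
  have x0: "0 < x n" for n using r[of n] \<epsilon>[of n] by (auto simp: x_def)
  have xx: "(x n)\<^sup>2 = (1 - r n) * \<epsilon> n" for n using r[of n] \<epsilon>[of n] by (simp add: x_def)
  have xe: "x n / \<epsilon> n = sqrt ((1 - r n) / \<epsilon> n)" for n
  proof -
    have "sqrt ((1 - r n) / \<epsilon> n) * \<epsilon> n = sqrt ((1 - r n) / \<epsilon> n) * sqrt ((\<epsilon> n)\<^sup>2)" using \<epsilon>[of n] by simp
    also have "\<dots> = x n" unfolding x_def real_sqrt_mult[symmetric]
      using \<epsilon>[of n] by (simp add: power2_eq_square)
    finally show ?thesis using \<epsilon>[of n] by (simp add: field_simps)
  qed
  have dx: "4 * (1 - r n) / x n = 4 * (x n / \<epsilon> n)" for n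
  proof -
    have "(1 - r n) * \<epsilon> n = x n * x n" using xx[of n] by (simp add: power2_eq_square)
    then show ?thesis using x0[of n] \<epsilon>[of n] by (simp add: field_simps)
  qed
  have xsum: "summable (\<lambda>n. x n / \<epsilon> n)" unfolding xe by (rule sm)
  define \<psi> where "\<psi> t = (\<Sum>n. 4 * (1 - r n) * (t\<^sup>2 / ((x n)\<^sup>2 + t\<^sup>2)))" for t
  have dsum: "summable (\<lambda>n. 4 * (1 - r n))" by (intro summable_mult summable_rings[OF rd])
  have F: "\<psi> \<in> class_F" unfolding \<psi>_def
  proof (rule class_F_from_series[OF _ dsum x0])
    show "0 \<le> 4 * (1 - r n)" for n using r[of n] by simp
    show "summable (\<lambda>n. 4 * (1 - r n) / x n)" unfolding dx by (intro summable_mult xsum)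
  qed
  define Z where "Z n = ring_point r \<epsilon> n ` {j \<in> ring_points (1 - r n) (\<epsilon> n). norm (ring_point r \<epsilon> n j - 1) < x n}" for n
  obtain S where S: "\<And>k. (\<Sum>a\<in>(\<Union>n<k. Z n). 1 - norm a) \<le> S"
    using sum_near_1_bounded[OF rd less_imp_le[OF x0] xsum] unfolding Z_def by blast
  have finZ: "finite (Z n)" for n unfolding Z_def by (intro finite_imageI finite_subset[OF _ finite_ring_points]) auto
  have nZ: "norm a = r n" if "a \<in> Z n" for a n using that norm_ring_point[OF rd] by (auto simp: Z_def)
  have sub: "discretized_rings r \<epsilon> \<inter> Gamma_region \<psi> 1 \<subseteq> (\<Union>n. Z n)"
  proof
    fix z assume z: "z \<in> discretized_rings r \<epsilon> \<inter> Gamma_region \<psi> 1"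
    then obtain n j where j: "j \<in> ring_points (1 - r n) (\<epsilon> n)" and zj: "z = ring_point r \<epsilon> n j"
      unfolding discretized_rings_conv by auto
    have nz: "norm z = r n" by (simp add: zj norm_ring_point[OF rd])
    define t where "t = norm (z - 1)"
    have pos: "0 < (x k)\<^sup>2 + t\<^sup>2" for k using x0[of k] by (intro add_pos_nonneg) auto
    have "(\<Sum>k\<in>{n}. 4 * (1 - r k) * (t\<^sup>2 / ((x k)\<^sup>2 + t\<^sup>2))) \<le> \<psi> t" unfolding \<psi>_def
    proof (rule sum_le_suminf)
      have "4 * (1 - r k) * (t\<^sup>2 / ((x k)\<^sup>2 + t\<^sup>2)) \<le> 4 * (1 - r k) * 1" for k
        using r[of k] pos[of k] by (intro mult_left_mono) auto
      moreover have nn: "0 \<le> 4 * (1 - r k) * (t\<^sup>2 / ((x k)\<^sup>2 + t\<^sup>2))" for k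
        using r[of k] pos[of k] by (intro mult_nonneg_nonneg divide_nonneg_pos) auto
      ultimately show "summable (\<lambda>k. 4 * (1 - r k) * (t\<^sup>2 / ((x k)\<^sup>2 + t\<^sup>2)))"
        by (intro summable_comparison_test'[OF dsum]) (simp only: real_norm_def abs_of_nonneg mult_1_right)
      show "0 \<le> 4 * (1 - r k) * (t\<^sup>2 / ((x k)\<^sup>2 + t\<^sup>2))" for k by (rule nn)
    qed simp
    moreover have "\<psi> t \<le> 1 - r n" using z by (simp add: Gamma_region_def t_def nz)
    ultimately have "(1 - r n) * (4 * (t\<^sup>2 / ((x n)\<^sup>2 + t\<^sup>2))) \<le> (1 - r n) * 1"
      by (simp only: sum.insert finite.emptyI sum.empty insert_absorb empty_iff not_False_eq_True add_0_right mult_1_right mult.left_commute[of 4] mult.assoc)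
    then have "4 * (t\<^sup>2 / ((x n)\<^sup>2 + t\<^sup>2)) \<le> 1" using r[of n] by (subst (asm) mult_le_cancel_left_pos) auto
    then have "3 * t\<^sup>2 \<le> (x n)\<^sup>2" using pos[of n] by (simp add: divide_simps split: if_splits)
    then have "t\<^sup>2 < (x n)\<^sup>2" using x0[of n] by (smt (verit) zero_le_power2 zero_less_power)
    then have "t < x n" using x0[of n] by (intro power_less_imp_less_base[of t 2]) auto
    then show "z \<in> (\<Union>n. Z n)" unfolding Z_def using j zj t_def by blast
  qed
  have "(\<Sum>\<^sub>\<infinity>z\<in>discretized_rings r \<epsilon> \<inter> Gamma_region \<psi> 1. ennreal (1 - norm z)) \<le> ennreal S"
  proof (rule infsum_le_finite_sums)
    fix F assume F: "finite F" "F \<subseteq> discretized_rings r \<epsilon> \<inter> Gamma_region \<psi> 1"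
    have "\<exists>k. F \<subseteq> (\<Union>n<k. Z n)"
    proof -
      have "\<forall>a\<in>F. \<exists>n. a \<in> Z n" using F(2) sub by blast
      then obtain N where N: "\<And>a. a \<in> F \<Longrightarrow> a \<in> Z (N a)" by metis
      have "a \<in> (\<Union>n<Suc (Max (N ` F)). Z n)" if "a \<in> F" for a
        using N[OF that] Max_ge[of "N ` F" "N a"] F(1) that by (auto simp: less_Suc_eq_le)
      then show ?thesis by blast
    qed
    then obtain k where k: "F \<subseteq> (\<Union>n<k. Z n)" by blast
    have n1: "norm a < 1" if "a \<in> (\<Union>n<k. Z n)" for a using that nZ r by fastforce
    have "(\<Sum>z\<in>F. ennreal (1 - norm z)) = ennreal (\<Sum>z\<in>F. 1 - norm z)"
    proof (rule sum_ennreal)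
      show "0 \<le> 1 - norm z" if "z \<in> F" for z using n1[of z] k that by fastforce
    qed
    also have "\<dots> \<le> ennreal S"
    proof (rule ennreal_leI)
      have "(\<Sum>z\<in>F. 1 - norm z) \<le> (\<Sum>z\<in>(\<Union>n<k. Z n). 1 - norm z)"
      proof (rule sum_mono2[OF _ k])
        show "finite (\<Union>n<k. Z n)" using finZ by simp
        show "0 \<le> 1 - norm z" if "z \<in> (\<Union>n<k. Z n) - F" for z using n1[of z] that by simp
      qed
      then show "(\<Sum>z\<in>F. 1 - norm z) \<le> S" using S[of k] by linarith
    qed
    finally show "(\<Sum>z\<in>F. ennreal (1 - norm z)) \<le> ennreal S" .
  qed (simp add: nonneg_summable_on_complete)
  then have "(\<Sum>\<^sub>\<infinity>z\<in>discretized_rings r \<epsilon> \<inter> Gamma_region \<psi> 1. ennreal (1 - norm z)) \<noteq> \<infinity>"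
    by (metis ennreal_neq_top infinity_ennreal_def top_unique)
  then show ?thesis using F by blast
qed

text \<open>A half-interval of length \<open>X / 2\<close> on one side of \<open>\<phi>\<close> avoids the gap of the lattice at \<open>2 \<pi>\<close> and contains
  at least \<open>X / (2 \<Delta>) - 2\<close> points of the lattice with step \<open>\<Delta> = 2 \<pi> \<delta> \<epsilon>\<close>, which is at least half of \<open>X / (2 \<Delta>)\<close>.\<close>

lemma ring_count_lower:
  assumes \<delta>: "0 < \<delta>" "\<delta> < 1" and \<epsilon>: "0 < \<epsilon>" "\<epsilon> < 1" and X: "0 < X" "X \<le> 1 / 2" "56 * \<delta> \<le> X"
    and \<phi>: "0 \<le> \<phi>" "\<phi> < 2 * pi"
  shows "X / (8 * pi * \<epsilon>)
    \<le> \<delta> * real (card {j \<in> ring_points \<delta> \<epsilon>. norm (of_real (1 - \<delta>) * cis (real j * (2 * pi * (\<delta> * \<epsilon>))) - cis \<phi>) < X})"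
proof -
  define \<Delta> where "\<Delta> = 2 * pi * (\<delta> * \<epsilon>)"
  have \<Delta>: "\<Delta> > 0" using \<delta> \<epsilon> by (simp add: \<Delta>_def)
  have \<Delta>X: "8 * \<Delta> \<le> X"
  proof -
    have "\<delta> * \<epsilon> \<le> \<delta> * 1" using \<delta> \<epsilon> by (intro mult_left_mono) auto
    then have "2 * pi * (\<delta> * \<epsilon>) \<le> 7 * \<delta>" using \<delta> \<epsilon> pi_approx by (intro mult_mono) auto
    then show ?thesis using X(3) by (simp add: \<Delta>_def)
  qed
  define a where "a = (if \<phi> \<le> pi then \<phi> else \<phi> - X / 2)"
  have a: "0 \<le> a" "a + X / 2 \<le> 2 * pi" "\<bar>y - \<phi>\<bar> \<le> X / 2" if "a \<le> y" "y \<le> a + X / 2" for y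
    using \<phi> X that pi_gt3 by (auto simp: a_def split: if_splits)
  define m where "m = nat \<lceil>a / \<Delta>\<rceil>"
  have a0: "0 \<le> a" using a(1)[of a] X by simp
  have m: "a \<le> real m * \<Delta>" "real m * \<Delta> \<le> a + \<Delta>"
  proof -
    have m1: "real m = of_int \<lceil>a / \<Delta>\<rceil>" using a0 \<Delta> by (simp add: m_def)
    have "a / \<Delta> \<le> real m" unfolding m1 by (rule le_of_int_ceiling)
    then show "a \<le> real m * \<Delta>" using \<Delta> by (simp add: pos_divide_le_eq)
    have "real m \<le> a / \<Delta> + 1" unfolding m1 using of_int_ceiling_le_add_one by simp
    then show "real m * \<Delta> \<le> a + \<Delta>" using \<Delta> by (simp add: field_simps)
  qed
  define Y where "Y = X / (2 * \<Delta>)"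
  have Y: "Y \<ge> 4" "Y * \<Delta> = X / 2" using \<Delta>X \<Delta> by (auto simp: Y_def field_simps)
  define K where "K = nat \<lfloor>Y\<rfloor> - 1"
  have fl: "real (nat \<lfloor>Y\<rfloor>) \<le> Y" "Y < real (nat \<lfloor>Y\<rfloor>) + 1" using Y by linarith+
  have K: "real K + 1 \<le> Y" "Y - 2 \<le> real K" using fl Y(1) unfolding K_def by linarith+
  define G where "G = {j \<in> ring_points \<delta> \<epsilon>. norm (of_real (1 - \<delta>) * cis (real j * \<Delta>) - cis \<phi>) < X}"
  have sub: "(\<lambda>i. m + i) ` {..<K} \<subseteq> G"
  proof
    fix j assume "j \<in> (\<lambda>i. m + i) ` {..<K}"
    then obtain i where i: "i < K" "j = m + i" by auto
    have j1: "a \<le> real j * \<Delta>" using m(1) \<Delta> i by (simp add: distrib_right add_increasing2)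
    have "real j + 1 \<le> real m + real K" using i by simp
    then have "(real j + 1) * \<Delta> \<le> (real m + real K) * \<Delta>" using \<Delta> by (intro mult_right_mono) auto
    moreover have "(real K + 1) * \<Delta> \<le> Y * \<Delta>" using K \<Delta> by (intro mult_right_mono) auto
    ultimately have j2: "(real j + 1) * \<Delta> \<le> a + X / 2" using m(2) unfolding Y(2) distrib_right by linarith
    then have j3: "real j * \<Delta> \<le> a + X / 2" using \<Delta> unfolding distrib_right by linarith
    have "(real j + 1) * \<Delta> \<le> 2 * pi" using j2 a(2)[OF j1 j3] by linarith
    moreover have "(2 * pi) * ((real j + 1) * (\<delta> * \<epsilon>)) = (real j + 1) * \<Delta>" by (simp add: \<Delta>_def)
    ultimately have "(2 * pi) * ((real j + 1) * (\<delta> * \<epsilon>)) \<le> (2 * pi) * 1" by (simp only: mult_1_right)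
    then have "(real j + 1) * (\<delta> * \<epsilon>) \<le> 1" by (rule mult_left_le_imp_le) simp
    then have "real j + 1 \<le> 1 / (\<delta> * \<epsilon>)" using \<delta> \<epsilon> by (simp only: pos_le_divide_eq mult_pos_pos)
    then have "real_of_int (int j + 1) \<le> 1 / (\<delta> * \<epsilon>)" by simp
    then have "int j + 1 \<le> \<lfloor>1 / (\<delta> * \<epsilon>)\<rfloor>" unfolding le_floor_iff .
    then have mem: "j \<in> ring_points \<delta> \<epsilon>" unfolding ring_points_def by simp
    have split: "of_real (1 - \<delta>) * cis (real j * \<Delta>) - cis \<phi>
        = (of_real 1 * cis (real j * \<Delta>) - of_real 1 * cis \<phi>) - of_real \<delta> * cis (real j * \<Delta>)"
      by (simp add: algebra_simps)
    have "norm (of_real (1 - \<delta>) * cis (real j * \<Delta>) - cis \<phi>)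
        \<le> norm (of_real 1 * cis (real j * \<Delta>) - of_real 1 * cis \<phi>) + norm (of_real \<delta> * cis (real j * \<Delta>))"
      unfolding split by (rule norm_triangle_ineq4)
    also have "norm (of_real \<delta> * cis (real j * \<Delta>)) = \<delta>" using \<delta> by (simp add: norm_mult)
    also have "norm (of_real 1 * cis (real j * \<Delta>) - of_real 1 * cis \<phi>) \<le> \<bar>real j * \<Delta> - \<phi>\<bar>" by (rule chord_le_angle) auto
    also have "\<bar>real j * \<Delta> - \<phi>\<bar> \<le> X / 2" by (rule a(3)[OF j1 j3])
    also have "X / 2 + \<delta> < X" using X \<delta> by linarith
    finally show "j \<in> G" using mem by (simp add: G_def)
  qed
  have "finite G" by (rule finite_subset[OF _ finite_ring_points[of \<delta> \<epsilon>]]) (auto simp: G_def)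
  then have "card ((\<lambda>i. m + i) ` {..<K}) \<le> card G" using sub by (rule card_mono)
  also have "card ((\<lambda>i. m + i) ` {..<K}) = K" by (simp add: card_image)
  finally have "Y / 2 \<le> real (card G)" using K Y(1) by linarith
  then have "\<delta> * (Y / 2) \<le> \<delta> * real (card G)" using \<delta> by (intro mult_left_mono) auto
  also have "\<delta> * (Y / 2) = X / (8 * pi * \<epsilon>)" using \<delta> \<epsilon> by (simp add: Y_def \<Delta>_def)
  finally show ?thesis by (simp add: G_def \<Delta>_def)
qed

lemma ring_point_inj:
  assumes rd: "ring_data r \<epsilon>"
  shows "inj_on (ring_point r \<epsilon> n) (ring_points (1 - r n) (\<epsilon> n))"
proof (rule inj_on_inverseI)
  fix j assume j: "j \<in> ring_points (1 - r n) (\<epsilon> n)"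
  have r: "0 < r n" "r n < 1" and \<epsilon>: "0 < \<epsilon> n" using rd by (auto simp: ring_data_def)
  define \<Delta> where "\<Delta> = (1 - r n) * \<epsilon> n"
  have \<Delta>: "\<Delta> > 0" using r \<epsilon> by (simp add: \<Delta>_def)
  have "int j < \<lfloor>1 / \<Delta>\<rfloor>" using j by (simp add: ring_points_def \<Delta>_def)
  then have "real j < 1 / \<Delta>" by linarith
  then have "real j * \<Delta> < 1" using \<Delta> by (simp add: field_simps)
  then have "real j * (2 * pi * \<Delta>) < 2 * pi" by simp
  then have "Arg2pi (ring_point r \<epsilon> n j) = real j * (2 * pi * \<Delta>)"
    by (intro Arg2pi_unique[of "r n"]) (use r \<Delta> in \<open>auto simp: ring_point_def \<Delta>_def cis_conv_exp\<close>)
  then show "nat \<lfloor>Arg2pi (ring_point r \<epsilon> n j) / (2 * pi * \<Delta>)\<rfloor> = j" using \<Delta> by simp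
qed

lemma ring_data_strict_mono:
  assumes rd: "ring_data r \<epsilon>" shows "strict_mono r"
proof (rule ring_data_ratio[OF rd])
  fix q assume q: "0 < q" "q < 1" "\<And>n. 1 - r (Suc n) \<le> q * (1 - r n)"
  have "r n < r (Suc n)" for n
  proof -
    have "r n < 1" using rd by (auto simp: ring_data_def)
    then have "q * (1 - r n) < 1 * (1 - r n)" using q by (intro mult_strict_right_mono) auto
    with q(3)[of n] have "1 - r (Suc n) < 1 * (1 - r n)" by (rule le_less_trans)
    then show ?thesis by simp
  qed
  then show ?thesis by (simp add: strict_mono_Suc_iff)
qed

text \<open>The sum is dominated by a geometric series starting from its first term, and this term is at most \<open>y\<close>.\<close>

lemma geometric_tail_sum:
  fixes d :: "nat \<Rightarrow> real" and q y :: real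
  assumes d: "\<And>n. 0 < d n" "\<And>n. d (Suc n) \<le> q * d n" and q: "0 < q" "q < 1" and I: "finite I" "\<And>n. n \<in> I \<Longrightarrow> d n \<le> y"
    and y: "0 \<le> y"
  shows "(\<Sum>n\<in>I. d n) \<le> y / (1 - q)"
proof (cases "I = {}")
  case True
  have "0 \<le> y / (1 - q)" using y q by (intro divide_nonneg_nonneg) auto
  then show ?thesis using True by simp
next
  case False
  define m where "m = Min I"
  have mI: "m \<in> I" using False I(1) by (simp add: m_def)
  have geo: "d (m + k) \<le> q ^ k * d m" for k
  proof (induction k)
    case (Suc k)
    have "d (m + Suc k) \<le> q * d (m + k)" using d(2)[of "m + k"] by simp
    also have "\<dots> \<le> q * (q ^ k * d m)" using Suc.IH q by (intro mult_left_mono) auto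
    finally show ?case by (simp add: mult.assoc)
  qed simp
  have sub: "I \<subseteq> (\<lambda>k. m + k) ` {..Max I}"
  proof
    fix n assume n: "n \<in> I"
    have "m \<le> n" "n \<le> Max I" using n I(1) by (auto simp: m_def)
    then show "n \<in> (\<lambda>k. m + k) ` {..Max I}" by (intro image_eqI[of _ _ "n - m"]) auto
  qed
  have "(\<Sum>n\<in>I. d n) \<le> (\<Sum>n\<in>(\<lambda>k. m + k) ` {..Max I}. d n)"
    by (rule sum_mono2[OF _ sub]) (use d in \<open>auto simp: less_imp_le\<close>)
  also have "\<dots> = (\<Sum>k\<le>Max I. d (m + k))" by (subst sum.reindex) auto
  also have "\<dots> \<le> (\<Sum>k\<le>Max I. q ^ k * d m)" by (intro sum_mono geo)
  also have "\<dots> = (\<Sum>k\<le>Max I. q ^ k) * d m" by (simp add: sum_distrib_right)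
  also have "\<dots> \<le> (1 / (1 - q)) * y"
  proof (rule mult_mono)
    have "(\<Sum>k\<le>Max I. q ^ k) \<le> (\<Sum>k. q ^ k)" by (rule sum_le_suminf) (use q in \<open>auto intro!: summable_geometric\<close>)
    then show "(\<Sum>k\<le>Max I. q ^ k) \<le> 1 / (1 - q)" using q by (simp add: suminf_geometric)
  qed (use I(2)[OF mI] q d in \<open>auto simp: less_imp_le\<close>)
  finally show ?thesis by simp
qed

text \<open>Positivity of the radius comes from continuity at \<open>0\<close>.\<close>

lemma sublevel_radii:
  assumes \<psi>: "mono_on {0..\<eta>} \<psi>" "continuous_on {0..\<eta>} \<psi>" "\<psi> 0 = 0" and \<eta>: "0 < (\<eta>::real)" and d: "0 < (d::real)"
  shows "\<exists>X. 0 < X \<and> X \<le> \<eta> \<and> (\<forall>t\<in>{0..<X}. \<psi> t \<le> d) \<and> (\<forall>t\<in>{X<..\<eta>}. d < \<psi> t)"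
proof -
  define E where "E = {t \<in> {0..\<eta>}. \<psi> t \<le> d}"
  define X where "X = Sup E"
  have bdd: "bdd_above E" by (rule bdd_aboveI[of _ \<eta>]) (auto simp: E_def)
  have ne: "0 \<in> E" using \<eta> d \<psi>(3) by (simp add: E_def)
  have "\<exists>s>0. s \<le> \<eta> \<and> \<psi> s \<le> d"
  proof -
    have "\<forall>e>0. \<exists>s>0. \<forall>t\<in>{0..\<eta>}. dist t 0 < s \<longrightarrow> dist (\<psi> t) (\<psi> 0) < e"
      by (rule bspec[OF \<psi>(2)[unfolded continuous_on_iff]]) (use \<eta> in simp)
    then obtain s where s: "s > 0" "\<And>t. t \<in> {0..\<eta>} \<Longrightarrow> dist t 0 < s \<Longrightarrow> dist (\<psi> t) (\<psi> 0) < d" using d by blast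
    define t where "t = min (s / 2) \<eta>"
    have t: "0 < t" "t \<le> \<eta>" "t < s" using s(1) \<eta> by (auto simp: t_def)
    then have "dist (\<psi> t) (\<psi> 0) < d" by (intro s(2)) auto
    then have "\<psi> t \<le> d" using \<psi>(3) by (simp add: dist_real_def)
    then show ?thesis using t by blast
  qed
  then obtain s where s: "s > 0" "s \<in> E" by (auto simp: E_def)
  have "s \<le> X" unfolding X_def by (rule cSup_upper[OF s(2) bdd])
  then have X0: "0 < X" using s(1) by simp
  have X\<eta>: "X \<le> \<eta>" unfolding X_def by (rule cSup_least) (use ne in \<open>auto simp: E_def\<close>)
  have "\<psi> t \<le> d" if t: "t \<in> {0..<X}" for t
  proof -
    obtain u where u: "u \<in> E" "t < u" using t less_cSup_iff[OF _ bdd, of t] ne unfolding X_def by auto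
    have "\<psi> t \<le> \<psi> u" using mono_onD[OF \<psi>(1), of t u] t u by (auto simp: E_def)
    then show ?thesis using u(1) by (simp add: E_def)
  qed
  moreover have "d < \<psi> t" if t: "t \<in> {X<..\<eta>}" for t
  proof (rule ccontr)
    assume "\<not> d < \<psi> t"
    then have "t \<in> E" using t X0 by (auto simp: E_def)
    then have "t \<le> X" unfolding X_def using bdd by (rule cSup_upper)
    then show False using t by simp
  qed
  ultimately show ?thesis using X0 X\<eta> by blast
qed

text \<open>Up to a summable term \<open>d n / \<eta>\<close>, the quotient \<open>d n / X n\<close> is the integral of \<open>d n / t\<^sup>2\<close> over \<open>[X n, \<eta>]\<close>. At a
  point \<open>t\<close> only indices with \<open>X n \<le> t\<close> contribute; for these \<open>d n < \<psi> t\<close> (except at \<open>t = X n\<close>, which happens on a null set),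
  and by geometric decay their sum is at most \<open>\<psi> t / (1 - q)\<close>.\<close>

lemma summable_sublevel_radii:
  fixes d X :: "nat \<Rightarrow> real" and q \<eta> :: real and \<psi> :: "real \<Rightarrow> real"
  assumes d: "\<And>n. 0 < d n" "\<And>n. d (Suc n) \<le> q * d n" and q: "0 < q" "q < 1"
    and X: "\<And>n. 0 < X n" "\<And>n. X n \<le> \<eta>" "\<And>n t. t \<in> {X n<..\<eta>} \<Longrightarrow> d n < \<psi> t"
    and \<psi>: "\<And>t. t \<in> {0..\<eta>} \<Longrightarrow> 0 \<le> \<psi> t" and int: "set_integrable lborel {0<..\<eta>} (\<lambda>t. \<psi> t / t\<^sup>2)" and \<eta>: "0 < \<eta>"
  shows "summable (\<lambda>n. d n / X n)"
proof -
  define I where "I = (LINT t:{0<..\<eta>}|lborel. \<psi> t / t\<^sup>2)"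
  have hb: "has_bochner_integral lborel (\<lambda>t. d n / t\<^sup>2 * indicator {X n..\<eta>} t) (- d n / \<eta> - (- d n / X n))" for n
  proof (rule has_bochner_integral_FTC_Icc_nonneg[OF _ _ _ X(2)])
    fix t assume t: "t \<in> {X n..\<eta>}"
    have "t > 0" using X(1)[of n] t by simp
    then show "DERIV (\<lambda>t. - d n / t) t :> d n / t\<^sup>2"
      by (auto intro!: derivative_eq_intros simp: power2_eq_square)
    show "0 \<le> d n / t\<^sup>2" using d(1)[of n] by simp
  qed measurable
  have ineq: "(\<Sum>n<N. d n / X n - d n / \<eta>) \<le> I / (1 - q)" for N
  proof -
    let ?f = "\<lambda>t. \<Sum>n<N. d n / t\<^sup>2 * indicator {X n..\<eta>} t"
    have hf: "has_bochner_integral lborel ?f (\<Sum>n<N. - d n / \<eta> - (- d n / X n))"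
      by (intro has_bochner_integral_sum hb)
    have "(\<Sum>n<N. d n / X n - d n / \<eta>) = (\<integral>t. ?f t \<partial>lborel)"
      using has_bochner_integral_integral_eq[OF hf] by simp
    also have "\<dots> \<le> (\<integral>t. (1 / (1 - q)) * (indicator {0<..\<eta>} t *\<^sub>R (\<psi> t / t\<^sup>2)) \<partial>lborel)"
    proof (rule integral_mono_AE)
      show "integrable lborel ?f" using hf by (rule integrable.intros)
      show "integrable lborel (\<lambda>t. (1 / (1 - q)) * (indicator {0<..\<eta>} t *\<^sub>R (\<psi> t / t\<^sup>2)))"
        using int unfolding set_integrable_def by (rule integrable_mult_right)
      have "AE t in lborel. t \<notin> X ` {..<N}"
        by (rule AE_not_in[OF finite_imp_null_set_lborel]) simp
      then show "AE t in lborel. ?f t \<le> (1 / (1 - q)) * (indicator {0<..\<eta>} t *\<^sub>R (\<psi> t / t\<^sup>2))"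
      proof (rule eventually_mono)
        fix t assume t: "t \<notin> X ` {..<N}"
        show "?f t \<le> (1 / (1 - q)) * (indicator {0<..\<eta>} t *\<^sub>R (\<psi> t / t\<^sup>2))"
        proof (cases "t \<in> {0<..\<eta>}")
          case True
          define J where "J = {n \<in> {..<N}. X n \<le> t}"
          have "d n \<le> \<psi> t" if "n \<in> J" for n
          proof -
            have "X n \<noteq> t" using t that by (auto simp: J_def)
            then show ?thesis using X(3)[of t n] that True by (auto simp: J_def)
          qed
          then have sJ: "(\<Sum>n\<in>J. d n) \<le> \<psi> t / (1 - q)"
            by (intro geometric_tail_sum[where d = d and q = q]) (use True \<psi> d q in \<open>auto simp: J_def\<close>)
          have "?f t = (\<Sum>n<N. if n \<in> J then d n / t\<^sup>2 else 0)"
            by (intro sum.cong) (use True in \<open>auto simp: J_def indicator_def\<close>)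
          also have "\<dots> = (\<Sum>n\<in>{..<N} \<inter> J. d n / t\<^sup>2)" by (rule sum.inter_restrict[symmetric]) simp
          also have "{..<N} \<inter> J = J" by (auto simp: J_def)
          also have "(\<Sum>n\<in>J. d n / t\<^sup>2) = (\<Sum>n\<in>J. d n) / t\<^sup>2" by (rule sum_divide_distrib[symmetric])
          also have "\<dots> \<le> \<psi> t / (1 - q) / t\<^sup>2" using sJ by (rule divide_right_mono) simp
          finally show ?thesis using True by simp
        next
          case False
          have "indicator {X n..\<eta>} t = (0::real)" for n using False X(1)[of n] by (auto simp: indicator_def)
          then have "?f t = 0" by simp
          then show ?thesis using False by simp
        qed
      qed
    qed
    also have "\<dots> = 1 / (1 - q) * I" unfolding I_def set_lebesgue_integral_def by (rule integral_mult_right_zero)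
    also have "\<dots> = I / (1 - q)" by simp
    finally show ?thesis .
  qed
  have dsum: "summable d" by (rule summable_ratio_test[of q 0]) (use d q in \<open>auto simp: abs_of_pos\<close>)
  have "summable (\<lambda>n. d n / X n - d n / \<eta>)"
  proof (rule summableI_nonneg_bounded)
    show "0 \<le> d n / X n - d n / \<eta>" for n
      using d(1)[of n] X(1,2)[of n] by (simp add: divide_left_mono)
    show "(\<Sum>n<N. d n / X n - d n / \<eta>) \<le> I / (1 - q)" for N by (rule ineq)
  qed
  then have "summable (\<lambda>n. (d n / X n - d n / \<eta>) + d n / \<eta>)" by (intro summable_add summable_divide dsum)
  then show ?thesis by simp
qed

text \<open>With \<open>X\<^sub>n\<close> the sublevel radii of \<open>\<psi>\<close>, all points of the ring \<open>n\<close> at distance less than \<open>X\<^sub>n\<close> from \<open>\<zeta>\<close> belong to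
  the region, and they contribute at least \<open>X\<^sub>n / (8 \<pi> \<epsilon>\<^sub>n)\<close> as soon as \<open>\<delta>\<^sub>n\<close> is small compared with \<open>X\<^sub>n\<close>. The
  inequality of arithmetic and geometric means combines the two convergent series.\<close>

theorem finite_region_sum_imp_summable:
  assumes rd: "ring_data r \<epsilon>" and \<zeta>: "norm \<zeta> = 1" and \<psi>: "\<psi> \<in> class_F"
    and fin: "(\<Sum>\<^sub>\<infinity>z\<in>discretized_rings r \<epsilon> \<inter> Gamma_region \<psi> \<zeta>. ennreal (1 - norm z)) \<noteq> \<infinity>"
  shows "summable (\<lambda>n. sqrt ((1 - r n) / \<epsilon> n))"
proof -
  have r: "0 < r n" "r n < 1" for n using rd by (auto simp: ring_data_def)
  have \<epsilon>: "0 < \<epsilon> n" "\<epsilon> n < 1" for n using rd by (auto simp: ring_data_def)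
  obtain q where q: "0 < q" "q < 1" and ratio: "\<And>n. 1 - r (Suc n) \<le> q * (1 - r n)"
  proof (rule ring_data_ratio[OF rd])
    fix q assume *: "0 < q" "q < 1" "\<And>n. 1 - r (Suc n) \<le> q * (1 - r n)"
    show thesis by (rule that[of q]) (fact *)+
  qed
  define T where "T = discretized_rings r \<epsilon> \<inter> Gamma_region \<psi> \<zeta>"
  obtain \<delta> where \<delta>: "0 < \<delta>" "\<delta> < 1" and int: "set_integrable lborel {0<..<\<delta>} (\<lambda>x. \<psi> x / x\<^sup>2)"
    using \<psi> unfolding class_F_def by blast
  have p: "mono_on {0..<1} \<psi>" "continuous_on {0..<1} \<psi>" "\<And>x. x \<in> {0..<1} \<Longrightarrow> 0 \<le> \<psi> x" "\<psi> 0 = 0"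
    using \<psi> unfolding class_F_def by auto
  define \<eta> where "\<eta> = \<delta> / 2"
  have \<eta>: "0 < \<eta>" "\<eta> \<le> 1 / 2" "\<eta> < \<delta>" using \<delta> by (auto simp: \<eta>_def)
  have sub1: "{0..\<eta>} \<subseteq> {0..<1}" using \<eta> by auto
  have "\<forall>n. \<exists>X. 0 < X \<and> X \<le> \<eta> \<and> (\<forall>t\<in>{0..<X}. \<psi> t \<le> 1 - r n) \<and> (\<forall>t\<in>{X<..\<eta>}. 1 - r n < \<psi> t)"
    by (intro allI sublevel_radii[OF mono_on_subset[OF p(1) sub1] continuous_on_subset[OF p(2) sub1] p(4) \<eta>(1)]) (use r in simp)
  from choice[OF this] obtain X where X': "\<forall>n. 0 < X n \<and> X n \<le> \<eta> \<and> (\<forall>t\<in>{0..<X n}. \<psi> t \<le> 1 - r n) \<and> (\<forall>t\<in>{X n<..\<eta>}. 1 - r n < \<psi> t)"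
    by (elim exE)
  have X: "0 < X n" "X n \<le> \<eta>" "t \<in> {0..<X n} \<Longrightarrow> \<psi> t \<le> 1 - r n" "t \<in> {X n<..\<eta>} \<Longrightarrow> 1 - r n < \<psi> t" for n t
    using X'[rule_format, of n] by blast+
  have sdX: "summable (\<lambda>n. (1 - r n) / X n)"
  proof (rule summable_sublevel_radii[where q = q and \<eta> = \<eta> and \<psi> = \<psi>])
    show "0 < 1 - r n" "1 - r (Suc n) \<le> q * (1 - r n)" for n using r(2)[of n] ratio[of n] by simp_all
    show "1 - r n < \<psi> t" if "t \<in> {X n<..\<eta>}" for n t using that by (rule X(4))
    show "0 \<le> \<psi> t" if "t \<in> {0..\<eta>}" for t using p(3) sub1 that by blast
    show "set_integrable lborel {0<..\<eta>} (\<lambda>t. \<psi> t / t\<^sup>2)"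
      by (rule set_integrable_subset[OF int]) (use \<eta> in auto)
  qed (fact q X(1,2) \<eta>(1))+
  have sXe: "summable (\<lambda>n. X n / \<epsilon> n)"
  proof -
    define \<phi> where "\<phi> = Arg2pi \<zeta>"
    have \<phi>: "0 \<le> \<phi>" "\<phi> < 2 * pi" "cis \<phi> = \<zeta>"
      using Arg2pi[of \<zeta>] \<zeta> by (auto simp: \<phi>_def cis_conv_exp is_Arg_def)
    define J where "J n = {j \<in> ring_points (1 - r n) (\<epsilon> n). norm (ring_point r \<epsilon> n j - \<zeta>) < X n}" for n
    define Z where "Z n = ring_point r \<epsilon> n ` J n" for n
    have finJ: "finite (J n)" for n by (rule finite_subset[OF _ finite_ring_points[of "1 - r n" "\<epsilon> n"]]) (auto simp: J_def)
    have nZ: "norm a = r n" if "a \<in> Z n" for a n using that norm_ring_point[OF rd] by (auto simp: Z_def)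
    have ZT: "Z n \<subseteq> T" for n
    proof
      fix a assume a: "a \<in> Z n"
      have "a \<in> discretized_rings r \<epsilon>" using a unfolding discretized_rings_conv Z_def J_def by auto
      moreover have aX: "norm (a - \<zeta>) < X n" using a by (auto simp: Z_def J_def)
      then have "\<psi> (norm (a - \<zeta>)) \<le> 1 - norm a" using X(3)[of "norm (a - \<zeta>)" n] nZ[OF a] by simp
      ultimately show "a \<in> T" using aX X(2)[of n] \<eta>(2) nZ[OF a] r(2)[of n] by (simp add: T_def Gamma_region_def)
    qed
    have sumZ: "(\<Sum>a\<in>Z n. 1 - norm a) = (1 - r n) * real (card (J n))" for n
    proof -
      have "inj_on (ring_point r \<epsilon> n) (J n)" by (rule inj_on_subset[OF ring_point_inj[OF rd]]) (auto simp: J_def)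
      then have "card (Z n) = card (J n)" unfolding Z_def by (rule card_image)
      then show ?thesis using nZ by simp
    qed
    obtain S where S: "0 \<le> S" "(\<Sum>\<^sub>\<infinity>z\<in>T. ennreal (1 - norm z)) = ennreal S"
      using fin unfolding T_def by (cases "\<Sum>\<^sub>\<infinity>z\<in>discretized_rings r \<epsilon> \<inter> Gamma_region \<psi> \<zeta>. ennreal (1 - norm z)") auto
    have bound: "(\<Sum>n<N. \<Sum>a\<in>Z n. 1 - norm a) \<le> S" for N
    proof -
      have n1: "0 \<le> 1 - norm a" if "a \<in> (\<Union>n<N. Z n)" for a using that nZ r(2) by (auto simp: less_imp_le)
      have "(\<Sum>n<N. \<Sum>a\<in>Z n. 1 - norm a) = (\<Sum>a\<in>(\<Union>n<N. Z n). 1 - norm a)"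
      proof (rule sum.UNION_disjoint[symmetric])
        show "\<forall>i\<in>{..<N}. \<forall>j\<in>{..<N}. i \<noteq> j \<longrightarrow> Z i \<inter> Z j = {}"
        proof (intro ballI impI)
          fix i j :: nat assume "i \<noteq> j"
          then have "r i \<noteq> r j" using strict_mono_eq[OF ring_data_strict_mono[OF rd]] by simp
          then show "Z i \<inter> Z j = {}" using nZ[of _ i] nZ[of _ j] by force
        qed
      qed (use finJ in \<open>auto simp: Z_def\<close>)
      moreover have "ennreal (\<Sum>a\<in>(\<Union>n<N. Z n). 1 - norm a) \<le> ennreal S"
      proof -
        have "ennreal (\<Sum>a\<in>(\<Union>n<N. Z n). 1 - norm a) = (\<Sum>a\<in>(\<Union>n<N. Z n). ennreal (1 - norm a))"
          by (rule sum_ennreal[symmetric]) (rule n1)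
        also have "\<dots> = (\<Sum>\<^sub>\<infinity>a\<in>(\<Union>n<N. Z n). ennreal (1 - norm a))"
          by (rule infsum_finite[symmetric]) (use finJ in \<open>auto simp: Z_def\<close>)
        also have "\<dots> \<le> (\<Sum>\<^sub>\<infinity>z\<in>T. ennreal (1 - norm z))"
        proof (rule infsum_mono_neutral)
          show "ennreal (1 - norm a) \<le> 0" if "a \<in> (\<Union>n<N. Z n) - T" for a using ZT that by blast
        qed (simp_all add: nonneg_summable_on_complete)
        finally show ?thesis by (simp only: S(2))
      qed
      ultimately show ?thesis using S(1) by (simp add: ennreal_le_iff)
    qed
    have "(\<lambda>n. (1 - r n) / X n) \<longlonglongrightarrow> 0" by (rule summable_LIMSEQ_zero[OF sdX])
    then have "\<forall>\<^sub>F n in sequentially. (1 - r n) / X n < 1 / 56" by (rule order_tendstoD) simp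
    then have ev: "\<forall>\<^sub>F n in sequentially. norm (X n / \<epsilon> n) \<le> 8 * pi * (\<Sum>a\<in>Z n. 1 - norm a)"
    proof eventually_elim
      case (elim n)
      have le: "56 * (1 - r n) \<le> X n" using elim X(1)[of n] by (simp add: field_simps)
      have "X n / (8 * pi * \<epsilon> n) \<le> (1 - r n) * real (card (J n))"
        unfolding J_def ring_point_def \<phi>(3)[symmetric]
        by (rule ring_count_lower[OF _ _ \<epsilon> X(1) _ le \<phi>(1,2)]) (use r[of n] X(2)[of n] \<eta>(2) in auto)
      then have "8 * pi * (X n / (8 * pi * \<epsilon> n)) \<le> 8 * pi * (\<Sum>a\<in>Z n. 1 - norm a)"
        unfolding sumZ by (intro mult_left_mono) auto
      moreover have "8 * pi * (X n / (8 * pi * \<epsilon> n)) = X n / \<epsilon> n" by simp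
      ultimately show ?case using X(1)[of n] \<epsilon>(1)[of n] by (simp add: abs_of_pos)
    qed
    have "summable (\<lambda>n. \<Sum>a\<in>Z n. 1 - norm a)"
    proof (rule summableI_nonneg_bounded)
      show "0 \<le> (\<Sum>a\<in>Z n. 1 - norm a)" for n using nZ r(2)[of n] by (intro sum_nonneg) auto
      show "(\<Sum>n<N. \<Sum>a\<in>Z n. 1 - norm a) \<le> S" for N by (rule bound)
    qed
    then show ?thesis by (intro summable_comparison_test_ev[OF ev] summable_mult)
  qed
  have half_le: "(u + v) / 2 \<le> u + v" if "0 \<le> u" "0 \<le> v" for u v :: real using that by simp
  show ?thesis
  proof (rule summable_comparison_test'[OF summable_add[OF sdX sXe]])
    fix n
    have nn: "0 \<le> (1 - r n) / X n" "0 \<le> X n / \<epsilon> n" using r[of n] X(1)[of n] \<epsilon>(1)[of n] by auto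
    have "sqrt ((1 - r n) / \<epsilon> n) = sqrt ((1 - r n) / X n * (X n / \<epsilon> n))" using X(1)[of n] by simp
    also have "\<dots> \<le> ((1 - r n) / X n + X n / \<epsilon> n) / 2" by (rule arith_geo_mean_sqrt[OF nn])
    also have "\<dots> \<le> (1 - r n) / X n + X n / \<epsilon> n" by (rule half_le[OF nn])
    finally show "norm (sqrt ((1 - r n) / \<epsilon> n)) \<le> (1 - r n) / X n + X n / \<epsilon> n" using real_sqrt_ge_zero[of "(1 - r n) / \<epsilon> n"] r[of n] \<epsilon>[of n]
      by (simp only: real_norm_def abs_of_nonneg divide_nonneg_pos less_imp_le diff_ge_0_iff_ge)
  qed
qed

section \<open>The equivalences\<close>

theorem theorem4p5:
  fixes r \<epsilon> :: "nat \<Rightarrow> real" and \<Lambda> :: "complex set"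
  assumes "ring_data r \<epsilon>"
    and "\<Lambda> = discretized_rings r \<epsilon>"
  shows "(sampling_nevanlinna \<Lambda> \<longleftrightarrow>
            (\<forall>\<zeta>\<in>sphere 0 1. \<forall>\<psi>\<in>class_F.
               (\<Sum>\<^sub>\<infinity>z\<in>\<Lambda> \<inter> Gamma_region \<psi> \<zeta>. ennreal (1 - norm z)) = \<infinity>)) \<and>
         ((\<forall>\<zeta>\<in>sphere 0 1. \<forall>\<psi>\<in>class_F.
               (\<Sum>\<^sub>\<infinity>z\<in>\<Lambda> \<inter> Gamma_region \<psi> \<zeta>. ennreal (1 - norm z)) = \<infinity>) \<longleftrightarrow>
            (\<Sum>n. ennreal (((1 - r n) / \<epsilon> n) powr (1 / 2))) = \<infinity>)"
proof -
  have pos: "0 \<le> (1 - r n) / \<epsilon> n" for n using assms(1) by (auto simp: ring_data_def less_imp_le)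
  define s where "s n = sqrt ((1 - r n) / \<epsilon> n)" for n
  have s0: "0 \<le> s n" for n unfolding s_def by (rule real_sqrt_ge_zero[OF pos])
  have eq: "((1 - r n) / \<epsilon> n) powr (1 / 2) = s n" for n unfolding s_def by (rule powr_half_sqrt[OF pos])
  have c: "(\<Sum>n. ennreal (((1 - r n) / \<epsilon> n) powr (1 / 2))) = \<infinity> \<longleftrightarrow> \<not> summable s"
    unfolding eq infinity_ennreal_def
  proof (intro iffI notI)
    assume eq: "(\<Sum>n. ennreal (s n)) = top" and sm: "summable s"
    have "(\<Sum>n. ennreal (s n)) \<noteq> top" by (rule ennreal_suminf_neq_top[OF sm s0])
    then show False using eq by contradiction
  next
    assume ns: "\<not> summable s"
    show "(\<Sum>n. ennreal (s n)) = top"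
    proof (rule ccontr)
      assume "(\<Sum>n. ennreal (s n)) \<noteq> top"
      then have "summable s" by (intro summable_suminf_not_top s0)
      then show False using ns by contradiction
    qed
  qed
  have a: "sampling_nevanlinna \<Lambda> \<longleftrightarrow> \<not> summable s"
    unfolding assms(2) s_def[abs_def]
  proof (intro iffI notI)
    assume "summable (\<lambda>n. sqrt ((1 - r n) / \<epsilon> n))" "sampling_nevanlinna (discretized_rings r \<epsilon>)"
    then show False using summable_imp_not_sampling[OF assms(1)] by simp
  qed (rule divergent_imp_sampling[OF assms(1)])
  have b: "(\<forall>\<zeta>\<in>sphere 0 1. \<forall>\<psi>\<in>class_F. (\<Sum>\<^sub>\<infinity>z\<in>\<Lambda> \<inter> Gamma_region \<psi> \<zeta>. ennreal (1 - norm z)) = \<infinity>)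
      \<longleftrightarrow> \<not> summable s"
  proof (intro iffI notI)
    assume all: "\<forall>\<zeta>\<in>sphere 0 1. \<forall>\<psi>\<in>class_F. (\<Sum>\<^sub>\<infinity>z\<in>\<Lambda> \<inter> Gamma_region \<psi> \<zeta>. ennreal (1 - norm z)) = \<infinity>"
      and sm: "summable s"
    from summable_imp_finite_region_sum[OF assms(1) sm[unfolded s_def[abs_def]]]
    obtain \<psi> where \<psi>: "\<psi> \<in> class_F"
        "(\<Sum>\<^sub>\<infinity>z\<in>discretized_rings r \<epsilon> \<inter> Gamma_region \<psi> 1. ennreal (1 - norm z)) \<noteq> \<infinity>" by (elim bexE)
    have "(1::complex) \<in> sphere 0 1" by simp
    from bspec[OF bspec[OF all this] \<psi>(1)] \<psi>(2) show False unfolding assms(2) by contradiction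
  next
    assume ns: "\<not> summable s"
    show "\<forall>\<zeta>\<in>sphere 0 1. \<forall>\<psi>\<in>class_F. (\<Sum>\<^sub>\<infinity>z\<in>\<Lambda> \<inter> Gamma_region \<psi> \<zeta>. ennreal (1 - norm z)) = \<infinity>"
    proof (intro ballI, rule ccontr)
      fix \<zeta> \<psi> assume *: "\<zeta> \<in> sphere 0 1" "\<psi> \<in> class_F"
        "(\<Sum>\<^sub>\<infinity>z\<in>\<Lambda> \<inter> Gamma_region \<psi> \<zeta>. ennreal (1 - norm z)) \<noteq> \<infinity>"
      have "norm \<zeta> = 1" using *(1) by simp
      from finite_region_sum_imp_summable[OF assms(1) this *(2) *(3)[unfolded assms(2)]] show False
        using ns unfolding s_def[abs_def] by contradiction
    qed
  qed
  show ?thesis unfolding a b c by (intro conjI refl)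
qed

end
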